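(* Fix constants $\mu_{\min},\mu_{\max},\Phi,\eta,L,w_{\min},w_{\max},w_{\mathrm{sep}}>0$ and an integer $d\ge 1$, none of which depend on $n$. For each $n$, let $N_1,\dots,N_n$ be an $n$-variate Hawkes process satisfying assumptions (A1)--(A6) of the context with these constants, and let $G^*$ be its dependency graph. Suppose that the point processes $N_1,\dots,N_n$ are observed in $[0,T]$, with $T=\log^{100}(n)$. Then there is an estimator $\widehat G$ (a function of the observed processes on $[0,T]$ that may depend on the fixed constants above, but not on the unknown functions $\mu_i,\phi_{ij}$ or the unknown weights $w_{ij}$) such that $\widehat G=G^*$ with probability $1-o(1)$ as $n\to\infty$.
   Context: Setting (multivariate non-stationary Hawkes process). Let $n\ge 2$ and $[n]=\{1,\dots,n\}$. $N_1,\dots,N_n$ are point processes on $[0,\infty)$, with no simultaneous events, where $N_i(t)$ is the number of events at node $i$ in $[0,t]$; $\{\mathcal F_t\}_{t\ge 0}$ is the natural filtration of $(N_1,\dots,N_n)$. The rate function of $N_i$ is $\lambda_i(t)=\lim_{\epsilon\downarrow 0}\epsilon^{-1}\left(\mathbb E[N_i(t+\epsilon)\mid\mathcal F_t]-N_i(t)\right)$, and it is given by $$\lambda_i(t)=\mu_i(t)+\sum_{j=1}^n w_{ij}\int_0^t\phi_{ij}(t,s)\,dN_j(s),$$ where an event at time $t$ itself is included in the integral (so an event at $j$ at time $t$ makes $\lambda_i$ jump by $w_{ij}$ at time $t$). Here $\mu_i\ge 0$ is deterministic, $\phi_{ij}\ge0$ is a deterministic delay kernel and $w_{ij}\ge 0$.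 The functions and weights may depend on $n$. Assumptions. (A1) $\mu_{\min}\le\mu_i(t)\le\mu_{\max}$ for all $i\in[n]$, $t\ge 0$. (A2) For all $i,j$, $\phi_{ij}$ is continuous and non-negative; for all $s\ge0$, $\phi_{ij}(s,s)=1$ and $\phi_{ij}(\cdot,s)$ is decreasing. (A3) $\int_0^t\phi_{ij}(t,x)\,dx\le\Phi$ for all $i,j\in[n]$, $t\ge0$, and $\sum_{j=1}^n w_{ij}\int_0^t\phi_{ij}(t,x)\,dx\le 1-\eta$ for all $i\in[n]$, $t\ge 0$. (A4) $|\mu_i'(t)|/\mu_i(t)\le L$ for all $i\in[n]$, $t\ge 0$, and $|\frac{\partial}{\partial t}\phi_{ij}(t,s)|/\phi_{ij}(t,s)\le L$ for all $i,j\in[n]$, $t\ge s\ge 0$. (A5) For all $i,j\in[n]$, either $w_{ij}=0$ or $w_{\min}\le w_{ij}\le w_{\max}$; and $w_{ii}-w_{ij}\ge w_{\mathrm{sep}}$ for all distinct $i,j\in[n]$. (A6) For each $i\in[n]$ at most $d$ of the numbers $\{w_{ij}\}_{j\in[n]}$ are nonzero. Dependency graph. $G^*$ is the undirected graph with vertex set $[n]$ in which, for distinct $i,j$, $(i,j)$ is an edge if and only if $w_{ij}>0$ or $w_{ji}>0$. *)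

theory Defs
  imports "HOL-Probability.Probability"
begin

text \<open>
  A simple point process on the half-line is a random locally finite set of event times;
  \<open>E i \<omega>\<close> is the set of event times at node \<open>i\<close>, for nodes \<open>i \<in> {1..n}\<close>.
\<close>

definition event_count :: "(nat \<Rightarrow> 'a \<Rightarrow> real set) \<Rightarrow> nat \<Rightarrow> real \<Rightarrow> 'a \<Rightarrow> nat" where
  "event_count E i t \<omega> = card (E i \<omega> \<inter> {0..t})"

definition path_space :: "nat \<Rightarrow> real \<Rightarrow> (nat \<times> real \<Rightarrow> nat) measure" where
  "path_space n t = PiM ({1..n} \<times> {0..t}) (\<lambda>_. count_space UNIV)"

definition observed_path ::
  "nat \<Rightarrow> (nat \<Rightarrow> 'a \<Rightarrow> real set) \<Rightarrow> real \<Rightarrow> 'a \<Rightarrow> (nat \<times> real \<Rightarrow> nat)" where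
  "observed_path n E t \<omega> = (\<lambda>(i, s)\<in>{1..n} \<times> {0..t}. event_count E i s \<omega>)"

definition natural_filtration ::
  "'a measure \<Rightarrow> nat \<Rightarrow> (nat \<Rightarrow> 'a \<Rightarrow> real set) \<Rightarrow> real \<Rightarrow> 'a measure" where
  "natural_filtration M n E t = vimage_algebra (space M) (observed_path n E t) (path_space n t)"

text \<open>
  The limit of the conditional expectations is taken in \<open>L\<^sup>1(M)\<close>: conditional expectations are
  only determined up to null sets, so an almost sure limit along the uncountable family
  \<open>\<epsilon> \<down> 0\<close> would depend on the chosen versions.  The nonnegative integral is used so that the
  condition cannot hold merely because an integrand fails to be integrable.
\<close>

definition has_rate ::
  "'a measure \<Rightarrow> (real \<Rightarrow> 'a measure) \<Rightarrow> (real \<Rightarrow> 'a \<Rightarrow> nat) \<Rightarrow> (real \<Rightarrow> 'a \<Rightarrow> real) \<Rightarrow> bool" where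
  "has_rate M F X r \<longleftrightarrow>
     (\<forall>t\<ge>0. integrable M (\<lambda>\<omega>. real (X t \<omega>))) \<and>
     (\<forall>t\<ge>0. ((\<lambda>\<epsilon>. \<integral>\<^sup>+\<omega>. ennreal \<bar>(real_cond_exp M (F t) (\<lambda>\<omega>. real (X (t + \<epsilon>) \<omega>)) \<omega>
                                    - real (X t \<omega>)) / \<epsilon> - r t \<omega>\<bar> \<partial>M) \<longlongrightarrow> 0) (at_right 0))"

text \<open>
  The inner sum is the integral of \<open>\<phi> i j t\<close> over \<open>[0,t]\<close> with respect to the counting process
  of node \<open>j\<close>; an event at time \<open>t\<close> itself is included.
\<close>

definition hawkes_rate ::
  "nat \<Rightarrow> (nat \<Rightarrow> 'a \<Rightarrow> real set) \<Rightarrow> (nat \<Rightarrow> real \<Rightarrow> real) \<Rightarrow> (nat \<Rightarrow> nat \<Rightarrow> real \<Rightarrow> real \<Rightarrow> real) \<Rightarrow>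
    (nat \<Rightarrow> nat \<Rightarrow> real) \<Rightarrow> nat \<Rightarrow> real \<Rightarrow> 'a \<Rightarrow> real" where
  "hawkes_rate n E \<mu> \<phi> w i t \<omega> =
     \<mu> i t + (\<Sum>j=1..n. w i j * (\<Sum>s\<in>E j \<omega> \<inter> {0..t}. \<phi> i j t s))"

text \<open>
  The condition \<open>no_fixed_atoms\<close> is part of what it means for events to be generated by a rate
  function: the right limit defining the rate does not see an event placed at a deterministic
  time \<open>t > 0\<close>, because that event lies in the future of every earlier time and in the past of
  \<open>t\<close> itself.  Kernels are functions of \<open>(t, s)\<close> of which only the values for \<open>0 \<le> s \<le> t\<close>
  matter.
\<close>

locale hawkes_process = prob_space M
  for M :: "'a measure" and n :: nat and E :: "nat \<Rightarrow> 'a \<Rightarrow> real set"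
    and \<mu> :: "nat \<Rightarrow> real \<Rightarrow> real" and \<phi> :: "nat \<Rightarrow> nat \<Rightarrow> real \<Rightarrow> real \<Rightarrow> real"
    and w :: "nat \<Rightarrow> nat \<Rightarrow> real" +
  assumes events_nonneg: "\<And>i \<omega>. i \<in> {1..n} \<Longrightarrow> \<omega> \<in> space M \<Longrightarrow> E i \<omega> \<subseteq> {0..}"
    and locally_finite: "\<And>i t \<omega>. i \<in> {1..n} \<Longrightarrow> \<omega> \<in> space M \<Longrightarrow> finite (E i \<omega> \<inter> {0..t})"
    and measurable_count: "\<And>i t. i \<in> {1..n} \<Longrightarrow> t \<ge> 0 \<Longrightarrow> event_count E i t \<in> M \<rightarrow>\<^sub>M count_space UNIV"
    and no_simultaneous: "AE \<omega> in M. disjoint_family_on (\<lambda>i. E i \<omega>) {1..n}"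
    and no_fixed_atoms: "\<And>i t. i \<in> {1..n} \<Longrightarrow> t > 0 \<Longrightarrow> AE \<omega> in M. t \<notin> E i \<omega>"
    and baseline_nonneg: "\<And>i t. i \<in> {1..n} \<Longrightarrow> t \<ge> 0 \<Longrightarrow> \<mu> i t \<ge> 0"
    and kernel_nonneg: "\<And>i j s t. i \<in> {1..n} \<Longrightarrow> j \<in> {1..n} \<Longrightarrow> 0 \<le> s \<Longrightarrow> s \<le> t \<Longrightarrow> \<phi> i j t s \<ge> 0"
    and weight_nonneg: "\<And>i j. i \<in> {1..n} \<Longrightarrow> j \<in> {1..n} \<Longrightarrow> w i j \<ge> 0"
    and rate: "\<And>i. i \<in> {1..n} \<Longrightarrow>
      has_rate M (natural_filtration M n E) (event_count E i) (hawkes_rate n E \<mu> \<phi> w i)"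

text \<open>
  Derivatives at the left end of the domain (\<open>t = 0\<close> for \<open>\<mu>\<close>, \<open>t = s\<close> for \<open>\<phi>\<close>) are one-sided.
  Monotonicity is not strict.
\<close>

locale hawkes_assumptions =
  fixes n :: nat
    and \<mu> :: "nat \<Rightarrow> real \<Rightarrow> real" and \<phi> :: "nat \<Rightarrow> nat \<Rightarrow> real \<Rightarrow> real \<Rightarrow> real"
    and w :: "nat \<Rightarrow> nat \<Rightarrow> real"
    and \<mu>_min \<mu>_max \<Phi> \<eta> L w_min w_max w_sep :: real and d :: nat
  assumes baseline_bounds: "\<And>i t. i \<in> {1..n} \<Longrightarrow> t \<ge> 0 \<Longrightarrow> \<mu>_min \<le> \<mu> i t \<and> \<mu> i t \<le> \<mu>_max"
    and kernel_continuous: "\<And>i j. i \<in> {1..n} \<Longrightarrow> j \<in> {1..n} \<Longrightarrow>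
      continuous_on {(t, s). 0 \<le> s \<and> s \<le> t} (\<lambda>(t, s). \<phi> i j t s)"
    and kernel_nonneg: "\<And>i j s t. i \<in> {1..n} \<Longrightarrow> j \<in> {1..n} \<Longrightarrow> 0 \<le> s \<Longrightarrow> s \<le> t \<Longrightarrow> \<phi> i j t s \<ge> 0"
    and kernel_diagonal: "\<And>i j s. i \<in> {1..n} \<Longrightarrow> j \<in> {1..n} \<Longrightarrow> 0 \<le> s \<Longrightarrow> \<phi> i j s s = 1"
    and kernel_decreasing: "\<And>i j s. i \<in> {1..n} \<Longrightarrow> j \<in> {1..n} \<Longrightarrow> 0 \<le> s \<Longrightarrow>
      antimono_on {s..} (\<lambda>t. \<phi> i j t s)"
    and kernel_integral: "\<And>i j t. i \<in> {1..n} \<Longrightarrow> j \<in> {1..n} \<Longrightarrow> t \<ge> 0 \<Longrightarrow>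
      integral {0..t} (\<lambda>x. \<phi> i j t x) \<le> \<Phi>"
    and subcritical: "\<And>i t. i \<in> {1..n} \<Longrightarrow> t \<ge> 0 \<Longrightarrow>
      (\<Sum>j=1..n. w i j * integral {0..t} (\<lambda>x. \<phi> i j t x)) \<le> 1 - \<eta>"
    and baseline_log_derivative: "\<And>i t. i \<in> {1..n} \<Longrightarrow> t \<ge> 0 \<Longrightarrow>
      \<exists>D. (\<mu> i has_real_derivative D) (at t within {0..}) \<and> \<bar>D\<bar> / \<mu> i t \<le> L"
    and kernel_log_derivative: "\<And>i j s t. i \<in> {1..n} \<Longrightarrow> j \<in> {1..n} \<Longrightarrow> 0 \<le> s \<Longrightarrow> s \<le> t \<Longrightarrow>
      \<exists>D. ((\<lambda>u. \<phi> i j u s) has_real_derivative D) (at t within {s..}) \<and> \<bar>D\<bar> / \<phi> i j t s \<le> L"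
    and weight_bounds: "\<And>i j. i \<in> {1..n} \<Longrightarrow> j \<in> {1..n} \<Longrightarrow>
      w i j = 0 \<or> w_min \<le> w i j \<and> w i j \<le> w_max"
    and weight_separation: "\<And>i j. i \<in> {1..n} \<Longrightarrow> j \<in> {1..n} \<Longrightarrow> i \<noteq> j \<Longrightarrow> w i i - w i j \<ge> w_sep"
    and sparsity: "\<And>i. i \<in> {1..n} \<Longrightarrow> card {j\<in>{1..n}. w i j \<noteq> 0} \<le> d"

text \<open>Undirected graphs as pairs of a vertex set and a set of two-element edges.\<close>

definition dependency_graph :: "nat \<Rightarrow> (nat \<Rightarrow> nat \<Rightarrow> real) \<Rightarrow> nat set \<times> nat set set" where
  "dependency_graph n w =
     ({1..n}, {{i, j} | i j. i \<in> {1..n} \<and> j \<in> {1..n} \<and> i \<noteq> j \<and> (w i j > 0 \<or> w j i > 0)})"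

definition horizon :: "nat \<Rightarrow> real" where
  "horizon n = (ln (real n)) ^ 100"

end

theory Submission
  imports Defs "HOL-Real_Asymp.Real_Asymp"
begin

text \<open>
  The estimator divides \<open>[0, T]\<close> into blocks of three consecutive short windows of length
  \<open>\<delta>\<close>.  For an ordered pair \<open>(i, j)\<close> it counts the blocks whose windows contain
  events of \<open>i, j, i\<close> in this order, minus the blocks with the order \<open>i, i, j\<close>.  An event
  raises the rates of its successors at once, so with \<open>x = w i j\<close>, \<open>y = w j i\<close> and the
  current rates \<open>b\<close> of \<open>i\<close> and \<open>a\<close> of \<open>j\<close>, one block has conditional drift about
  \<open>\<delta>\<^sup>3 * g i j\<close> with \<open>g i j = b * (x * (a + y) - y * (b + w i i))\<close>: the
  leading terms \<open>a * b * b\<close> of the two orders cancel.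
  The drift vanishes if \<open>x = y = 0\<close>.  Otherwise
  \<open>- y * g i j - x * g j i = (x * a - y * b)\<^sup>2 + a * x\<^sup>2 * (w j j - y) + b * y\<^sup>2 * (w i i - x)\<close>
  is bounded away from zero, so at least one of the two statistics of the pair is large.

  Exponential moments give concentration of the statistics around their accumulated drifts.  By
  subcriticality, exponential moments also show that with high probability all rates stay
  below \<open>(ln n)\<^sup>2\<close> up to time \<open>T\<close>.  To compute the drifts, time is cut
  into cells of length \<open>\<delta> / n ^ 4\<close>, so short that with high probability no cell contains two
  events.
\<close>

section \<open>Bounded random variables\<close>

text \<open>Third order is the lowest that works. Comparing the orders \<open>i, j\<close> and
  \<open>j, i\<close> has drift proportional to \<open>b * y - a * x\<close>, whose mean is zero in
  every model symmetric under exchanging the two nodes. Where it vanishes,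
  \<open>x * a = y * b\<close> and hence \<open>g i j = - b * y * (w i i - x)\<close>, which the
  separation of the weights keeps away from zero.

  The rates move in an unknown way, so a single drift may change sign and cancel in the sum over the
  blocks. The coefficients \<open>- y\<close> and \<open>- x\<close> of the combination are constant
  in time, so its positivity survives the summation, and no rate has to be estimated.

  The scales come from a balance. A block contributes a drift of order \<open>\<delta> ^ 3\<close>,
  so a union bound over all pairs needs \<open>K * \<delta> ^ 6\<close> much larger than
  \<open>ln n\<close> for \<open>K\<close> blocks; the error of the expansion is of order
  \<open>\<delta> ^ 4\<close> times a power of the bound on the rates, so \<open>\<delta>\<close>
  must be small against that power. Windows are still too long to exclude two events somewhere in
  the network, which happens within a length \<open>h\<close> with probability of order
  \<open>(n * h) ^ 2\<close> up to the size of the rates; hence the finer cells.\<close>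

definition bdd_rv :: "'a measure \<Rightarrow> ('a \<Rightarrow> real) \<Rightarrow> bool" where
  "bdd_rv F X \<longleftrightarrow> X \<in> borel_measurable F \<and> (\<exists>B. \<forall>\<omega>\<in>space F. \<bar>X \<omega>\<bar> \<le> B)"

lemma bdd_rvI:
  assumes "X \<in> borel_measurable F" "\<And>\<omega>. \<omega> \<in> space F \<Longrightarrow> \<bar>X \<omega>\<bar> \<le> B"
  shows "bdd_rv F X"
  using assms unfolding bdd_rv_def by blast

lemma bdd_rv_measurable: "bdd_rv F X \<Longrightarrow> X \<in> borel_measurable F"
  by (simp add: bdd_rv_def)

lemma bdd_rv_const: "bdd_rv F (\<lambda>_. c)"
  by (rule bdd_rvI[where B = "\<bar>c\<bar>"]) auto

lemma bdd_rv_of_bool: "Measurable.pred F P \<Longrightarrow> bdd_rv F (\<lambda>\<omega>. of_bool (P \<omega>))"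
  by (rule bdd_rvI[where B = 1]) auto

lemma bdd_rv_add:
  assumes "bdd_rv F X" "bdd_rv F Y" shows "bdd_rv F (\<lambda>\<omega>. X \<omega> + Y \<omega>)"
proof -
  obtain B C where "\<And>\<omega>. \<omega> \<in> space F \<Longrightarrow> \<bar>X \<omega>\<bar> \<le> B" "\<And>\<omega>. \<omega> \<in> space F \<Longrightarrow> \<bar>Y \<omega>\<bar> \<le> C"
    using assms unfolding bdd_rv_def by blast
  then show ?thesis using assms
    by (intro bdd_rvI[where B = "B + C"]) (auto simp: bdd_rv_def intro!: abs_triangle_ineq[THEN order_trans] add_mono)
qed

lemma bdd_rv_mult:
  assumes "bdd_rv F X" "bdd_rv F Y" shows "bdd_rv F (\<lambda>\<omega>. X \<omega> * Y \<omega>)"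
proof -
  obtain B C where BC: "\<And>\<omega>. \<omega> \<in> space F \<Longrightarrow> \<bar>X \<omega>\<bar> \<le> B" "\<And>\<omega>. \<omega> \<in> space F \<Longrightarrow> \<bar>Y \<omega>\<bar> \<le> C"
    using assms unfolding bdd_rv_def by blast
  have "\<bar>X \<omega> * Y \<omega>\<bar> \<le> B * C" if "\<omega> \<in> space F" for \<omega>
    unfolding abs_mult by (rule mult_mono) (use BC[OF that] in linarith)+
  then show ?thesis using assms
    by (intro bdd_rvI[where B = "B * C"]) (auto simp: bdd_rv_def)
qed

lemma bdd_rv_uminus: "bdd_rv F X \<Longrightarrow> bdd_rv F (\<lambda>\<omega>. - X \<omega>)"
  using bdd_rv_mult[OF bdd_rv_const[of F "-1"]] by simp

lemma bdd_rv_diff: "bdd_rv F X \<Longrightarrow> bdd_rv F Y \<Longrightarrow> bdd_rv F (\<lambda>\<omega>. X \<omega> - Y \<omega>)"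
  using bdd_rv_add[of F X "\<lambda>\<omega>. - Y \<omega>"] bdd_rv_uminus[of F Y] by simp

lemma bdd_rv_sum: "(\<And>i. i \<in> I \<Longrightarrow> bdd_rv F (X i)) \<Longrightarrow> bdd_rv F (\<lambda>\<omega>. \<Sum>i\<in>I. X i \<omega>)"
  by (induction I rule: infinite_finite_induct) (auto intro: bdd_rv_const bdd_rv_add)

lemma bdd_rv_exp:
  assumes "bdd_rv F X" shows "bdd_rv F (\<lambda>\<omega>. exp (X \<omega>))"
proof -
  obtain B where "\<And>\<omega>. \<omega> \<in> space F \<Longrightarrow> \<bar>X \<omega>\<bar> \<le> B"
    using assms unfolding bdd_rv_def by blast
  then show ?thesis using assms
    by (intro bdd_rvI[where B = "exp B"]) (auto simp: bdd_rv_def dest: abs_le_D1)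
qed

lemma bdd_rv_le:
  assumes "bdd_rv F Y" "X \<in> borel_measurable F" "\<And>\<omega>. \<omega> \<in> space F \<Longrightarrow> \<bar>X \<omega>\<bar> \<le> Y \<omega>"
  shows "bdd_rv F X"
proof -
  obtain B where B: "\<And>\<omega>. \<omega> \<in> space F \<Longrightarrow> \<bar>Y \<omega>\<bar> \<le> B"
    using assms unfolding bdd_rv_def by blast
  show ?thesis
    by (rule bdd_rvI[where B = B]) (use assms(2,3) B in \<open>force+\<close>)
qed

lemma bdd_rv_subalgebra: "subalgebra M F \<Longrightarrow> bdd_rv F X \<Longrightarrow> bdd_rv M X"
  unfolding bdd_rv_def by (simp add: subalgebra_def measurable_from_subalg[unfolded subalgebra_def])

text \<open>Nonnegative test variables stand in for conditional expectations: \<open>expectation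
  (\<lambda>\<omega>. Y \<omega> * X \<omega>) \<le> c * expectation Y\<close> for all weights
  \<open>Y\<close> of \<open>F\<close> says that the conditional expectation of an integrable
  \<open>X\<close> given \<open>F\<close> is at most \<open>c\<close>, without a choice of versions.
  Restriction to an event of \<open>F\<close> becomes multiplication of \<open>Y\<close> by an
  indicator.\<close>

definition weight :: "'a measure \<Rightarrow> ('a \<Rightarrow> real) \<Rightarrow> bool" where
  "weight F Y \<longleftrightarrow> bdd_rv F Y \<and> (\<forall>\<omega>\<in>space F. 0 \<le> Y \<omega>)"

lemma weight_bdd: "weight F Y \<Longrightarrow> bdd_rv F Y"
  and weight_ge_0: "weight F Y \<Longrightarrow> \<omega> \<in> space F \<Longrightarrow> 0 \<le> Y \<omega>"
  by (auto simp: weight_def)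

lemma weight_mult: "weight F X \<Longrightarrow> weight F Y \<Longrightarrow> weight F (\<lambda>\<omega>. X \<omega> * Y \<omega>)"
  by (auto simp: weight_def intro: bdd_rv_mult)

lemma weight_of_bool: "Measurable.pred F P \<Longrightarrow> weight F (\<lambda>\<omega>. of_bool (P \<omega>))"
  by (auto simp: weight_def intro: bdd_rv_of_bool)

lemma weight_const: "0 \<le> c \<Longrightarrow> weight F (\<lambda>_. c)"
  by (auto simp: weight_def intro: bdd_rv_const)

lemma weight_exp: "bdd_rv F X \<Longrightarrow> weight F (\<lambda>\<omega>. exp (X \<omega>))"
  by (auto simp: weight_def intro: bdd_rv_exp)

lemma (in prob_space) bdd_rv_integrable [simp, intro]:
  assumes "bdd_rv M X" shows "integrable M X"
proof -
  obtain B where "\<And>\<omega>. \<omega> \<in> space M \<Longrightarrow> \<bar>X \<omega>\<bar> \<le> B" and "X \<in> borel_measurable M"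
    using assms unfolding bdd_rv_def by blast
  then show ?thesis by (intro integrable_const_bound[where B = B]) auto
qed

lemma (in prob_space) expectation_mono_bdd:
  assumes "bdd_rv M X" "bdd_rv M Y" "\<And>\<omega>. \<omega> \<in> space M \<Longrightarrow> X \<omega> \<le> Y \<omega>"
  shows "expectation X \<le> expectation Y"
  by (rule integral_mono) (use assms bdd_rv_integrable in auto)

lemma (in prob_space) expectation_nonneg_weight:
  assumes "weight M X" shows "0 \<le> expectation X"
  by (rule integral_nonneg_AE) (use assms in \<open>auto simp: weight_def\<close>)

lemmas bdd_intros = bdd_rv_const bdd_rv_add bdd_rv_diff bdd_rv_mult bdd_rv_sum bdd_rv_exp
  bdd_rv_of_bool

locale filtered_prob_space = prob_space M for M :: "'a measure" +
  fixes F :: "nat \<Rightarrow> 'a measure"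
  assumes subalg: "subalgebra M (F l)"
    and filtration_step: "sets (F l) \<subseteq> sets (F (Suc l))"
begin

lemma space_F [simp]: "space (F l) = space M"
  using subalg[of l] by (simp add: subalgebra_def)

lemma sets_F_mono: "l \<le> l' \<Longrightarrow> sets (F l) \<subseteq> sets (F l')"
  by (induction rule: dec_induct) (use filtration_step in auto)

lemma measurable_F_mono: "l \<le> l' \<Longrightarrow> X \<in> measurable (F l) N \<Longrightarrow> X \<in> measurable (F l') N"
  using sets_F_mono[of l l'] unfolding measurable_def by auto

lemma bdd_rv_F_mono: "l \<le> l' \<Longrightarrow> bdd_rv (F l) X \<Longrightarrow> bdd_rv (F l') X"
  unfolding bdd_rv_def using measurable_F_mono by auto

lemma bdd_rv_F_M: "bdd_rv (F l) X \<Longrightarrow> bdd_rv M X"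
  using bdd_rv_subalgebra[OF subalg] .

lemma weight_F_mono: "l \<le> l' \<Longrightarrow> weight (F l) X \<Longrightarrow> weight (F l') X"
  unfolding weight_def using bdd_rv_F_mono by auto

lemma weight_F_M: "weight (F l) X \<Longrightarrow> weight M X"
  unfolding weight_def using bdd_rv_F_M by auto

lemma weight_bdd_M: "weight (F l) X \<Longrightarrow> bdd_rv M X"
  using weight_F_M weight_bdd by blast

end

section \<open>Discrete chains of rare events\<close>

text \<open>The interface between the process and the combinatorics of the statistics:
  \<open>c l i\<close> counts the events of node \<open>i\<close> in cell \<open>l\<close>, which
  has length \<open>h\<close>, and \<open>lam l i\<close> is the rate at the start of that cell. The
  probabilistic assumptions concern only weights supported where all rates are at most
  \<open>B\<close>, because the error \<open>\<rho>\<close> of a cell grows with the rates.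
  \<open>lam_upper\<close> and \<open>lam_lower\<close> are pathwise: over a stretch of cells a rate
  changes by the excitation received, up to a drift \<open>\<kappa>\<close> upwards and a relative
  loss \<open>L\<close> downwards, both per unit of time.\<close>

locale firing_chain = filtered_prob_space M F for M :: "'a measure" and F +
  fixes n :: nat and c :: "nat \<Rightarrow> nat \<Rightarrow> 'a \<Rightarrow> nat" and lam :: "nat \<Rightarrow> nat \<Rightarrow> 'a \<Rightarrow> real"
    and w :: "nat \<Rightarrow> nat \<Rightarrow> real" and h \<rho> \<kappa> L wm B :: real and d :: nat
  assumes c_meas: "i \<in> {1..n} \<Longrightarrow> c l i \<in> measurable (F (Suc l)) (count_space UNIV)"
    and lam_meas: "i \<in> {1..n} \<Longrightarrow> lam l i \<in> borel_measurable (F l)"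
    and lam_nonneg: "i \<in> {1..n} \<Longrightarrow> \<omega> \<in> space M \<Longrightarrow> 0 \<le> lam l i \<omega>"
    and w_range: "i \<in> {1..n} \<Longrightarrow> j \<in> {1..n} \<Longrightarrow> 0 \<le> w i j \<and> w i j \<le> wm"
    and w_sparse: "i \<in> {1..n} \<Longrightarrow> card {j\<in>{1..n}. w i j \<noteq> 0} \<le> d"
    and param_nonneg: "0 \<le> h" "0 \<le> \<rho>" "0 \<le> \<kappa>" "0 \<le> L" "0 \<le> wm" "0 \<le> B"
    and fire_upper: "weight (F l) Y \<Longrightarrow>
      (\<And>\<omega> k. \<omega> \<in> space M \<Longrightarrow> Y \<omega> \<noteq> 0 \<Longrightarrow> k \<in> {1..n} \<Longrightarrow> lam l k \<omega> \<le> B) \<Longrightarrow> i \<in> {1..n} \<Longrightarrow>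
      expectation (\<lambda>\<omega>. Y \<omega> * of_bool (1 \<le> c l i \<omega>))
        \<le> h * expectation (\<lambda>\<omega>. Y \<omega> * lam l i \<omega>) + \<rho> * expectation Y"
    and fire_lower: "weight (F l) Y \<Longrightarrow>
      (\<And>\<omega> k. \<omega> \<in> space M \<Longrightarrow> Y \<omega> \<noteq> 0 \<Longrightarrow> k \<in> {1..n} \<Longrightarrow> lam l k \<omega> \<le> B) \<Longrightarrow> i \<in> {1..n} \<Longrightarrow>
      h * expectation (\<lambda>\<omega>. Y \<omega> * lam l i \<omega>) - \<rho> * expectation Y
        \<le> expectation (\<lambda>\<omega>. Y \<omega> * of_bool (1 \<le> c l i \<omega>))"
    and two_upper: "weight (F l) Y \<Longrightarrow>
      (\<And>\<omega> k. \<omega> \<in> space M \<Longrightarrow> Y \<omega> \<noteq> 0 \<Longrightarrow> k \<in> {1..n} \<Longrightarrow> lam l k \<omega> \<le> B) \<Longrightarrow>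
      expectation (\<lambda>\<omega>. Y \<omega> * of_bool (2 \<le> (\<Sum>i=1..n. c l i \<omega>))) \<le> \<rho> * expectation Y"
    and lam_upper: "l \<le> l' \<Longrightarrow> i \<in> {1..n} \<Longrightarrow> \<omega> \<in> space M \<Longrightarrow>
      lam l' i \<omega> \<le> lam l i \<omega> + \<kappa> * (h * real (l' - l))
        + (\<Sum>j=1..n. w i j * (\<Sum>x=l..<l'. real (c x j \<omega>)))"
    and lam_lower: "l \<le> l' \<Longrightarrow> i \<in> {1..n} \<Longrightarrow> \<omega> \<in> space M \<Longrightarrow> L * (h * real (l' - l)) \<le> 1 \<Longrightarrow>
      (1 - L * (h * real (l' - l))) * (lam l i \<omega>
        + (\<Sum>j=1..n. w i j * (\<Sum>x=l..<l'. real (c x j \<omega>)))) \<le> lam l' i \<omega>"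
begin

definition tot :: "nat \<Rightarrow> 'a \<Rightarrow> nat" where
  "tot l \<omega> = (\<Sum>i=1..n. c l i \<omega>)"

text \<open>Rates are restricted up to the start of cell \<open>l\<close>, event numbers only in the
  cells before it. The condition is therefore decided by \<open>F l\<close> and can be multiplied
  into a weight.\<close>

definition alive :: "real \<Rightarrow> nat \<Rightarrow> nat \<Rightarrow> 'a \<Rightarrow> bool" where
  "alive R a l \<omega> \<longleftrightarrow> (\<forall>r\<in>{a..l}. \<forall>k\<in>{1..n}. lam r k \<omega> \<le> R) \<and> (\<forall>r\<in>{a..<l}. tot r \<omega> \<le> 1)"

text \<open>A cell counts only if the chain has been alive from \<open>a\<close> up to its start,
  which makes the bound \<open>B\<close> on the rates available in every counted cell. Several
  firings within one cell count once.\<close>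

definition nfire :: "nat set \<Rightarrow> nat \<Rightarrow> nat \<Rightarrow> 'a \<Rightarrow> nat" where
  "nfire S a l \<omega> = card {x\<in>{a..<l}. alive B a x \<omega> \<and> (\<exists>i\<in>S. 1 \<le> c x i \<omega>)}"

definition parents :: "nat \<Rightarrow> nat set" where
  "parents i = {j\<in>{1..n}. w i j \<noteq> 0}"

lemma finite_parents [simp]: "finite (parents i)" and parents_subset: "parents i \<subseteq> {1..n}"
  by (auto simp: parents_def)

lemma pred_c: "l < l' \<Longrightarrow> i \<in> {1..n} \<Longrightarrow> Measurable.pred (F l') (\<lambda>\<omega>. 1 \<le> c l i \<omega>)"
  using measurable_F_mono[OF Suc_leI c_meas, of l l' i] by measurable

lemma pred_tot: "l < l' \<Longrightarrow> Measurable.pred (F l') (\<lambda>\<omega>. tot l \<omega> \<le> 1)"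
proof -
  assume l: "l < l'"
  have "c l i \<in> measurable (F l') (count_space UNIV)" if "i \<in> {1..n}" for i
    by (rule measurable_F_mono[OF _ c_meas]) (use that l in auto)
  then have "(\<lambda>\<omega>. \<Sum>i=1..n. c l i \<omega>) \<in> measurable (F l') (count_space UNIV)"
    by measurable
  then show ?thesis unfolding tot_def by measurable
qed

lemma pred_alive: "l \<le> l' \<Longrightarrow> Measurable.pred (F l') (alive R a l)"
proof -
  assume l: "l \<le> l'"
  have 1: "Measurable.pred (F l') (\<lambda>\<omega>. lam r k \<omega> \<le> R)" if "r \<in> {a..l}" "k \<in> {1..n}" for r k
  proof -
    have "lam r k \<in> borel_measurable (F l')"
      by (rule measurable_F_mono[OF _ lam_meas]) (use that l in auto)
    then show ?thesis by measurable
  qed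
  have 2: "Measurable.pred (F l') (\<lambda>\<omega>. tot r \<omega> \<le> 1)" if "r \<in> {a..<l}" for r
    using pred_tot that l by auto
  show ?thesis unfolding alive_def
    by (intro pred_intros_logic(4) pred_intros_finite(3) pred_intros_logic) (use 1 2 in auto)
qed

lemma alive_mono: "alive R a l \<omega> \<Longrightarrow> a \<le> a' \<Longrightarrow> l' \<le> l \<Longrightarrow> alive R a' l' \<omega>"
  unfolding alive_def by auto

lemma alive_lam: "alive R a l \<omega> \<Longrightarrow> a \<le> l \<Longrightarrow> k \<in> {1..n} \<Longrightarrow> lam l k \<omega> \<le> R"
  unfolding alive_def by auto

lemma measurable_nfire:
  assumes "l \<le> l'" "S \<subseteq> {1..n}"
  shows "nfire S a l \<in> measurable (F l') (count_space UNIV)"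
proof -
  have fin: "finite S" using assms(2) finite_subset by blast
  have *: "Measurable.pred (F l') (\<lambda>\<omega>. alive B a x \<omega> \<and> (\<exists>i\<in>S. 1 \<le> c x i \<omega>))" if "x \<in> {a..<l}" for x
  proof -
    have "Measurable.pred (F l') (alive B a x)" using pred_alive that assms by auto
    moreover have "Measurable.pred (F l') (\<lambda>\<omega>. \<exists>i\<in>S. 1 \<le> c x i \<omega>)"
      by (rule pred_intros_finite(4)[OF fin]) (use pred_c that assms in auto)
    ultimately show ?thesis by measurable
  qed
  have eq: "nfire S a l = (\<lambda>\<omega>. \<Sum>x\<in>{a..<l}. of_bool (alive B a x \<omega> \<and> (\<exists>i\<in>S. 1 \<le> c x i \<omega>)))"
    unfolding nfire_def by (rule ext) (simp add: sum.If_cases of_bool_def Int_def)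
  have **: "(\<lambda>\<omega>. of_bool (P \<omega>) :: nat) \<in> measurable (F l') (count_space UNIV)"
    if "Measurable.pred (F l') P" for P
    unfolding of_bool_def using that by measurable
  show ?thesis unfolding eq
    by (rule measurable_sum_nat) (use * ** in blast)
qed

lemma pred_nfire:
  assumes "l \<le> l'" "S \<subseteq> {1..n}"
  shows "Measurable.pred (F l') (\<lambda>\<omega>. m \<le> nfire S a l \<omega>)"
  using measurable_nfire[OF assms] by measurable

lemma nfire_Suc:
  assumes "a \<le> l"
  shows "nfire S a (Suc l) \<omega> = nfire S a l \<omega> + of_bool (alive B a l \<omega> \<and> (\<exists>i\<in>S. 1 \<le> c l i \<omega>))"
proof -
  let ?P = "\<lambda>x. alive B a x \<omega> \<and> (\<exists>i\<in>S. 1 \<le> c x i \<omega>)"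
  have "{x\<in>{a..<Suc l}. ?P x} = {x\<in>{a..<l}. ?P x} \<union> (if ?P l then {l} else {})"
    using assms by (auto simp: less_Suc_eq)
  then show ?thesis unfolding nfire_def by auto
qed

lemma weighted_lam_bdd:
  assumes "weight (F l) Y" "i \<in> {1..n}"
    and "\<And>\<omega>. \<omega> \<in> space M \<Longrightarrow> Y \<omega> \<noteq> 0 \<Longrightarrow> lam l i \<omega> \<le> C"
  shows "weight (F l) (\<lambda>\<omega>. Y \<omega> * lam l i \<omega>)"
proof -
  have [measurable]: "Y \<in> borel_measurable (F l)" "lam l i \<in> borel_measurable (F l)"
    using assms lam_meas by (auto simp: weight_def bdd_rv_def)
  have nn: "0 \<le> Y \<omega> * lam l i \<omega>" "Y \<omega> * lam l i \<omega> \<le> C * Y \<omega>" if "\<omega> \<in> space M" for \<omega>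
    using assms(3)[OF that] lam_nonneg[OF assms(2) that, of l] weight_ge_0[OF assms(1), of \<omega>] that
    by (cases "Y \<omega> = 0"; simp add: mult_mono' mult.commute)+
  have "bdd_rv (F l) (\<lambda>\<omega>. Y \<omega> * lam l i \<omega>)"
    by (rule bdd_rv_le[where Y = "\<lambda>\<omega>. C * Y \<omega>"]) (use assms nn in \<open>auto intro!: bdd_rv_mult bdd_rv_const intro: weight_bdd\<close>)
  then show ?thesis using nn by (auto simp: weight_def)
qed

lemma weighted_lam_le:
  assumes "weight (F l) Y" "i \<in> {1..n}"
    and "\<And>\<omega>. \<omega> \<in> space M \<Longrightarrow> Y \<omega> \<noteq> 0 \<Longrightarrow> lam l i \<omega> \<le> C"
  shows "expectation (\<lambda>\<omega>. Y \<omega> * lam l i \<omega>) \<le> C * expectation Y"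
proof -
  have "expectation (\<lambda>\<omega>. Y \<omega> * lam l i \<omega>) \<le> expectation (\<lambda>\<omega>. C * Y \<omega>)"
  proof (rule expectation_mono_bdd)
    show "bdd_rv M (\<lambda>\<omega>. Y \<omega> * lam l i \<omega>)"
      using weighted_lam_bdd[OF assms] weight_bdd_M by blast
    show "bdd_rv M (\<lambda>\<omega>. C * Y \<omega>)" by (intro bdd_intros weight_bdd_M[OF assms(1)])
    show "Y \<omega> * lam l i \<omega> \<le> C * Y \<omega>" if "\<omega> \<in> space M" for \<omega>
      using assms(3)[OF that] weight_ge_0[OF assms(1), of \<omega>] that
      by (cases "Y \<omega> = 0") (simp_all add: mult.commute)
  qed
  then show ?thesis by simp
qed

text \<open>An alive cell fires in \<open>S\<close> with conditional probability at most
  \<open>p\<close>. Induction on \<open>r\<close>: the \<open>m\<close>-th firing has happened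
  before the last cell, or the last cell fires after \<open>m - 1\<close> earlier firings. The
  exponent \<open>m\<close> ranks the error terms of all later expansions: each additional event
  costs one more factor \<open>real r * p\<close>.\<close>

lemma multi_fire:
  assumes S: "S \<subseteq> {1..n}" and p: "real (card S) * (h * B + \<rho>) \<le> p" and Y: "weight (F a) Y"
  shows "expectation (\<lambda>\<omega>. Y \<omega> * of_bool (m \<le> nfire S a (a + r) \<omega>)) \<le> (real r * p) ^ m * expectation Y"
proof (induction r arbitrary: m)
  case 0
  show ?case by (cases m) (simp_all add: nfire_def)
next
  case (Suc r)
  have EY: "0 \<le> expectation Y" using expectation_nonneg_weight weight_F_M[OF Y] .
  have fin: "finite S" using S finite_subset by blast
  have "0 \<le> real (card S) * (h * B + \<rho>)"
    using param_nonneg by (intro mult_nonneg_nonneg add_nonneg_nonneg) auto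
  then have p0: "0 \<le> p" using p by linarith
  show ?case
  proof (cases m)
    case 0 then show ?thesis by simp
  next
    case (Suc k)
    define l where "l = a + r"
    let ?Z = "\<lambda>\<omega>. Y \<omega> * of_bool (k \<le> nfire S a l \<omega> \<and> alive B a l \<omega>)"
    have Yl: "weight (F l) Y" using weight_F_mono[OF _ Y] by (simp add: l_def)
    have Zp: "Measurable.pred (F l) (\<lambda>\<omega>. k \<le> nfire S a l \<omega> \<and> alive B a l \<omega>)"
      using pred_nfire[OF order_refl S] pred_alive[OF order_refl] by measurable
    have Z: "weight (F l) ?Z" using weight_mult[OF Yl weight_of_bool[OF Zp]] .
    have Zb: "\<And>\<omega> k. \<omega> \<in> space M \<Longrightarrow> ?Z \<omega> \<noteq> 0 \<Longrightarrow> k \<in> {1..n} \<Longrightarrow> lam l k \<omega> \<le> B"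
      by (auto simp: l_def intro: alive_lam)
    have bk: "weight M (\<lambda>\<omega>. Y \<omega> * of_bool (k \<le> nfire S a l \<omega>))" for k
      by (rule weight_F_M[of l], rule weight_mult[OF Yl], rule weight_of_bool, rule pred_nfire[OF order_refl S])
    have Zc: "weight M (\<lambda>\<omega>. ?Z \<omega> * of_bool (1 \<le> c l i \<omega>))" if "i \<in> S" for i
      by (rule weight_F_M[of "Suc l"], rule weight_mult[OF weight_F_mono[OF _ Z]], simp,
          rule weight_of_bool, rule pred_c) (use that S in auto)
    have "expectation (\<lambda>\<omega>. Y \<omega> * of_bool (m \<le> nfire S a (a + Suc r) \<omega>))
       \<le> expectation (\<lambda>\<omega>. Y \<omega> * of_bool (Suc k \<le> nfire S a l \<omega>)
            + (\<Sum>i\<in>S. ?Z \<omega> * of_bool (1 \<le> c l i \<omega>)))"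
    proof (rule expectation_mono_bdd)
      show "bdd_rv M (\<lambda>\<omega>. Y \<omega> * of_bool (m \<le> nfire S a (a + Suc r) \<omega>))"
        by (rule bdd_rv_F_M[of "a + Suc r"], rule bdd_rv_mult[OF weight_bdd[OF weight_F_mono[OF _ Y]]], simp,
            rule bdd_rv_of_bool, rule pred_nfire[OF order_refl S])
      show "bdd_rv M (\<lambda>\<omega>. Y \<omega> * of_bool (Suc k \<le> nfire S a l \<omega>)
            + (\<Sum>i\<in>S. ?Z \<omega> * of_bool (1 \<le> c l i \<omega>)))"
        by (intro bdd_rv_add bdd_rv_sum weight_bdd bk Zc)
      fix \<omega> assume om: "\<omega> \<in> space M"
      have Y0: "0 \<le> Y \<omega>" using weight_ge_0[OF Y] om by simp
      have nn: "0 \<le> (\<Sum>i\<in>S. ?Z \<omega> * of_bool (1 \<le> c l i \<omega>))"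
        by (intro sum_nonneg mult_nonneg_nonneg Y0) auto
      show "Y \<omega> * of_bool (m \<le> nfire S a (a + Suc r) \<omega>)
         \<le> Y \<omega> * of_bool (Suc k \<le> nfire S a l \<omega>) + (\<Sum>i\<in>S. ?Z \<omega> * of_bool (1 \<le> c l i \<omega>))"
      proof (cases "Suc k \<le> nfire S a (Suc l) \<omega> \<and> \<not> Suc k \<le> nfire S a l \<omega>")
        case True
        have sc: "nfire S a (Suc l) \<omega> = nfire S a l \<omega> + of_bool (alive B a l \<omega> \<and> (\<exists>i\<in>S. 1 \<le> c l i \<omega>))"
          by (rule nfire_Suc) (simp add: l_def)
        from True have al: "alive B a l \<omega> \<and> (\<exists>i\<in>S. 1 \<le> c l i \<omega>)" and kk: "k \<le> nfire S a l \<omega>"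
          unfolding sc by (auto simp: of_bool_def split: if_splits)
        then obtain i where i: "i \<in> S" "1 \<le> c l i \<omega>" by blast
        have "?Z \<omega> * of_bool (1 \<le> c l i \<omega>) \<le> (\<Sum>i\<in>S. ?Z \<omega> * of_bool (1 \<le> c l i \<omega>))"
          by (rule member_le_sum) (use i fin Y0 in auto)
        moreover have "?Z \<omega> * of_bool (1 \<le> c l i \<omega>) = Y \<omega>" using i al kk by simp
        moreover have "Y \<omega> * of_bool (m \<le> nfire S a (a + Suc r) \<omega>) \<le> Y \<omega>" using Y0 by simp
        moreover have "0 \<le> Y \<omega> * of_bool (Suc k \<le> nfire S a l \<omega>)" using Y0 by simp
        ultimately show ?thesis by linarith
      next
        case False
        then have "Y \<omega> * of_bool (m \<le> nfire S a (a + Suc r) \<omega>) \<le> Y \<omega> * of_bool (Suc k \<le> nfire S a l \<omega>)"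
          using Y0 Suc by (auto simp: l_def)
        then show ?thesis using nn by linarith
      qed
    qed
    also have "\<dots> = expectation (\<lambda>\<omega>. Y \<omega> * of_bool (Suc k \<le> nfire S a l \<omega>))
        + (\<Sum>i\<in>S. expectation (\<lambda>\<omega>. ?Z \<omega> * of_bool (1 \<le> c l i \<omega>)))"
      using weight_bdd[OF bk] weight_bdd[OF Zc]
      by (subst Bochner_Integration.integral_add, (auto intro!: bdd_rv_integrable bdd_rv_sum)[2],
          subst Bochner_Integration.integral_sum, auto intro!: bdd_rv_integrable)
    also have "\<dots> \<le> (real r * p) ^ Suc k * expectation Y + (\<Sum>i\<in>S. (h * B + \<rho>) * expectation ?Z)"
    proof (intro add_mono sum_mono)
      show "expectation (\<lambda>\<omega>. Y \<omega> * of_bool (Suc k \<le> nfire S a l \<omega>)) \<le> (real r * p) ^ Suc k * expectation Y"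
        using Suc.IH[of "Suc k"] by (simp add: l_def)
      fix i assume "i \<in> S"
      then have i: "i \<in> {1..n}" using S by auto
      have "h * expectation (\<lambda>\<omega>. ?Z \<omega> * lam l i \<omega>) \<le> h * (B * expectation ?Z)"
        by (rule mult_left_mono[OF weighted_lam_le[OF Z i]]) (use Zb i param_nonneg in auto)
      then show "expectation (\<lambda>\<omega>. ?Z \<omega> * of_bool (1 \<le> c l i \<omega>)) \<le> (h * B + \<rho>) * expectation ?Z"
        using fire_upper[OF Z Zb i] by (simp add: algebra_simps)
    qed
    finally have 1: "expectation (\<lambda>\<omega>. Y \<omega> * of_bool (m \<le> nfire S a (a + Suc r) \<omega>))
      \<le> (real r * p) ^ Suc k * expectation Y + (\<Sum>i\<in>S. (h * B + \<rho>) * expectation ?Z)" .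
    have "(\<Sum>i\<in>S. (h * B + \<rho>) * expectation ?Z) = (real (card S) * (h * B + \<rho>)) * expectation ?Z"
      by simp
    also have "\<dots> \<le> p * expectation (\<lambda>\<omega>. Y \<omega> * of_bool (k \<le> nfire S a l \<omega>))"
    proof (rule mult_mono[OF p _ p0])
      show "expectation ?Z \<le> expectation (\<lambda>\<omega>. Y \<omega> * of_bool (k \<le> nfire S a l \<omega>))"
        by (rule expectation_mono_bdd) (use weight_bdd_M[OF Z] weight_bdd[OF bk] weight_ge_0[OF Y] in auto)
      show "0 \<le> expectation ?Z" using expectation_nonneg_weight weight_F_M[OF Z] .
    qed
    also have "\<dots> \<le> p * ((real r * p) ^ k * expectation Y)"
      using Suc.IH[of k] p0 by (simp add: l_def mult_left_mono)
    finally have 2: "(\<Sum>i\<in>S. (h * B + \<rho>) * expectation ?Z) \<le> p * ((real r * p) ^ k * expectation Y)" .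
    \<comment> \<open>The recursion closes because
      \<open>r ^ k * (r + 1) \<le> (r + 1) ^ Suc k\<close>.\<close>
    have "(real r * p) ^ Suc k * expectation Y + p * ((real r * p) ^ k * expectation Y)
       = (real r ^ k * (real r + 1)) * (p ^ Suc k * expectation Y)"
      by (simp add: algebra_simps power_mult_distrib)
    also have "\<dots> \<le> ((real r + 1) ^ k * (real r + 1)) * (p ^ Suc k * expectation Y)"
      using p0 EY by (intro mult_right_mono power_mono) auto
    also have "\<dots> = (real (Suc r) * p) ^ m * expectation Y"
      unfolding power_mult_distrib Suc by (simp add: add.commute)
    finally show ?thesis using 1 2 by linarith
  qed
qed

end

lemma (in prob_space) expectation_add_bdd:
  "bdd_rv M X \<Longrightarrow> bdd_rv M Y \<Longrightarrow> expectation (\<lambda>\<omega>. X \<omega> + Y \<omega>) = expectation X + expectation Y"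
  by (rule Bochner_Integration.integral_add) (rule bdd_rv_integrable, assumption)+

lemma (in prob_space) expectation_diff_bdd:
  "bdd_rv M X \<Longrightarrow> bdd_rv M Y \<Longrightarrow> expectation (\<lambda>\<omega>. X \<omega> - Y \<omega>) = expectation X - expectation Y"
  by (rule Bochner_Integration.integral_diff) (rule bdd_rv_integrable, assumption)+

lemma (in prob_space) expectation_sum_bdd:
  "(\<And>i. i \<in> I \<Longrightarrow> bdd_rv M (X i)) \<Longrightarrow>
    expectation (\<lambda>\<omega>. \<Sum>i\<in>I. X i \<omega>) = (\<Sum>i\<in>I. expectation (X i))"
  by (rule Bochner_Integration.integral_sum) (rule bdd_rv_integrable, blast)

section \<open>Survival below the level \<open>B\<close> over a short stretch of cells\<close>

context firing_chain
begin

lemma nfire_mono: "l \<le> l' \<Longrightarrow> nfire S a l \<omega> \<le> nfire S a l' \<omega>"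
  unfolding nfire_def by (rule card_mono) auto

lemma sum_count_eq:
  assumes "S \<subseteq> {1..n}" "tot x \<omega> \<le> 1"
  shows "(\<Sum>i\<in>S. c x i \<omega>) = of_bool (\<exists>i\<in>S. 1 \<le> c x i \<omega>)"
proof -
  have fin: "finite S" using assms(1) finite_subset by blast
  have "(\<Sum>i\<in>S. c x i \<omega>) \<le> 1"
    using sum_mono2[of "{1..n}" S "\<lambda>i. c x i \<omega>"] assms unfolding tot_def by auto
  moreover have "(\<Sum>i\<in>S. c x i \<omega>) = 0 \<longleftrightarrow> \<not> (\<exists>i\<in>S. 1 \<le> c x i \<omega>)"
    using fin by (auto simp: not_le)
  ultimately show ?thesis by (cases "\<exists>i\<in>S. 1 \<le> c x i \<omega>") auto
qed

lemma nfire_eq: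
  assumes "S \<subseteq> {1..n}" "\<And>x. x \<in> {a..<l} \<Longrightarrow> alive B a x \<omega> \<and> tot x \<omega> \<le> 1"
  shows "(\<Sum>i\<in>S. \<Sum>x=a..<l. real (c x i \<omega>)) = real (nfire S a l \<omega>)"
proof -
  have "(\<Sum>i\<in>S. \<Sum>x=a..<l. real (c x i \<omega>)) = real (\<Sum>x=a..<l. \<Sum>i\<in>S. c x i \<omega>)"
    by (subst sum.swap) simp
  also have "(\<Sum>x=a..<l. \<Sum>i\<in>S. c x i \<omega>) = (\<Sum>x=a..<l. of_bool (alive B a x \<omega> \<and> (\<exists>i\<in>S. 1 \<le> c x i \<omega>)))"
    by (rule sum.cong) (use assms sum_count_eq in auto)
  also have "\<dots> = nfire S a l \<omega>"
    unfolding nfire_def by (simp add: sum.If_cases of_bool_def Int_def)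
  finally show ?thesis .
qed

lemma weighted_count_le:
  assumes "k \<in> {1..n}" "\<And>x. x \<in> {a..<l} \<Longrightarrow> alive B a x \<omega> \<and> tot x \<omega> \<le> 1"
    and S: "parents k \<subseteq> S" "S \<subseteq> {1..n}"
  shows "(\<Sum>j=1..n. w k j * (\<Sum>x=a..<l. real (c x j \<omega>))) \<le> wm * real (nfire S a l \<omega>)"
proof -
  have "(\<Sum>j=1..n. w k j * (\<Sum>x=a..<l. real (c x j \<omega>))) = (\<Sum>j\<in>S. w k j * (\<Sum>x=a..<l. real (c x j \<omega>)))"
    by (rule sum.mono_neutral_right) (use S in \<open>auto simp: parents_def\<close>)
  also have "\<dots> \<le> (\<Sum>j\<in>S. wm * (\<Sum>x=a..<l. real (c x j \<omega>)))"
    by (intro sum_mono mult_right_mono sum_nonneg) (use w_range assms in \<open>auto simp: subset_iff\<close>)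
  also have "\<dots> = wm * real (nfire S a l \<omega>)"
    unfolding sum_distrib_left[symmetric] by (subst nfire_eq[OF S(2) assms(2)]) simp_all
  finally show ?thesis .
qed

lemma alive_Suc:
  assumes "a \<le> l" "alive R a l \<omega>" "tot l \<omega> \<le> 1" "\<And>k. k \<in> {1..n} \<Longrightarrow> lam (Suc l) k \<omega> \<le> R"
  shows "alive R a (Suc l) \<omega>"
  using assms unfolding alive_def by (auto simp: less_Suc_eq le_Suc_eq)

lemma alive_prefix:
  assumes "alive B a l \<omega>" "x \<in> {a..<l}"
  shows "alive B a x \<omega> \<and> tot x \<omega> \<le> 1"
  using assms unfolding alive_def by auto

text \<open>Death needs a cause. As long as no cell holds two events and no node has seen
  \<open>m\<close> firings among its parents, \<open>lam_upper\<close> keeps every rate below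
  \<open>R\<close> plus the drift plus \<open>wm * real m\<close>, hence below \<open>B\<close>. The
  slack between \<open>R\<close> and \<open>B\<close> is what the events of one stretch may use
  up.\<close>

lemma not_alive_cases:
  assumes om: "\<omega> \<in> space M" and start: "\<And>k. k \<in> {1..n} \<Longrightarrow> lam a k \<omega> \<le> R"
    and R: "R + \<kappa> * (h * real r) + wm * real m \<le> B" and na: "\<not> alive B a (a + r) \<omega>"
  shows "(\<exists>x\<in>{a..<a+r}. alive B a x \<omega> \<and> 2 \<le> tot x \<omega>) \<or>
         (\<exists>k\<in>{1..n}. m \<le> nfire (parents k) a (a + r) \<omega>)"
proof (rule ccontr)
  assume nc: "\<not> ?thesis"
  have "alive B a (a + s) \<omega>" if "s \<le> r" for s
    using that
  proof (induction s)
    case 0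
    have "R \<le> B" using R param_nonneg by (smt (verit) mult_nonneg_nonneg of_nat_0_le_iff)
    then show ?case unfolding alive_def using start by force
  next
    case (Suc s)
    then have al: "alive B a (a + s) \<omega>" by simp
    have t: "tot (a + s) \<omega> \<le> 1" using nc al Suc.prems by fastforce
    show ?case unfolding add_Suc_right
    proof (rule alive_Suc[OF _ al t])
      fix k assume k: "k \<in> {1..n}"
      have pre: "alive B a x \<omega> \<and> tot x \<omega> \<le> 1" if "x \<in> {a..<Suc (a + s)}" for x
        using that al t alive_prefix[OF al, of x] by (cases "x = a + s") auto
      have nf: "nfire (parents k) a (Suc (a + s)) \<omega> \<le> m"
      proof -
        have "\<not> m \<le> nfire (parents k) a (a + r) \<omega>" using nc k by blast
        moreover have "nfire (parents k) a (Suc (a + s)) \<omega> \<le> nfire (parents k) a (a + r) \<omega>"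
          by (rule nfire_mono) (use Suc.prems in simp)
        ultimately show ?thesis by linarith
      qed
      have "lam (Suc (a + s)) k \<omega> \<le> lam a k \<omega> + \<kappa> * (h * real (Suc (a + s) - a))
          + (\<Sum>j=1..n. w k j * (\<Sum>x=a..<Suc (a + s). real (c x j \<omega>)))"
        by (rule lam_upper) (use k om in auto)
      also have "\<dots> \<le> R + \<kappa> * (h * real r) + wm * real m"
      proof (intro add_mono start k)
        show "\<kappa> * (h * real (Suc (a + s) - a)) \<le> \<kappa> * (h * real r)"
          using param_nonneg Suc.prems by (intro mult_left_mono) auto
        have "(\<Sum>j=1..n. w k j * (\<Sum>x=a..<Suc (a + s). real (c x j \<omega>)))
            \<le> wm * real (nfire (parents k) a (Suc (a + s)) \<omega>)"
          by (rule weighted_count_le[OF k _ order_refl parents_subset]) (rule pre)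
        also have "\<dots> \<le> wm * real m"
          using nf param_nonneg by (intro mult_left_mono) auto
        finally show "(\<Sum>j=1..n. w k j * (\<Sum>x=a..<Suc (a + s). real (c x j \<omega>))) \<le> wm * real m" .
      qed
      finally show "lam (Suc (a + s)) k \<omega> \<le> B" using R by simp
    qed simp
  qed
  then show False using na by blast
qed

lemma weight_alive: "weight (F a) Y \<Longrightarrow> a \<le> l \<Longrightarrow> l' \<le> l \<Longrightarrow> weight (F l) (\<lambda>\<omega>. Y \<omega> * of_bool (alive R b l' \<omega>))"
  by (rule weight_mult[OF weight_F_mono weight_of_bool[OF pred_alive]])

lemma pred_not_alive: "l \<le> l' \<Longrightarrow> Measurable.pred (F l') (\<lambda>\<omega>. \<not> alive R a l \<omega>)"
  using pred_alive by (rule pred_intros_logic)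

lemma weight_not_alive: "weight (F a) Y \<Longrightarrow> a \<le> l \<Longrightarrow> l' \<le> l \<Longrightarrow> weight (F l) (\<lambda>\<omega>. Y \<omega> * of_bool (\<not> alive R b l' \<omega>))"
  by (rule weight_mult[OF weight_F_mono weight_of_bool[OF pred_not_alive]])

lemma weight_alive_tot:
  assumes "weight (F a) Y" "a \<le> l"
  shows "weight (F (Suc l)) (\<lambda>\<omega>. (Y \<omega> * of_bool (alive R a l \<omega>)) * of_bool (2 \<le> tot l \<omega>))"
proof -
  have "Measurable.pred (F (Suc l)) (\<lambda>\<omega>. \<not> tot l \<omega> \<le> 1)"
    using pred_tot[of l "Suc l"] by (intro pred_intros_logic) simp
  moreover have "(\<lambda>\<omega>. \<not> tot l \<omega> \<le> 1) = (\<lambda>\<omega>. 2 \<le> tot l \<omega>)" by auto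
  ultimately have "Measurable.pred (F (Suc l)) (\<lambda>\<omega>. 2 \<le> tot l \<omega>)" by simp
  then show ?thesis
    by (intro weight_mult[OF weight_F_mono[OF _ weight_alive[OF assms(1,2) order_refl]] weight_of_bool]) auto
qed

lemma weight_nfire:
  assumes "weight (F a) Y" "a \<le> l" "S \<subseteq> {1..n}"
  shows "weight (F l) (\<lambda>\<omega>. Y \<omega> * of_bool (m \<le> nfire S b l \<omega>))"
  using weight_mult[OF weight_F_mono[OF assms(2,1)] weight_of_bool[OF pred_nfire[OF order_refl assms(3)]]] .

lemma two_alive:
  assumes Y: "weight (F a) Y" and al: "a \<le> l"
  shows "expectation (\<lambda>\<omega>. (Y \<omega> * of_bool (alive B a l \<omega>)) * of_bool (2 \<le> tot l \<omega>)) \<le> \<rho> * expectation Y"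
proof -
  let ?Z = "\<lambda>\<omega>. Y \<omega> * of_bool (alive B a l \<omega>)"
  have Z: "weight (F l) ?Z" using weight_alive[OF Y al order_refl] .
  have "expectation (\<lambda>\<omega>. ?Z \<omega> * of_bool (2 \<le> tot l \<omega>)) \<le> \<rho> * expectation ?Z"
    unfolding tot_def by (rule two_upper[OF Z]) (use al in \<open>auto intro: alive_lam\<close>)
  also have "\<dots> \<le> \<rho> * expectation Y"
    by (intro mult_left_mono expectation_mono_bdd weight_bdd_M[OF Z] weight_bdd_M[OF Y])
      (use param_nonneg weight_ge_0[OF Y] in auto)
  finally show ?thesis .
qed

text \<open>Union bound over the causes of death: \<open>\<rho>\<close> for each cell, and
  \<open>multi_fire\<close> for the parents of each node. The number of nodes stands in front of an
  \<open>m\<close>-th power, so it is absorbed once \<open>real r * p\<close> is below a constant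
  less than 1 and \<open>m\<close> is large compared with its logarithm.\<close>

lemma death_bound:
  assumes Y: "weight (F a) Y" and start: "\<And>\<omega> k. \<omega> \<in> space M \<Longrightarrow> Y \<omega> \<noteq> 0 \<Longrightarrow> k \<in> {1..n} \<Longrightarrow> lam a k \<omega> \<le> R"
    and R: "R + \<kappa> * (h * real r) + wm * real m \<le> B" and p: "real d * (h * B + \<rho>) \<le> p"
  shows "expectation (\<lambda>\<omega>. Y \<omega> * of_bool (\<not> alive B a (a + r) \<omega>))
     \<le> (real r * \<rho> + real n * (real r * p) ^ m) * expectation Y"
proof -
  let ?T = "\<lambda>x \<omega>. (Y \<omega> * of_bool (alive B a x \<omega>)) * of_bool (2 \<le> tot x \<omega>)"
  let ?N = "\<lambda>k \<omega>. Y \<omega> * of_bool (m \<le> nfire (parents k) a (a + r) \<omega>)"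
  have T: "bdd_rv M (?T x)" if "x \<in> {a..<a+r}" for x
    using weight_bdd_M[OF weight_alive_tot[OF Y, of x]] that by auto
  have N: "bdd_rv M (?N k)" for k
    using weight_bdd_M[OF weight_nfire[OF Y, of "a + r" "parents k"]] parents_subset by auto
  have "expectation (\<lambda>\<omega>. Y \<omega> * of_bool (\<not> alive B a (a + r) \<omega>))
      \<le> expectation (\<lambda>\<omega>. (\<Sum>x\<in>{a..<a+r}. ?T x \<omega>) + (\<Sum>k\<in>{1..n}. ?N k \<omega>))"
  proof (rule expectation_mono_bdd)
    show "bdd_rv M (\<lambda>\<omega>. Y \<omega> * of_bool (\<not> alive B a (a + r) \<omega>))"
      using weight_bdd_M[OF weight_not_alive[OF Y le_add1 order_refl]] .
    show "bdd_rv M (\<lambda>\<omega>. (\<Sum>x\<in>{a..<a+r}. ?T x \<omega>) + (\<Sum>k\<in>{1..n}. ?N k \<omega>))"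
      by (intro bdd_rv_add bdd_rv_sum T N)
    fix \<omega> assume om: "\<omega> \<in> space M"
    have Y0: "0 \<le> Y \<omega>" using weight_ge_0[OF Y] om by simp
    have nn: "0 \<le> (\<Sum>x\<in>{a..<a+r}. ?T x \<omega>)" "0 \<le> (\<Sum>k\<in>{1..n}. ?N k \<omega>)"
      using Y0 by (auto intro!: sum_nonneg)
    show "Y \<omega> * of_bool (\<not> alive B a (a + r) \<omega>) \<le> (\<Sum>x\<in>{a..<a+r}. ?T x \<omega>) + (\<Sum>k\<in>{1..n}. ?N k \<omega>)"
    proof (cases "Y \<omega> = 0 \<or> alive B a (a + r) \<omega>")
      case True then show ?thesis using nn by auto
    next
      case False
      then have "(\<exists>x\<in>{a..<a+r}. alive B a x \<omega> \<and> 2 \<le> tot x \<omega>) \<or>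
         (\<exists>k\<in>{1..n}. m \<le> nfire (parents k) a (a + r) \<omega>)"
        using not_alive_cases[OF om start[OF om] R] by blast
      then show ?thesis
      proof
        assume "\<exists>x\<in>{a..<a+r}. alive B a x \<omega> \<and> 2 \<le> tot x \<omega>"
        then obtain x where x: "x \<in> {a..<a+r}" "alive B a x \<omega>" "2 \<le> tot x \<omega>" by blast
        have "?T x \<omega> \<le> (\<Sum>x\<in>{a..<a+r}. ?T x \<omega>)"
          by (rule member_le_sum[OF x(1)]) (use Y0 in auto)
        then show ?thesis using x nn False by simp
      next
        assume "\<exists>k\<in>{1..n}. m \<le> nfire (parents k) a (a + r) \<omega>"
        then obtain k where k: "k \<in> {1..n}" "m \<le> nfire (parents k) a (a + r) \<omega>" by blast
        have "?N k \<omega> \<le> (\<Sum>k\<in>{1..n}. ?N k \<omega>)"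
          by (rule member_le_sum[OF k(1)]) (use Y0 in auto)
        then show ?thesis using k nn False by simp
      qed
    qed
  qed
  also have "\<dots> = (\<Sum>x\<in>{a..<a+r}. expectation (?T x)) + (\<Sum>k\<in>{1..n}. expectation (?N k))"
    by (subst expectation_add_bdd, (intro bdd_rv_sum T N, assumption?)+,
        subst expectation_sum_bdd, (intro T, assumption), subst expectation_sum_bdd, (intro N), rule refl)
  also have "\<dots> \<le> (\<Sum>x\<in>{a..<a+r}. \<rho> * expectation Y) + (\<Sum>k\<in>{1..n}. (real r * p) ^ m * expectation Y)"
  proof (intro add_mono sum_mono)
    fix x assume "x \<in> {a..<a+r}"
    then show "expectation (?T x) \<le> \<rho> * expectation Y" using two_alive[OF Y] by simp
  next
    fix k assume k: "k \<in> {1..n}"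
    have "real (card (parents k)) * (h * B + \<rho>) \<le> real d * (h * B + \<rho>)"
      using w_sparse[OF k] param_nonneg by (intro mult_right_mono) (auto simp: parents_def)
    then show "expectation (?N k) \<le> (real r * p) ^ m * expectation Y"
      using multi_fire[OF parents_subset _ Y] p by fastforce
  qed
  also have "\<dots> = (real r * \<rho> + real n * (real r * p) ^ m) * expectation Y"
    by (simp add: algebra_simps)
  finally show ?thesis .
qed

section \<open>Firing in one window, to first order in its length\<close>

definition fires :: "nat \<Rightarrow> nat \<Rightarrow> nat \<Rightarrow> 'a \<Rightarrow> bool" where
  "fires i l l' \<omega> \<longleftrightarrow> (\<exists>x\<in>{l..<l'}. 1 \<le> c x i \<omega>)"

lemma pred_fires: "l' \<le> l'' \<Longrightarrow> i \<in> {1..n} \<Longrightarrow> Measurable.pred (F l'') (fires i l l')"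
  unfolding fires_def by (rule pred_intros_finite(4), simp, rule pred_c) auto

lemma weight_fires:
  "weight (F a) Y \<Longrightarrow> a \<le> l' \<Longrightarrow> i \<in> {1..n} \<Longrightarrow> weight (F l') (\<lambda>\<omega>. Y \<omega> * of_bool (fires i l l' \<omega>))"
  by (rule weight_mult[OF weight_F_mono weight_of_bool[OF pred_fires]]) auto

lemma weight_c:
  "weight (F l) Y \<Longrightarrow> i \<in> {1..n} \<Longrightarrow> weight (F (Suc l)) (\<lambda>\<omega>. Y \<omega> * of_bool (1 \<le> c l i \<omega>))"
  by (rule weight_mult[OF weight_F_mono weight_of_bool[OF pred_c]]) auto

text \<open>Union bound over the cells of the window. The rate at a later cell exceeds the initial
  one only by the drift, unless \<open>i\<close> or a parent has fired before; that exception costs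
  at most \<open>real q * p\<close>, and the rate is then still at most \<open>B\<close>. Paths that
  die inside the window are charged in the last term.\<close>

lemma window_upper:
  assumes Y: "weight (F l) Y" and supp: "\<And>\<omega> k. \<omega> \<in> space M \<Longrightarrow> Y \<omega> \<noteq> 0 \<Longrightarrow> k \<in> {1..n} \<Longrightarrow> lam l k \<omega> \<le> B"
    and i: "i \<in> {1..n}" and p: "real (card (insert i (parents i))) * (h * B + \<rho>) \<le> p"
  shows "expectation (\<lambda>\<omega>. Y \<omega> * of_bool (fires i l (l + q) \<omega>))
    \<le> (h * real q) * expectation (\<lambda>\<omega>. Y \<omega> * lam l i \<omega>)
      + ((h * real q) * (\<kappa> * (h * real q) + B * (real q * p)) + real q * \<rho>) * expectation Y
      + expectation (\<lambda>\<omega>. Y \<omega> * of_bool (\<not> alive B l (l + q) \<omega>))"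
proof -
  let ?S = "insert i (parents i)"
  let ?Z = "\<lambda>x \<omega>. Y \<omega> * of_bool (alive B l x \<omega>)"
  let ?T = "\<lambda>x \<omega>. ?Z x \<omega> * of_bool (1 \<le> c x i \<omega>)"
  let ?D = "\<lambda>\<omega>. Y \<omega> * of_bool (\<not> alive B l (l + q) \<omega>)"
  let ?N = "\<lambda>x \<omega>. Y \<omega> * of_bool (1 \<le> nfire ?S l x \<omega>)"
  have S: "?S \<subseteq> {1..n}" using i parents_subset by auto
  have EY: "0 \<le> expectation Y" using expectation_nonneg_weight weight_F_M[OF Y] .
  have "0 \<le> real (card ?S) * (h * B + \<rho>)"
    using param_nonneg by (intro mult_nonneg_nonneg add_nonneg_nonneg) auto
  then have p0: "0 \<le> p" using p by linarith
  have Z: "weight (F x) (?Z x)" if "l \<le> x" for x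
    using weight_alive[OF Y that order_refl] .
  have T: "bdd_rv M (?T x)" if "l \<le> x" for x
    using weight_bdd_M[OF weight_c[OF Z[OF that] i]] .
  have D: "bdd_rv M ?D" using weight_bdd_M[OF weight_not_alive[OF Y le_add1 order_refl]] .
  have Yl: "bdd_rv M (\<lambda>\<omega>. Y \<omega> * lam l i \<omega>)"
    using weight_bdd_M[OF weighted_lam_bdd[OF Y i supp]] i by blast
  have each: "expectation (?T x) \<le> h * (expectation (\<lambda>\<omega>. Y \<omega> * lam l i \<omega>)
      + (\<kappa> * (h * real q) + B * (real q * p)) * expectation Y) + \<rho> * expectation Y"
    if x: "x \<in> {l..<l+q}" for x
  proof -
    have lx: "l \<le> x" using x by simp
    have supZ: "\<And>\<omega> k. \<omega> \<in> space M \<Longrightarrow> ?Z x \<omega> \<noteq> 0 \<Longrightarrow> k \<in> {1..n} \<Longrightarrow> lam x k \<omega> \<le> B"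
      using lx by (auto intro: alive_lam)
    have N: "bdd_rv M (?N x)" using weight_bdd_M[OF weight_nfire[OF Y lx S]] .
    have 1: "expectation (?T x) \<le> h * expectation (\<lambda>\<omega>. ?Z x \<omega> * lam x i \<omega>) + \<rho> * expectation (?Z x)"
      by (rule fire_upper[OF Z[OF lx] supZ i])
    have "expectation (\<lambda>\<omega>. ?Z x \<omega> * lam x i \<omega>)
       \<le> expectation (\<lambda>\<omega>. (Y \<omega> * lam l i \<omega> + (\<kappa> * (h * real q)) * Y \<omega>) + B * ?N x \<omega>)"
    proof (rule expectation_mono_bdd)
      show "bdd_rv M (\<lambda>\<omega>. ?Z x \<omega> * lam x i \<omega>)"
        using weight_bdd_M[OF weighted_lam_bdd[OF Z[OF lx] i supZ]] i by blast
      show "bdd_rv M (\<lambda>\<omega>. (Y \<omega> * lam l i \<omega> + (\<kappa> * (h * real q)) * Y \<omega>) + B * ?N x \<omega>)"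
        by (intro bdd_rv_add Yl bdd_rv_mult[OF bdd_rv_const] N weight_bdd_M[OF Y])
      fix \<omega> assume om: "\<omega> \<in> space M"
      have Y0: "0 \<le> Y \<omega>" using weight_ge_0[OF Y] om by simp
      have nn: "0 \<le> Y \<omega> * lam l i \<omega>" "0 \<le> (\<kappa> * (h * real q)) * Y \<omega>" "0 \<le> B * ?N x \<omega>"
        using Y0 param_nonneg lam_nonneg[OF i om, of l] by auto
      show "?Z x \<omega> * lam x i \<omega> \<le> (Y \<omega> * lam l i \<omega> + (\<kappa> * (h * real q)) * Y \<omega>) + B * ?N x \<omega>"
      proof (cases "alive B l x \<omega>")
        case False then show ?thesis using nn by simp
      next
        case al: True
        show ?thesis
        proof (cases "1 \<le> nfire ?S l x \<omega>")
          case True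
          have "Y \<omega> * lam x i \<omega> \<le> Y \<omega> * B"
            by (rule mult_left_mono[OF alive_lam[OF al lx i] Y0])
          then show ?thesis using nn al True by (simp add: mult.commute)
        next
          case False
          have "(\<Sum>j=1..n. w i j * (\<Sum>x=l..<x. real (c x j \<omega>))) \<le> wm * real (nfire ?S l x \<omega>)"
            by (rule weighted_count_le[OF i alive_prefix[OF al] _ S]) auto
          moreover have "nfire ?S l x \<omega> = 0" using False by linarith
          ultimately have "(\<Sum>j=1..n. w i j * (\<Sum>x=l..<x. real (c x j \<omega>))) \<le> 0" by simp
          then have "lam x i \<omega> \<le> lam l i \<omega> + \<kappa> * (h * real (x - l))"
            using lam_upper[OF lx i om] by linarith
          also have "\<dots> \<le> lam l i \<omega> + \<kappa> * (h * real q)"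
            using x param_nonneg by (intro add_left_mono mult_left_mono) auto
          finally have "Y \<omega> * lam x i \<omega> \<le> Y \<omega> * (lam l i \<omega> + \<kappa> * (h * real q))"
            using Y0 by (rule mult_left_mono)
          then show ?thesis using al False by (simp add: algebra_simps)
        qed
      qed
    qed
    also have "\<dots> = expectation (\<lambda>\<omega>. Y \<omega> * lam l i \<omega>) + (\<kappa> * (h * real q)) * expectation Y + B * expectation (?N x)"
      by (subst expectation_add_bdd, (intro bdd_rv_add Yl bdd_rv_mult[OF bdd_rv_const] N weight_bdd_M[OF Y])+,
          subst expectation_add_bdd, (intro Yl bdd_rv_mult[OF bdd_rv_const] weight_bdd_M[OF Y])+) simp
    also have "\<dots> \<le> expectation (\<lambda>\<omega>. Y \<omega> * lam l i \<omega>) + (\<kappa> * (h * real q) + B * (real q * p)) * expectation Y"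
    proof -
      have "expectation (?N x) \<le> (real (x - l) * p) ^ 1 * expectation Y"
        using multi_fire[OF S p Y, of 1 "x - l"] lx by simp
      also have "\<dots> \<le> (real q * p) * expectation Y"
        using x p0 EY by (auto intro!: mult_right_mono)
      finally have "B * expectation (?N x) \<le> B * ((real q * p) * expectation Y)"
        using param_nonneg by (intro mult_left_mono)
      then show ?thesis by (simp add: algebra_simps)
    qed
    finally have "h * expectation (\<lambda>\<omega>. ?Z x \<omega> * lam x i \<omega>) \<le>
       h * (expectation (\<lambda>\<omega>. Y \<omega> * lam l i \<omega>) + (\<kappa> * (h * real q) + B * (real q * p)) * expectation Y)"
      using param_nonneg by (intro mult_left_mono)
    moreover have "\<rho> * expectation (?Z x) \<le> \<rho> * expectation Y"
      by (intro mult_left_mono expectation_mono_bdd weight_bdd_M[OF Z[OF lx]] weight_bdd_M[OF Y])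
        (use param_nonneg weight_ge_0[OF Y] in auto)
    ultimately show ?thesis using 1 by linarith
  qed
  have "expectation (\<lambda>\<omega>. Y \<omega> * of_bool (fires i l (l + q) \<omega>))
      \<le> expectation (\<lambda>\<omega>. (\<Sum>x\<in>{l..<l+q}. ?T x \<omega>) + ?D \<omega>)"
  proof (rule expectation_mono_bdd)
    show "bdd_rv M (\<lambda>\<omega>. Y \<omega> * of_bool (fires i l (l + q) \<omega>))"
      using weight_bdd_M[OF weight_fires[OF Y le_add1 i]] .
    show "bdd_rv M (\<lambda>\<omega>. (\<Sum>x\<in>{l..<l+q}. ?T x \<omega>) + ?D \<omega>)"
      by (intro bdd_rv_add bdd_rv_sum T D) auto
    fix \<omega> assume om: "\<omega> \<in> space M"
    have Y0: "0 \<le> Y \<omega>" using weight_ge_0[OF Y] om by simp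
    have nn: "0 \<le> (\<Sum>x\<in>{l..<l+q}. ?T x \<omega>)"
      using Y0 by (auto intro!: sum_nonneg)
    show "Y \<omega> * of_bool (fires i l (l + q) \<omega>) \<le> (\<Sum>x\<in>{l..<l+q}. ?T x \<omega>) + ?D \<omega>"
    proof (cases "alive B l (l + q) \<omega> \<and> fires i l (l + q) \<omega>")
      case True
      then obtain x where x: "x \<in> {l..<l+q}" "1 \<le> c x i \<omega>" unfolding fires_def by blast
      have "?T x \<omega> \<le> (\<Sum>x\<in>{l..<l+q}. ?T x \<omega>)"
        by (rule member_le_sum[OF x(1)]) (use Y0 in auto)
      moreover have "alive B l x \<omega>" using alive_prefix x True by blast
      ultimately show ?thesis using x True by simp
    qed (use nn Y0 in auto)
  qed
  also have "\<dots> = (\<Sum>x\<in>{l..<l+q}. expectation (?T x)) + expectation ?D"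
    by (subst expectation_add_bdd, (intro bdd_rv_sum T, simp), rule D, subst expectation_sum_bdd, rule T, simp, rule refl)
  also have "(\<Sum>x\<in>{l..<l+q}. expectation (?T x)) \<le> (\<Sum>x\<in>{l..<l+q}. h * (expectation (\<lambda>\<omega>. Y \<omega> * lam l i \<omega>)
      + (\<kappa> * (h * real q) + B * (real q * p)) * expectation Y) + \<rho> * expectation Y)"
    by (intro sum_mono each)
  also have "\<dots> = (h * real q) * expectation (\<lambda>\<omega>. Y \<omega> * lam l i \<omega>)
      + ((h * real q) * (\<kappa> * (h * real q) + B * (real q * p)) + real q * \<rho>) * expectation Y"
    by (simp add: algebra_simps)
  finally show ?thesis by simp
qed

text \<open>A sum of cell indicators may count a window more than once. Therefore only those cells
  are kept before which neither \<open>i\<close> nor a parent has fired; at most one of them can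
  fire at \<open>i\<close>, so their indicators add up to at most the indicator of the window. The
  restriction loses a term of the same order as the error in \<open>window_upper\<close>.\<close>

lemma window_lower:
  assumes Y: "weight (F l) Y" and supp: "\<And>\<omega> k. \<omega> \<in> space M \<Longrightarrow> Y \<omega> \<noteq> 0 \<Longrightarrow> k \<in> {1..n} \<Longrightarrow> lam l k \<omega> \<le> B"
    and i: "i \<in> {1..n}" and p: "real (card (insert i (parents i))) * (h * B + \<rho>) \<le> p"
    and Lq: "L * (h * real q) \<le> 1"
  shows "(h * real q) * expectation (\<lambda>\<omega>. Y \<omega> * lam l i \<omega>)
      - ((h * real q) * (L * (h * real q) * B + B * (real q * p)) + real q * \<rho>) * expectation Y
      - (h * real q * B) * expectation (\<lambda>\<omega>. Y \<omega> * of_bool (\<not> alive B l (l + q) \<omega>))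
    \<le> expectation (\<lambda>\<omega>. Y \<omega> * of_bool (fires i l (l + q) \<omega>))"
proof -
  let ?S = "insert i (parents i)"
  let ?P = "\<lambda>x \<omega>. alive B l x \<omega> \<and> \<not> 1 \<le> nfire ?S l x \<omega>"
  let ?Z = "\<lambda>x \<omega>. Y \<omega> * of_bool (?P x \<omega>)"
  let ?T = "\<lambda>x \<omega>. ?Z x \<omega> * of_bool (1 \<le> c x i \<omega>)"
  let ?D = "\<lambda>\<omega>. Y \<omega> * of_bool (\<not> alive B l (l + q) \<omega>)"
  let ?N = "\<lambda>\<omega>. Y \<omega> * of_bool (1 \<le> nfire ?S l (l + q) \<omega>)"
  let ?L = "L * (h * real q)"
  have S: "?S \<subseteq> {1..n}" using i parents_subset by auto
  have EY: "0 \<le> expectation Y" using expectation_nonneg_weight weight_F_M[OF Y] .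
  have "0 \<le> real (card ?S) * (h * B + \<rho>)"
    using param_nonneg by (intro mult_nonneg_nonneg add_nonneg_nonneg) auto
  then have p0: "0 \<le> p" using p by linarith
  have Z: "weight (F x) (?Z x)" if "l \<le> x" for x
  proof -
    have "Measurable.pred (F x) (?P x)"
      by (intro pred_intros_logic pred_alive order_refl pred_nfire S)
    then show ?thesis using weight_mult[OF weight_F_mono[OF that Y] weight_of_bool] by blast
  qed
  have T: "bdd_rv M (?T x)" if "l \<le> x" for x
    using weight_bdd_M[OF weight_c[OF Z[OF that] i]] .
  have D: "bdd_rv M ?D" using weight_bdd_M[OF weight_not_alive[OF Y le_add1 order_refl]] .
  have N: "bdd_rv M ?N" using weight_bdd_M[OF weight_nfire[OF Y le_add1 S]] .
  have Ylw: "weight (F l) (\<lambda>\<omega>. Y \<omega> * lam l i \<omega>)"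
    by (rule weighted_lam_bdd[OF Y i supp]) (use i in auto)
  have Yl: "bdd_rv M (\<lambda>\<omega>. Y \<omega> * lam l i \<omega>)"
    using weight_bdd_M[OF Ylw] .
  have L0: "0 \<le> ?L" using param_nonneg by auto
  have each: "h * (expectation (\<lambda>\<omega>. Y \<omega> * lam l i \<omega>) - (?L * B + B * (real q * p)) * expectation Y
        - B * expectation ?D) - \<rho> * expectation Y \<le> expectation (?T x)"
    if x: "x \<in> {l..<l+q}" for x
  proof -
    have lx: "l \<le> x" using x by simp
    have supZ: "\<And>\<omega> k. \<omega> \<in> space M \<Longrightarrow> ?Z x \<omega> \<noteq> 0 \<Longrightarrow> k \<in> {1..n} \<Longrightarrow> lam x k \<omega> \<le> B"
      using lx by (auto intro: alive_lam)
    have 1: "h * expectation (\<lambda>\<omega>. ?Z x \<omega> * lam x i \<omega>) - \<rho> * expectation (?Z x) \<le> expectation (?T x)"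
      by (rule fire_lower[OF Z[OF lx] supZ i])
    have "expectation (\<lambda>\<omega>. (1 - ?L) * (Y \<omega> * lam l i \<omega>) - (B * ?D \<omega> + B * ?N \<omega>))
       \<le> expectation (\<lambda>\<omega>. ?Z x \<omega> * lam x i \<omega>)"
    proof (rule expectation_mono_bdd)
      show "bdd_rv M (\<lambda>\<omega>. ?Z x \<omega> * lam x i \<omega>)"
        using weight_bdd_M[OF weighted_lam_bdd[OF Z[OF lx] i supZ]] i by blast
      show "bdd_rv M (\<lambda>\<omega>. (1 - ?L) * (Y \<omega> * lam l i \<omega>) - (B * ?D \<omega> + B * ?N \<omega>))"
        by (intro bdd_rv_add bdd_rv_diff Yl bdd_rv_mult[OF bdd_rv_const] N D)
      fix \<omega> assume om: "\<omega> \<in> space M"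
      have Y0: "0 \<le> Y \<omega>" using weight_ge_0[OF Y] om by simp
      have nn: "0 \<le> ?Z x \<omega> * lam x i \<omega>" "0 \<le> B * ?D \<omega>" "0 \<le> B * ?N \<omega>"
        using Y0 param_nonneg lam_nonneg[OF i om, of x] by auto
      show "(1 - ?L) * (Y \<omega> * lam l i \<omega>) - (B * ?D \<omega> + B * ?N \<omega>) \<le> ?Z x \<omega> * lam x i \<omega>"
      proof (cases "Y \<omega> \<noteq> 0 \<and> ?P x \<omega>")
        case True
        have "0 \<le> (\<Sum>j=1..n. w i j * (\<Sum>x=l..<x. real (c x j \<omega>)))"
          by (intro sum_nonneg mult_nonneg_nonneg) (use w_range[OF i] in auto)
        then have a: "lam l i \<omega> \<le> lam l i \<omega> + (\<Sum>j=1..n. w i j * (\<Sum>x=l..<x. real (c x j \<omega>)))" by simp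
        have b: "L * (h * real (x - l)) \<le> ?L"
          using x param_nonneg by (intro mult_left_mono) auto
        have "(1 - ?L) * lam l i \<omega> \<le> (1 - L * (h * real (x - l))) * (lam l i \<omega> + (\<Sum>j=1..n. w i j * (\<Sum>x=l..<x. real (c x j \<omega>))))"
          by (rule mult_mono) (use a b Lq lam_nonneg[OF i om, of l] in auto)
        also have "\<dots> \<le> lam x i \<omega>"
          by (rule lam_lower[OF lx i om]) (use b Lq in linarith)
        finally have "Y \<omega> * ((1 - ?L) * lam l i \<omega>) \<le> Y \<omega> * lam x i \<omega>"
          using Y0 by (rule mult_left_mono)
        then show ?thesis using True nn by (simp add: algebra_simps)
      next
        case False
        show ?thesis
        proof (cases "Y \<omega> = 0")
          case True then show ?thesis using nn by simp
        next
          case Y: False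
          \<comment> \<open>A path excluded at cell \<open>x\<close> has fired or died by the end of
            the window; either way its initial rate, at most \<open>B\<close>, is charged to
            \<open>?N\<close> or \<open>?D\<close>.\<close>
          have "1 \<le> nfire ?S l (l + q) \<omega> \<or> \<not> alive B l (l + q) \<omega>"
            using False Y nfire_mono[of x "l + q" ?S l \<omega>] alive_mono[of B l "l + q" \<omega> l x] x by auto
          then have dn: "Y \<omega> * B \<le> B * ?D \<omega> + B * ?N \<omega>"
            using Y0 param_nonneg by auto
          have "(1 - ?L) * (Y \<omega> * lam l i \<omega>) \<le> 1 * (Y \<omega> * B)"
            by (rule mult_mono) (use L0 Lq Y0 supp[OF om Y i] lam_nonneg[OF i om, of l] in \<open>auto intro: mult_left_mono\<close>)
          then show ?thesis using dn nn by linarith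
        qed
      qed
    qed
    also have "expectation (\<lambda>\<omega>. (1 - ?L) * (Y \<omega> * lam l i \<omega>) - (B * ?D \<omega> + B * ?N \<omega>))
       = (1 - ?L) * expectation (\<lambda>\<omega>. Y \<omega> * lam l i \<omega>) - (B * expectation ?D + B * expectation ?N)"
      by (subst expectation_diff_bdd, (intro bdd_rv_add Yl bdd_rv_mult[OF bdd_rv_const] N D)+,
          subst expectation_add_bdd, (intro Yl bdd_rv_mult[OF bdd_rv_const] N D)+) simp
    finally have 2: "(1 - ?L) * expectation (\<lambda>\<omega>. Y \<omega> * lam l i \<omega>) - (B * expectation ?D + B * expectation ?N)
       \<le> expectation (\<lambda>\<omega>. ?Z x \<omega> * lam x i \<omega>)" .
    have "?L * expectation (\<lambda>\<omega>. Y \<omega> * lam l i \<omega>) \<le> ?L * (B * expectation Y)"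
      by (rule mult_left_mono[OF weighted_lam_le[OF Y i supp[OF _ _ i]] L0])
    moreover have "expectation ?N \<le> (real q * p) ^ 1 * expectation Y"
      using multi_fire[OF S p Y, of 1 q] by simp
    then have "B * expectation ?N \<le> B * ((real q * p) * expectation Y)"
      using param_nonneg by (intro mult_left_mono) auto
    ultimately have "expectation (\<lambda>\<omega>. Y \<omega> * lam l i \<omega>) - (?L * B + B * (real q * p)) * expectation Y - B * expectation ?D
       \<le> expectation (\<lambda>\<omega>. ?Z x \<omega> * lam x i \<omega>)"
      using 2 by (simp add: algebra_simps)
    then have "h * (expectation (\<lambda>\<omega>. Y \<omega> * lam l i \<omega>) - (?L * B + B * (real q * p)) * expectation Y - B * expectation ?D)
       \<le> h * expectation (\<lambda>\<omega>. ?Z x \<omega> * lam x i \<omega>)"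
      using param_nonneg by (intro mult_left_mono)
    moreover have "\<rho> * expectation (?Z x) \<le> \<rho> * expectation Y"
      by (intro mult_left_mono expectation_mono_bdd weight_bdd_M[OF Z[OF lx]] weight_bdd_M[OF Y])
        (use param_nonneg weight_ge_0[OF Y] in auto)
    ultimately show ?thesis using 1 by linarith
  qed
  have "(h * real q) * expectation (\<lambda>\<omega>. Y \<omega> * lam l i \<omega>)
      - ((h * real q) * (L * (h * real q) * B + B * (real q * p)) + real q * \<rho>) * expectation Y
      - (h * real q * B) * expectation ?D
    = (\<Sum>x\<in>{l..<l+q}. h * (expectation (\<lambda>\<omega>. Y \<omega> * lam l i \<omega>) - (?L * B + B * (real q * p)) * expectation Y
        - B * expectation ?D) - \<rho> * expectation Y)"
    by (simp add: algebra_simps)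
  also have "\<dots> \<le> (\<Sum>x\<in>{l..<l+q}. expectation (?T x))"
    by (intro sum_mono each)
  also have "\<dots> = expectation (\<lambda>\<omega>. \<Sum>x\<in>{l..<l+q}. ?T x \<omega>)"
    by (rule expectation_sum_bdd[symmetric], rule T) simp
  also have "\<dots> \<le> expectation (\<lambda>\<omega>. Y \<omega> * of_bool (fires i l (l + q) \<omega>))"
  proof (rule expectation_mono_bdd)
    show "bdd_rv M (\<lambda>\<omega>. Y \<omega> * of_bool (fires i l (l + q) \<omega>))"
      using weight_bdd_M[OF weight_fires[OF Y le_add1 i]] .
    show "bdd_rv M (\<lambda>\<omega>. \<Sum>x\<in>{l..<l+q}. ?T x \<omega>)"
      by (intro bdd_rv_sum T) auto
    fix \<omega> assume om: "\<omega> \<in> space M"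
    have Y0: "0 \<le> Y \<omega>" using weight_ge_0[OF Y] om by simp
    let ?X = "{x\<in>{l..<l+q}. ?P x \<omega> \<and> 1 \<le> c x i \<omega>}"
    \<comment> \<open>An earlier firing at \<open>i\<close> would already be counted by
      \<open>nfire\<close> at the later cell.\<close>
    have uniq: "x = y" if "x \<in> ?X" "y \<in> ?X" "x \<le> y" for x y
    proof (rule ccontr)
      assume "x \<noteq> y"
      with that have "x \<in> {x\<in>{l..<y}. alive B l x \<omega> \<and> (\<exists>i\<in>?S. 1 \<le> c x i \<omega>)}" by auto
      then have "nfire ?S l y \<omega> \<noteq> 0" unfolding nfire_def by (subst card_0_eq) auto
      then show False using that by auto
    qed
    have "\<forall>x\<in>?X. \<forall>y\<in>?X. x = y"
    proof (intro ballI)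
      fix x y assume "x \<in> ?X" "y \<in> ?X"
      then show "x = y" using uniq[of x y] uniq[of y x] by (cases x y rule: linorder_le_cases) auto
    qed
    then have "card ?X \<le> 1" using card_le_Suc0_iff_eq[of ?X] by simp
    moreover have "?X \<noteq> {} \<Longrightarrow> fires i l (l + q) \<omega>" unfolding fires_def by auto
    ultimately have cX: "real (card ?X) \<le> of_bool (fires i l (l + q) \<omega>)"
      by (cases "?X = {}") auto
    have sX: "(\<Sum>x\<in>{l..<l+q}. ?T x \<omega>) = Y \<omega> * real (card ?X)"
    proof -
      have "(\<Sum>x\<in>{l..<l+q}. ?T x \<omega>) = (\<Sum>x\<in>{l..<l+q}. if ?P x \<omega> \<and> 1 \<le> c x i \<omega> then Y \<omega> else 0)"
        by (rule sum.cong) auto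
      then show ?thesis by (simp add: sum.If_cases Int_def mult.commute)
    qed
    show "(\<Sum>x\<in>{l..<l+q}. ?T x \<omega>) \<le> Y \<omega> * of_bool (fires i l (l + q) \<omega>)"
      unfolding sX by (rule mult_left_mono[OF cX Y0])
  qed
  finally show ?thesis .
qed

text \<open>Appending a window to an event \<open>J\<close> of the past multiplies by the length of
  the window times the rate, and that rate is the initial one plus a deterministic jump
  \<open>v\<close>. The error is one order higher than the main term: \<open>J\<close> forces
  \<open>m\<close> firings in \<open>S\<close>, which cost \<open>(real u * p) ^ m\<close>; with
  exactly \<open>m\<close> of them the excitation is known to be \<open>v\<close>, and with more a
  further factor \<open>real u * p\<close> is gained.\<close>

lemma step_bound:
  assumes Y: "weight (F a) Y" and start: "\<And>\<omega> k. \<omega> \<in> space M \<Longrightarrow> Y \<omega> \<noteq> 0 \<Longrightarrow> k \<in> {1..n} \<Longrightarrow> lam a k \<omega> \<le> B"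
    and i: "i \<in> {1..n}" and S: "S \<subseteq> {1..n}" "insert i (parents i) \<subseteq> S"
    and p: "real (card S) * (h * B + \<rho>) \<le> p"
    and Lq: "L * (h * real q) \<le> 1" and Lu: "L * (h * real u) \<le> 1"
    and J: "Measurable.pred (F (a + u)) J"
    and J1: "\<And>\<omega>. \<omega> \<in> space M \<Longrightarrow> J \<omega> \<Longrightarrow> alive B a (a + u) \<omega> \<Longrightarrow> m \<le> nfire S a (a + u) \<omega>"
    and J2: "\<And>\<omega>. \<omega> \<in> space M \<Longrightarrow> J \<omega> \<Longrightarrow> alive B a (a + u) \<omega> \<Longrightarrow> nfire S a (a + u) \<omega> = m \<Longrightarrow>
       (\<Sum>j=1..n. w i j * (\<Sum>x=a..<a+u. real (c x j \<omega>))) = v"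
    and v: "0 \<le> v"
    and death: "expectation (\<lambda>\<omega>. Y \<omega> * of_bool (\<not> alive B a (a + u + q) \<omega>)) \<le> \<tau> * expectation Y"
  shows "\<bar>expectation (\<lambda>\<omega>. Y \<omega> * of_bool (J \<omega> \<and> fires i (a + u) (a + u + q) \<omega>))
     - (h * real q) * expectation (\<lambda>\<omega>. Y \<omega> * (lam a i \<omega> + v) * of_bool (J \<omega>))\<bar>
    \<le> (((h * real q) * (\<kappa> * (h * real q) + L * (h * real q) * B + B * (real q * p)) + real q * \<rho>) * (real u * p) ^ m
       + (h * real q) * ((h * real u) * (\<kappa> + L * (B + v)) * (real u * p) ^ m + (B + v) * (real u * p) ^ Suc m)
       + \<tau> * (1 + (1 + h * real q * B) + h * real q * (B + v))) * expectation Y"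
proof -
  let ?b = "a + u" and ?dl = "h * real q"
  define Y' where "Y' = (\<lambda>\<omega>. Y \<omega> * of_bool (J \<omega> \<and> alive B a ?b \<omega>))"
  let ?D = "expectation (\<lambda>\<omega>. Y \<omega> * of_bool (\<not> alive B a (?b + q) \<omega>))"
  have EY: "0 \<le> expectation Y" using expectation_nonneg_weight weight_F_M[OF Y] .
  have dl0: "0 \<le> ?dl" using param_nonneg by simp
  have Y': "weight (F ?b) Y'" unfolding Y'_def
    by (rule weight_mult[OF weight_F_mono[OF le_add1 Y] weight_of_bool]) (intro pred_intros_logic J pred_alive order_refl)
  have supp: "\<And>\<omega> k. \<omega> \<in> space M \<Longrightarrow> Y' \<omega> \<noteq> 0 \<Longrightarrow> k \<in> {1..n} \<Longrightarrow> lam ?b k \<omega> \<le> B"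
    unfolding Y'_def by (auto intro: alive_lam)
  have fS: "finite S" using S finite_subset by blast
  have "card (insert i (parents i)) \<le> card S" by (rule card_mono[OF fS S(2)])
  then have p': "real (card (insert i (parents i))) * (h * B + \<rho>) \<le> p"
    using p param_nonneg by (smt (verit) mult_right_mono add_nonneg_nonneg mult_nonneg_nonneg of_nat_mono)
  have wS: "weight M (\<lambda>\<omega>. Y \<omega> * of_bool (k \<le> nfire S a ?b \<omega>))" for k
    using weight_F_M[OF weight_nfire[OF Y le_add1 S(1)]] .
  note bS = weight_bdd[OF wS]
  have bD: "bdd_rv M (\<lambda>\<omega>. Y \<omega> * of_bool (\<not> alive B a (?b + q) \<omega>))"
    by (rule weight_bdd_M[OF weight_not_alive[OF Y _ order_refl]]) simp
  have bY': "bdd_rv M Y'" using weight_bdd_M[OF Y'] .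
  have EY': "expectation Y' \<le> (real u * p) ^ m * expectation Y"
  proof -
    have "expectation Y' \<le> expectation (\<lambda>\<omega>. Y \<omega> * of_bool (m \<le> nfire S a ?b \<omega>))"
      by (rule expectation_mono_bdd[OF bY' bS]) (use J1 weight_ge_0[OF Y] in \<open>auto simp: Y'_def\<close>)
    also have "\<dots> \<le> (real u * p) ^ m * expectation Y"
      by (rule multi_fire[OF S(1) p Y])
    finally show ?thesis .
  qed
  have Yf: "bdd_rv M (\<lambda>\<omega>. Y' \<omega> * of_bool (fires i ?b (?b + q) \<omega>))"
    using weight_bdd_M[OF weight_fires[OF Y' le_add1 i]] .
  have YJf: "bdd_rv M (\<lambda>\<omega>. Y \<omega> * of_bool (J \<omega> \<and> fires i ?b (?b + q) \<omega>))"
  proof (rule weight_bdd_M[of "?b + q"], rule weight_mult, rule weight_F_mono[OF _ Y], simp, rule weight_of_bool)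
    have "Measurable.pred (F (?b + q)) J" by (rule measurable_F_mono[OF le_add1 J])
    then show "Measurable.pred (F (?b + q)) (\<lambda>\<omega>. J \<omega> \<and> fires i ?b (?b + q) \<omega>)"
      by (intro pred_intros_logic pred_fires order_refl i)
  qed
  have A1: "expectation (\<lambda>\<omega>. Y' \<omega> * of_bool (fires i ?b (?b + q) \<omega>))
      \<le> expectation (\<lambda>\<omega>. Y \<omega> * of_bool (J \<omega> \<and> fires i ?b (?b + q) \<omega>))"
    by (rule expectation_mono_bdd[OF Yf YJf]) (use weight_ge_0[OF Y] in \<open>auto simp: Y'_def\<close>)
  have "expectation (\<lambda>\<omega>. Y \<omega> * of_bool (J \<omega> \<and> fires i ?b (?b + q) \<omega>))
      \<le> expectation (\<lambda>\<omega>. Y' \<omega> * of_bool (fires i ?b (?b + q) \<omega>) + Y \<omega> * of_bool (\<not> alive B a (?b + q) \<omega>))"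
  proof (rule expectation_mono_bdd[OF YJf bdd_rv_add[OF Yf bD]])
    fix \<omega> assume om: "\<omega> \<in> space M"
    then show "Y \<omega> * of_bool (J \<omega> \<and> fires i ?b (?b + q) \<omega>)
      \<le> Y' \<omega> * of_bool (fires i ?b (?b + q) \<omega>) + Y \<omega> * of_bool (\<not> alive B a (?b + q) \<omega>)"
      using weight_ge_0[OF Y, of \<omega>] alive_mono[of B a "?b + q" \<omega> a ?b] by (auto simp: Y'_def)
  qed
  also have "\<dots> = expectation (\<lambda>\<omega>. Y' \<omega> * of_bool (fires i ?b (?b + q) \<omega>)) + ?D"
    by (rule expectation_add_bdd[OF Yf bD])
  finally have A2: "expectation (\<lambda>\<omega>. Y \<omega> * of_bool (J \<omega> \<and> fires i ?b (?b + q) \<omega>))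
     \<le> expectation (\<lambda>\<omega>. Y' \<omega> * of_bool (fires i ?b (?b + q) \<omega>)) + ?D" .
  have D': "expectation (\<lambda>\<omega>. Y' \<omega> * of_bool (\<not> alive B ?b (?b + q) \<omega>)) \<le> ?D"
  proof (rule expectation_mono_bdd[OF _ bD])
    show "bdd_rv M (\<lambda>\<omega>. Y' \<omega> * of_bool (\<not> alive B ?b (?b + q) \<omega>))"
      by (rule weight_bdd_M[OF weight_not_alive[OF Y' le_add1 order_refl]])
    show "Y' \<omega> * of_bool (\<not> alive B ?b (?b + q) \<omega>) \<le> Y \<omega> * of_bool (\<not> alive B a (?b + q) \<omega>)" if "\<omega> \<in> space M" for \<omega>
      using weight_ge_0[OF Y, of \<omega>] alive_mono[of B a "?b + q" \<omega> ?b "?b + q"] that by (auto simp: Y'_def)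
  qed
  have D0: "0 \<le> expectation (\<lambda>\<omega>. Y' \<omega> * of_bool (\<not> alive B ?b (?b + q) \<omega>))"
    by (rule expectation_nonneg_weight[OF weight_F_M[OF weight_not_alive[OF Y' le_add1 order_refl]]])
  \<comment> \<open>A common bound for the errors of \<open>window_upper\<close> and
    \<open>window_lower\<close>.\<close>
  define e where "e = ?dl * (\<kappa> * ?dl + L * ?dl * B + B * (real q * p)) + real q * \<rho>"
  have "0 \<le> real (card S) * (h * B + \<rho>)"
    using param_nonneg by (intro mult_nonneg_nonneg add_nonneg_nonneg) auto
  then have p0: "0 \<le> p" using p by linarith
  have e0: "0 \<le> e" unfolding e_def using param_nonneg p0 by (intro add_nonneg_nonneg mult_nonneg_nonneg) auto
  have EY'0: "0 \<le> expectation Y'" using expectation_nonneg_weight weight_F_M[OF Y'] .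
  have e1: "(?dl * (\<kappa> * ?dl + B * (real q * p)) + real q * \<rho>) * expectation Y' \<le> e * expectation Y'"
    unfolding e_def using param_nonneg by (intro mult_right_mono EY'0 add_right_mono mult_left_mono) auto
  have e2: "(?dl * (L * ?dl * B + B * (real q * p)) + real q * \<rho>) * expectation Y' \<le> e * expectation Y'"
    unfolding e_def using param_nonneg by (intro mult_right_mono EY'0 add_right_mono mult_left_mono) auto
  have W1: "expectation (\<lambda>\<omega>. Y' \<omega> * of_bool (fires i ?b (?b + q) \<omega>))
      \<le> ?dl * expectation (\<lambda>\<omega>. Y' \<omega> * lam ?b i \<omega>) + e * expectation Y' + ?D"
    using window_upper[OF Y' supp i p', of q] e1 D' by linarith
  have "(?dl * B) * expectation (\<lambda>\<omega>. Y' \<omega> * of_bool (\<not> alive B ?b (?b + q) \<omega>)) \<le> (?dl * B) * ?D"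
    using D' dl0 param_nonneg by (intro mult_left_mono) auto
  then have W2: "?dl * expectation (\<lambda>\<omega>. Y' \<omega> * lam ?b i \<omega>) - e * expectation Y' - (?dl * B) * ?D
      \<le> expectation (\<lambda>\<omega>. Y' \<omega> * of_bool (fires i ?b (?b + q) \<omega>))"
    using window_lower[OF Y' supp i p' Lq] e2 by linarith
  let ?C = "(h * real u) * (\<kappa> + L * (B + v))"
  have C0: "0 \<le> ?C" using param_nonneg v by auto
  \<comment> \<open>Pointwise error of replacing the rate at the start of the window: drift and
    decay if exactly \<open>m\<close> firings occurred, the crude bound \<open>B + v\<close> if
    there were more.\<close>
  let ?G = "\<lambda>\<omega>. ?C * (Y \<omega> * of_bool (m \<le> nfire S a ?b \<omega>)) + (B + v) * (Y \<omega> * of_bool (Suc m \<le> nfire S a ?b \<omega>))"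
  have bG: "bdd_rv M ?G" by (intro bdd_rv_add bdd_rv_mult[OF bdd_rv_const] bS)
  have EG: "expectation ?G \<le> (?C * (real u * p) ^ m + (B + v) * (real u * p) ^ Suc m) * expectation Y"
  proof -
    have "expectation ?G = ?C * expectation (\<lambda>\<omega>. Y \<omega> * of_bool (m \<le> nfire S a ?b \<omega>))
        + (B + v) * expectation (\<lambda>\<omega>. Y \<omega> * of_bool (Suc m \<le> nfire S a ?b \<omega>))"
      by (subst expectation_add_bdd, (intro bdd_rv_mult[OF bdd_rv_const] bS)+) simp
    also have "\<dots> \<le> ?C * ((real u * p) ^ m * expectation Y) + (B + v) * ((real u * p) ^ Suc m * expectation Y)"
      using C0 v param_nonneg by (intro add_mono mult_left_mono multi_fire[OF S(1) p Y]) auto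
    finally show ?thesis by (simp add: algebra_simps)
  qed
  have lw: "weight (F ?b) (\<lambda>\<omega>. Y' \<omega> * lam ?b i \<omega>)"
    by (rule weighted_lam_bdd[OF Y' i supp]) (use i in auto)
  have la: "weight (F a) (\<lambda>\<omega>. Y \<omega> * lam a i \<omega>)"
    by (rule weighted_lam_bdd[OF Y i start]) (use i in auto)
  have YLw: "weight (F a) (\<lambda>\<omega>. Y \<omega> * (lam a i \<omega> + v))"
    using la bdd_rv_add[OF weight_bdd[OF la] bdd_rv_mult[OF weight_bdd[OF Y] bdd_rv_const[of _ v]]]
      weight_ge_0[OF Y] lam_nonneg[OF i] v
    by (auto simp: weight_def distrib_left)
  let ?Yv = "\<lambda>\<omega>. Y \<omega> * (lam a i \<omega> + v) * of_bool (J \<omega> \<and> alive B a ?b \<omega>)"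
  have Yvw: "weight (F ?b) ?Yv"
    by (rule weight_mult[OF weight_F_mono[OF le_add1 YLw] weight_of_bool]) (intro pred_intros_logic J pred_alive order_refl)
  have YvJ: "weight (F ?b) (\<lambda>\<omega>. Y \<omega> * (lam a i \<omega> + v) * of_bool (J \<omega>))"
    by (rule weight_mult[OF weight_F_mono[OF le_add1 YLw] weight_of_bool[OF J]])
  have diff: "\<bar>Y' \<omega> * lam ?b i \<omega> - ?Yv \<omega>\<bar> \<le> ?G \<omega>" if om: "\<omega> \<in> space M" for \<omega>
  proof (cases "Y' \<omega> = 0")
    case True
    then have z: "?Yv \<omega> = 0" by (auto simp: Y'_def)
    have "0 \<le> ?G \<omega>" using C0 v param_nonneg weight_ge_0[OF Y, of \<omega>] om by simp
    then show ?thesis unfolding z True by (simp only: mult_zero_left diff_self abs_zero)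
  next
    case False
    then have Jw: "J \<omega>" and al: "alive B a ?b \<omega>" and Yn: "Y \<omega> \<noteq> 0" by (auto simp: Y'_def)
    have Y0: "0 \<le> Y \<omega>" using weight_ge_0[OF Y] om by simp
    have nm: "m \<le> nfire S a ?b \<omega>" using J1[OF om Jw al] .
    have eq: "Y' \<omega> * lam ?b i \<omega> - ?Yv \<omega> = Y \<omega> * (lam ?b i \<omega> - (lam a i \<omega> + v))"
      using Jw al by (simp add: Y'_def algebra_simps)
    have l1: "lam ?b i \<omega> \<le> B" using alive_lam[OF al _ i] by simp
    have l2: "lam a i \<omega> \<le> B" using start[OF om Yn i] .
    have l3: "0 \<le> lam ?b i \<omega>" "0 \<le> lam a i \<omega>" using lam_nonneg[OF i om] by auto
    show ?thesis
    proof (cases "nfire S a ?b \<omega> = m")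
      case True
      note J2' = J2[OF om Jw al True]
      have "lam ?b i \<omega> \<le> lam a i \<omega> + \<kappa> * (h * real (?b - a)) + v"
        using lam_upper[of a ?b i \<omega>] i om J2' by simp
      moreover have "(1 - L * (h * real (?b - a))) * (lam a i \<omega> + v) \<le> lam ?b i \<omega>"
        using lam_lower[of a ?b i \<omega>] i om J2' Lu by simp
      moreover have "L * (h * real u) * (lam a i \<omega> + v) \<le> L * (h * real u) * (B + v)"
        using l2 param_nonneg by (intro mult_left_mono) auto
      moreover have "0 \<le> \<kappa> * (h * real u)" "0 \<le> L * (h * real u) * (B + v)"
        using param_nonneg v by auto
      ultimately have "\<bar>lam ?b i \<omega> - (lam a i \<omega> + v)\<bar> \<le> ?C"
        by (simp add: algebra_simps abs_le_iff)
      then have "Y \<omega> * \<bar>lam ?b i \<omega> - (lam a i \<omega> + v)\<bar> \<le> Y \<omega> * ?C"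
        using Y0 by (rule mult_left_mono)
      then show ?thesis unfolding eq using True Y0 by (simp add: abs_mult mult.commute)
    next
      case False
      then have sm: "Suc m \<le> nfire S a ?b \<omega>" using nm by simp
      have "\<bar>lam ?b i \<omega> - (lam a i \<omega> + v)\<bar> \<le> B + v" using l1 l2 l3 v by (simp add: abs_le_iff)
      then have "Y \<omega> * \<bar>lam ?b i \<omega> - (lam a i \<omega> + v)\<bar> \<le> Y \<omega> * (B + v)"
        using Y0 by (rule mult_left_mono)
      moreover have "0 \<le> ?C * (Y \<omega> * of_bool (m \<le> nfire S a ?b \<omega>))" using C0 Y0 by simp
      ultimately show ?thesis unfolding eq using sm Y0 by (simp add: abs_mult mult.commute)
    qed
  qed
  have "\<bar>expectation (\<lambda>\<omega>. Y' \<omega> * lam ?b i \<omega> - ?Yv \<omega>)\<bar> \<le> expectation ?G"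
  proof -
    note bd = bdd_rv_diff[OF weight_bdd_M[OF lw] weight_bdd_M[OF Yvw]]
    have "expectation (\<lambda>\<omega>. Y' \<omega> * lam ?b i \<omega> - ?Yv \<omega>) \<le> expectation ?G"
      by (rule expectation_mono_bdd[OF bd bG]) (use diff abs_le_D1 in blast)
    moreover have "expectation (\<lambda>\<omega>. - (Y' \<omega> * lam ?b i \<omega> - ?Yv \<omega>)) \<le> expectation ?G"
      by (rule expectation_mono_bdd[OF bdd_rv_uminus[OF bd] bG]) (use diff abs_le_D2 in blast)
    moreover have "expectation (\<lambda>\<omega>. - (Y' \<omega> * lam ?b i \<omega> - ?Yv \<omega>))
        = - expectation (\<lambda>\<omega>. Y' \<omega> * lam ?b i \<omega> - ?Yv \<omega>)"
      by (rule Bochner_Integration.integral_minus)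
    ultimately show ?thesis by linarith
  qed
  then have B1: "\<bar>expectation (\<lambda>\<omega>. Y' \<omega> * lam ?b i \<omega>) - expectation ?Yv\<bar>
      \<le> (?C * (real u * p) ^ m + (B + v) * (real u * p) ^ Suc m) * expectation Y"
    using EG expectation_diff_bdd[OF weight_bdd_M[OF lw] weight_bdd_M[OF Yvw]] by simp
  have B2: "expectation ?Yv \<le> expectation (\<lambda>\<omega>. Y \<omega> * (lam a i \<omega> + v) * of_bool (J \<omega>))"
    by (rule expectation_mono_bdd[OF weight_bdd_M[OF Yvw] weight_bdd_M[OF YvJ]])
      (use weight_ge_0[OF YLw] in auto)
  have "expectation (\<lambda>\<omega>. Y \<omega> * (lam a i \<omega> + v) * of_bool (J \<omega>))
     \<le> expectation (\<lambda>\<omega>. ?Yv \<omega> + (B + v) * (Y \<omega> * of_bool (\<not> alive B a (?b + q) \<omega>)))"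
  proof (rule expectation_mono_bdd[OF weight_bdd_M[OF YvJ] bdd_rv_add[OF weight_bdd_M[OF Yvw] bdd_rv_mult[OF bdd_rv_const bD]]])
    fix \<omega> assume om: "\<omega> \<in> space M"
    have Y0: "0 \<le> Y \<omega>" using weight_ge_0[OF Y] om by simp
    have "Y \<omega> * (lam a i \<omega> + v) \<le> (B + v) * Y \<omega>"
      using start[OF om _ i] Y0 by (cases "Y \<omega> = 0") (auto simp: mult.commute)
    moreover have "0 \<le> Y \<omega> * (lam a i \<omega> + v)" using weight_ge_0[OF YLw] om by simp
    moreover have "0 \<le> (B + v) * (Y \<omega> * of_bool (\<not> alive B a (?b + q) \<omega>))"
      using Y0 v param_nonneg by auto
    ultimately show "Y \<omega> * (lam a i \<omega> + v) * of_bool (J \<omega>)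
        \<le> ?Yv \<omega> + (B + v) * (Y \<omega> * of_bool (\<not> alive B a (?b + q) \<omega>))"
      using alive_mono[of B a "?b + q" \<omega> a ?b]
      by (cases "J \<omega>"; cases "alive B a ?b \<omega>"; cases "alive B a (?b + q) \<omega>") auto
  qed
  also have "\<dots> = expectation ?Yv + (B + v) * ?D"
    by (subst expectation_add_bdd[OF weight_bdd_M[OF Yvw] bdd_rv_mult[OF bdd_rv_const bD]]) simp
  finally have B3: "expectation (\<lambda>\<omega>. Y \<omega> * (lam a i \<omega> + v) * of_bool (J \<omega>)) \<le> expectation ?Yv + (B + v) * ?D" .
  \<comment> \<open>From \<open>X1\<close> to \<open>X5\<close>: drop the dead paths, expand the
    window, replace the rate by \<open>lam a i + v\<close>, restore the dead paths.\<close>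
  define X1 where "X1 = expectation (\<lambda>\<omega>. Y \<omega> * of_bool (J \<omega> \<and> fires i ?b (?b + q) \<omega>))"
  define X2 where "X2 = expectation (\<lambda>\<omega>. Y' \<omega> * of_bool (fires i ?b (?b + q) \<omega>))"
  define X3 where "X3 = expectation (\<lambda>\<omega>. Y' \<omega> * lam ?b i \<omega>)"
  define X4 where "X4 = expectation ?Yv"
  define X5 where "X5 = expectation (\<lambda>\<omega>. Y \<omega> * (lam a i \<omega> + v) * of_bool (J \<omega>))"
  define G where "G = (?C * (real u * p) ^ m + (B + v) * (real u * p) ^ Suc m) * expectation Y"
  have D0': "0 \<le> ?D" using D0 D' by linarith
  have x12: "\<bar>X1 - X2\<bar> \<le> ?D" using A1 A2 D0' unfolding X1_def X2_def by linarith
  have "0 \<le> ?dl * B" using dl0 param_nonneg by simp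
  then have "0 \<le> (?dl * B) * ?D" using D0' by (rule mult_nonneg_nonneg)
  then have x23: "\<bar>X2 - ?dl * X3\<bar> \<le> e * expectation Y' + (?D + (?dl * B) * ?D)"
    using W1 W2 D0' unfolding X2_def X3_def by (simp add: abs_le_iff)
  have "\<bar>?dl * X3 - ?dl * X4\<bar> = ?dl * \<bar>X3 - X4\<bar>"
    using dl0 by (metis abs_mult abs_of_nonneg right_diff_distrib)
  also have "\<dots> \<le> ?dl * G" using B1 dl0 unfolding X3_def X4_def G_def by (intro mult_left_mono)
  finally have x34: "\<bar>?dl * X3 - ?dl * X4\<bar> \<le> ?dl * G" .
  have "\<bar>?dl * X4 - ?dl * X5\<bar> = ?dl * \<bar>X4 - X5\<bar>"
    using dl0 by (metis abs_mult abs_of_nonneg right_diff_distrib)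
  also have "\<dots> \<le> ?dl * ((B + v) * ?D)"
    using B2 B3 dl0 unfolding X4_def X5_def by (intro mult_left_mono) auto
  finally have x45: "\<bar>?dl * X4 - ?dl * X5\<bar> \<le> ?dl * ((B + v) * ?D)" .
  have "\<bar>X1 - ?dl * X5\<bar> \<le> ?D + (e * expectation Y' + (?D + (?dl * B) * ?D)) + ?dl * G + ?dl * ((B + v) * ?D)"
    using x12 x23 x34 x45 by linarith
  also have "\<dots> = e * expectation Y' + ?dl * G + (1 + (1 + ?dl * B) + ?dl * (B + v)) * ?D"
    by (simp add: algebra_simps)
  also have "\<dots> \<le> e * ((real u * p) ^ m * expectation Y) + ?dl * G + (1 + (1 + ?dl * B) + ?dl * (B + v)) * (\<tau> * expectation Y)"
    using dl0 param_nonneg v by (intro add_mono mult_left_mono EY' e0 death order_refl) auto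
  finally show ?thesis
    unfolding X1_def X5_def G_def e_def by (simp add: algebra_simps)
qed

section \<open>Three consecutive windows\<close>

definition fireset :: "nat set \<Rightarrow> nat \<Rightarrow> nat \<Rightarrow> 'a \<Rightarrow> nat set" where
  "fireset S a l \<omega> = {x\<in>{a..<l}. \<exists>k\<in>S. 1 \<le> c x k \<omega>}"

lemma card_fireset: "alive B a l \<omega> \<Longrightarrow> card (fireset S a l \<omega>) = nfire S a l \<omega>"
  unfolding fireset_def nfire_def using alive_prefix by (intro arg_cong[of _ _ card]) auto

lemma single_fire_sum:
  assumes "tot x \<omega> \<le> 1" "k \<in> {1..n}" "1 \<le> c x k \<omega>"
  shows "(\<Sum>j=1..n. w i j * real (c x j \<omega>)) = w i k"
proof -
  have t: "tot x \<omega> = c x k \<omega> + (\<Sum>j\<in>{1..n} - {k}. c x j \<omega>)"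
    unfolding tot_def using assms(2) by (simp add: sum.remove)
  then have "c x k \<omega> = 1" "(\<Sum>j\<in>{1..n} - {k}. c x j \<omega>) = 0" using assms(1,3) by linarith+
  then have "\<And>j. j \<in> {1..n} - {k} \<Longrightarrow> c x j \<omega> = 0" by simp
  then have "(\<Sum>j\<in>{1..n} - {k}. w i j * real (c x j \<omega>)) = 0" by (intro sum.neutral) auto
  then show ?thesis using assms(2) \<open>c x k \<omega> = 1\<close> by (simp add: sum.remove)
qed

lemma weighted_count_fireset:
  assumes al: "alive B a l \<omega>" and S: "parents i \<subseteq> S"
  shows "(\<Sum>j=1..n. w i j * (\<Sum>x=a..<l. real (c x j \<omega>)))
     = (\<Sum>x\<in>fireset S a l \<omega>. \<Sum>j=1..n. w i j * real (c x j \<omega>))"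
proof -
  have "(\<Sum>j=1..n. w i j * (\<Sum>x=a..<l. real (c x j \<omega>))) = (\<Sum>x=a..<l. \<Sum>j=1..n. w i j * real (c x j \<omega>))"
    unfolding sum_distrib_left by (rule sum.swap)
  also have "\<dots> = (\<Sum>x\<in>fireset S a l \<omega>. \<Sum>j=1..n. w i j * real (c x j \<omega>))"
  proof (rule sum.mono_neutral_right)
    show "\<forall>x\<in>{a..<l} - fireset S a l \<omega>. (\<Sum>j=1..n. w i j * real (c x j \<omega>)) = 0"
    proof
      fix x assume x: "x \<in> {a..<l} - fireset S a l \<omega>"
      show "(\<Sum>j=1..n. w i j * real (c x j \<omega>)) = 0"
      proof (rule sum.neutral, rule ballI)
        fix j assume j: "j \<in> {1..n}"
        show "w i j * real (c x j \<omega>) = 0"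
        proof (cases "w i j = 0")
          case False
          then have "j \<in> S" using S j by (auto simp: parents_def)
          then show ?thesis using x by (auto simp: fireset_def not_le)
        qed simp
      qed
    qed
  qed (auto simp: fireset_def)
  finally show ?thesis .
qed

text \<open>If the known firing is the only one in \<open>S\<close>, and \<open>S\<close> contains
  all parents of \<open>i\<close>, then nothing else has excited \<open>i\<close>. This supplies the
  jump \<open>v\<close> of \<open>step_bound\<close> for \<open>m = 1\<close>.\<close>

lemma fires_one:
  assumes al: "alive B a l \<omega>" and S: "parents i \<subseteq> S" and x1: "x1 \<in> S" "S \<subseteq> {1..n}"
    and f: "fires x1 a l \<omega>"
  shows "1 \<le> nfire S a l \<omega>"
    and "nfire S a l \<omega> = 1 \<Longrightarrow> (\<Sum>j=1..n. w i j * (\<Sum>x=a..<l. real (c x j \<omega>))) = w i x1"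
proof -
  obtain z where z: "z \<in> {a..<l}" "1 \<le> c z x1 \<omega>" using f unfolding fires_def by blast
  have zF: "z \<in> fireset S a l \<omega>" using z x1 by (auto simp: fireset_def)
  have fin: "finite (fireset S a l \<omega>)" by (simp add: fireset_def)
  show "1 \<le> nfire S a l \<omega>" unfolding card_fireset[OF al, symmetric]
    using zF fin by (metis One_nat_def Suc_leI card_gt_0_iff empty_iff)
  assume "nfire S a l \<omega> = 1"
  then have "card (fireset S a l \<omega>) = 1" by (simp add: card_fireset[OF al])
  then have F: "fireset S a l \<omega> = {z}" using zF by (auto simp: card_1_singleton_iff)
  show "(\<Sum>j=1..n. w i j * (\<Sum>x=a..<l. real (c x j \<omega>))) = w i x1"
    unfolding weighted_count_fireset[OF al S] F
    using single_fire_sum[of z \<omega> x1 i] alive_prefix[OF al z(1)] z x1 by auto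
qed

text \<open>Firings in disjoint windows lie in different cells and therefore count as two; if there
  are no others, their excitations of \<open>i\<close> add up. This is the case \<open>m = 2\<close>
  of \<open>step_bound\<close>.\<close>

lemma fires_two:
  assumes al: "alive B a l \<omega>" and S: "parents i \<subseteq> S" and x12: "x1 \<in> S" "x2 \<in> S" "S \<subseteq> {1..n}"
    and f: "fires x1 a b \<omega>" "fires x2 b l \<omega>" and ab: "a \<le> b" "b \<le> l"
  shows "2 \<le> nfire S a l \<omega>"
    and "nfire S a l \<omega> = 2 \<Longrightarrow> (\<Sum>j=1..n. w i j * (\<Sum>x=a..<l. real (c x j \<omega>))) = w i x1 + w i x2"
proof -
  obtain z1 where z1: "z1 \<in> {a..<b}" "1 \<le> c z1 x1 \<omega>" using f unfolding fires_def by blast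
  obtain z2 where z2: "z2 \<in> {b..<l}" "1 \<le> c z2 x2 \<omega>" using f unfolding fires_def by blast
  have ne: "z1 \<noteq> z2" using z1 z2 by auto
  have sub: "{z1, z2} \<subseteq> fireset S a l \<omega>" using z1 z2 x12 ab by (auto simp: fireset_def)
  have fin: "finite (fireset S a l \<omega>)" by (simp add: fireset_def)
  show "2 \<le> nfire S a l \<omega>" unfolding card_fireset[OF al, symmetric]
    using card_mono[OF fin sub] ne by simp
  assume "nfire S a l \<omega> = 2"
  then have "card (fireset S a l \<omega>) = card {z1, z2}" using ne by (simp add: card_fireset[OF al])
  then have F: "fireset S a l \<omega> = {z1, z2}" using card_subset_eq[OF fin sub] by simp
  have z1': "z1 \<in> {a..<l}" and z2': "z2 \<in> {a..<l}" using z1 z2 ab by auto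
  have xn: "x1 \<in> {1..n}" "x2 \<in> {1..n}" using x12 by auto
  have "(\<Sum>j=1..n. w i j * real (c z1 j \<omega>)) = w i x1"
    using single_fire_sum[OF _ xn(1) z1(2)] alive_prefix[OF al z1'] by blast
  moreover have "(\<Sum>j=1..n. w i j * real (c z2 j \<omega>)) = w i x2"
    using single_fire_sum[OF _ xn(2) z2(2)] alive_prefix[OF al z2'] by blast
  ultimately show "(\<Sum>j=1..n. w i j * (\<Sum>x=a..<l. real (c x j \<omega>))) = w i x1 + w i x2"
    unfolding weighted_count_fireset[OF al S] F using ne by simp
qed

lemma death_mono:
  assumes Y: "weight (F a) Y" and "r \<le> r'"
  shows "expectation (\<lambda>\<omega>. Y \<omega> * of_bool (\<not> alive B a (a + r) \<omega>))
      \<le> expectation (\<lambda>\<omega>. Y \<omega> * of_bool (\<not> alive B a (a + r') \<omega>))"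
proof (rule expectation_mono_bdd)
  show "bdd_rv M (\<lambda>\<omega>. Y \<omega> * of_bool (\<not> alive B a (a + r) \<omega>))"
    "bdd_rv M (\<lambda>\<omega>. Y \<omega> * of_bool (\<not> alive B a (a + r') \<omega>))"
    using weight_bdd_M[OF weight_not_alive[OF Y le_add1 order_refl]] by blast+
  show "Y \<omega> * of_bool (\<not> alive B a (a + r) \<omega>) \<le> Y \<omega> * of_bool (\<not> alive B a (a + r') \<omega>)" if "\<omega> \<in> space M" for \<omega>
    using weight_ge_0[OF Y, of \<omega>] that alive_mono[of B a "a + r'" \<omega> a "a + r"] assms(2) by auto
qed

text \<open>The error factor of \<open>step_bound\<close>, as a function of the quantities that vary
  when it is applied to the three windows of a block.\<close>

definition step_err :: "nat \<Rightarrow> real \<Rightarrow> real \<Rightarrow> nat \<Rightarrow> nat \<Rightarrow> real \<Rightarrow> real" where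
  "step_err q p \<tau> m u v = ((h * real q) * (\<kappa> * (h * real q) + L * (h * real q) * B + B * (real q * p)) + real q * \<rho>) * (real u * p) ^ m
       + (h * real q) * ((h * real u) * (\<kappa> + L * (B + v)) * (real u * p) ^ m + (B + v) * (real u * p) ^ Suc m)
       + \<tau> * (1 + (1 + h * real q * B) + h * real q * (B + v))"

lemma step_err_mono:
  assumes "v \<le> v'" "0 \<le> p" "0 \<le> \<tau>"
  shows "step_err q p \<tau> m u v \<le> step_err q p \<tau> m u v'"
  unfolding step_err_def using assms param_nonneg
  by (intro add_mono mult_left_mono mult_right_mono order_refl mult_nonneg_nonneg zero_le_power) auto

definition fires3 :: "nat \<Rightarrow> nat \<Rightarrow> nat \<Rightarrow> nat \<Rightarrow> nat \<Rightarrow> 'a \<Rightarrow> bool" where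
  "fires3 q a x1 x2 x3 \<omega> \<longleftrightarrow> (fires x1 a (a + q) \<omega> \<and> fires x2 (a + q) (a + (q + q)) \<omega>)
     \<and> fires x3 (a + (q + q)) (a + (q + q) + q) \<omega>"

lemma weight_shift:
  assumes Y: "weight (F a) Y" and start: "\<And>\<omega> k. \<omega> \<in> space M \<Longrightarrow> Y \<omega> \<noteq> 0 \<Longrightarrow> k \<in> {1..n} \<Longrightarrow> lam a k \<omega> \<le> R"
    and i: "i \<in> {1..n}" and v: "0 \<le> v"
  shows "weight (F a) (\<lambda>\<omega>. Y \<omega> * (lam a i \<omega> + v))"
    and "expectation (\<lambda>\<omega>. Y \<omega> * (lam a i \<omega> + v)) \<le> (R + v) * expectation Y"
proof -
  have la: "weight (F a) (\<lambda>\<omega>. Y \<omega> * lam a i \<omega>)"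
    by (rule weighted_lam_bdd[OF Y i start]) (use i in auto)
  have vb: "bdd_rv (F a) (\<lambda>\<omega>. Y \<omega> * v)"
    by (rule bdd_rv_mult[OF weight_bdd[OF Y] bdd_rv_const])
  show "weight (F a) (\<lambda>\<omega>. Y \<omega> * (lam a i \<omega> + v))"
    using bdd_rv_add[OF weight_bdd[OF la] vb] weight_ge_0[OF Y] lam_nonneg[OF i] v
    by (auto simp: weight_def distrib_left)
  have "expectation (\<lambda>\<omega>. Y \<omega> * (lam a i \<omega> + v)) = expectation (\<lambda>\<omega>. Y \<omega> * lam a i \<omega>) + expectation Y * v"
    unfolding distrib_left by (subst expectation_add_bdd[OF weight_bdd_M[OF la] bdd_rv_F_M[OF vb]]) simp
  also have "\<dots> \<le> R * expectation Y + expectation Y * v"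
    using weighted_lam_le[OF Y i start[OF _ _ i]] by simp
  finally show "expectation (\<lambda>\<omega>. Y \<omega> * (lam a i \<omega> + v)) \<le> (R + v) * expectation Y"
    by (simp add: algebra_simps)
qed

text \<open>The windows are peeled off from the last to the first: each use of
  \<open>step_bound\<close> turns the last window into a factor \<open>lam a x + v\<close> that is
  known at time \<open>a\<close> and can be moved into the weight. The rate of \<open>x3\<close> has
  been raised by two earlier events and that of \<open>x2\<close> by one, which gives the three
  factors of the main term. In the error, the order \<open>m\<close> drops from 2 to 0 while the
  power of the window length in front rises from 0 to 2, so all three terms are of comparable
  size.\<close>

lemma triple_bound:
  assumes Y: "weight (F a) Y" and start: "\<And>\<omega> k. \<omega> \<in> space M \<Longrightarrow> Y \<omega> \<noteq> 0 \<Longrightarrow> k \<in> {1..n} \<Longrightarrow> lam a k \<omega> \<le> R"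
    and RB: "R + \<kappa> * (h * real (q + q + q)) + wm * real m0 \<le> B"
    and S: "S \<subseteq> {1..n}" "x1 \<in> S" "x2 \<in> S" "x3 \<in> S" "parents x1 \<subseteq> S" "parents x2 \<subseteq> S" "parents x3 \<subseteq> S"
    and p: "real (card S) * (h * B + \<rho>) \<le> p" "real d * (h * B + \<rho>) \<le> p"
    and Lq: "L * (h * real (q + q)) \<le> 1"
    and \<tau>: "real (q + q + q) * \<rho> + real n * (real (q + q + q) * p) ^ m0 \<le> \<tau>"
  shows "\<bar>expectation (\<lambda>\<omega>. Y \<omega> * of_bool (fires3 q a x1 x2 x3 \<omega>))
     - (h * real q) ^ 3 * expectation (\<lambda>\<omega>. Y \<omega> * (lam a x3 \<omega> + (w x3 x1 + w x3 x2)) * (lam a x2 \<omega> + w x2 x1) * lam a x1 \<omega>)\<bar>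
    \<le> (step_err q p \<tau> 2 (q + q) (2 * wm) + (h * real q) * step_err q p \<tau> 1 q (2 * wm) * (B + 2 * wm)
        + (h * real q) ^ 2 * step_err q p \<tau> 0 0 (2 * wm) * (B + 2 * wm) ^ 2) * expectation Y"
proof -
  let ?dl = "h * real q" and ?V = "2 * wm"
  have xn: "x1 \<in> {1..n}" "x2 \<in> {1..n}" "x3 \<in> {1..n}" using S by auto
  have EY: "0 \<le> expectation Y" using expectation_nonneg_weight weight_F_M[OF Y] .
  have dl0: "0 \<le> ?dl" using param_nonneg by simp
  have "0 \<le> \<kappa> * (h * real (q + q + q))" "0 \<le> wm * real m0" using param_nonneg by auto
  then have RB': "R \<le> B" using RB by linarith
  have "0 \<le> real (card S) * (h * B + \<rho>)"
    using param_nonneg by (intro mult_nonneg_nonneg add_nonneg_nonneg) auto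
  then have p0: "0 \<le> p" using p by linarith
  have "0 \<le> real (q + q + q) * \<rho> + real n * (real (q + q + q) * p) ^ m0" using p0 param_nonneg by auto
  then have \<tau>0: "0 \<le> \<tau>" using \<tau> by linarith
  have Lq': "L * (h * real q) \<le> 1"
    using Lq param_nonneg by (smt (verit) distrib_left mult_nonneg_nonneg of_nat_0_le_iff of_nat_add)
  \<comment> \<open>The weights \<open>Y2\<close> and \<open>Y3\<close> below vanish where
    \<open>Y\<close> does, so they too live where the rates start below \<open>R\<close>; one death
    bound over the whole block serves all three steps.\<close>
  have dth: "expectation (\<lambda>\<omega>. W \<omega> * of_bool (\<not> alive B a (a + r) \<omega>)) \<le> \<tau> * expectation W"
    if W: "weight (F a) W" and sW: "\<And>\<omega>. \<omega> \<in> space M \<Longrightarrow> W \<omega> \<noteq> 0 \<Longrightarrow> Y \<omega> \<noteq> 0" and r: "r \<le> q + q + q" for W r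
  proof -
    have EW: "0 \<le> expectation W" using expectation_nonneg_weight weight_F_M[OF W] .
    have "expectation (\<lambda>\<omega>. W \<omega> * of_bool (\<not> alive B a (a + r) \<omega>))
       \<le> expectation (\<lambda>\<omega>. W \<omega> * of_bool (\<not> alive B a (a + (q + q + q)) \<omega>))"
      by (rule death_mono[OF W r])
    also have "\<dots> \<le> (real (q + q + q) * \<rho> + real n * (real (q + q + q) * p) ^ m0) * expectation W"
      by (rule death_bound[OF W _ RB p(2)]) (use start sW in auto)
    also have "\<dots> \<le> \<tau> * expectation W" by (rule mult_right_mono[OF \<tau> EW])
    finally show ?thesis .
  qed
  have startB: "\<And>\<omega> k. \<omega> \<in> space M \<Longrightarrow> Y \<omega> \<noteq> 0 \<Longrightarrow> k \<in> {1..n} \<Longrightarrow> lam a k \<omega> \<le> B"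
    using start RB' by force
  have wV: "0 \<le> w x3 x1 + w x3 x2" "w x3 x1 + w x3 x2 \<le> ?V" "0 \<le> w x2 x1" "w x2 x1 \<le> ?V" "0 \<le> ?V"
    using w_range[OF xn(3) xn(1)] w_range[OF xn(3) xn(2)] w_range[OF xn(2) xn(1)] by auto
  define Y2 where "Y2 = (\<lambda>\<omega>. Y \<omega> * (lam a x3 \<omega> + (w x3 x1 + w x3 x2)))"
  define Y3 where "Y3 = (\<lambda>\<omega>. Y2 \<omega> * (lam a x2 \<omega> + w x2 x1))"
  have Y2: "weight (F a) Y2" "expectation Y2 \<le> (B + ?V) * expectation Y"
  proof -
    show "weight (F a) Y2" unfolding Y2_def by (rule weight_shift[OF Y startB xn(3) wV(1)])
    have "expectation Y2 \<le> (B + (w x3 x1 + w x3 x2)) * expectation Y"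
      unfolding Y2_def by (rule weight_shift[OF Y startB xn(3) wV(1)])
    also have "\<dots> \<le> (B + ?V) * expectation Y" using wV EY by (intro mult_right_mono) auto
    finally show "expectation Y2 \<le> (B + ?V) * expectation Y" .
  qed
  have s2: "Y2 \<omega> \<noteq> 0 \<Longrightarrow> Y \<omega> \<noteq> 0" for \<omega> by (auto simp: Y2_def)
  have startB2: "\<And>\<omega> k. \<omega> \<in> space M \<Longrightarrow> Y2 \<omega> \<noteq> 0 \<Longrightarrow> k \<in> {1..n} \<Longrightarrow> lam a k \<omega> \<le> B"
    using startB s2 by blast
  have EY2: "0 \<le> expectation Y2" using expectation_nonneg_weight weight_F_M[OF Y2(1)] .
  have Y3: "weight (F a) Y3" "expectation Y3 \<le> (B + ?V) * expectation Y2"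
  proof -
    show "weight (F a) Y3" unfolding Y3_def by (rule weight_shift[OF Y2(1) startB2 xn(2) wV(3)])
    have "expectation Y3 \<le> (B + w x2 x1) * expectation Y2"
      unfolding Y3_def by (rule weight_shift[OF Y2(1) startB2 xn(2) wV(3)])
    also have "\<dots> \<le> (B + ?V) * expectation Y2" using wV EY2 by (intro mult_right_mono) auto
    finally show "expectation Y3 \<le> (B + ?V) * expectation Y2" .
  qed
  have s3: "Y3 \<omega> \<noteq> 0 \<Longrightarrow> Y \<omega> \<noteq> 0" for \<omega> using s2 by (auto simp: Y3_def)
  have startB3: "\<And>\<omega> k. \<omega> \<in> space M \<Longrightarrow> Y3 \<omega> \<noteq> 0 \<Longrightarrow> k \<in> {1..n} \<Longrightarrow> lam a k \<omega> \<le> B"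
    using startB s3 by blast
  have BV: "0 \<le> B + ?V" using param_nonneg by simp
  have err0: "0 \<le> step_err q p \<tau> m u ?V" for m u
    unfolding step_err_def using p0 \<tau>0 param_nonneg
    by (intro add_nonneg_nonneg mult_nonneg_nonneg zero_le_power) auto
  define P3 where "P3 = expectation (\<lambda>\<omega>. Y \<omega> * of_bool (fires3 q a x1 x2 x3 \<omega>))"
  define P2 where "P2 = expectation (\<lambda>\<omega>. Y2 \<omega> * of_bool (fires x1 a (a + q) \<omega> \<and> fires x2 (a + q) (a + q + q) \<omega>))"
  define P1 where "P1 = expectation (\<lambda>\<omega>. Y3 \<omega> * of_bool (fires x1 a (a + q) \<omega>))"
  define P0 where "P0 = expectation (\<lambda>\<omega>. Y3 \<omega> * lam a x1 \<omega>)"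
  have 3: "\<bar>P3 - ?dl * P2\<bar> \<le> step_err q p \<tau> 2 (q + q) ?V * expectation Y"
  proof -
    let ?J = "\<lambda>\<omega>. fires x1 a (a + q) \<omega> \<and> fires x2 (a + q) (a + (q + q)) \<omega>"
    have "\<bar>expectation (\<lambda>\<omega>. Y \<omega> * of_bool (?J \<omega> \<and> fires x3 (a + (q + q)) (a + (q + q) + q) \<omega>))
      - ?dl * expectation (\<lambda>\<omega>. Y \<omega> * (lam a x3 \<omega> + (w x3 x1 + w x3 x2)) * of_bool (?J \<omega>))\<bar>
      \<le> step_err q p \<tau> 2 (q + q) (w x3 x1 + w x3 x2) * expectation Y"
      unfolding step_err_def
    proof (rule step_bound[OF Y startB xn(3) S(1) _ p(1) Lq' Lq])
      show "insert x3 (parents x3) \<subseteq> S" using S by auto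
      show "Measurable.pred (F (a + (q + q))) ?J"
        by (intro pred_intros_logic pred_fires xn) auto
      show "2 \<le> nfire S a (a + (q + q)) \<omega>" if "?J \<omega>" "alive B a (a + (q + q)) \<omega>" for \<omega>
        using fires_two(1)[OF that(2) S(7) S(2,3,1), of "a + q"] that by auto
      show "(\<Sum>j=1..n. w x3 j * (\<Sum>x=a..<a+(q+q). real (c x j \<omega>))) = w x3 x1 + w x3 x2"
        if "?J \<omega>" "alive B a (a + (q + q)) \<omega>" "nfire S a (a + (q + q)) \<omega> = 2" for \<omega>
        using fires_two(2)[OF that(2) S(7) S(2,3,1), of "a + q"] that by auto
      show "expectation (\<lambda>\<omega>. Y \<omega> * of_bool (\<not> alive B a (a + (q + q) + q) \<omega>)) \<le> \<tau> * expectation Y"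
        using dth[OF Y, of "q + q + q"] by (simp add: add.assoc)
    qed (use wV in auto)
    also have "\<dots> \<le> step_err q p \<tau> 2 (q + q) ?V * expectation Y"
      by (rule mult_right_mono[OF step_err_mono[OF wV(2) p0 \<tau>0] EY])
    finally show ?thesis unfolding P3_def P2_def fires3_def Y2_def by (simp add: add.assoc)
  qed
  have 2: "\<bar>P2 - ?dl * P1\<bar> \<le> step_err q p \<tau> 1 q ?V * expectation Y2"
  proof -
    let ?J = "fires x1 a (a + q)"
    have "\<bar>expectation (\<lambda>\<omega>. Y2 \<omega> * of_bool (?J \<omega> \<and> fires x2 (a + q) (a + q + q) \<omega>))
      - ?dl * expectation (\<lambda>\<omega>. Y2 \<omega> * (lam a x2 \<omega> + w x2 x1) * of_bool (?J \<omega>))\<bar>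
      \<le> step_err q p \<tau> 1 q (w x2 x1) * expectation Y2"
      unfolding step_err_def
    proof (rule step_bound[OF Y2(1) startB2 xn(2) S(1) _ p(1) Lq' Lq'])
      show "insert x2 (parents x2) \<subseteq> S" using S by auto
      show "Measurable.pred (F (a + q)) ?J"
        by (intro pred_fires xn) auto
      show "1 \<le> nfire S a (a + q) \<omega>" if "?J \<omega>" "alive B a (a + q) \<omega>" for \<omega>
        using fires_one(1)[OF that(2) S(6) S(2,1) that(1)] .
      show "(\<Sum>j=1..n. w x2 j * (\<Sum>x=a..<a+q. real (c x j \<omega>))) = w x2 x1"
        if "?J \<omega>" "alive B a (a + q) \<omega>" "nfire S a (a + q) \<omega> = 1" for \<omega>
        using fires_one(2)[OF that(2) S(6) S(2,1) that(1,3)] .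
      show "expectation (\<lambda>\<omega>. Y2 \<omega> * of_bool (\<not> alive B a (a + q + q) \<omega>)) \<le> \<tau> * expectation Y2"
        using dth[OF Y2(1) s2, of "q + q"] by (simp add: add.assoc)
    qed (use wV in auto)
    also have "\<dots> \<le> step_err q p \<tau> 1 q ?V * expectation Y2"
      by (rule mult_right_mono[OF step_err_mono[OF wV(4) p0 \<tau>0] EY2])
    finally show ?thesis unfolding P2_def P1_def Y3_def .
  qed
  have EY3: "0 \<le> expectation Y3" using expectation_nonneg_weight weight_F_M[OF Y3(1)] .
  have 1: "\<bar>P1 - ?dl * P0\<bar> \<le> step_err q p \<tau> 0 0 ?V * expectation Y3"
  proof -
    have "\<bar>expectation (\<lambda>\<omega>. Y3 \<omega> * of_bool (True \<and> fires x1 (a + 0) (a + 0 + q) \<omega>))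
      - ?dl * expectation (\<lambda>\<omega>. Y3 \<omega> * (lam a x1 \<omega> + 0) * of_bool True)\<bar>
      \<le> step_err q p \<tau> 0 0 0 * expectation Y3"
      unfolding step_err_def
    proof (rule step_bound[OF Y3(1) startB3 xn(1) S(1) _ p(1) Lq'])
      show "insert x1 (parents x1) \<subseteq> S" using S by auto
      show "expectation (\<lambda>\<omega>. Y3 \<omega> * of_bool (\<not> alive B a (a + 0 + q) \<omega>)) \<le> \<tau> * expectation Y3"
        using dth[OF Y3(1) s3, of q] by simp
    qed auto
    also have "\<dots> \<le> step_err q p \<tau> 0 0 ?V * expectation Y3"
      by (rule mult_right_mono[OF step_err_mono[OF wV(5) p0 \<tau>0] EY3])
    finally show ?thesis unfolding P1_def P0_def by simp
  qed
  have "\<bar>?dl * P2 - ?dl * (?dl * P1)\<bar> = ?dl * \<bar>P2 - ?dl * P1\<bar>"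
    using dl0 by (metis abs_mult abs_of_nonneg right_diff_distrib)
  also have "\<dots> \<le> ?dl * (step_err q p \<tau> 1 q ?V * ((B + ?V) * expectation Y))"
    using 2 Y2(2) err0 dl0 by (meson mult_left_mono order_trans)
  finally have b2: "\<bar>?dl * P2 - ?dl * (?dl * P1)\<bar> \<le> ?dl * (step_err q p \<tau> 1 q ?V * ((B + ?V) * expectation Y))" .
  have "\<bar>?dl^2 * P1 - ?dl^2 * (?dl * P0)\<bar> = ?dl^2 * \<bar>P1 - ?dl * P0\<bar>"
    by (metis abs_mult abs_power2 right_diff_distrib)
  also have "\<dots> \<le> ?dl^2 * (step_err q p \<tau> 0 0 ?V * ((B + ?V) * ((B + ?V) * expectation Y)))"
  proof (rule mult_left_mono[OF order_trans[OF 1]])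
    have "expectation Y3 \<le> (B + ?V) * ((B + ?V) * expectation Y)"
      using Y3(2) mult_left_mono[OF Y2(2) BV] by linarith
    then show "step_err q p \<tau> 0 0 ?V * expectation Y3 \<le> step_err q p \<tau> 0 0 ?V * ((B + ?V) * ((B + ?V) * expectation Y))"
      using err0 by (intro mult_left_mono) auto
  qed simp
  finally have b1: "\<bar>?dl^2 * P1 - ?dl^2 * (?dl * P0)\<bar> \<le> ?dl^2 * (step_err q p \<tau> 0 0 ?V * ((B + ?V) * ((B + ?V) * expectation Y)))" .
  have "\<bar>P3 - ?dl^3 * P0\<bar> \<le> \<bar>P3 - ?dl * P2\<bar> + \<bar>?dl * P2 - ?dl * (?dl * P1)\<bar> + \<bar>?dl^2 * P1 - ?dl^2 * (?dl * P0)\<bar>"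
    by (simp add: power2_eq_square power3_eq_cube algebra_simps)
  also have "\<dots> \<le> (step_err q p \<tau> 2 (q + q) ?V + ?dl * step_err q p \<tau> 1 q ?V * (B + ?V)
        + ?dl ^ 2 * step_err q p \<tau> 0 0 ?V * (B + ?V) ^ 2) * expectation Y"
    using 3 b2 b1 by (simp add: power2_eq_square algebra_simps)
  finally show ?thesis unfolding P3_def P0_def Y3_def Y2_def .
qed

end

section \<open>Concentration over blocks\<close>

lemma exp_le_quadratic:
  fixes x :: real assumes "\<bar>x\<bar> \<le> 1" shows "exp x \<le> 1 + x + x\<^sup>2"
proof (cases "0 \<le> x")
  case True then show ?thesis using exp_bound[of x] assms by auto
next
  case False
  define y where "y = - x"
  have y: "0 < y" "y \<le> 1" using False assms by (auto simp: y_def)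
  \<comment> \<open>The product equals \<open>1 + y ^ 3\<close>.\<close>
  have "1 \<le> (1 + y) * (1 - y + y\<^sup>2)" using y by (simp add: algebra_simps power2_eq_square)
  also have "\<dots> \<le> exp y * (1 - y + y\<^sup>2)"
    using exp_ge_add_one_self[of y] y by (intro mult_right_mono) (auto simp: add_nonneg_nonneg)
  finally have "exp (- y) \<le> 1 - y + y\<^sup>2" by (simp add: exp_minus field_simps)
  then show ?thesis by (simp add: y_def)
qed

context filtered_prob_space
begin

text \<open>Exponential supermartingale argument: the exponential of a partial sum is itself a
  weight of the past, so the drift bound applies to it. Increments of size at most 2 and
  \<open>\<theta> \<le> 1/2\<close> keep the exponent within the range of the quadratic bound for
  \<open>exp\<close>, whose last term is at most \<open>(2 * \<theta>) ^ 2\<close>.\<close>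

lemma expectation_exp_sum_le:
  fixes U :: "nat \<Rightarrow> 'a \<Rightarrow> real" and a :: "nat \<Rightarrow> nat"
  assumes a: "\<And>k. a k \<le> a (Suc k)"
    and U: "\<And>k. bdd_rv (F (a (Suc k))) (U k)" "\<And>k \<omega>. \<omega> \<in> space M \<Longrightarrow> \<bar>U k \<omega>\<bar> \<le> 2"
    and drift: "\<And>k Y. weight (F (a k)) Y \<Longrightarrow> expectation (\<lambda>\<omega>. Y \<omega> * U k \<omega>) \<le> err * expectation Y"
    and \<theta>: "0 \<le> \<theta>" "\<theta> \<le> 1/2" and err: "0 \<le> err"
  shows "weight (F (a K)) (\<lambda>\<omega>. exp (\<theta> * (\<Sum>k<K. U k \<omega>))) \<and>
    expectation (\<lambda>\<omega>. exp (\<theta> * (\<Sum>k<K. U k \<omega>))) \<le> (1 + (\<theta> * err + 4 * \<theta>\<^sup>2)) ^ K"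
proof (induction K)
  case 0 then show ?case by (simp add: weight_const prob_space)
next
  case (Suc K)
  let ?Y = "\<lambda>\<omega>. exp (\<theta> * (\<Sum>k<K. U k \<omega>))"
  have Y: "weight (F (a K)) ?Y" and IH: "expectation ?Y \<le> (1 + (\<theta> * err + 4 * \<theta>\<^sup>2)) ^ K" using Suc by auto
  have Ye: "exp (\<theta> * (\<Sum>k<Suc K. U k \<omega>)) = ?Y \<omega> * exp (\<theta> * U K \<omega>)" for \<omega>
    by (simp add: exp_add[symmetric] distrib_left)
  have W: "weight (F (a (Suc K))) (\<lambda>\<omega>. exp (\<theta> * (\<Sum>k<Suc K. U k \<omega>)))"
    unfolding Ye
    by (rule weight_mult[OF weight_F_mono[OF a Y] weight_exp[OF bdd_rv_mult[OF bdd_rv_const U(1)]]])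
  note bY = weight_bdd_M[OF Y] and bU = bdd_rv_F_M[OF U(1)[of K]]
  have "expectation (\<lambda>\<omega>. exp (\<theta> * (\<Sum>k<Suc K. U k \<omega>)))
      \<le> expectation (\<lambda>\<omega>. (1 + 4 * \<theta>\<^sup>2) * ?Y \<omega> + \<theta> * (?Y \<omega> * U K \<omega>))"
  proof (rule expectation_mono_bdd[OF weight_bdd_M[OF W]])
    show "bdd_rv M (\<lambda>\<omega>. (1 + 4 * \<theta>\<^sup>2) * ?Y \<omega> + \<theta> * (?Y \<omega> * U K \<omega>))"
      by (intro bdd_rv_add bdd_rv_mult[OF bdd_rv_const] bY bdd_rv_mult[OF bY bU])
    fix \<omega> assume om: "\<omega> \<in> space M"
    have "\<theta> * \<bar>U K \<omega>\<bar> \<le> (1/2) * 2" using \<theta> U(2)[OF om] by (intro mult_mono) auto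
    then have 1: "\<bar>\<theta> * U K \<omega>\<bar> \<le> 1" using \<theta> by (simp add: abs_mult)
    have "(\<theta> * U K \<omega>)\<^sup>2 \<le> \<theta>\<^sup>2 * 2\<^sup>2"
      unfolding power_mult_distrib using U(2)[OF om, of K] abs_le_square_iff[of "U K \<omega>" 2]
      by (intro mult_left_mono) auto
    then have "exp (\<theta> * U K \<omega>) \<le> (1 + 4 * \<theta>\<^sup>2) + \<theta> * U K \<omega>"
      using exp_le_quadratic[OF 1] by simp
    then have "?Y \<omega> * exp (\<theta> * U K \<omega>) \<le> ?Y \<omega> * ((1 + 4 * \<theta>\<^sup>2) + \<theta> * U K \<omega>)"
      by (rule mult_left_mono) simp
    then show "exp (\<theta> * (\<Sum>k<Suc K. U k \<omega>)) \<le> (1 + 4 * \<theta>\<^sup>2) * ?Y \<omega> + \<theta> * (?Y \<omega> * U K \<omega>)"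
      unfolding Ye by (simp add: algebra_simps)
  qed
  also have "\<dots> = (1 + 4 * \<theta>\<^sup>2) * expectation ?Y + \<theta> * expectation (\<lambda>\<omega>. ?Y \<omega> * U K \<omega>)"
    by (subst expectation_add_bdd, (intro bdd_rv_mult[OF bdd_rv_const] bY bdd_rv_mult[OF bY bU])+) simp
  also have "\<dots> \<le> (1 + 4 * \<theta>\<^sup>2) * expectation ?Y + \<theta> * (err * expectation ?Y)"
    using drift[OF Y] \<theta> by (intro add_left_mono mult_left_mono)
  also have "\<dots> = (1 + (\<theta> * err + 4 * \<theta>\<^sup>2)) * expectation ?Y" by (simp add: algebra_simps)
  also have "\<dots> \<le> (1 + (\<theta> * err + 4 * \<theta>\<^sup>2)) * (1 + (\<theta> * err + 4 * \<theta>\<^sup>2)) ^ K"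
    using IH \<theta> err by (intro mult_left_mono) auto
  finally show ?case using W by simp
qed

text \<open>Markov's inequality for the exponential of the sum, then
  \<open>1 + x \<le> exp x\<close> in each factor.\<close>

lemma sum_tail_bound:
  fixes U :: "nat \<Rightarrow> 'a \<Rightarrow> real" and a :: "nat \<Rightarrow> nat"
  assumes a: "\<And>k. a k \<le> a (Suc k)"
    and U: "\<And>k. bdd_rv (F (a (Suc k))) (U k)" "\<And>k \<omega>. \<omega> \<in> space M \<Longrightarrow> \<bar>U k \<omega>\<bar> \<le> 2"
    and drift: "\<And>k Y. weight (F (a k)) Y \<Longrightarrow> expectation (\<lambda>\<omega>. Y \<omega> * U k \<omega>) \<le> err * expectation Y"
    and \<theta>: "0 \<le> \<theta>" "\<theta> \<le> 1/2" and err: "0 \<le> err"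
  shows "expectation (\<lambda>\<omega>. of_bool (s \<le> (\<Sum>k<K. U k \<omega>))) \<le> exp (- (\<theta> * s) + real K * (\<theta> * err + 4 * \<theta>\<^sup>2))"
proof -
  let ?Y = "\<lambda>\<omega>. exp (\<theta> * (\<Sum>k<K. U k \<omega>))"
  have W: "weight (F (a K)) ?Y" and E: "expectation ?Y \<le> (1 + (\<theta> * err + 4 * \<theta>\<^sup>2)) ^ K"
    using expectation_exp_sum_le[where a = a and U = U, OF assms] by auto
  have [measurable]: "U k \<in> borel_measurable M" for k
    using bdd_rv_measurable[OF bdd_rv_F_M[OF U(1)]] .
  have "expectation (\<lambda>\<omega>. of_bool (s \<le> (\<Sum>k<K. U k \<omega>))) \<le> expectation (\<lambda>\<omega>. exp (- (\<theta> * s)) * ?Y \<omega>)"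
  proof (rule expectation_mono_bdd)
    show "bdd_rv M (\<lambda>\<omega>. of_bool (s \<le> (\<Sum>k<K. U k \<omega>)))"
      by (rule bdd_rv_of_bool) measurable
    show "bdd_rv M (\<lambda>\<omega>. exp (- (\<theta> * s)) * ?Y \<omega>)"
      by (rule bdd_rv_mult[OF bdd_rv_const weight_bdd_M[OF W]])
    fix \<omega>
    have "s \<le> x \<Longrightarrow> 1 \<le> exp (- (\<theta> * s)) * exp (\<theta> * x)" for x
      using \<theta> by (simp add: exp_add[symmetric] mult_left_mono)
    then show "of_bool (s \<le> (\<Sum>k<K. U k \<omega>)) \<le> exp (- (\<theta> * s)) * ?Y \<omega>" by simp
  qed
  also have "\<dots> = exp (- (\<theta> * s)) * expectation ?Y" by simp
  also have "\<dots> \<le> exp (- (\<theta> * s)) * (1 + (\<theta> * err + 4 * \<theta>\<^sup>2)) ^ K"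
    using E by (intro mult_left_mono) auto
  also have "\<dots> \<le> exp (- (\<theta> * s)) * exp (\<theta> * err + 4 * \<theta>\<^sup>2) ^ K"
    using \<theta> err exp_ge_add_one_self[of "\<theta> * err + 4 * \<theta>\<^sup>2"] by (intro mult_left_mono power_mono) auto
  also have "\<dots> = exp (- (\<theta> * s) + real K * (\<theta> * err + 4 * \<theta>\<^sup>2))"
    by (simp only: exp_add exp_of_nat_mult)
  finally show ?thesis .
qed

end

section \<open>The orientation statistics, their drifts and the decision rule\<close>

context firing_chain
begin

definition gap :: "nat \<Rightarrow> nat \<Rightarrow> nat \<Rightarrow> 'a \<Rightarrow> real" where
  "gap l i j \<omega> = lam l i \<omega> * (w i j * (lam l j \<omega> + w j i) - w j i * (lam l i \<omega> + w i i))"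

definition orient :: "nat \<Rightarrow> nat \<Rightarrow> nat \<Rightarrow> nat \<Rightarrow> 'a \<Rightarrow> real" where
  "orient q a i j \<omega> = of_bool (fires3 q a i j i \<omega>) - of_bool (fires3 q a i i j \<omega>)"

definition triple_err :: "nat \<Rightarrow> real \<Rightarrow> real \<Rightarrow> real" where
  "triple_err q p \<tau> = step_err q p \<tau> 2 (q + q) (2 * wm) + (h * real q) * step_err q p \<tau> 1 q (2 * wm) * (B + 2 * wm)
        + (h * real q) ^ 2 * step_err q p \<tau> 0 0 (2 * wm) * (B + 2 * wm) ^ 2"

lemma pred_fires3:
  "x1 \<in> {1..n} \<Longrightarrow> x2 \<in> {1..n} \<Longrightarrow> x3 \<in> {1..n} \<Longrightarrow> a + (q + q + q) \<le> l \<Longrightarrow> Measurable.pred (F l) (fires3 q a x1 x2 x3)"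
  unfolding fires3_def by (intro pred_intros_logic pred_fires) auto

lemma orient_bdd: "i \<in> {1..n} \<Longrightarrow> j \<in> {1..n} \<Longrightarrow> a + (q + q + q) \<le> l \<Longrightarrow> bdd_rv (F l) (orient q a i j)"
  unfolding orient_def by (intro bdd_rv_diff bdd_rv_of_bool pred_fires3)

text \<open>\<open>triple_bound\<close> for both orders. In the notation of the overview the main
  terms are \<open>(b + w i i + x) * (a + y) * b\<close> and
  \<open>(a + 2 * y) * (b + w i i) * b\<close>, and their difference is the gap. The number
  \<open>2 * d + 2\<close> bounds the two nodes together with all their parents.\<close>

lemma orient_drift:
  assumes Y: "weight (F a) Y" and start: "\<And>\<omega> k. \<omega> \<in> space M \<Longrightarrow> Y \<omega> \<noteq> 0 \<Longrightarrow> k \<in> {1..n} \<Longrightarrow> lam a k \<omega> \<le> R"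
    and RB: "R + \<kappa> * (h * real (q + q + q)) + wm * real m0 \<le> B"
    and ij: "i \<in> {1..n}" "j \<in> {1..n}"
    and p: "real (2 * d + 2) * (h * B + \<rho>) \<le> p"
    and Lq: "L * (h * real (q + q)) \<le> 1"
    and \<tau>: "real (q + q + q) * \<rho> + real n * (real (q + q + q) * p) ^ m0 \<le> \<tau>"
  shows "\<bar>expectation (\<lambda>\<omega>. Y \<omega> * orient q a i j \<omega>) - (h * real q) ^ 3 * expectation (\<lambda>\<omega>. Y \<omega> * gap a i j \<omega>)\<bar>
    \<le> 2 * triple_err q p \<tau> * expectation Y"
proof -
  define S where "S = {i, j} \<union> parents i \<union> parents j"
  have S: "S \<subseteq> {1..n}" "i \<in> S" "j \<in> S" "parents i \<subseteq> S" "parents j \<subseteq> S"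
    using ij parents_subset by (auto simp: S_def)
  have hB: "0 \<le> h * B + \<rho>" using param_nonneg by auto
  have "card S \<le> card {i, j} + card (parents i) + card (parents j)"
    unfolding S_def by (intro order_trans[OF card_Un_le] add_right_mono card_Un_le)
  also have "card {i, j} \<le> 2" by (simp add: card_insert_if)
  finally have "card S \<le> 2 * d + 2"
    using w_sparse[OF ij(1)] w_sparse[OF ij(2)] unfolding parents_def by linarith
  then have "real (card S) * (h * B + \<rho>) \<le> real (2 * d + 2) * (h * B + \<rho>)"
    by (intro mult_right_mono hB) auto
  then have p1: "real (card S) * (h * B + \<rho>) \<le> p" using p by linarith
  have "real d * (h * B + \<rho>) \<le> real (2 * d + 2) * (h * B + \<rho>)"
    by (intro mult_right_mono hB) auto
  then have p2: "real d * (h * B + \<rho>) \<le> p" using p by linarith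
  define A1 where "A1 = (\<lambda>\<omega>. Y \<omega> * (lam a i \<omega> + (w i i + w i j)) * (lam a j \<omega> + w j i) * lam a i \<omega>)"
  define A2 where "A2 = (\<lambda>\<omega>. Y \<omega> * (lam a j \<omega> + (w j i + w j i)) * (lam a i \<omega> + w i i) * lam a i \<omega>)"
  have t1: "\<bar>expectation (\<lambda>\<omega>. Y \<omega> * of_bool (fires3 q a i j i \<omega>)) - (h * real q) ^ 3 * expectation A1\<bar>
     \<le> triple_err q p \<tau> * expectation Y"
    unfolding triple_err_def A1_def
    by (rule triple_bound[OF Y start RB S(1) S(2) S(3) S(2) S(4) S(5) S(4) p1 p2 Lq \<tau>])
  have t2: "\<bar>expectation (\<lambda>\<omega>. Y \<omega> * of_bool (fires3 q a i i j \<omega>)) - (h * real q) ^ 3 * expectation A2\<bar>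
     \<le> triple_err q p \<tau> * expectation Y"
    unfolding triple_err_def A2_def
    by (rule triple_bound[OF Y start RB S(1) S(2) S(2) S(3) S(4) S(4) S(5) p1 p2 Lq \<tau>])
  have shift: "weight (F a) (\<lambda>\<omega>. Y \<omega> * (lam a x \<omega> + u) * (lam a y \<omega> + v) * lam a z \<omega>)"
    if "x \<in> {1..n}" "y \<in> {1..n}" "z \<in> {1..n}" "0 \<le> u" "0 \<le> v" for x y z u v
  proof -
    have 1: "weight (F a) (\<lambda>\<omega>. Y \<omega> * (lam a x \<omega> + u))"
      by (rule weight_shift[OF Y start that(1,4)])
    have 2: "weight (F a) (\<lambda>\<omega>. Y \<omega> * (lam a x \<omega> + u) * (lam a y \<omega> + v))"
      by (rule weight_shift[OF 1 _ that(2,5), of R]) (use start in auto)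
    show ?thesis
      using weight_shift(1)[OF 2 _ that(3) order_refl, of R] start by auto
  qed
  have b1: "bdd_rv M A1" and b2: "bdd_rv M A2" unfolding A1_def A2_def
    by (rule weight_bdd_M[OF shift]; use ij w_range in auto)+
  have bf: "bdd_rv M (\<lambda>\<omega>. Y \<omega> * of_bool (fires3 q a x1 x2 x3 \<omega>))"
    if "x1 \<in> {1..n}" "x2 \<in> {1..n}" "x3 \<in> {1..n}" for x1 x2 x3
    by (rule bdd_rv_mult[OF weight_bdd_M[OF Y] bdd_rv_F_M[OF bdd_rv_of_bool[OF pred_fires3[OF that order_refl]]]])
  have "expectation (\<lambda>\<omega>. Y \<omega> * orient q a i j \<omega>)
     = expectation (\<lambda>\<omega>. Y \<omega> * of_bool (fires3 q a i j i \<omega>)) - expectation (\<lambda>\<omega>. Y \<omega> * of_bool (fires3 q a i i j \<omega>))"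
    unfolding orient_def right_diff_distrib by (rule expectation_diff_bdd; intro bf ij)
  moreover have "expectation (\<lambda>\<omega>. Y \<omega> * gap a i j \<omega>) = expectation A1 - expectation A2"
  proof -
    have "(\<lambda>\<omega>. Y \<omega> * gap a i j \<omega>) = (\<lambda>\<omega>. A1 \<omega> - A2 \<omega>)"
      by (rule ext) (simp add: A1_def A2_def gap_def algebra_simps)
    then show ?thesis using expectation_diff_bdd[OF b1 b2] by simp
  qed
  ultimately have "expectation (\<lambda>\<omega>. Y \<omega> * orient q a i j \<omega>) - (h * real q) ^ 3 * expectation (\<lambda>\<omega>. Y \<omega> * gap a i j \<omega>)
     = (expectation (\<lambda>\<omega>. Y \<omega> * of_bool (fires3 q a i j i \<omega>)) - (h * real q) ^ 3 * expectation A1)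
       - (expectation (\<lambda>\<omega>. Y \<omega> * of_bool (fires3 q a i i j \<omega>)) - (h * real q) ^ 3 * expectation A2)"
    by (simp add: right_diff_distrib)
  then show ?thesis using t1 t2 by linarith
qed

definition calm :: "real \<Rightarrow> nat \<Rightarrow> 'a \<Rightarrow> bool" where
  "calm R l \<omega> \<longleftrightarrow> (\<forall>k\<in>{1..n}. lam l k \<omega> \<le> R)"

lemma pred_calm: "Measurable.pred (F l) (calm R l)"
proof -
  have 1: "Measurable.pred (F l) (\<lambda>\<omega>. lam l k \<omega> \<le> R)" if "k \<in> {1..n}" for k
    using lam_meas[OF that] by measurable
  show ?thesis unfolding calm_def by (rule pred_intros_finite(3)) (use 1 in auto)
qed

lemma gap_bounds:
  assumes "\<omega> \<in> space M" "calm R l \<omega>" "i \<in> {1..n}" "j \<in> {1..n}"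
  shows "\<bar>gap l i j \<omega>\<bar> \<le> R * (wm * (R + wm))"
proof -
  have l: "0 \<le> lam l i \<omega>" "lam l i \<omega> \<le> R" "0 \<le> lam l j \<omega>" "lam l j \<omega> \<le> R"
    using assms lam_nonneg unfolding calm_def by auto
  have w: "0 \<le> w i j" "w i j \<le> wm" "0 \<le> w j i" "w j i \<le> wm" "0 \<le> w i i" "w i i \<le> wm"
    using assms w_range by auto
  have a: "0 \<le> w i j * (lam l j \<omega> + w j i)" "w i j * (lam l j \<omega> + w j i) \<le> wm * (R + wm)"
    using l w by (auto intro!: mult_mono)
  have b: "0 \<le> w j i * (lam l i \<omega> + w i i)" "w j i * (lam l i \<omega> + w i i) \<le> wm * (R + wm)"
    using l w by (auto intro!: mult_mono)
  show ?thesis unfolding gap_def abs_mult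
    by (rule mult_mono) (use l a b in auto)
qed

text \<open>Blocks that start with some rate above \<open>R\<close> are switched off. This makes the
  increments bounded and the drift bound valid without conditioning on the future; on a path that is
  calm at all block starts the sum is the statistic minus its accumulated drift.\<close>

definition dev :: "real \<Rightarrow> nat \<Rightarrow> nat \<Rightarrow> nat \<Rightarrow> nat \<Rightarrow> 'a \<Rightarrow> real" where
  "dev R q i j k \<omega> = of_bool (calm R ((q + q + q) * k) \<omega>) *
     (orient q ((q + q + q) * k) i j \<omega> - (h * real q) ^ 3 * gap ((q + q + q) * k) i j \<omega>)"

lemma dev_tail:
  assumes RB: "R + \<kappa> * (h * real (q + q + q)) + wm * real m0 \<le> B"
    and ij: "i \<in> {1..n}" "j \<in> {1..n}"
    and p: "real (2 * d + 2) * (h * B + \<rho>) \<le> p"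
    and Lq: "L * (h * real (q + q)) \<le> 1"
    and \<tau>: "real (q + q + q) * \<rho> + real n * (real (q + q + q) * p) ^ m0 \<le> \<tau>"
    and gl: "(h * real q) ^ 3 * (R * (wm * (R + wm))) \<le> 1"
    and err: "2 * triple_err q p \<tau> \<le> err" "0 \<le> err"
    and \<theta>: "0 \<le> \<theta>" "\<theta> \<le> 1/2"
  shows "bdd_rv M (\<lambda>\<omega>. of_bool (s \<le> \<bar>\<Sum>k<K. dev R q i j k \<omega>\<bar>))"
    and "expectation (\<lambda>\<omega>. of_bool (s \<le> \<bar>\<Sum>k<K. dev R q i j k \<omega>\<bar>))
      \<le> 2 * exp (- (\<theta> * s) + real K * (\<theta> * err + 4 * \<theta>\<^sup>2))"
proof -
  define a where "a = (\<lambda>k. (q + q + q) * k)"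
  have aS: "a (Suc k) = a k + (q + q + q)" for k by (simp add: a_def)
  have dl0: "0 \<le> h * real q" using param_nonneg by simp
  let ?V = "\<lambda>k \<omega>. of_bool (calm R (a k) \<omega>) :: real"
  have cgb: "bdd_rv (F (a k)) (\<lambda>\<omega>. ?V k \<omega> * gap (a k) i j \<omega>)" for k
  proof (rule bdd_rvI)
    have [measurable]: "Measurable.pred (F (a k)) (calm R (a k))" by (rule pred_calm)
    have [measurable]: "lam (a k) i \<in> borel_measurable (F (a k))" "lam (a k) j \<in> borel_measurable (F (a k))"
      using lam_meas ij by auto
    show "(\<lambda>\<omega>. ?V k \<omega> * gap (a k) i j \<omega>) \<in> borel_measurable (F (a k))"
      unfolding gap_def by measurable
    show "\<bar>?V k \<omega> * gap (a k) i j \<omega>\<bar> \<le> \<bar>R * (wm * (R + wm))\<bar>" if "\<omega> \<in> space (F (a k))" for \<omega>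
      using gap_bounds[of \<omega> R "a k" i j] that ij by (cases "calm R (a k) \<omega>") auto
  qed
  have Vb: "bdd_rv (F (a k)) (?V k)" for k by (rule bdd_rv_of_bool[OF pred_calm])
  have ob: "bdd_rv (F (a (Suc k))) (orient q (a k) i j)" for k
    by (rule orient_bdd[OF ij]) (simp add: aS)
  have dv: "dev R q i j k = (\<lambda>\<omega>. ?V k \<omega> * orient q (a k) i j \<omega> - (h * real q) ^ 3 * (?V k \<omega> * gap (a k) i j \<omega>))" for k
    by (rule ext) (simp add: dev_def a_def algebra_simps)
  have ak: "a k \<le> a (Suc k)" for k by (simp add: aS)
  have U1: "bdd_rv (F (a (Suc k))) (dev R q i j k)" for k
    unfolding dv by (intro bdd_rv_diff bdd_rv_mult[OF _ ob] bdd_rv_mult[OF bdd_rv_const] bdd_rv_F_mono[OF ak cgb] bdd_rv_F_mono[OF ak Vb])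
  have U2: "\<bar>dev R q i j k \<omega>\<bar> \<le> 2" if om: "\<omega> \<in> space M" for k \<omega>
  proof (cases "calm R (a k) \<omega>")
    case True
    have "(h * real q) ^ 3 * \<bar>gap (a k) i j \<omega>\<bar> \<le> (h * real q) ^ 3 * (R * (wm * (R + wm)))"
      using gap_bounds[OF om True ij] dl0 by (intro mult_left_mono) auto
    then have "\<bar>(h * real q) ^ 3 * gap (a k) i j \<omega>\<bar> \<le> 1" using gl dl0 by (simp add: abs_mult)
    moreover have "\<bar>orient q (a k) i j \<omega>\<bar> \<le> 1" unfolding orient_def by simp
    ultimately show ?thesis using True unfolding dv by auto
  qed (simp add: dv)
  have drift: "\<bar>expectation (\<lambda>\<omega>. Y \<omega> * dev R q i j k \<omega>)\<bar> \<le> err * expectation Y"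
    if Y: "weight (F (a k)) Y" for k Y
  proof -
    let ?W = "\<lambda>\<omega>. Y \<omega> * ?V k \<omega>"
    have W: "weight (F (a k)) ?W" by (rule weight_mult[OF Y weight_of_bool[OF pred_calm]])
    have 0: "\<And>\<omega> k'. \<omega> \<in> space M \<Longrightarrow> ?W \<omega> \<noteq> 0 \<Longrightarrow> k' \<in> {1..n} \<Longrightarrow> lam (a k) k' \<omega> \<le> R"
      by (auto simp: calm_def)
    have EW: "expectation ?W \<le> expectation Y"
      by (rule expectation_mono_bdd[OF weight_bdd_M[OF W] weight_bdd_M[OF Y]]) (use weight_ge_0[OF Y] in auto)
    have EW0: "0 \<le> expectation ?W" using expectation_nonneg_weight weight_F_M[OF W] .
    have "\<bar>expectation (\<lambda>\<omega>. ?W \<omega> * orient q (a k) i j \<omega>) - (h * real q) ^ 3 * expectation (\<lambda>\<omega>. ?W \<omega> * gap (a k) i j \<omega>)\<bar>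
      \<le> 2 * triple_err q p \<tau> * expectation ?W"
      by (rule orient_drift[OF W 0 RB ij p Lq \<tau>])
    also have "\<dots> \<le> err * expectation ?W" by (rule mult_right_mono[OF err(1) EW0])
    also have "\<dots> \<le> err * expectation Y" by (rule mult_left_mono[OF EW err(2)])
    finally have 1: "\<bar>expectation (\<lambda>\<omega>. ?W \<omega> * orient q (a k) i j \<omega>) - (h * real q) ^ 3 * expectation (\<lambda>\<omega>. ?W \<omega> * gap (a k) i j \<omega>)\<bar>
      \<le> err * expectation Y" .
    have b1: "bdd_rv M (\<lambda>\<omega>. ?W \<omega> * orient q (a k) i j \<omega>)"
      by (rule bdd_rv_mult[OF weight_bdd_M[OF W] bdd_rv_F_M[OF ob]])
    have "bdd_rv M (\<lambda>\<omega>. Y \<omega> * (?V k \<omega> * gap (a k) i j \<omega>))"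
      by (rule bdd_rv_mult[OF weight_bdd_M[OF Y] bdd_rv_F_M[OF cgb]])
    then have b2: "bdd_rv M (\<lambda>\<omega>. (h * real q) ^ 3 * (?W \<omega> * gap (a k) i j \<omega>))"
      by (intro bdd_rv_mult[OF bdd_rv_const]) (simp add: mult.assoc)
    have "(\<lambda>\<omega>. Y \<omega> * dev R q i j k \<omega>)
        = (\<lambda>\<omega>. ?W \<omega> * orient q (a k) i j \<omega> - (h * real q) ^ 3 * (?W \<omega> * gap (a k) i j \<omega>))"
      unfolding dv by (rule ext) (simp add: algebra_simps)
    then show ?thesis using 1 expectation_diff_bdd[OF b1 b2] by simp
  qed
  have bs: "bdd_rv M (\<lambda>\<omega>. \<Sum>k<K. dev R q i j k \<omega>)" by (intro bdd_rv_sum bdd_rv_F_M[OF U1])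
  have ms [measurable]: "(\<lambda>\<omega>. \<Sum>k<K. dev R q i j k \<omega>) \<in> borel_measurable M"
    using bdd_rv_measurable[OF bs] .
  show bb: "bdd_rv M (\<lambda>\<omega>. of_bool (s \<le> \<bar>\<Sum>k<K. dev R q i j k \<omega>\<bar>))"
    by (rule bdd_rv_of_bool) measurable
  have b1: "bdd_rv M (\<lambda>\<omega>. of_bool (s \<le> (\<Sum>k<K. dev R q i j k \<omega>)))"
    by (rule bdd_rv_of_bool) measurable
  have b2: "bdd_rv M (\<lambda>\<omega>. of_bool (s \<le> (\<Sum>k<K. - dev R q i j k \<omega>)))"
    unfolding sum_negf by (rule bdd_rv_of_bool) measurable
  have e1: "expectation (\<lambda>\<omega>. of_bool (s \<le> (\<Sum>k<K. dev R q i j k \<omega>))) \<le> exp (- (\<theta> * s) + real K * (\<theta> * err + 4 * \<theta>\<^sup>2))"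
    by (rule sum_tail_bound[where a = a, OF ak U1 U2 _ \<theta> err(2)]) (use drift abs_le_D1 in blast)+
  have e2: "expectation (\<lambda>\<omega>. of_bool (s \<le> (\<Sum>k<K. - dev R q i j k \<omega>))) \<le> exp (- (\<theta> * s) + real K * (\<theta> * err + 4 * \<theta>\<^sup>2))"
  proof (rule sum_tail_bound[where a = a, OF ak bdd_rv_uminus[OF U1] _ _ \<theta> err(2)])
    show "\<bar>- dev R q i j k \<omega>\<bar> \<le> 2" if "\<omega> \<in> space M" for k \<omega> using U2[OF that] by simp
    show "expectation (\<lambda>\<omega>. Y \<omega> * - dev R q i j k \<omega>) \<le> err * expectation Y" if "weight (F (a k)) Y" for k Y
      using drift[OF that] by simp
  qed
  have "expectation (\<lambda>\<omega>. of_bool (s \<le> \<bar>\<Sum>k<K. dev R q i j k \<omega>\<bar>) :: real)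
      \<le> expectation (\<lambda>\<omega>. of_bool (s \<le> (\<Sum>k<K. dev R q i j k \<omega>)) + of_bool (s \<le> (\<Sum>k<K. - dev R q i j k \<omega>)))"
  proof (rule expectation_mono_bdd)
    show "bdd_rv M (\<lambda>\<omega>. of_bool (s \<le> \<bar>\<Sum>k<K. dev R q i j k \<omega>\<bar>))" by (rule bb)
    show "bdd_rv M (\<lambda>\<omega>. of_bool (s \<le> (\<Sum>k<K. dev R q i j k \<omega>)) + of_bool (s \<le> (\<Sum>k<K. - dev R q i j k \<omega>)))"
      by (rule bdd_rv_add[OF b1 b2])
  qed (auto simp: sum_negf abs_if split: if_splits)
  also have "\<dots> \<le> 2 * exp (- (\<theta> * s) + real K * (\<theta> * err + 4 * \<theta>\<^sup>2))"
    unfolding expectation_add_bdd[OF b1 b2] using e1 e2 by linarith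
  finally show "expectation (\<lambda>\<omega>. of_bool (s \<le> \<bar>\<Sum>k<K. dev R q i j k \<omega>\<bar>))
      \<le> 2 * exp (- (\<theta> * s) + real K * (\<theta> * err + 4 * \<theta>\<^sup>2))" .
qed

text \<open>
  Both statistics of an unordered pair are needed: a combination of the two drifts is a square
  plus terms controlled by the separation of the weights, so they cannot vanish together.
\<close>

lemma gap_combination:
  assumes om: "\<omega> \<in> space M" and ij: "i \<in> {1..n}" "j \<in> {1..n}"
    and sep: "ws \<le> w i i - w i j" "ws \<le> w j j - w j i" "0 \<le> ws"
    and low: "mu \<le> lam l i \<omega>" "mu \<le> lam l j \<omega>" "0 \<le> mu"
  shows "ws * mu * ((w i j)\<^sup>2 + (w j i)\<^sup>2) \<le> - (w j i) * gap l i j \<omega> - (w i j) * gap l j i \<omega>"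
proof -
  let ?x = "w i j" and ?y = "w j i" and ?a = "lam l j \<omega>" and ?b = "lam l i \<omega>"
  have eq: "- ?y * gap l i j \<omega> - ?x * gap l j i \<omega>
     = (?x * ?a - ?y * ?b)\<^sup>2 + ?x\<^sup>2 * (?a * (w j j - ?y)) + ?y\<^sup>2 * (?b * (w i i - ?x))"
    by (simp add: gap_def power2_eq_square algebra_simps)
  have "ws * mu * ?x\<^sup>2 \<le> ?x\<^sup>2 * (?a * (w j j - ?y))"
    using mult_mono[of ws "w j j - ?y" mu ?a] sep low
    by (subst mult.commute, intro mult_left_mono) (auto simp: mult.commute)
  moreover have "ws * mu * ?y\<^sup>2 \<le> ?y\<^sup>2 * (?b * (w i i - ?x))"
    using mult_mono[of ws "w i i - ?x" mu ?b] sep low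
    by (subst mult.commute, intro mult_left_mono) (auto simp: mult.commute)
  moreover have "ws * mu * (?x\<^sup>2 + ?y\<^sup>2) = ws * mu * ?x\<^sup>2 + ws * mu * ?y\<^sup>2"
    by (rule distrib_left)
  ultimately show ?thesis unfolding eq using zero_le_power2[of "?x * ?a - ?y * ?b"]
    by linarith
qed

definition stat :: "nat \<Rightarrow> nat \<Rightarrow> nat \<Rightarrow> nat \<Rightarrow> 'a \<Rightarrow> real" where
  "stat q K i j \<omega> = (\<Sum>k<K. orient q ((q + q + q) * k) i j \<omega>)"

text \<open>Without an edge both gaps vanish and the statistics consist of deviations only. With an
  edge, two small statistics would bound the negatives of both accumulated drifts by
  \<open>2 * thr\<close>, against \<open>gap_combination\<close>. The factor 8 in the threshold
  leaves the necessary room: with \<open>s = w_lo * (x + y)\<close>, where \<open>x = w i j\<close>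
  and \<open>y = w j i\<close>, the argument gives
  \<open>s \<le> 2 * (x ^ 2 + y ^ 2) \<le> s / 2\<close>.\<close>

lemma stat_decides:
  assumes om: "\<omega> \<in> space M" and ij: "i \<in> {1..n}" "j \<in> {1..n}"
    and sep: "ws \<le> w i i - w i j" "ws \<le> w j j - w j i" "0 < ws"
    and low: "\<And>l k. k \<in> {1..n} \<Longrightarrow> mu \<le> lam l k \<omega>" "0 < mu"
    and wmin: "0 < w_lo" "w i j = 0 \<or> w_lo \<le> w i j" "w j i = 0 \<or> w_lo \<le> w j i"
    and K: "0 < K" and dl: "0 < h * real q"
    and calm: "\<And>k. k < K \<Longrightarrow> calm R ((q + q + q) * k) \<omega>"
    and thr: "thr = ws * mu * w_lo / 8 * real K * (h * real q) ^ 3"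
    and dev: "\<bar>\<Sum>k<K. dev R q i j k \<omega>\<bar> < thr" "\<bar>\<Sum>k<K. dev R q j i k \<omega>\<bar> < thr"
  shows "(thr < \<bar>stat q K i j \<omega>\<bar> \<or> thr < \<bar>stat q K j i \<omega>\<bar>) \<longleftrightarrow> (0 < w i j \<or> 0 < w j i)"
proof -
  let ?dl3 = "(h * real q) ^ 3" and ?a = "\<lambda>k. (q + q + q) * k"
  have dev_eq: "(\<Sum>k<K. dev R q i j k \<omega>) = stat q K i j \<omega> - ?dl3 * (\<Sum>k<K. gap (?a k) i j \<omega>)" for i j
    unfolding stat_def dev_def sum_distrib_left sum_subtractf[symmetric]
    by (rule sum.cong) (use calm in auto)
  have w0: "0 \<le> w i j" "0 \<le> w j i" using w_range ij by auto
  show ?thesis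
  proof (cases "w i j = 0 \<and> w j i = 0")
    case True
    then have "gap l i j \<omega> = 0" "gap l j i \<omega> = 0" for l by (auto simp: gap_def)
    then show ?thesis using dev True unfolding dev_eq by simp
  next
    case False
    let ?x = "w i j" and ?y = "w j i"
    have xy: "w_lo \<le> ?x + ?y" using False wmin w0 by linarith
    have "\<not> (\<bar>stat q K i j \<omega>\<bar> \<le> thr \<and> \<bar>stat q K j i \<omega>\<bar> \<le> thr)"
    proof
      assume as: "\<bar>stat q K i j \<omega>\<bar> \<le> thr \<and> \<bar>stat q K j i \<omega>\<bar> \<le> thr"
      have g1: "- ?dl3 * (\<Sum>k<K. gap (?a k) i j \<omega>) \<le> 2 * thr"
        using as dev(1) unfolding dev_eq by linarith
      have g2: "- ?dl3 * (\<Sum>k<K. gap (?a k) j i \<omega>) \<le> 2 * thr"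
        using as dev(2) unfolding dev_eq by linarith
      have "?dl3 * (real K * (ws * mu * (?x\<^sup>2 + ?y\<^sup>2)))
         = ?dl3 * (\<Sum>k<K. ws * mu * (?x\<^sup>2 + ?y\<^sup>2))" by simp
      also have "\<dots> \<le> ?dl3 * (\<Sum>k<K. - ?y * gap (?a k) i j \<omega> - ?x * gap (?a k) j i \<omega>)"
        by (intro mult_left_mono sum_mono gap_combination[OF om ij sep(1,2) _ low(1)[OF ij(1)] low(1)[OF ij(2)]])
          (use dl sep low in auto)
      also have "\<dots> = ?y * (- ?dl3 * (\<Sum>k<K. gap (?a k) i j \<omega>)) + ?x * (- ?dl3 * (\<Sum>k<K. gap (?a k) j i \<omega>))"
        by (simp add: sum_subtractf sum_negf sum_distrib_left[symmetric] algebra_simps)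
      also have "\<dots> \<le> ?y * (2 * thr) + ?x * (2 * thr)"
        by (intro add_mono mult_left_mono g1 g2 w0)
      also have "\<dots> = ?dl3 * (real K * (ws * mu * (w_lo * (?x + ?y) / 4)))"
        unfolding thr by (simp add: algebra_simps)
      finally have "?dl3 * (real K * (ws * mu * (?x\<^sup>2 + ?y\<^sup>2))) \<le> ?dl3 * (real K * (ws * mu * (w_lo * (?x + ?y) / 4)))" .
      then have 1: "?x\<^sup>2 + ?y\<^sup>2 \<le> w_lo * (?x + ?y) / 4"
        using dl K sep low by (simp add: mult_le_cancel_left_pos)
      define s where "s = w_lo * (?x + ?y)"
      have "s \<le> (?x + ?y) * (?x + ?y)"
        unfolding s_def using xy w0 by (intro mult_right_mono) auto
      also have "\<dots> \<le> 2 * (?x\<^sup>2 + ?y\<^sup>2)"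
        using zero_le_power2[of "?x - ?y"] by (simp add: power2_eq_square algebra_simps)
      also have "\<dots> \<le> 2 * (s / 4)" using 1 unfolding s_def by (intro mult_left_mono) auto
      finally have "s \<le> 0" by simp
      moreover have "0 < s" unfolding s_def using xy wmin by auto
      ultimately show False by simp
    qed
    moreover have "0 < ?x \<or> 0 < ?y" using False w0 by auto
    ultimately show ?thesis by auto
  qed
qed

text \<open>A first-passage argument. Before some rate first exceeds \<open>R\<close> all rates are
  at most \<open>R\<close>, so the excitation felt at cell \<open>m\<close>, split into
  contributions \<open>X m l i\<close> of the earlier cells, has conditional means adding up to at
  most \<open>Rp * (1 - \<eta>)\<close>. Its exponential moment makes an excitation above
  \<open>R - b0\<close> unlikely when \<open>R - b0\<close> is well above that mean. The kernels
  depend on the time at which the excitation is felt; therefore each pair \<open>m\<close>,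
  \<open>i\<close> gets its own exponential product, carried forward in \<open>l\<close>.\<close>

lemma not_alive_bound:
  assumes X: "\<And>m l i. i \<in> {1..n} \<Longrightarrow> X m l i \<in> borel_measurable (F (Suc l))"
      "\<And>m l i \<omega>. i \<in> {1..n} \<Longrightarrow> \<omega> \<in> space M \<Longrightarrow> 0 \<le> X m l i \<omega> \<and> X m l i \<omega> \<le> wm * real (tot l \<omega>)"
    and lamX: "\<And>m i \<omega>. i \<in> {1..n} \<Longrightarrow> \<omega> \<in> space M \<Longrightarrow> lam m i \<omega> \<le> b0 + (\<Sum>l<m. X m l i \<omega>)"
    and EX: "\<And>m l i Y. l < m \<Longrightarrow> i \<in> {1..n} \<Longrightarrow> weight (F l) Y \<Longrightarrow>
      (\<And>\<omega> k. \<omega> \<in> space M \<Longrightarrow> Y \<omega> \<noteq> 0 \<Longrightarrow> k \<in> {1..n} \<Longrightarrow> lam l k \<omega> \<le> R) \<Longrightarrow>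
      expectation (\<lambda>\<omega>. Y \<omega> * (of_bool (tot l \<omega> \<le> 1) * X m l i \<omega>)) \<le> Rp * v m l i * expectation Y"
    and v: "\<And>m l i. i \<in> {1..n} \<Longrightarrow> 0 \<le> v m l i" "\<And>m i. i \<in> {1..n} \<Longrightarrow> (\<Sum>l<m. v m l i) \<le> 1 - \<eta>"
    and pos: "0 \<le> \<theta>" "0 \<le> Rp" "R \<le> B"
  shows "expectation (\<lambda>\<omega>. of_bool (\<not> alive R 0 Q \<omega>))
    \<le> real Q * \<rho> + real (Suc Q) * (real n * exp (\<theta> * (b0 - R) + \<theta> * exp (\<theta> * wm) * Rp * (1 - \<eta>)))"
proof -
  \<comment> \<open>\<open>V\<close> keeps the contributions of alive cells with at most one event,
    hence never exceeds \<open>wm\<close>. On \<open>G m\<close> nothing is lost by this truncation,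
    and \<open>W\<close> is the exponential restricted to the paths that are still good.\<close>
  define G where "G = (\<lambda>l \<omega>. \<forall>x\<in>{..<l}. alive R 0 x \<omega> \<and> tot x \<omega> \<le> 1)"
  define V where "V = (\<lambda>m l i \<omega>. of_bool (alive R 0 l \<omega> \<and> tot l \<omega> \<le> 1) * X m l i \<omega>)"
  define W where "W = (\<lambda>m l i \<omega>. of_bool (G l \<omega>) * exp (\<theta> * (\<Sum>x<l. V m x i \<omega>)))"
  let ?c = "\<theta> * exp (\<theta> * wm)"
  have c0: "0 \<le> ?c" using pos by simp
  have pred_at: "Measurable.pred (F l) (\<lambda>\<omega>. alive R 0 x \<omega> \<and> tot x \<omega> \<le> 1)" if "x < l" for x l
  proof -
    have 1: "Measurable.pred (F l) (alive R 0 x)" by (rule pred_alive) (use that in simp)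
    have 2: "Measurable.pred (F l) (\<lambda>\<omega>. tot x \<omega> \<le> 1)" by (rule pred_tot[OF that])
    show ?thesis by (intro pred_intros_logic 1 2)
  qed
  have pG: "Measurable.pred (F l) (G l)" for l
  proof -
    show ?thesis unfolding G_def
      by (rule pred_intros_finite(3)[OF finite_lessThan pred_at]) simp
  qed
  have Vb: "bdd_rv (F (Suc l)) (V m l i)" "\<omega> \<in> space M \<Longrightarrow> 0 \<le> V m l i \<omega> \<and> V m l i \<omega> \<le> wm" if i: "i \<in> {1..n}" for m l i \<omega>
  proof -
    have pv: "Measurable.pred (F (Suc l)) (\<lambda>\<omega>. alive R 0 l \<omega> \<and> tot l \<omega> \<le> 1)"
      by (rule pred_at) simp
    have bd: "0 \<le> V m l i \<omega> \<and> V m l i \<omega> \<le> wm" if "\<omega> \<in> space M" for \<omega>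
    proof (cases "tot l \<omega> \<le> 1")
      case True
      then have "wm * real (tot l \<omega>) \<le> wm * 1" using param_nonneg by (intro mult_left_mono) auto
      then show ?thesis using X(2)[OF i that, of m l] param_nonneg unfolding V_def by auto
    qed (use param_nonneg in \<open>auto simp: V_def\<close>)
    show "bdd_rv (F (Suc l)) (V m l i)"
    proof (rule bdd_rvI[where B = wm])
      have [measurable]: "X m l i \<in> borel_measurable (F (Suc l))" using X(1)[OF i] .
      note pv[measurable]
      show "V m l i \<in> borel_measurable (F (Suc l))" unfolding V_def by measurable
      show "\<bar>V m l i \<omega>\<bar> \<le> wm" if "\<omega> \<in> space (F (Suc l))" for \<omega> using bd[of \<omega>] that by simp
    qed
    show "\<omega> \<in> space M \<Longrightarrow> 0 \<le> V m l i \<omega> \<and> V m l i \<omega> \<le> wm" using bd .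
  qed
  have Ww: "weight (F l) (W m l i)" if i: "i \<in> {1..n}" for m l i
    unfolding W_def
    by (intro weight_mult[OF weight_of_bool[OF pG] weight_exp] bdd_rv_mult[OF bdd_rv_const] bdd_rv_sum)
      (auto intro: bdd_rv_F_mono[OF _ Vb(1)[OF i]])
  have W0: "0 \<le> W m l i \<omega>" for m l i \<omega> by (simp add: W_def)
  have step: "expectation (W m (Suc l) i) \<le> (1 + ?c * Rp * v m l i) * expectation (W m l i)"
    if i: "i \<in> {1..n}" and lm: "l < m" for m l i
  proof -
    let ?Y = "\<lambda>\<omega>. W m l i \<omega> * of_bool (alive R 0 l \<omega>)"
    have Y: "weight (F l) ?Y" by (rule weight_mult[OF Ww[OF i] weight_of_bool[OF pred_alive[OF order_refl]]])
    have bYV: "bdd_rv M (\<lambda>\<omega>. ?Y \<omega> * V m l i \<omega>)"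
      by (rule bdd_rv_mult[OF weight_bdd_M[OF Y] bdd_rv_F_M[OF Vb(1)[OF i]]])
    have YV: "?Y \<omega> * V m l i \<omega> = ?Y \<omega> * (of_bool (tot l \<omega> \<le> 1) * X m l i \<omega>)" for \<omega>
      by (simp add: V_def)
    have "expectation (W m (Suc l) i) \<le> expectation (\<lambda>\<omega>. ?Y \<omega> + ?c * (?Y \<omega> * V m l i \<omega>))"
    proof (rule expectation_mono_bdd[OF weight_bdd_M[OF Ww[OF i]] bdd_rv_add[OF weight_bdd_M[OF Y] bdd_rv_mult[OF bdd_rv_const bYV]]])
      fix \<omega> assume om: "\<omega> \<in> space M"
      show "W m (Suc l) i \<omega> \<le> ?Y \<omega> + ?c * (?Y \<omega> * V m l i \<omega>)"
      proof (cases "G (Suc l) \<omega>")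
        case False
        then have "W m (Suc l) i \<omega> = 0" by (simp add: W_def)
        moreover have "0 \<le> ?Y \<omega>" using W0 by simp
        moreover have "0 \<le> ?c * (?Y \<omega> * V m l i \<omega>)" using W0 c0 Vb(2)[OF i om, of m l] by simp
        ultimately show ?thesis by linarith
      next
        case True
        then have G: "G l \<omega>" "alive R 0 l \<omega>" by (auto simp: G_def)
        have "W m (Suc l) i \<omega> = W m l i \<omega> * exp (\<theta> * V m l i \<omega>)"
          using True G by (simp add: W_def distrib_left exp_add)
        \<comment> \<open>\<open>exp t \<le> 1 + t * exp t\<close>, and the last exponential is at
          most \<open>exp (\<theta> * wm)\<close>. This makes the bound linear in \<open>V\<close>,
          so that only its conditional mean matters.\<close>
        moreover have "exp (\<theta> * V m l i \<omega>) \<le> 1 + ?c * V m l i \<omega>"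
        proof -
          let ?t = "\<theta> * V m l i \<omega>"
          have t: "0 \<le> ?t" "?t \<le> \<theta> * wm" using Vb(2)[OF i om, of m l] pos by (auto intro: mult_left_mono)
          have "1 - ?t \<le> exp (- ?t)" using exp_ge_add_one_self[of "- ?t"] by simp
          then have "exp ?t * (1 - ?t) \<le> exp ?t * exp (- ?t)" by (intro mult_left_mono) auto
          then have "exp ?t \<le> 1 + ?t * exp ?t" by (simp add: exp_minus_inverse algebra_simps)
          also have "?t * exp ?t \<le> ?t * exp (\<theta> * wm)" using t by (intro mult_left_mono) auto
          finally show ?thesis by (simp add: mult.commute mult.left_commute)
        qed
        ultimately have "W m (Suc l) i \<omega> \<le> W m l i \<omega> * (1 + ?c * V m l i \<omega>)"
          using W0 by (simp add: mult_left_mono)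
        then show ?thesis using G by (simp add: algebra_simps)
      qed
    qed
    also have "\<dots> = expectation ?Y + ?c * expectation (\<lambda>\<omega>. ?Y \<omega> * V m l i \<omega>)"
      by (subst expectation_add_bdd[OF weight_bdd_M[OF Y] bdd_rv_mult[OF bdd_rv_const bYV]]) simp
    also have "\<dots> \<le> expectation ?Y + ?c * (Rp * v m l i * expectation ?Y)"
      unfolding YV by (intro add_left_mono mult_left_mono EX[OF lm i Y] c0) (auto intro: alive_lam)
    also have "\<dots> = (1 + ?c * Rp * v m l i) * expectation ?Y" by (simp add: algebra_simps)
    also have "\<dots> \<le> (1 + ?c * Rp * v m l i) * expectation (W m l i)"
    proof (rule mult_left_mono)
      show "expectation ?Y \<le> expectation (W m l i)"
        by (rule expectation_mono_bdd[OF weight_bdd_M[OF Y] weight_bdd_M[OF Ww[OF i]]]) (use W0 in auto)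
      show "0 \<le> 1 + ?c * Rp * v m l i" using c0 pos v(1)[OF i] by simp
    qed
    finally show ?thesis .
  qed
  have EW: "expectation (W m l i) \<le> exp (?c * Rp * (\<Sum>x<l. v m x i))" if i: "i \<in> {1..n}" and "l \<le> m" for m l i
    using that(2)
  proof (induction l)
    case 0 then show ?case by (simp add: W_def G_def prob_space)
  next
    case (Suc l)
    have "expectation (W m (Suc l) i) \<le> (1 + ?c * Rp * v m l i) * expectation (W m l i)"
      using step[OF i, of l m] Suc.prems by simp
    also have "\<dots> \<le> exp (?c * Rp * v m l i) * exp (?c * Rp * (\<Sum>x<l. v m x i))"
    proof (rule mult_mono)
      show "1 + ?c * Rp * v m l i \<le> exp (?c * Rp * v m l i)" by (rule exp_ge_add_one_self)
      show "expectation (W m l i) \<le> exp (?c * Rp * (\<Sum>x<l. v m x i))" using Suc by simp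
      show "0 \<le> expectation (W m l i)" by (rule expectation_nonneg_weight[OF weight_F_M[OF Ww[OF i]]])
    qed simp
    also have "\<dots> = exp (?c * Rp * (v m l i + (\<Sum>x<l. v m x i)))"
      by (simp only: exp_add distrib_left)
    also have "v m l i + (\<Sum>x<l. v m x i) = (\<Sum>x<Suc l. v m x i)" by simp
    finally show ?case .
  qed
  define bnd where "bnd = exp (\<theta> * (b0 - R) + ?c * Rp * (1 - \<eta>))"
  \<comment> \<open>Cell \<open>m\<close> is the first at whose start the rate bound fails, and it
    fails at node \<open>i\<close>; no earlier cell held two events.\<close>
  define H where "H = (\<lambda>m i \<omega>. G m \<omega> \<and> R < lam m i \<omega>)"
  have pH: "Measurable.pred (F m) (H m i)" if i: "i \<in> {1..n}" for m i
  proof -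
    have "lam m i \<in> borel_measurable (F m)" using lam_meas[OF i] .
    then have "Measurable.pred (F m) (\<lambda>\<omega>. R < lam m i \<omega>)" by measurable
    then show ?thesis unfolding H_def using pG by (intro pred_intros_logic)
  qed
  have bH: "bdd_rv M (\<lambda>\<omega>. of_bool (H m i \<omega>))" if i: "i \<in> {1..n}" for m i
    by (rule bdd_rv_F_M[OF bdd_rv_of_bool[OF pH[OF i]]])
  have EH: "expectation (\<lambda>\<omega>. of_bool (H m i \<omega>)) \<le> bnd" if i: "i \<in> {1..n}" for m i
  proof -
    have "expectation (\<lambda>\<omega>. of_bool (H m i \<omega>)) \<le> expectation (\<lambda>\<omega>. exp (\<theta> * (b0 - R)) * W m m i \<omega>)"
    proof (rule expectation_mono_bdd[OF bH[OF i] bdd_rv_mult[OF bdd_rv_const weight_bdd_M[OF Ww[OF i]]]])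
      fix \<omega> assume om: "\<omega> \<in> space M"
      show "of_bool (H m i \<omega>) \<le> exp (\<theta> * (b0 - R)) * W m m i \<omega>"
      proof (cases "H m i \<omega>")
        case True
        then have G: "G m \<omega>" and Rl: "R < lam m i \<omega>" by (auto simp: H_def)
        have "(\<Sum>x<m. V m x i \<omega>) = (\<Sum>l<m. X m l i \<omega>)"
          by (rule sum.cong) (use G in \<open>auto simp: V_def G_def\<close>)
        then have "0 \<le> b0 - R + (\<Sum>x<m. V m x i \<omega>)" using lamX[OF i om, of m] Rl by linarith
        then have "0 \<le> \<theta> * (b0 - R + (\<Sum>x<m. V m x i \<omega>))" using pos by simp
        then have "1 \<le> exp (\<theta> * (b0 - R + (\<Sum>x<m. V m x i \<omega>)))" by simp
        then show ?thesis using True G by (simp add: W_def distrib_left exp_add)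
      qed (use W0 in simp)
    qed
    also have "\<dots> = exp (\<theta> * (b0 - R)) * expectation (W m m i)" by simp
    also have "\<dots> \<le> exp (\<theta> * (b0 - R)) * exp (?c * Rp * (1 - \<eta>))"
    proof (intro mult_left_mono order_trans[OF EW[OF i order_refl]])
      show "exp (?c * Rp * (\<Sum>x<m. v m x i)) \<le> exp (?c * Rp * (1 - \<eta>))"
        using v(2)[OF i, of m] c0 pos by (simp add: mult_left_mono)
    qed simp
    also have "\<dots> = bnd" by (simp add: bnd_def exp_add)
    finally show ?thesis .
  qed
  let ?T = "\<lambda>x \<omega>. (1 * of_bool (alive R 0 x \<omega>)) * of_bool (2 \<le> tot x \<omega>) :: real"
  have w1: "weight (F 0) (\<lambda>_. 1)" by (rule weight_const) simp
  have bT: "bdd_rv M (?T x)" for x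
    by (rule weight_bdd_M[OF weight_alive_tot[OF w1 le0]])
  have ET: "expectation (?T x) \<le> \<rho>" for x
  proof -
    have Z: "weight (F x) (\<lambda>\<omega>. 1 * of_bool (alive R 0 x \<omega>))" using weight_alive[OF w1 le0 order_refl] .
    have "expectation (?T x) \<le> \<rho> * expectation (\<lambda>\<omega>. 1 * of_bool (alive R 0 x \<omega>))"
      unfolding tot_def
    proof (rule two_upper[OF Z])
      show "\<And>\<omega> k. \<omega> \<in> space M \<Longrightarrow> 1 * of_bool (alive R 0 x \<omega>) \<noteq> (0::real) \<Longrightarrow> k \<in> {1..n} \<Longrightarrow> lam x k \<omega> \<le> B"
        using pos(3) by (auto dest!: alive_lam)
    qed
    also have "\<dots> \<le> \<rho> * expectation (\<lambda>\<omega>. 1)"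
      by (intro mult_left_mono expectation_mono_bdd weight_bdd_M[OF Z] bdd_rv_const) (use param_nonneg in auto)
    finally show ?thesis by (simp add: prob_space)
  qed
  have "expectation (\<lambda>\<omega>. of_bool (\<not> alive R 0 Q \<omega>))
     \<le> expectation (\<lambda>\<omega>. (\<Sum>x<Q. ?T x \<omega>) + (\<Sum>m<Suc Q. \<Sum>i=1..n. of_bool (H m i \<omega>)))"
  proof (rule expectation_mono_bdd)
    show "bdd_rv M (\<lambda>\<omega>. of_bool (\<not> alive R 0 Q \<omega>))"
      by (rule bdd_rv_F_M[OF bdd_rv_of_bool[OF pred_not_alive[OF order_refl]]])
    show "bdd_rv M (\<lambda>\<omega>. (\<Sum>x<Q. ?T x \<omega>) + (\<Sum>m<Suc Q. \<Sum>i=1..n. of_bool (H m i \<omega>)))"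
      by (intro bdd_rv_add bdd_rv_sum bT bH)
    fix \<omega> assume om: "\<omega> \<in> space M"
    have nn: "0 \<le> (\<Sum>x<Q. ?T x \<omega>)" "0 \<le> (\<Sum>m<Suc Q. \<Sum>i=1..n. of_bool (H m i \<omega>) :: real)"
      by (intro sum_nonneg; simp)+
    show "of_bool (\<not> alive R 0 Q \<omega>) \<le> (\<Sum>x<Q. ?T x \<omega>) + (\<Sum>m<Suc Q. \<Sum>i=1..n. of_bool (H m i \<omega>))"
    proof (cases "(\<exists>x<Q. alive R 0 x \<omega> \<and> 2 \<le> tot x \<omega>) \<or> (\<exists>m<Suc Q. \<exists>i\<in>{1..n}. H m i \<omega>)")
      case True
      then show ?thesis
      proof
        assume "\<exists>x<Q. alive R 0 x \<omega> \<and> 2 \<le> tot x \<omega>"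
        then obtain x where x: "x < Q" "alive R 0 x \<omega>" "2 \<le> tot x \<omega>" by blast
        have "?T x \<omega> \<le> (\<Sum>x<Q. ?T x \<omega>)" by (rule member_le_sum) (use x in auto)
        then have "1 \<le> (\<Sum>x<Q. ?T x \<omega>)" using x by simp
        moreover have "of_bool (\<not> alive R 0 Q \<omega>) \<le> (1::real)" by simp
        ultimately show ?thesis using nn(2) by linarith
      next
        assume "\<exists>m<Suc Q. \<exists>i\<in>{1..n}. H m i \<omega>"
        then obtain m i where m: "m < Suc Q" "i \<in> {1..n}" "H m i \<omega>" by blast
        have "(1::real) \<le> of_bool (H m i \<omega>)" using m by simp
        also have "\<dots> \<le> (\<Sum>i=1..n. of_bool (H m i \<omega>))" by (rule member_le_sum) (use m in auto)
        also have "\<dots> \<le> (\<Sum>m<Suc Q. \<Sum>i=1..n. of_bool (H m i \<omega>))"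
          by (rule member_le_sum[of m "{..<Suc Q}" "\<lambda>m. \<Sum>i=1..n. of_bool (H m i \<omega>)"]) (use m in \<open>auto intro: sum_nonneg simp del: sum_of_bool_eq\<close>)
        finally have "(1::real) \<le> (\<Sum>m<Suc Q. \<Sum>i=1..n. of_bool (H m i \<omega>))" .
        moreover have "of_bool (\<not> alive R 0 Q \<omega>) \<le> (1::real)" by simp
        ultimately show ?thesis using nn(1) by linarith
      qed
    next
      case False
      have "alive R 0 x \<omega>" if "x \<le> Q" for x
        using that
      proof (induction x rule: less_induct)
        case (less x)
        have t: "tot y \<omega> \<le> 1" if "y < x" for y
        proof -
          have "alive R 0 y \<omega>" using less that by simp
          then have "\<not> 2 \<le> tot y \<omega>" using False less.prems that by auto
          then show ?thesis by simp
        qed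
        have G: "G y \<omega>" if "y \<le> x" for y unfolding G_def using less t that by auto
        have "lam y k \<omega> \<le> R" if "y \<le> x" "k \<in> {1..n}" for y k
        proof -
          have "y < Suc Q" using that less.prems by simp
          then have "\<not> H y k \<omega>" using False that(2) by blast
          then show ?thesis using G[OF that(1)] unfolding H_def by simp
        qed
        then show ?case unfolding alive_def using t by auto
      qed
      then show ?thesis using nn by simp
    qed
  qed
  also have "\<dots> = (\<Sum>x<Q. expectation (?T x)) + (\<Sum>m<Suc Q. \<Sum>i=1..n. expectation (\<lambda>\<omega>. of_bool (H m i \<omega>)))"
  proof -
    have "expectation (\<lambda>\<omega>. \<Sum>m<Suc Q. \<Sum>i=1..n. of_bool (H m i \<omega>) :: real)
       = (\<Sum>m<Suc Q. expectation (\<lambda>\<omega>. \<Sum>i=1..n. of_bool (H m i \<omega>)))"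
      by (rule expectation_sum_bdd) (intro bdd_rv_sum bH)
    also have "\<dots> = (\<Sum>m<Suc Q. \<Sum>i=1..n. expectation (\<lambda>\<omega>. of_bool (H m i \<omega>)))"
      by (intro sum.cong refl expectation_sum_bdd bH)
    finally have 1: "expectation (\<lambda>\<omega>. \<Sum>m<Suc Q. \<Sum>i=1..n. of_bool (H m i \<omega>) :: real)
       = (\<Sum>m<Suc Q. \<Sum>i=1..n. expectation (\<lambda>\<omega>. of_bool (H m i \<omega>)))" .
    have 2: "expectation (\<lambda>\<omega>. \<Sum>x<Q. ?T x \<omega>) = (\<Sum>x<Q. expectation (?T x))"
      by (rule expectation_sum_bdd) (rule bT)
    show ?thesis unfolding 1[symmetric] 2[symmetric]
      by (rule expectation_add_bdd) (intro bdd_rv_sum bT bH)+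
  qed
  also have "\<dots> \<le> (\<Sum>x<Q. \<rho>) + (\<Sum>m<Suc Q. \<Sum>i=1..n. bnd)"
    by (intro add_mono sum_mono ET EH)
  also have "\<dots> = real Q * \<rho> + real (Suc Q) * (real n * bnd)" by simp
  finally show ?thesis unfolding bnd_def .
qed

text \<open>The bad events are collected in a variable \<open>Z\<close> that sums their indicators:
  \<open>Z < 1\<close> means that none of them occurs, and the expectation of \<open>Z\<close> is
  the union bound over death and over the deviations of all ordered pairs.\<close>

lemma recovery:
  assumes RB: "R + \<kappa> * (h * real (q + q + q)) + wm * real m0 \<le> B"
    and p: "real (2 * d + 2) * (h * B + \<rho>) \<le> p"
    and Lq: "L * (h * real (q + q)) \<le> 1"
    and \<tau>: "real (q + q + q) * \<rho> + real n * (real (q + q + q) * p) ^ m0 \<le> \<tau>"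
    and gl: "(h * real q) ^ 3 * (R * (wm * (R + wm))) \<le> 1"
    and err: "2 * triple_err q p \<tau> \<le> err" "0 \<le> err"
    and \<theta>: "0 \<le> \<theta>" "\<theta> \<le> 1/2"
    and sep: "\<And>i j. i \<in> {1..n} \<Longrightarrow> j \<in> {1..n} \<Longrightarrow> i \<noteq> j \<Longrightarrow> ws \<le> w i i - w i j" "0 < ws"
    and low: "\<And>l k \<omega>. k \<in> {1..n} \<Longrightarrow> \<omega> \<in> space M \<Longrightarrow> mu \<le> lam l k \<omega>" "0 < mu"
    and wmin: "0 < w_lo" "\<And>i j. i \<in> {1..n} \<Longrightarrow> j \<in> {1..n} \<Longrightarrow> w i j = 0 \<or> w_lo \<le> w i j"
    and K: "0 < K" and dl: "0 < h * real q"
    and thr: "thr = ws * mu * w_lo / 8 * real K * (h * real q) ^ 3"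
    and dead: "expectation (\<lambda>\<omega>. of_bool (\<not> alive R 0 ((q + q + q) * K) \<omega>)) \<le> \<beta>"
  shows "\<exists>Z. weight M Z \<and>
      expectation Z \<le> \<beta> + real n * (real n * (2 * exp (- (\<theta> * thr) + real K * (\<theta> * err + 4 * \<theta>\<^sup>2)))) \<and>
      (\<forall>\<omega>\<in>space M. Z \<omega> < 1 \<longrightarrow> (\<forall>i\<in>{1..n}. \<forall>j\<in>{1..n}. i \<noteq> j \<longrightarrow>
        ((thr < \<bar>stat q K i j \<omega>\<bar> \<or> thr < \<bar>stat q K j i \<omega>\<bar>) \<longleftrightarrow> (0 < w i j \<or> 0 < w j i))))"
proof (intro exI conjI)
  let ?D = "\<lambda>i j \<omega>. of_bool (thr \<le> \<bar>\<Sum>k<K. dev R q i j k \<omega>\<bar>) :: real"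
  let ?A = "\<lambda>\<omega>. of_bool (\<not> alive R 0 ((q + q + q) * K) \<omega>) :: real"
  let ?Z = "\<lambda>\<omega>. ?A \<omega> + (\<Sum>i=1..n. \<Sum>j=1..n. ?D i j \<omega>)"
  note tail = dev_tail[OF RB _ _ p Lq \<tau> gl err \<theta>]
  have bA: "bdd_rv M ?A" by (rule bdd_rv_F_M[OF bdd_rv_of_bool[OF pred_not_alive[OF order_refl]]])
  have bD: "bdd_rv M (?D i j)" if "i \<in> {1..n}" "j \<in> {1..n}" for i j using tail(1)[OF that] .
  have D0: "0 \<le> (\<Sum>i=1..n. \<Sum>j=1..n. ?D i j \<omega>)" for \<omega> by (intro sum_nonneg; simp)
  have "bdd_rv M ?Z" by (intro bdd_rv_add bdd_rv_sum bA bD)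
  then show "weight M ?Z" unfolding weight_def using D0 by (auto intro: add_nonneg_nonneg)
  have "expectation ?Z = expectation ?A + (\<Sum>i=1..n. \<Sum>j=1..n. expectation (?D i j))"
  proof -
    have "expectation (\<lambda>\<omega>. \<Sum>i=1..n. \<Sum>j=1..n. ?D i j \<omega>) = (\<Sum>i=1..n. expectation (\<lambda>\<omega>. \<Sum>j=1..n. ?D i j \<omega>))"
      by (rule expectation_sum_bdd) (intro bdd_rv_sum bD)
    also have "\<dots> = (\<Sum>i=1..n. \<Sum>j=1..n. expectation (?D i j))"
      by (intro sum.cong refl expectation_sum_bdd bD)
    finally show ?thesis
      by (subst expectation_add_bdd[OF bA]) (intro bdd_rv_sum bD, simp_all)
  qed
  also have "\<dots> \<le> \<beta> + (\<Sum>i=1..n. \<Sum>j=1..n. 2 * exp (- (\<theta> * thr) + real K * (\<theta> * err + 4 * \<theta>\<^sup>2)))"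
    by (intro add_mono dead sum_mono tail(2))
  finally show "expectation ?Z \<le> \<beta> + real n * (real n * (2 * exp (- (\<theta> * thr) + real K * (\<theta> * err + 4 * \<theta>\<^sup>2))))"
    by simp
  show "\<forall>\<omega>\<in>space M. ?Z \<omega> < 1 \<longrightarrow> (\<forall>i\<in>{1..n}. \<forall>j\<in>{1..n}. i \<noteq> j \<longrightarrow>
        ((thr < \<bar>stat q K i j \<omega>\<bar> \<or> thr < \<bar>stat q K j i \<omega>\<bar>) \<longleftrightarrow> (0 < w i j \<or> 0 < w j i)))"
  proof (intro ballI impI)
    fix \<omega> i j assume om: "\<omega> \<in> space M" and Z: "?Z \<omega> < 1" and ij: "i \<in> {1..n}" "j \<in> {1..n}" "i \<noteq> j"
    have "?A \<omega> < 1" using Z D0[of \<omega>] by linarith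
    then have al: "alive R 0 ((q + q + q) * K) \<omega>" by (auto split: if_splits)
    have D: "?D i j \<omega> < 1" if ij: "i \<in> {1..n}" "j \<in> {1..n}" for i j
    proof -
      have "?D i j \<omega> \<le> (\<Sum>j=1..n. ?D i j \<omega>)" by (rule member_le_sum) (use ij in auto)
      also have "\<dots> \<le> (\<Sum>i=1..n. \<Sum>j=1..n. ?D i j \<omega>)"
        by (rule member_le_sum[of i "{1..n}" "\<lambda>i. \<Sum>j=1..n. ?D i j \<omega>"])
          (use ij in \<open>auto intro: sum_nonneg simp del: sum_of_bool_eq\<close>)
      also have "\<dots> < 1"
      proof -
        have "0 \<le> ?A \<omega>" by simp
        then show ?thesis using Z by linarith
      qed
      finally show ?thesis .
    qed
    have dv: "\<bar>\<Sum>k<K. dev R q i j k \<omega>\<bar> < thr" if "i \<in> {1..n}" "j \<in> {1..n}" for i j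
      using D[OF that] by (auto split: if_splits)
    have calm: "calm R ((q + q + q) * k) \<omega>" if "k < K" for k
    proof -
      have "(q + q + q) * k \<le> (q + q + q) * K" using that by (intro mult_le_mono2) simp
      then show ?thesis using al unfolding alive_def calm_def by auto
    qed
    show "(thr < \<bar>stat q K i j \<omega>\<bar> \<or> thr < \<bar>stat q K j i \<omega>\<bar>) \<longleftrightarrow> (0 < w i j \<or> 0 < w j i)"
      by (rule stat_decides[OF om ij(1,2) sep(1)[OF ij] sep(1)[OF ij(2,1)] sep(2) low(1)[OF _ om] low(2) wmin(1)
            wmin(2)[OF ij(1,2)] wmin(2)[OF ij(2,1)] K dl calm thr dv[OF ij(1,2)] dv[OF ij(2,1)]]) (use ij in auto)
  qed
qed

end

section \<open>Rates of a Hawkes process\<close>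

text \<open>A one-sided mean value inequality. The rate is a limit from the right, so only right
  derivatives are available; the left condition excludes upward jumps. The set of points up to which
  \<open>f\<close> stays below the line of slope \<open>\<epsilon>\<close> contains its supremum by
  the left condition and extends beyond it by the right one, unless the supremum is
  \<open>b\<close>.\<close>

lemma right_derivative_le_imp_decreasing:
  fixes f :: "real \<Rightarrow> real"
  assumes ab: "a \<le> b"
    and right: "\<And>u \<epsilon>. a \<le> u \<Longrightarrow> u < b \<Longrightarrow> 0 < \<epsilon> \<Longrightarrow> \<exists>\<delta>>0. \<forall>v. u < v \<and> v < u + \<delta> \<and> v \<le> b \<longrightarrow> f v - f u \<le> \<epsilon> * (v - u)"
    and left: "\<And>u \<epsilon>. a < u \<Longrightarrow> u \<le> b \<Longrightarrow> 0 < \<epsilon> \<Longrightarrow> \<exists>\<delta>>0. \<forall>v. u - \<delta> < v \<and> v < u \<and> a \<le> v \<longrightarrow> f u - f v \<le> \<epsilon>"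
  shows "f b \<le> f a"
proof (rule field_le_epsilon)
  fix e :: real assume e: "0 < e"
  define \<epsilon> where "\<epsilon> = e / (b - a + 1)"
  have \<epsilon>: "0 < \<epsilon>" using e ab by (simp add: \<epsilon>_def)
  define S where "S = {u. a \<le> u \<and> u \<le> b \<and> (\<forall>v. a \<le> v \<and> v \<le> u \<longrightarrow> f v - f a \<le> \<epsilon> * (v - a))}"
  have aS: "a \<in> S" using ab by (auto simp: S_def)
  have bdd: "bdd_above S" unfolding S_def by (rule bdd_aboveI[of _ b]) auto
  define s where "s = Sup S"
  have "s \<le> b" unfolding s_def
  proof (rule cSup_least)
    show "S \<noteq> {}" using aS by blast
    show "\<And>x. x \<in> S \<Longrightarrow> x \<le> b" by (simp add: S_def)
  qed
  with cSup_upper[OF aS bdd] have sab: "a \<le> s" "s \<le> b" by (simp_all add: s_def)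
  have below: "f v - f a \<le> \<epsilon> * (v - a)" if v: "a \<le> v" "v < s" for v
  proof -
    obtain u where "u \<in> S" "v < u" using less_cSupD[of S v] aS v unfolding s_def by blast
    then show ?thesis using v unfolding S_def by auto
  qed
  have at_s: "f s - f a \<le> \<epsilon> * (s - a)"
  proof (cases "s = a")
    case False
    then have as: "a < s" using sab by simp
    show ?thesis
    proof (rule field_le_epsilon)
      fix e' :: real assume e': "0 < e'"
      obtain \<delta> where \<delta>: "0 < \<delta>" "\<And>v. s - \<delta> < v \<Longrightarrow> v < s \<Longrightarrow> a \<le> v \<Longrightarrow> f s - f v \<le> e'"
        using left[OF as sab(2) e'] by blast
      define v where "v = max a (s - \<delta> / 2)"
      have v: "s - \<delta> < v" "v < s" "a \<le> v" using \<delta> as by (auto simp: v_def)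
      have "\<epsilon> * (v - a) \<le> \<epsilon> * (s - a)" using \<epsilon> v by simp
      then show "f s - f a \<le> \<epsilon> * (s - a) + e'" using \<delta>(2)[OF v] below[OF v(3,2)] by linarith
    qed
  qed simp
  have sS: "s \<in> S" unfolding S_def using sab at_s below by (auto simp: le_less)
  have "s = b"
  proof (rule ccontr)
    assume "s \<noteq> b"
    then have sb: "s < b" using sab by simp
    obtain \<delta> where \<delta>: "0 < \<delta>" "\<And>v. s < v \<Longrightarrow> v < s + \<delta> \<Longrightarrow> v \<le> b \<Longrightarrow> f v - f s \<le> \<epsilon> * (v - s)"
      using right[OF sab(1) sb \<epsilon>] by blast
    define u where "u = min b (s + \<delta> / 2)"
    have u: "s < u" "u < s + \<delta>" "u \<le> b" using \<delta> sb by (auto simp: u_def)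
    have "f v - f a \<le> \<epsilon> * (v - a)" if "a \<le> v" "v \<le> u" for v
    proof (cases "v \<le> s")
      case True then show ?thesis using sS that by (auto simp: S_def)
    next
      case False
      then have "f v - f s \<le> \<epsilon> * (v - s)" using \<delta>(2)[of v] that u by auto
      then show ?thesis using at_s by (simp add: algebra_simps)
    qed
    then have "u \<in> S" using u sab unfolding S_def by auto
    then have "u \<le> s" unfolding s_def by (rule cSup_upper[OF _ bdd])
    then show False using u by simp
  qed
  then have "f b - f a \<le> \<epsilon> * (b - a)" using at_s by simp
  also have "\<epsilon> * (b - a) \<le> e" using e ab by (simp add: \<epsilon>_def field_simps)
  finally show "f b \<le> f a + e" by simp
qed

text \<open>\<open>f t * exp (L * t)\<close> is nondecreasing. The hypothesis is the one-sided bound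
  \<open>- L * f t \<le> D\<close> instead of a quotient, so that it makes sense at zeros of
  \<open>f\<close>.\<close>

lemma log_derivative_lower:
  fixes f :: "real \<Rightarrow> real"
  assumes su: "s \<le> u" and sub: "{s..} \<subseteq> A" and L: "0 \<le> L" and fs: "0 \<le> f s"
    and der: "\<And>t. s \<le> t \<Longrightarrow> \<exists>D. (f has_real_derivative D) (at t within A) \<and> - L * f t \<le> D"
  shows "(1 - L * (u - s)) * f s \<le> f u"
proof -
  let ?g = "\<lambda>t. f t * exp (L * (t - s))"
  have "?g s \<le> ?g u"
  proof (rule DERIV_nonneg_imp_increasing_open[OF su])
    fix t assume t: "s < t" "t < u"
    obtain D where D: "(f has_real_derivative D) (at t within A)" "- L * f t \<le> D"
      using der[of t] t by auto
    have "(f has_real_derivative D) (at t within {s<..})"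
      by (rule DERIV_subset[OF D(1)]) (use sub in auto)
    then have fd: "(f has_real_derivative D) (at t)"
      by (subst (asm) at_within_open) (use t in auto)
    have "(?g has_real_derivative (D * exp (L * (t - s)) + f t * (exp (L * (t - s)) * L))) (at t)"
      by (auto intro!: derivative_eq_intros fd)
    moreover have "0 \<le> D * exp (L * (t - s)) + f t * (exp (L * (t - s)) * L)"
    proof -
      have "0 \<le> (D + L * f t) * exp (L * (t - s))" using D(2) by simp
      then show ?thesis by (simp add: algebra_simps)
    qed
    ultimately show "\<exists>y. (?g has_real_derivative y) (at t) \<and> 0 \<le> y" by blast
  next
    have "continuous_on {s..u} f"
    proof -
      have "continuous (at t within {s..}) f" if "s \<le> t" for t
        using der[OF that] DERIV_subset[OF _ sub] DERIV_continuous by blast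
      then have "continuous_on {s..} f" by (auto simp: continuous_on_eq_continuous_within)
      then show "continuous_on {s..u} f" by (rule continuous_on_subset) auto
    qed
    then show "continuous_on {s..u} ?g" by (intro continuous_intros)
  qed
  then have 1: "f s \<le> f u * exp (L * (u - s))" by simp
  have e: "1 - L * (u - s) \<le> exp (- (L * (u - s)))" using exp_ge_add_one_self[of "- (L * (u - s))"] by simp
  have "(1 - L * (u - s)) * f s \<le> exp (- (L * (u - s))) * f s" by (rule mult_right_mono[OF e fs])
  also have "\<dots> \<le> exp (- (L * (u - s))) * (f u * exp (L * (u - s)))"
    by (rule mult_left_mono[OF 1]) simp
  also have "\<dots> = f u" by (simp add: exp_minus)
  finally show ?thesis .
qed

section \<open>Counts and integrals over half-open intervals, and the natural filtration\<close>

locale bounded_hawkes = hawkes_process M n E \<mu> \<phi> w +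
  A: hawkes_assumptions n \<mu> \<phi> w \<mu>_min \<mu>_max \<Phi> \<eta> L w_min w_max w_sep d
  for M :: "'a measure" and n E \<mu> \<phi> w \<mu>_min \<mu>_max \<Phi> \<eta> L w_min w_max w_sep d +
  assumes n_pos: "1 \<le> n"
    and const_pos: "0 < \<mu>_min" "0 < \<mu>_max" "0 < \<Phi>" "0 < \<eta>" "0 < L" "0 < w_min" "0 < w_max" "0 < w_sep"
begin

abbreviation \<F> :: "real \<Rightarrow> 'a measure" where
  "\<F> t \<equiv> natural_filtration M n E t"

abbreviation rt :: "nat \<Rightarrow> real \<Rightarrow> 'a \<Rightarrow> real" where
  "rt \<equiv> hawkes_rate n E \<mu> \<phi> w"

text \<open>Open on the left, so that consecutive intervals tile the axis and an event at a common
  endpoint belongs to the earlier one, in agreement with \<open>event_count\<close>. An event at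
  time 0 lies in no such interval and is carried separately.\<close>

definition evs :: "nat \<Rightarrow> real \<Rightarrow> real \<Rightarrow> 'a \<Rightarrow> real set" where
  "evs i s t \<omega> = E i \<omega> \<inter> {s<..t}"

definition cnt :: "nat \<Rightarrow> real \<Rightarrow> real \<Rightarrow> 'a \<Rightarrow> nat" where
  "cnt i s t \<omega> = card (evs i s t \<omega>)"

definition isum :: "(real \<Rightarrow> real) \<Rightarrow> nat \<Rightarrow> real \<Rightarrow> real \<Rightarrow> 'a \<Rightarrow> real" where
  "isum f i s t \<omega> = (\<Sum>x\<in>evs i s t \<omega>. f x)"

lemma finite_evs: "i \<in> {1..n} \<Longrightarrow> \<omega> \<in> space M \<Longrightarrow> 0 \<le> s \<Longrightarrow> finite (evs i s t \<omega>)"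
  by (rule finite_subset[OF _ locally_finite[of i \<omega> t]]) (auto simp: evs_def)

lemma evs_split: "s \<le> u \<Longrightarrow> u \<le> t \<Longrightarrow> evs i s t \<omega> = evs i s u \<omega> \<union> evs i u t \<omega>"
  and evs_disjoint: "evs i s u \<omega> \<inter> evs i u t \<omega> = {}"
  by (auto simp: evs_def)

lemma isum_split:
  assumes "i \<in> {1..n}" "\<omega> \<in> space M" "0 \<le> s" "s \<le> u" "u \<le> t"
  shows "isum f i s t \<omega> = isum f i s u \<omega> + isum f i u t \<omega>"
  unfolding isum_def evs_split[OF assms(4,5)]
  by (rule sum.union_disjoint) (use assms finite_evs evs_disjoint in auto)

lemma cnt_split:
  assumes "i \<in> {1..n}" "\<omega> \<in> space M" "0 \<le> s" "s \<le> u" "u \<le> t"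
  shows "cnt i s t \<omega> = cnt i s u \<omega> + cnt i u t \<omega>"
  unfolding cnt_def evs_split[OF assms(4,5)]
  by (rule card_Un_disjoint) (use assms finite_evs evs_disjoint in auto)

lemma cnt_mono:
  assumes "i \<in> {1..n}" "\<omega> \<in> space M" "0 \<le> s'" "s' \<le> s" "t \<le> t'"
  shows "cnt i s t \<omega> \<le> cnt i s' t' \<omega>"
  unfolding cnt_def by (rule card_mono) (use assms finite_evs in \<open>auto simp: evs_def\<close>)

lemma isum_one: "isum (\<lambda>_. 1) i s t \<omega> = real (cnt i s t \<omega>)"
  by (simp add: isum_def cnt_def)

lemma isum_nonneg: "(\<And>x. s < x \<Longrightarrow> x \<le> t \<Longrightarrow> 0 \<le> f x) \<Longrightarrow> 0 \<le> isum f i s t \<omega>"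
  unfolding isum_def evs_def by (rule sum_nonneg) auto

lemma isum_mono: "(\<And>x. s < x \<Longrightarrow> x \<le> t \<Longrightarrow> f x \<le> g x) \<Longrightarrow> isum f i s t \<omega> \<le> isum g i s t \<omega>"
  unfolding isum_def evs_def by (rule sum_mono) auto

lemma isum_le: "(\<And>x. s < x \<Longrightarrow> x \<le> t \<Longrightarrow> f x \<le> C) \<Longrightarrow> isum f i s t \<omega> \<le> C * real (cnt i s t \<omega>)"
  using isum_mono[of s t f "\<lambda>_. C" i \<omega>] by (simp add: isum_def cnt_def mult.commute)

lemma isum_ge: "(\<And>x. s < x \<Longrightarrow> x \<le> t \<Longrightarrow> C \<le> f x) \<Longrightarrow> C * real (cnt i s t \<omega>) \<le> isum f i s t \<omega>"
  using isum_mono[of s t "\<lambda>_. C" f i \<omega>] by (simp add: isum_def cnt_def mult.commute)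

lemma event_count_split:
  assumes "i \<in> {1..n}" "\<omega> \<in> space M" "0 \<le> s" "s \<le> t"
  shows "event_count E i t \<omega> = event_count E i s \<omega> + cnt i s t \<omega>"
proof -
  have "E i \<omega> \<inter> {0..t} = (E i \<omega> \<inter> {0..s}) \<union> evs i s t \<omega>" using assms by (auto simp: evs_def)
  then show ?thesis unfolding event_count_def cnt_def
    by (simp only:) (rule card_Un_disjoint; use assms finite_evs locally_finite in \<open>auto simp: evs_def\<close>)
qed

lemma cnt_le_event_count:
  assumes "i \<in> {1..n}" "\<omega> \<in> space M" "0 \<le> s"
  shows "cnt i s t \<omega> \<le> event_count E i t \<omega>"
  unfolding cnt_def event_count_def
  by (rule card_mono[OF locally_finite]) (use assms in \<open>auto simp: evs_def\<close>)

lemma observed_path_space: "observed_path n E t \<in> space M \<rightarrow> space (path_space n t)"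
  unfolding observed_path_def path_space_def space_PiM by auto

lemma space_filtration [simp]: "space (\<F> t) = space M"
  by (simp add: natural_filtration_def)

lemma event_count_filtration:
  assumes "i \<in> {1..n}" "0 \<le> s" "s \<le> t"
  shows "event_count E i s \<in> measurable (\<F> t) (count_space UNIV)"
proof -
  have 1: "observed_path n E t \<in> measurable (\<F> t) (path_space n t)"
    unfolding natural_filtration_def by (rule measurable_vimage_algebra1[OF observed_path_space])
  have 2: "(\<lambda>p. p (i, s)) \<in> measurable (path_space n t) (count_space UNIV)"
    unfolding path_space_def by (rule measurable_component_singleton) (use assms in auto)
  have "(\<lambda>\<omega>. observed_path n E t \<omega> (i, s)) \<in> measurable (\<F> t) (count_space UNIV)"
    using measurable_compose[OF 1 2] .
  moreover have "(\<lambda>\<omega>. observed_path n E t \<omega> (i, s)) = event_count E i s"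
    unfolding observed_path_def using assms by auto
  ultimately show ?thesis by simp
qed

lemma observed_path_measurable:
  assumes sp: "space G = space M"
    and G: "\<And>i s. i \<in> {1..n} \<Longrightarrow> 0 \<le> s \<Longrightarrow> s \<le> t \<Longrightarrow> event_count E i s \<in> measurable G (count_space UNIV)"
  shows "observed_path n E t \<in> measurable G (path_space n t)"
  unfolding path_space_def observed_path_def
  by (rule measurable_restrict) (use G in auto)

text \<open>Minimality of the generated sigma-algebra. It yields both that the filtration lies in
  \<open>M\<close> and that it increases.\<close>

lemma filtration_least:
  assumes sp: "space G = space M"
    and G: "\<And>i s. i \<in> {1..n} \<Longrightarrow> 0 \<le> s \<Longrightarrow> s \<le> t \<Longrightarrow> event_count E i s \<in> measurable G (count_space UNIV)"
  shows "sets (\<F> t) \<subseteq> sets G"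
  using sets_image_in_sets[OF sp observed_path_measurable[OF assms]]
  by (simp add: natural_filtration_def)

lemma filtration_subalgebra: "subalgebra M (\<F> t)"
  unfolding subalgebra_def using filtration_least[of M t] measurable_count by auto

lemma filtration_mono: "s \<le> t \<Longrightarrow> sets (\<F> s) \<subseteq> sets (\<F> t)"
  by (rule filtration_least) (auto intro: event_count_filtration)

lemma measurable_filtration_mono: "s \<le> t \<Longrightarrow> X \<in> measurable (\<F> s) G \<Longrightarrow> X \<in> measurable (\<F> t) G"
  using filtration_mono[of s t] unfolding measurable_def by auto

lemma weight_filtration_mono:
  assumes "s \<le> t" "weight (\<F> s) Y" shows "weight (\<F> t) Y"
proof -
  have "Y \<in> borel_measurable (\<F> t)"
    by (rule measurable_filtration_mono[OF assms(1) bdd_rv_measurable[OF weight_bdd[OF assms(2)]]])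
  then show ?thesis using assms(2) unfolding weight_def bdd_rv_def space_filtration by blast
qed

lemma bdd_rv_filtration_M: "bdd_rv (\<F> t) Y \<Longrightarrow> bdd_rv M Y"
  using bdd_rv_subalgebra[OF filtration_subalgebra] .

lemma weight_filtration_M:
  assumes "weight (\<F> t) Y" shows "weight M Y"
  using bdd_rv_filtration_M[OF weight_bdd[OF assms]] weight_ge_0[OF assms] by (simp add: weight_def)

lemma cnt_filtration:
  assumes "i \<in> {1..n}" "0 \<le> s" "s \<le> u" "u \<le> t"
  shows "cnt i s u \<in> measurable (\<F> t) (count_space UNIV)"
proof -
  have [measurable]: "event_count E i s \<in> measurable (\<F> t) (count_space UNIV)"
    by (rule event_count_filtration[OF assms(1,2)]) (use assms in simp)
  have [measurable]: "event_count E i u \<in> measurable (\<F> t) (count_space UNIV)"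
    by (rule event_count_filtration[OF assms(1) _ assms(4)]) (use assms in simp)
  have "(\<lambda>\<omega>. event_count E i u \<omega> - event_count E i s \<omega>) \<in> measurable (\<F> t) (count_space UNIV)"
    by measurable
  moreover have "event_count E i u \<omega> - event_count E i s \<omega> = cnt i s u \<omega>" if "\<omega> \<in> space (\<F> t)" for \<omega>
    using event_count_split[of i \<omega> s u] assms that by simp
  ultimately show ?thesis by (rule measurable_cong[THEN iffD1, rotated])
qed

lemma real_cnt_filtration:
  assumes "i \<in> {1..n}" "0 \<le> s" "s \<le> u" "u \<le> t"
  shows "(\<lambda>\<omega>. real (cnt i s u \<omega>)) \<in> borel_measurable (\<F> t)"
  using measurable_compose[OF cnt_filtration[OF assms], of real borel] by simp

section \<open>Riemann sums along uniform grids\<close>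

definition grid :: "real \<Rightarrow> real \<Rightarrow> nat \<Rightarrow> nat \<Rightarrow> real" where
  "grid s t m p = s + (t - s) * real p / real m"

lemma grid_bounds:
  assumes "s \<le> t" "p \<le> m"
  shows "s \<le> grid s t m p" "grid s t m p \<le> t"
proof -
  show "s \<le> grid s t m p" unfolding grid_def using assms by simp
  have "real p / real m \<le> 1" using assms by (cases "m = 0") (auto simp: divide_le_eq)
  then have "(t - s) * (real p / real m) \<le> (t - s) * 1" using assms by (intro mult_left_mono) auto
  then show "grid s t m p \<le> t" unfolding grid_def by simp
qed

lemma grid_mono: "s \<le> t \<Longrightarrow> p \<le> p' \<Longrightarrow> grid s t m p \<le> grid s t m p'"
  unfolding grid_def by (intro add_left_mono divide_right_mono mult_left_mono) auto

lemma grid_0 [simp]: "grid s t m 0 = s" and grid_m: "0 < m \<Longrightarrow> grid s t m m = t"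
  by (auto simp: grid_def)

lemma grid_step: "grid s t m (Suc p) - grid s t m p = (t - s) / real m"
  by (simp add: grid_def add_divide_distrib[symmetric] diff_divide_distrib[symmetric] algebra_simps)

lemma isum_grid:
  assumes "i \<in> {1..n}" "\<omega> \<in> space M" "0 \<le> s" "s \<le> t" "k \<le> m"
  shows "isum f i s (grid s t m k) \<omega> = (\<Sum>p<k. isum f i (grid s t m p) (grid s t m (Suc p)) \<omega>)"
  using assms(5)
proof (induction k)
  case 0 then show ?case by (simp add: isum_def evs_def)
next
  case (Suc k)
  have "isum f i s (grid s t m (Suc k)) \<omega> = isum f i s (grid s t m k) \<omega> + isum f i (grid s t m k) (grid s t m (Suc k)) \<omega>"
    by (rule isum_split) (use assms Suc.prems grid_bounds grid_mono in auto)
  then show ?case using Suc by simp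
qed

lemma uniform_grid:
  fixes f :: "real \<Rightarrow> real"
  assumes "continuous_on {s..t} f" "s \<le> t" "0 < \<epsilon>"
  shows "\<exists>m0>0. \<forall>m\<ge>m0. \<forall>p<m. \<forall>x\<in>{grid s t m p..grid s t m (Suc p)}. \<bar>f x - f (grid s t m p)\<bar> \<le> \<epsilon>"
proof -
  have "uniformly_continuous_on {s..t} f" using compact_uniformly_continuous[OF assms(1)] by simp
  then obtain \<delta> where \<delta>: "0 < \<delta>" "\<And>x y. x \<in> {s..t} \<Longrightarrow> y \<in> {s..t} \<Longrightarrow> dist y x < \<delta> \<Longrightarrow> dist (f y) (f x) < \<epsilon>"
    unfolding uniformly_continuous_on_def using assms(3) by metis
  obtain m0 :: nat where m0: "(t - s) / \<delta> < real m0" using reals_Archimedean2 by blast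
  show ?thesis
  proof (intro exI[of _ "Suc m0"] conjI allI impI ballI)
    fix m p x assume m: "Suc m0 \<le> m" and p: "p < m" and x: "x \<in> {grid s t m p..grid s t m (Suc p)}"
    have "(t - s) / \<delta> < real m" using m m0 by linarith
    then have "(t - s) / real m < \<delta>" using \<delta> m by (simp add: field_simps)
    then have "\<bar>x - grid s t m p\<bar> < \<delta>" using x grid_step[of s t m p] by auto
    moreover have "x \<in> {s..t}" "grid s t m p \<in> {s..t}"
      using x grid_bounds[OF assms(2), of p m] grid_bounds[OF assms(2), of "Suc p" m] p by auto
    ultimately have "dist (f x) (f (grid s t m p)) < \<epsilon>" by (intro \<delta>(2)) (auto simp: dist_real_def)
    then show "\<bar>f x - f (grid s t m p)\<bar> \<le> \<epsilon>" by (simp add: dist_real_def)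
  qed simp
qed

text \<open>The filtration is generated by counts at fixed times, not by event times. For a
  continuous integrand the sum over event times is the pointwise limit of Riemann sums built from
  counts.\<close>

lemma isum_filtration:
  assumes i: "i \<in> {1..n}" and st: "0 \<le> s" "s \<le> t" and f: "continuous_on {s..t} f"
  shows "isum f i s t \<in> borel_measurable (\<F> t)"
proof -
  define R where "R = (\<lambda>m \<omega>. \<Sum>p<m. f (grid s t m p) * real (cnt i (grid s t m p) (grid s t m (Suc p)) \<omega>))"
  have gb: "0 \<le> grid s t m p" "grid s t m p \<le> t" if "p \<le> m" for m p
    using grid_bounds[OF st(2) that] st by auto
  have Rm: "R m \<in> borel_measurable (\<F> t)" for m
    unfolding R_def
    by (intro borel_measurable_sum borel_measurable_times borel_measurable_const real_cnt_filtration i)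
      (use gb grid_mono[OF st(2)] in auto)
  show ?thesis
  proof (rule borel_measurable_LIMSEQ_real[OF _ Rm])
    fix \<omega> assume "\<omega> \<in> space (\<F> t)"
    then have om: "\<omega> \<in> space M" by simp
    show "(\<lambda>m. R m \<omega>) \<longlonglongrightarrow> isum f i s t \<omega>"
    proof (rule LIMSEQ_I)
      fix r :: real assume r: "0 < r"
      \<comment> \<open>The Riemann sum errs by at most \<open>\<epsilon>\<close> per event; the
        added 1 covers paths without events.\<close>
      define \<epsilon> where "\<epsilon> = r / 2 / (real (cnt i s t \<omega>) + 1)"
      have \<epsilon>: "0 < \<epsilon>" using r by (simp add: \<epsilon>_def)
      obtain m0 where m0: "0 < m0" "\<And>m p x. m0 \<le> m \<Longrightarrow> p < m \<Longrightarrow> x \<in> {grid s t m p..grid s t m (Suc p)} \<Longrightarrow> \<bar>f x - f (grid s t m p)\<bar> \<le> \<epsilon>"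
        using uniform_grid[OF f st(2) \<epsilon>] by blast
      have "norm (R m \<omega> - isum f i s t \<omega>) < r" if m: "m0 \<le> m" for m
      proof -
        have mp: "0 < m" using m m0 by simp
        let ?c = "\<lambda>p. real (cnt i (grid s t m p) (grid s t m (Suc p)) \<omega>)"
        have I: "isum f i s t \<omega> = (\<Sum>p<m. isum f i (grid s t m p) (grid s t m (Suc p)) \<omega>)" for f
          using isum_grid[OF i om st order_refl, of f m] grid_m[OF mp, of s t] by simp
        have "\<bar>f (grid s t m p) * ?c p - isum f i (grid s t m p) (grid s t m (Suc p)) \<omega>\<bar> \<le> \<epsilon> * ?c p" if "p < m" for p
        proof -
          have x: "f (grid s t m p) - \<epsilon> \<le> f x \<and> f x \<le> f (grid s t m p) + \<epsilon>" if "grid s t m p < x" "x \<le> grid s t m (Suc p)" for x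
            using m0(2)[OF m \<open>p < m\<close>, of x] that by (auto simp: abs_le_iff)
          have "isum f i (grid s t m p) (grid s t m (Suc p)) \<omega> \<le> (f (grid s t m p) + \<epsilon>) * ?c p"
            by (rule isum_le) (use x in auto)
          moreover have "(f (grid s t m p) - \<epsilon>) * ?c p \<le> isum f i (grid s t m p) (grid s t m (Suc p)) \<omega>"
            by (rule isum_ge) (use x in auto)
          ultimately show ?thesis by (simp add: abs_le_iff algebra_simps)
        qed
        then have "\<bar>R m \<omega> - isum f i s t \<omega>\<bar> \<le> (\<Sum>p<m. \<epsilon> * ?c p)"
          unfolding R_def I sum_subtractf[symmetric] by (intro order_trans[OF sum_abs] sum_mono) auto
        also have "\<dots> = \<epsilon> * real (cnt i s t \<omega>)"
          using I[of "\<lambda>_. 1"] unfolding isum_one by (simp add: sum_distrib_left)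
        also have "\<dots> < r"
        proof -
          have "\<epsilon> * real (cnt i s t \<omega>) \<le> \<epsilon> * (real (cnt i s t \<omega>) + 1)" using \<epsilon> by simp
          also have "\<dots> = r / 2"
            unfolding \<epsilon>_def by (rule nonzero_eq_divide_eq[THEN iffD1, symmetric, OF _ refl, THEN sym]) linarith
          finally show ?thesis using r by simp
        qed
        finally show ?thesis by simp
      qed
      then show "\<exists>no. \<forall>m\<ge>no. norm (R m \<omega> - isum f i s t \<omega>) < r" by blast
    qed
  qed
qed

section \<open>Pathwise control of the rates\<close>

lemma kernel_le_1:
  assumes "i \<in> {1..n}" "j \<in> {1..n}" "0 \<le> s" "s \<le> t"
  shows "\<phi> i j t s \<le> 1"
  using A.kernel_decreasing[OF assms(1-3)] A.kernel_diagonal[OF assms(1-3)] assms(4)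
  unfolding monotone_on_def by fastforce

lemma kernel_antimono:
  assumes "i \<in> {1..n}" "j \<in> {1..n}" "0 \<le> s" "s \<le> t" "t \<le> u"
  shows "\<phi> i j u s \<le> \<phi> i j t s"
  using A.kernel_decreasing[OF assms(1-3)] assms(4,5) unfolding monotone_on_def by auto

lemma kernel_section_continuous:
  assumes "i \<in> {1..n}" "j \<in> {1..n}" "0 \<le> s"
  shows "continuous_on {s..t} (\<phi> i j t)"
proof -
  have "continuous_on {s..t} (\<lambda>x. (\<lambda>(t, s). \<phi> i j t s) (t, x))"
    by (rule continuous_on_compose2[OF A.kernel_continuous[OF assms(1,2)]])
      (use assms in \<open>auto intro!: continuous_intros\<close>)
  then show ?thesis by simp
qed

lemma kernel_lower:
  assumes i: "i \<in> {1..n}" "j \<in> {1..n}" and x: "0 \<le> x" "x \<le> s" "s \<le> u"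
  shows "(1 - L * (u - s)) * \<phi> i j s x \<le> \<phi> i j u x"
proof (rule log_derivative_lower[OF x(3), of "{x..}" L "\<lambda>u. \<phi> i j u x"])
  show "{s..} \<subseteq> {x..}" using x by auto
  show "0 \<le> L" using const_pos by simp
  show "0 \<le> \<phi> i j s x" using A.kernel_nonneg i x by auto
  fix t assume t: "s \<le> t"
  obtain D where D: "((\<lambda>u. \<phi> i j u x) has_real_derivative D) (at t within {x..})" "\<bar>D\<bar> / \<phi> i j t x \<le> L"
    using A.kernel_log_derivative[OF i x(1), of t] x t by auto
  have p: "0 \<le> \<phi> i j t x" using A.kernel_nonneg[OF i x(1), of t] x t by simp
  have "- L * \<phi> i j t x \<le> D"
  proof (cases "\<phi> i j t x = 0")
    case True
    \<comment> \<open>At a zero of the kernel the quotient is 0 by convention, so the log-derivative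
      bound says nothing about \<open>D\<close>. A negative derivative there would push the kernel
      below 0.\<close>
    have "\<not> D < 0"
    proof
      assume "D < 0"
      then obtain r where r: "r > 0" "\<And>h. 0 < h \<Longrightarrow> t + h \<in> {x..} \<Longrightarrow> h < r \<Longrightarrow> \<phi> i j (t + h) x < \<phi> i j t x"
        using has_real_derivative_neg_dec_right[OF D(1)] by blast
      have "\<phi> i j (t + r / 2) x < 0" using r(2)[of "r / 2"] r(1) x t True by simp
      moreover have "0 \<le> \<phi> i j (t + r / 2) x" by (rule A.kernel_nonneg[OF i x(1)]) (use x t r in simp)
      ultimately show False by simp
    qed
    then show ?thesis using True by simp
  next
    case False
    then have "\<bar>D\<bar> \<le> L * \<phi> i j t x" using D(2) p by (simp add: divide_le_eq)
    then show ?thesis by linarith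
  qed
  then show "\<exists>D. ((\<lambda>u. \<phi> i j u x) has_real_derivative D) (at t within {x..}) \<and> - L * \<phi> i j t x \<le> D"
    using D by blast
qed

lemma baseline_lower:
  assumes i: "i \<in> {1..n}" and s: "0 \<le> s" "s \<le> u"
  shows "(1 - L * (u - s)) * \<mu> i s \<le> \<mu> i u"
proof (rule log_derivative_lower[OF s(2), of "{0..}"])
  show "{s..} \<subseteq> {0..}" using s by auto
  show "0 \<le> L" using const_pos by simp
  show "0 \<le> \<mu> i s" using baseline_nonneg i s by auto
  fix t assume t: "s \<le> t"
  have "0 < \<mu> i t" using A.baseline_bounds[OF i, of t] const_pos s t by auto
  then show "\<exists>D. (\<mu> i has_real_derivative D) (at t within {0..}) \<and> - L * \<mu> i t \<le> D"
    using A.baseline_log_derivative[OF i, of t] s t by (force simp: divide_le_eq)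
qed

lemma baseline_upper:
  assumes i: "i \<in> {1..n}" and s: "0 \<le> s" "s \<le> u"
  shows "\<mu> i u \<le> \<mu> i s + L * \<mu>_max * (u - s)"
proof -
  have pos: "0 < \<mu> i t \<and> \<mu> i t \<le> \<mu>_max" if "0 \<le> t" for t
    using A.baseline_bounds[OF i that] const_pos by linarith
  have d: "\<exists>D. (\<mu> i has_real_derivative D) (at t within {0..}) \<and> D \<le> L * \<mu>_max" if t: "0 \<le> t" for t
  proof -
    obtain D where D: "(\<mu> i has_real_derivative D) (at t within {0..})" "\<bar>D\<bar> / \<mu> i t \<le> L"
      using A.baseline_log_derivative[OF i t] by blast
    have "\<bar>D\<bar> \<le> L * \<mu> i t" using D(2) pos[OF t] by (simp add: divide_le_eq)
    also have "\<dots> \<le> L * \<mu>_max" using pos[OF t] const_pos by (intro mult_left_mono) auto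
    finally show ?thesis using D(1) by auto
  qed
  have "(L * \<mu>_max * s - \<mu> i s) \<le> (L * \<mu>_max * u - \<mu> i u)"
  proof (rule DERIV_nonneg_imp_increasing_open[OF s(2), of "\<lambda>t. L * \<mu>_max * t - \<mu> i t"])
    fix t assume t: "s < t" "t < u"
    obtain D where D: "(\<mu> i has_real_derivative D) (at t within {0..})" "D \<le> L * \<mu>_max"
      using d[of t] t s by auto
    have "(\<mu> i has_real_derivative D) (at t within {0<..})"
      by (rule DERIV_subset[OF D(1)]) auto
    then have "(\<mu> i has_real_derivative D) (at t)"
      by (subst (asm) at_within_open) (use t s in auto)
    then have "((\<lambda>t. L * \<mu>_max * t - \<mu> i t) has_real_derivative (L * \<mu>_max - D)) (at t)"
      by (auto intro!: derivative_eq_intros)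
    then show "\<exists>y. ((\<lambda>t. L * \<mu>_max * t - \<mu> i t) has_real_derivative y) (at t) \<and> 0 \<le> y" using D(2) by force
  next
    have "continuous (at t within {0..}) (\<mu> i)" if "0 \<le> t" for t
      using d[OF that] DERIV_continuous by blast
    then have "continuous_on {0..} (\<mu> i)" by (auto simp: continuous_on_eq_continuous_within)
    then have "continuous_on {s..u} (\<mu> i)" by (rule continuous_on_subset) (use s in auto)
    then show "continuous_on {s..u} (\<lambda>t. L * \<mu>_max * t - \<mu> i t)" by (intro continuous_intros)
  qed
  then show ?thesis by (simp add: algebra_simps)
qed

lemma weight_range: "i \<in> {1..n} \<Longrightarrow> j \<in> {1..n} \<Longrightarrow> 0 \<le> w i j \<and> w i j \<le> w_max"
  using A.weight_bounds[of i j] const_pos by auto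

text \<open>Splits off a possible event at time 0, which the half-open intervals miss.\<close>

lemma rt_eq:
  assumes om: "\<omega> \<in> space M" and t: "0 \<le> t"
  shows "rt i t \<omega> = \<mu> i t + (\<Sum>j=1..n. w i j * (\<phi> i j t 0 * real (event_count E j 0 \<omega>) + isum (\<phi> i j t) j 0 t \<omega>))"
proof -
  have key: "(\<Sum>s\<in>E j \<omega> \<inter> {0..t}. \<phi> i j t s) = \<phi> i j t 0 * real (event_count E j 0 \<omega>) + isum (\<phi> i j t) j 0 t \<omega>"
    if j: "j \<in> {1..n}" for j
  proof -
    have eq: "E j \<omega> \<inter> {0..t} = (E j \<omega> \<inter> {0..0}) \<union> evs j 0 t \<omega>" using t by (auto simp: evs_def)
    have "(\<Sum>s\<in>E j \<omega> \<inter> {0..t}. \<phi> i j t s) = (\<Sum>s\<in>E j \<omega> \<inter> {0..0}. \<phi> i j t s) + isum (\<phi> i j t) j 0 t \<omega>"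
      unfolding eq isum_def
      by (rule sum.union_disjoint) (use locally_finite[OF j om] finite_evs[OF j om] in \<open>auto simp: evs_def\<close>)
    moreover have "(\<Sum>s\<in>E j \<omega> \<inter> {0..0}. \<phi> i j t s) = \<phi> i j t 0 * real (card (E j \<omega> \<inter> {0..0}))"
    proof -
      have "(\<Sum>s\<in>E j \<omega> \<inter> {0..0}. \<phi> i j t s) = (\<Sum>s\<in>E j \<omega> \<inter> {0..0}. \<phi> i j t 0)"
        by (rule sum.cong) auto
      then show ?thesis by (simp only: sum_constant mult.commute)
    qed
    ultimately show ?thesis unfolding event_count_def by linarith
  qed
  have "(\<Sum>j=1..n. w i j * (\<Sum>s\<in>E j \<omega> \<inter> {0..t}. \<phi> i j t s))
      = (\<Sum>j=1..n. w i j * (\<phi> i j t 0 * real (event_count E j 0 \<omega>) + isum (\<phi> i j t) j 0 t \<omega>))"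
    by (rule sum.cong[OF refl]) (simp only: key)
  then show ?thesis by (simp only: hawkes_rate_def)
qed

lemma rt_filtration:
  assumes i: "i \<in> {1..n}" and t: "0 \<le> t"
  shows "rt i t \<in> borel_measurable (\<F> t)"
proof -
  have ec: "(\<lambda>\<omega>. real (event_count E j 0 \<omega>)) \<in> borel_measurable (\<F> t)" if j: "j \<in> {1..n}" for j
    using measurable_compose[OF event_count_filtration[OF j order_refl t], of real borel] by simp
  have "(\<lambda>\<omega>. \<mu> i t + (\<Sum>j=1..n. w i j * (\<phi> i j t 0 * real (event_count E j 0 \<omega>) + isum (\<phi> i j t) j 0 t \<omega>)))
      \<in> borel_measurable (\<F> t)"
    by (intro borel_measurable_add borel_measurable_const borel_measurable_sum borel_measurable_times ec
        isum_filtration kernel_section_continuous i order_refl t)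
  then show ?thesis
    by (rule measurable_cong[THEN iffD2, rotated]) (use rt_eq t in auto)
qed

lemma rt_ge: "i \<in> {1..n} \<Longrightarrow> \<omega> \<in> space M \<Longrightarrow> 0 \<le> t \<Longrightarrow> \<mu>_min \<le> rt i t \<omega>"
proof -
  assume i: "i \<in> {1..n}" and om: "\<omega> \<in> space M" and t: "0 \<le> t"
  have "0 \<le> (\<Sum>j=1..n. w i j * (\<Sum>s\<in>E j \<omega> \<inter> {0..t}. \<phi> i j t s))"
    by (intro sum_nonneg mult_nonneg_nonneg A.kernel_nonneg) (use weight_range i in auto)
  then show ?thesis using A.baseline_bounds[OF i t] unfolding hawkes_rate_def by linarith
qed

lemma rt_nonneg: "i \<in> {1..n} \<Longrightarrow> \<omega> \<in> space M \<Longrightarrow> 0 \<le> t \<Longrightarrow> 0 \<le> rt i t \<omega>"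
  using rt_ge[of i \<omega> t] const_pos by linarith

lemma rt_le:
  assumes i: "i \<in> {1..n}" and om: "\<omega> \<in> space M" and t: "0 \<le> t"
  shows "rt i t \<omega> \<le> \<mu>_max + (\<Sum>j=1..n. w i j * real (event_count E j t \<omega>))"
  unfolding hawkes_rate_def
proof (intro add_mono sum_mono mult_left_mono)
  show "\<mu> i t \<le> \<mu>_max" using A.baseline_bounds[OF i t] by simp
  fix j assume j: "j \<in> {1..n}"
  have "(\<Sum>s\<in>E j \<omega> \<inter> {0..t}. \<phi> i j t s) \<le> (\<Sum>s\<in>E j \<omega> \<inter> {0..t}. 1)"
    by (intro sum_mono kernel_le_1) (use i j in auto)
  then show "(\<Sum>s\<in>E j \<omega> \<inter> {0..t}. \<phi> i j t s) \<le> real (event_count E j t \<omega>)"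
    by (simp add: event_count_def)
  show "0 \<le> w i j" using weight_range[OF i j] by simp
qed

text \<open>Old excitation only decays, and a new event adds at most its weight because kernels are
  at most 1. The baseline alone can grow by itself, at speed at most
  \<open>L * \<mu>_max\<close>.\<close>

lemma rt_upper:
  assumes k: "k \<in> {1..n}" and om: "\<omega> \<in> space M" and s: "0 \<le> s" "s \<le> u"
  shows "rt k u \<omega> \<le> rt k s \<omega> + L * \<mu>_max * (u - s) + (\<Sum>j=1..n. w k j * real (cnt j s u \<omega>))"
proof -
  have u: "0 \<le> u" using s by simp
  have "isum (\<phi> k j u) j 0 u \<omega> \<le> isum (\<phi> k j s) j 0 s \<omega> + real (cnt j s u \<omega>)" if j: "j \<in> {1..n}" for j
  proof -
    have "isum (\<phi> k j u) j 0 u \<omega> = isum (\<phi> k j u) j 0 s \<omega> + isum (\<phi> k j u) j s u \<omega>"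
      by (rule isum_split[OF j om order_refl s])
    moreover have "isum (\<phi> k j u) j 0 s \<omega> \<le> isum (\<phi> k j s) j 0 s \<omega>"
      by (rule isum_mono) (use kernel_antimono k j s in auto)
    moreover have "isum (\<phi> k j u) j s u \<omega> \<le> 1 * real (cnt j s u \<omega>)"
      by (rule isum_le) (use kernel_le_1 k j s in auto)
    ultimately show ?thesis by linarith
  qed
  then have "(\<Sum>j=1..n. w k j * (\<phi> k j u 0 * real (event_count E j 0 \<omega>) + isum (\<phi> k j u) j 0 u \<omega>))
     \<le> (\<Sum>j=1..n. w k j * ((\<phi> k j s 0 * real (event_count E j 0 \<omega>) + isum (\<phi> k j s) j 0 s \<omega>) + real (cnt j s u \<omega>)))"
    unfolding add.assoc
    by (intro sum_mono mult_left_mono add_mono mult_right_mono kernel_antimono) (use weight_range k s in auto)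
  also have "\<dots> = (\<Sum>j=1..n. w k j * (\<phi> k j s 0 * real (event_count E j 0 \<omega>) + isum (\<phi> k j s) j 0 s \<omega>))
      + (\<Sum>j=1..n. w k j * real (cnt j s u \<omega>))"
    by (simp only: distrib_left sum.distrib)
  finally show ?thesis unfolding rt_eq[OF om u] rt_eq[OF om s(1)] using baseline_upper[OF k s] by linarith
qed

text \<open>Each summand keeps at least the fraction \<open>1 - L * (u - s)\<close>: baseline and
  old kernels by the log-derivative bounds, and a new event because its kernel starts at 1 and then
  obeys the same bound.\<close>

lemma rt_lower:
  assumes k: "k \<in> {1..n}" and om: "\<omega> \<in> space M" and s: "0 \<le> s" "s \<le> u" and Lu: "L * (u - s) \<le> 1"
  shows "(1 - L * (u - s)) * (rt k s \<omega> + (\<Sum>j=1..n. w k j * real (cnt j s u \<omega>))) \<le> rt k u \<omega>"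
proof -
  have u: "0 \<le> u" using s by simp
  let ?c = "1 - L * (u - s)"
  have c0: "0 \<le> ?c" using Lu by simp
  have "?c * (isum (\<phi> k j s) j 0 s \<omega> + real (cnt j s u \<omega>)) \<le> isum (\<phi> k j u) j 0 u \<omega>" if j: "j \<in> {1..n}" for j
  proof -
    have "isum (\<phi> k j u) j 0 u \<omega> = isum (\<phi> k j u) j 0 s \<omega> + isum (\<phi> k j u) j s u \<omega>"
      by (rule isum_split[OF j om order_refl s])
    moreover have "isum (\<lambda>x. ?c * \<phi> k j s x) j 0 s \<omega> \<le> isum (\<phi> k j u) j 0 s \<omega>"
      by (rule isum_mono) (use kernel_lower k j s in auto)
    moreover have "isum (\<lambda>x. ?c * \<phi> k j s x) j 0 s \<omega> = ?c * isum (\<phi> k j s) j 0 s \<omega>"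
      by (simp add: isum_def sum_distrib_left)
    moreover have "?c * real (cnt j s u \<omega>) \<le> isum (\<phi> k j u) j s u \<omega>"
    proof (rule isum_ge)
      fix x assume x: "s < x" "x \<le> u"
      have "L * (u - x) \<le> L * (u - s)" using x const_pos by (intro mult_left_mono) auto
      moreover have "(1 - L * (u - x)) * \<phi> k j x x \<le> \<phi> k j u x" by (rule kernel_lower[OF k j]) (use x s in auto)
      ultimately show "?c \<le> \<phi> k j u x" using A.kernel_diagonal[OF k j, of x] x s by simp
    qed
    ultimately show ?thesis by (simp add: distrib_left)
  qed
  then have "(\<Sum>j=1..n. w k j * (?c * (\<phi> k j s 0 * real (event_count E j 0 \<omega>)) + ?c * (isum (\<phi> k j s) j 0 s \<omega> + real (cnt j s u \<omega>))))
     \<le> (\<Sum>j=1..n. w k j * (\<phi> k j u 0 * real (event_count E j 0 \<omega>) + isum (\<phi> k j u) j 0 u \<omega>))"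
    unfolding mult.assoc[symmetric]
    by (intro sum_mono mult_left_mono add_mono mult_right_mono kernel_lower) (use weight_range k s in \<open>auto simp: mult.assoc\<close>)
  also have "(\<Sum>j=1..n. w k j * (?c * (\<phi> k j s 0 * real (event_count E j 0 \<omega>)) + ?c * (isum (\<phi> k j s) j 0 s \<omega> + real (cnt j s u \<omega>))))
     = ?c * ((\<Sum>j=1..n. w k j * (\<phi> k j s 0 * real (event_count E j 0 \<omega>) + isum (\<phi> k j s) j 0 s \<omega>))
         + (\<Sum>j=1..n. w k j * real (cnt j s u \<omega>)))"
    by (simp add: sum_distrib_left sum.distrib[symmetric] algebra_simps)
  finally show ?thesis unfolding rt_eq[OF om u] rt_eq[OF om s(1)] using baseline_lower[OF k s]
    by (simp add: algebra_simps)
qed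

section \<open>From the rate to bounds on expected counts\<close>

lemma count_integrable: "i \<in> {1..n} \<Longrightarrow> 0 \<le> t \<Longrightarrow> integrable M (\<lambda>\<omega>. real (event_count E i t \<omega>))"
  using rate[of i] unfolding has_rate_def by blast

lemma bdd_mult_integrable:
  assumes Y: "bdd_rv M Y" and X: "integrable M (X :: 'a \<Rightarrow> real)"
  shows "integrable M (\<lambda>\<omega>. Y \<omega> * X \<omega>)"
proof -
  obtain C where C: "\<And>\<omega>. \<omega> \<in> space M \<Longrightarrow> \<bar>Y \<omega>\<bar> \<le> C" using Y unfolding bdd_rv_def by blast
  have [measurable]: "Y \<in> borel_measurable M" "X \<in> borel_measurable M"
    using bdd_rv_measurable[OF Y] X by auto
  show ?thesis
  proof (rule Bochner_Integration.integrable_bound)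
    show "integrable M (\<lambda>\<omega>. C * X \<omega>)" using X by simp
    show "AE \<omega> in M. norm (Y \<omega> * X \<omega>) \<le> norm (C * X \<omega>)"
      using C by (intro AE_I2) (fastforce simp: abs_mult intro!: mult_right_mono)
  qed simp
qed

lemma cnt_integrable:
  assumes "i \<in> {1..n}" "0 \<le> s" "s \<le> t"
  shows "integrable M (\<lambda>\<omega>. real (cnt i s t \<omega>))"
proof (rule Bochner_Integration.integrable_bound[OF count_integrable[of i t]])
  show "(\<lambda>\<omega>. real (cnt i s t \<omega>)) \<in> borel_measurable M"
    by (rule measurable_from_subalg[OF filtration_subalgebra real_cnt_filtration[OF assms order_refl]])
  show "AE \<omega> in M. norm (real (cnt i s t \<omega>)) \<le> norm (real (event_count E i t \<omega>))"
    using cnt_le_event_count assms by (intro AE_I2) auto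
qed (use assms in auto)

lemma rt_integrable:
  assumes i: "i \<in> {1..n}" and t: "0 \<le> t"
  shows "integrable M (rt i t)"
proof (rule Bochner_Integration.integrable_bound)
  show "integrable M (\<lambda>\<omega>. \<mu>_max + (\<Sum>j=1..n. w i j * real (event_count E j t \<omega>)))"
    using count_integrable t
    by (intro Bochner_Integration.integrable_add Bochner_Integration.integrable_sum Bochner_Integration.integrable_mult_right) auto
  show "rt i t \<in> borel_measurable M"
    by (rule measurable_from_subalg[OF filtration_subalgebra rt_filtration[OF assms]])
  show "AE \<omega> in M. norm (rt i t \<omega>) \<le> norm (\<mu>_max + (\<Sum>j=1..n. w i j * real (event_count E j t \<omega>)))"
  proof (rule AE_I2)
    fix \<omega> assume om: "\<omega> \<in> space M"
    show "norm (rt i t \<omega>) \<le> norm (\<mu>_max + (\<Sum>j=1..n. w i j * real (event_count E j t \<omega>)))"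
      using rt_nonneg[OF i om t] rt_le[OF i om t] by simp
  qed
qed

text \<open>Testing the rate against a bounded variable of the past removes the conditional
  expectation: \<open>Y\<close> may be moved inside it, and convergence in mean is preserved with
  the bound of \<open>Y\<close> as a factor. All later estimates use the rate only through this
  statement.\<close>

lemma rate_deriv:
  assumes i: "i \<in> {1..n}" and t: "0 \<le> t" and Y: "bdd_rv (\<F> t) Y"
  shows "((\<lambda>\<epsilon>. expectation (\<lambda>\<omega>. Y \<omega> * real (cnt i t (t + \<epsilon>) \<omega>)) / \<epsilon>) \<longlongrightarrow> expectation (\<lambda>\<omega>. Y \<omega> * rt i t \<omega>)) (at_right 0)"
proof -
  interpret S: finite_measure_subalgebra M "\<F> t"
    by unfold_locales (rule filtration_subalgebra)
  let ?N = "\<lambda>u \<omega>. real (event_count E i u \<omega>)"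
  let ?r = "\<lambda>\<epsilon> \<omega>. (real_cond_exp M (\<F> t) (?N (t + \<epsilon>)) \<omega> - ?N t \<omega>) / \<epsilon> - rt i t \<omega>"
  have YM: "bdd_rv M Y" using bdd_rv_filtration_M[OF Y] .
  obtain C where C: "\<And>\<omega>. \<omega> \<in> space M \<Longrightarrow> \<bar>Y \<omega>\<bar> \<le> C"
    using YM unfolding bdd_rv_def by blast
  have lim: "((\<lambda>\<epsilon>. \<integral>\<^sup>+\<omega>. ennreal \<bar>?r \<epsilon> \<omega>\<bar> \<partial>M) \<longlongrightarrow> 0) (at_right 0)"
    using rate[OF i] t unfolding has_rate_def by blast
  have ci: "integrable M (real_cond_exp M (\<F> t) (?N u))" if "0 \<le> u" for u
    using S.real_cond_exp_int(1)[OF count_integrable[OF i that]] .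
  have ri: "integrable M (?r \<epsilon>)" if "0 < \<epsilon>" for \<epsilon>
    using that t ci[of "t + \<epsilon>"] count_integrable[OF i t] rt_integrable[OF i t] by auto
  have Er: "((\<lambda>\<epsilon>. C * expectation (\<lambda>\<omega>. \<bar>?r \<epsilon> \<omega>\<bar>)) \<longlongrightarrow> C * 0) (at_right 0)"
  proof (rule tendsto_mult_left)
    have "((\<lambda>\<epsilon>. ennreal (expectation (\<lambda>\<omega>. \<bar>?r \<epsilon> \<omega>\<bar>))) \<longlongrightarrow> ennreal 0) (at_right 0)"
    proof (rule Lim_transform_eventually)
      show "((\<lambda>\<epsilon>. \<integral>\<^sup>+\<omega>. ennreal \<bar>?r \<epsilon> \<omega>\<bar> \<partial>M) \<longlongrightarrow> ennreal 0) (at_right 0)" using lim by simp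
      show "\<forall>\<^sub>F \<epsilon> in at_right 0. (\<integral>\<^sup>+\<omega>. ennreal \<bar>?r \<epsilon> \<omega>\<bar> \<partial>M) = ennreal (expectation (\<lambda>\<omega>. \<bar>?r \<epsilon> \<omega>\<bar>))"
        using eventually_at_right_less[of 0]
      proof (rule eventually_mono)
        fix \<epsilon> :: real assume "0 < \<epsilon>"
        then show "(\<integral>\<^sup>+\<omega>. ennreal \<bar>?r \<epsilon> \<omega>\<bar> \<partial>M) = ennreal (expectation (\<lambda>\<omega>. \<bar>?r \<epsilon> \<omega>\<bar>))"
          by (intro nn_integral_eq_integral integrable_abs ri) auto
      qed
    qed
    then show "((\<lambda>\<epsilon>. expectation (\<lambda>\<omega>. \<bar>?r \<epsilon> \<omega>\<bar>)) \<longlongrightarrow> 0) (at_right 0)"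
      by (subst (asm) tendsto_ennreal_iff) auto
  qed
  have main: "\<bar>expectation (\<lambda>\<omega>. Y \<omega> * real (cnt i t (t + \<epsilon>) \<omega>)) / \<epsilon> - expectation (\<lambda>\<omega>. Y \<omega> * rt i t \<omega>)\<bar>
      \<le> C * expectation (\<lambda>\<omega>. \<bar>?r \<epsilon> \<omega>\<bar>)" if e: "0 < \<epsilon>" for \<epsilon>
  proof -
    have te: "0 \<le> t + \<epsilon>" using t e by simp
    have Nb: "?N (t + \<epsilon>) \<in> borel_measurable M" using count_integrable[OF i te] by auto
    have YN: "integrable M (\<lambda>\<omega>. Y \<omega> * ?N (t + \<epsilon>) \<omega>)" by (rule bdd_mult_integrable[OF YM count_integrable[OF i te]])
    have YNt: "integrable M (\<lambda>\<omega>. Y \<omega> * ?N t \<omega>)" by (rule bdd_mult_integrable[OF YM count_integrable[OF i t]])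
    have Yrt: "integrable M (\<lambda>\<omega>. Y \<omega> * rt i t \<omega>)" by (rule bdd_mult_integrable[OF YM rt_integrable[OF i t]])
    note ce = S.real_cond_exp_intg[OF YN bdd_rv_measurable[OF Y] Nb]
    have "expectation (\<lambda>\<omega>. Y \<omega> * ?r \<epsilon> \<omega>)
       = expectation (\<lambda>\<omega>. (Y \<omega> * real_cond_exp M (\<F> t) (?N (t + \<epsilon>)) \<omega> - Y \<omega> * ?N t \<omega>) / \<epsilon> - Y \<omega> * rt i t \<omega>)"
      by (simp add: algebra_simps diff_divide_distrib)
    also have "\<dots> = (expectation (\<lambda>\<omega>. Y \<omega> * ?N (t + \<epsilon>) \<omega>) - expectation (\<lambda>\<omega>. Y \<omega> * ?N t \<omega>)) / \<epsilon>
        - expectation (\<lambda>\<omega>. Y \<omega> * rt i t \<omega>)"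
      using ce YNt Yrt by simp
    also have "expectation (\<lambda>\<omega>. Y \<omega> * ?N (t + \<epsilon>) \<omega>) - expectation (\<lambda>\<omega>. Y \<omega> * ?N t \<omega>)
       = expectation (\<lambda>\<omega>. Y \<omega> * ?N (t + \<epsilon>) \<omega> - Y \<omega> * ?N t \<omega>)"
      using YN YNt by simp
    also have "\<dots> = expectation (\<lambda>\<omega>. Y \<omega> * real (cnt i t (t + \<epsilon>) \<omega>))"
    proof (rule Bochner_Integration.integral_cong[OF refl])
      fix \<omega> assume "\<omega> \<in> space M"
      then show "Y \<omega> * ?N (t + \<epsilon>) \<omega> - Y \<omega> * ?N t \<omega> = Y \<omega> * real (cnt i t (t + \<epsilon>) \<omega>)"
        using event_count_split[OF i, of \<omega> t "t + \<epsilon>"] t e by (simp add: algebra_simps)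
    qed
    finally have eq: "expectation (\<lambda>\<omega>. Y \<omega> * ?r \<epsilon> \<omega>) = expectation (\<lambda>\<omega>. Y \<omega> * real (cnt i t (t + \<epsilon>) \<omega>)) / \<epsilon>
        - expectation (\<lambda>\<omega>. Y \<omega> * rt i t \<omega>)" .
    have "\<bar>expectation (\<lambda>\<omega>. Y \<omega> * ?r \<epsilon> \<omega>)\<bar> \<le> expectation (\<lambda>\<omega>. \<bar>Y \<omega> * ?r \<epsilon> \<omega>\<bar>)"
      by (rule integral_abs_bound)
    also have "\<dots> \<le> expectation (\<lambda>\<omega>. C * \<bar>?r \<epsilon> \<omega>\<bar>)"
    proof (rule integral_mono)
      show "integrable M (\<lambda>\<omega>. \<bar>Y \<omega> * ?r \<epsilon> \<omega>\<bar>)" by (intro integrable_abs bdd_mult_integrable YM ri e)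
      show "integrable M (\<lambda>\<omega>. C * \<bar>?r \<epsilon> \<omega>\<bar>)" by (intro integrable_mult_right integrable_abs ri e)
      show "\<bar>Y \<omega> * ?r \<epsilon> \<omega>\<bar> \<le> C * \<bar>?r \<epsilon> \<omega>\<bar>" if "\<omega> \<in> space M" for \<omega>
        unfolding abs_mult by (rule mult_right_mono[OF C[OF that]]) simp
    qed
    also have "\<dots> = C * expectation (\<lambda>\<omega>. \<bar>?r \<epsilon> \<omega>\<bar>)" by simp
    finally show ?thesis unfolding eq .
  qed
  have "((\<lambda>\<epsilon>. expectation (\<lambda>\<omega>. Y \<omega> * real (cnt i t (t + \<epsilon>) \<omega>)) / \<epsilon> - expectation (\<lambda>\<omega>. Y \<omega> * rt i t \<omega>)) \<longlongrightarrow> 0) (at_right 0)"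
  proof (rule Lim_null_comparison)
    show "((\<lambda>\<epsilon>. C * expectation (\<lambda>\<omega>. \<bar>?r \<epsilon> \<omega>\<bar>)) \<longlongrightarrow> 0) (at_right 0)" using Er by simp
    show "\<forall>\<^sub>F \<epsilon> in at_right 0. norm (expectation (\<lambda>\<omega>. Y \<omega> * real (cnt i t (t + \<epsilon>) \<omega>)) / \<epsilon> - expectation (\<lambda>\<omega>. Y \<omega> * rt i t \<omega>))
      \<le> C * expectation (\<lambda>\<omega>. \<bar>?r \<epsilon> \<omega>\<bar>)"
      using eventually_at_right_less[of 0] by (rule eventually_mono) (use main in simp)
  qed
  then show ?thesis by (rule LIM_zero_cancel)
qed

lemma rate_right:
  assumes i: "i \<in> {1..n}" and t: "0 \<le> t" and Y: "bdd_rv (\<F> t) Y" and e: "0 < e"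
  shows "\<exists>\<delta>>0. \<forall>v. t < v \<and> v < t + \<delta> \<longrightarrow>
     \<bar>expectation (\<lambda>\<omega>. Y \<omega> * real (cnt i t v \<omega>)) - expectation (\<lambda>\<omega>. Y \<omega> * rt i t \<omega>) * (v - t)\<bar> \<le> e * (v - t)"
proof -
  have "\<forall>\<^sub>F \<epsilon> in at_right 0. dist (expectation (\<lambda>\<omega>. Y \<omega> * real (cnt i t (t + \<epsilon>) \<omega>)) / \<epsilon>) (expectation (\<lambda>\<omega>. Y \<omega> * rt i t \<omega>)) < e"
    using tendstoD[OF rate_deriv[OF i t Y] e] .
  then obtain \<delta> where \<delta>: "0 < \<delta>" "\<And>\<epsilon>. 0 < \<epsilon> \<Longrightarrow> \<epsilon> < \<delta> \<Longrightarrow>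
     \<bar>expectation (\<lambda>\<omega>. Y \<omega> * real (cnt i t (t + \<epsilon>) \<omega>)) / \<epsilon> - expectation (\<lambda>\<omega>. Y \<omega> * rt i t \<omega>)\<bar> < e"
    unfolding eventually_at_right_field dist_real_def by auto
  show ?thesis
  proof (intro exI[of _ \<delta>] conjI allI impI \<delta>(1))
    fix v assume v: "t < v \<and> v < t + \<delta>"
    let ?X = "expectation (\<lambda>\<omega>. Y \<omega> * real (cnt i t v \<omega>))" and ?R = "expectation (\<lambda>\<omega>. Y \<omega> * rt i t \<omega>)"
    have vt: "0 < v - t" using v by simp
    have "\<bar>?X / (v - t) - ?R\<bar> < e" using \<delta>(2)[of "v - t"] v by simp
    then have "\<bar>?X / (v - t) - ?R\<bar> * (v - t) \<le> e * (v - t)" using vt by (intro mult_right_mono) auto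
    moreover have "\<bar>?X / (v - t) - ?R\<bar> * (v - t) = \<bar>(?X / (v - t) - ?R) * (v - t)\<bar>" using vt by (simp add: abs_mult)
    moreover have "(?X / (v - t) - ?R) * (v - t) = ?X - ?R * (v - t)" using vt by (simp add: left_diff_distrib)
    ultimately show "\<bar>?X - ?R * (v - t)\<bar> \<le> e * (v - t)" by simp
  qed
qed

text \<open>The interval from \<open>v\<close> to \<open>t\<close> contains its right end, so this
  is where fixed atoms are excluded: almost surely \<open>t\<close> is no event time, and the counts
  vanish as \<open>v\<close> increases to \<open>t\<close>. Dominated convergence, with the total
  count up to \<open>t\<close> as majorant.\<close>

lemma cnt_expectation_left:
  assumes i: "i \<in> {1..n}" and t: "0 < t" and e: "0 < e"
  shows "\<exists>\<delta>>0. \<forall>v. t - \<delta> < v \<and> v < t \<and> 0 \<le> v \<longrightarrow> expectation (\<lambda>\<omega>. real (cnt i v t \<omega>)) \<le> e"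
proof -
  define v where "v = (\<lambda>k. t - t / real (Suc k))"
  have v0: "0 \<le> v k" "v k < t" for k
    using t by (auto simp: v_def field_simps)
  have "(\<lambda>k. expectation (\<lambda>\<omega>. real (cnt i (v k) t \<omega>))) \<longlonglongrightarrow> expectation (\<lambda>_. 0)"
  proof (rule integral_dominated_convergence)
    show "(\<lambda>\<omega>. real (cnt i (v k) t \<omega>)) \<in> borel_measurable M" for k
      using cnt_integrable[OF i v0(1)[of k]] v0(2)[of k] by (auto simp: less_imp_le)
    show "integrable M (\<lambda>\<omega>. real (event_count E i t \<omega>))" using count_integrable[OF i] t by simp
    show "AE \<omega> in M. norm (real (cnt i (v k) t \<omega>)) \<le> real (event_count E i t \<omega>)" for k
      using cnt_le_event_count[OF i _ v0(1)] by (intro AE_I2) auto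
    show "AE \<omega> in M. (\<lambda>k. real (cnt i (v k) t \<omega>)) \<longlonglongrightarrow> 0"
      using no_fixed_atoms[OF i t] AE_space
    proof eventually_elim
      case (elim \<omega>)
      let ?A = "E i \<omega> \<inter> {0..t}"
      have fin: "finite ?A" using locally_finite[OF i] elim by simp
      \<comment> \<open>The last event up to time \<open>t\<close>, or 0 if there is none. It lies
        strictly before \<open>t\<close>, and intervals that start after it are empty.\<close>
      define g where "g = Max (insert 0 ?A)"
      have gt: "g < t" unfolding g_def using fin t elim by (subst Max_less_iff) (auto simp: le_less)
      have g: "x \<le> g" if "x \<in> ?A" for x unfolding g_def using fin that by (intro Max_ge) auto
      have "v \<longlonglongrightarrow> t - 0"
        unfolding v_def by (intro tendsto_intros LIMSEQ_Suc[OF lim_const_over_n])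
      then have "\<forall>\<^sub>F k in sequentially. g < v k" using gt by (simp add: order_tendstoD)
      then have "\<forall>\<^sub>F k in sequentially. real (cnt i (v k) t \<omega>) = 0"
      proof eventually_elim
        case (elim k)
        have "evs i (v k) t \<omega> = {}" using g elim v0[of k] by (fastforce simp: evs_def)
        then show ?case by (simp add: cnt_def)
      qed
      then show ?case by (rule tendsto_eventually)
    qed
  qed simp
  then have "\<forall>\<^sub>F k in sequentially. expectation (\<lambda>\<omega>. real (cnt i (v k) t \<omega>)) < e"
    using e by (intro order_tendstoD) auto
  then obtain k where k: "expectation (\<lambda>\<omega>. real (cnt i (v k) t \<omega>)) < e"
    by (auto simp: eventually_sequentially)
  show ?thesis
  proof (intro exI[of _ "t - v k"] conjI allI impI)
    show "0 < t - v k" using v0 by simp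
    fix u assume u: "t - (t - v k) < u \<and> u < t \<and> 0 \<le> u"
    have "expectation (\<lambda>\<omega>. real (cnt i u t \<omega>)) \<le> expectation (\<lambda>\<omega>. real (cnt i (v k) t \<omega>))"
      by (rule integral_mono; (rule cnt_integrable)?) (use i u v0[of k] cnt_mono in auto)
    then show "expectation (\<lambda>\<omega>. real (cnt i u t \<omega>)) \<le> e" using k by simp
  qed
qed

lemma expectation_cnt_split:
  assumes i: "i \<in> {1..n}" and s: "0 \<le> s" "s \<le> u" "u \<le> v" and Y: "bdd_rv M Y"
  shows "expectation (\<lambda>\<omega>. Y \<omega> * real (cnt i s v \<omega>))
    = expectation (\<lambda>\<omega>. Y \<omega> * real (cnt i s u \<omega>)) + expectation (\<lambda>\<omega>. Y \<omega> * real (cnt i u v \<omega>))"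
proof -
  have Yc: "integrable M (\<lambda>\<omega>. Y \<omega> * real (cnt i u v \<omega>))" if "0 \<le> u" "u \<le> v" for u v
    by (rule bdd_mult_integrable[OF Y cnt_integrable[OF i that]])
  have "expectation (\<lambda>\<omega>. Y \<omega> * real (cnt i s v \<omega>))
    = expectation (\<lambda>\<omega>. Y \<omega> * real (cnt i s u \<omega>) + Y \<omega> * real (cnt i u v \<omega>))"
  proof (rule Bochner_Integration.integral_cong[OF refl])
    fix \<omega> assume "\<omega> \<in> space M"
    then have "cnt i s v \<omega> = cnt i s u \<omega> + cnt i u v \<omega>" by (rule cnt_split[OF i _ s])
    then show "Y \<omega> * real (cnt i s v \<omega>) = Y \<omega> * real (cnt i s u \<omega>) + Y \<omega> * real (cnt i u v \<omega>)"
      by (simp add: distrib_left)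
  qed
  also have "\<dots> = expectation (\<lambda>\<omega>. Y \<omega> * real (cnt i s u \<omega>)) + expectation (\<lambda>\<omega>. Y \<omega> * real (cnt i u v \<omega>))"
    by (rule Bochner_Integration.integral_add; rule Yc) (use s in auto)
  finally show ?thesis .
qed

text \<open>Integrated form of \<open>rate_deriv\<close>: the one-sided mean value inequality
  applied to the expected count minus its linear bound, with \<open>cnt_expectation_left\<close> as
  the left condition.\<close>

lemma expectation_cnt_upper:
  assumes i: "i \<in> {1..n}" and s: "0 \<le> s" "s \<le> t" and Y: "weight (\<F> s) Y"
    and b: "\<And>u. s \<le> u \<Longrightarrow> u < t \<Longrightarrow> expectation (\<lambda>\<omega>. Y \<omega> * rt i u \<omega>) \<le> b"
  shows "expectation (\<lambda>\<omega>. Y \<omega> * real (cnt i s t \<omega>)) \<le> b * (t - s)"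
proof -
  have YM: "bdd_rv M Y" using bdd_rv_filtration_M[OF weight_bdd[OF Y]] .
  obtain C where C: "\<And>\<omega>. \<omega> \<in> space M \<Longrightarrow> \<bar>Y \<omega>\<bar> \<le> C"
    using YM unfolding bdd_rv_def by blast
  let ?f = "\<lambda>u. expectation (\<lambda>\<omega>. Y \<omega> * real (cnt i s u \<omega>)) - b * (u - s)"
  have Yc: "integrable M (\<lambda>\<omega>. Y \<omega> * real (cnt i u v \<omega>))" if "0 \<le> u" "u \<le> v" for u v
    by (rule bdd_mult_integrable[OF YM cnt_integrable[OF i that]])
  have split: "?f v - ?f u = expectation (\<lambda>\<omega>. Y \<omega> * real (cnt i u v \<omega>)) - b * (v - u)" if "s \<le> u" "u \<le> v" for u v
    using expectation_cnt_split[OF i s(1) that YM] by (simp add: algebra_simps)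
  have "?f t \<le> ?f s"
  proof (rule right_derivative_le_imp_decreasing[OF s(2)])
    fix u \<epsilon> :: real assume u: "s \<le> u" "u < t" and e: "0 < \<epsilon>"
    have Yu: "bdd_rv (\<F> u) Y" using weight_bdd[OF weight_filtration_mono[OF u(1) Y]] .
    obtain \<delta> where \<delta>: "0 < \<delta>" "\<And>v. u < v \<Longrightarrow> v < u + \<delta> \<Longrightarrow>
      \<bar>expectation (\<lambda>\<omega>. Y \<omega> * real (cnt i u v \<omega>)) - expectation (\<lambda>\<omega>. Y \<omega> * rt i u \<omega>) * (v - u)\<bar> \<le> \<epsilon> * (v - u)"
      using rate_right[OF i _ Yu e] s u by auto
    show "\<exists>\<delta>>0. \<forall>v. u < v \<and> v < u + \<delta> \<and> v \<le> t \<longrightarrow> ?f v - ?f u \<le> \<epsilon> * (v - u)"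
    proof (intro exI[of _ \<delta>] conjI allI impI \<delta>(1))
      fix v assume v: "u < v \<and> v < u + \<delta> \<and> v \<le> t"
      have "expectation (\<lambda>\<omega>. Y \<omega> * rt i u \<omega>) * (v - u) \<le> b * (v - u)"
        using b[OF u] v by (intro mult_right_mono) auto
      moreover have "\<bar>expectation (\<lambda>\<omega>. Y \<omega> * real (cnt i u v \<omega>)) - expectation (\<lambda>\<omega>. Y \<omega> * rt i u \<omega>) * (v - u)\<bar> \<le> \<epsilon> * (v - u)"
        by (rule \<delta>(2)) (use v in auto)
      moreover have "?f v - ?f u = expectation (\<lambda>\<omega>. Y \<omega> * real (cnt i u v \<omega>)) - b * (v - u)"
        by (rule split) (use u v in auto)
      ultimately show "?f v - ?f u \<le> \<epsilon> * (v - u)" by linarith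
    qed
  next
    fix u \<epsilon> :: real assume u: "s < u" "u \<le> t" and e: "0 < \<epsilon>"
    have C0: "0 < \<bar>C\<bar> + \<bar>b\<bar> + 1" by simp
    \<comment> \<open>Close to \<open>u\<close> on the left the increment is at most
      \<open>(\<bar>C\<bar> + \<bar>b\<bar>) * e'\<close>, where \<open>C\<close> bounds the weight
      and \<open>b\<close> is the slope.\<close>
    define e' where "e' = \<epsilon> / (\<bar>C\<bar> + \<bar>b\<bar> + 1)"
    have e': "0 < e'" using e C0 by (simp add: e'_def)
    obtain \<delta> where \<delta>: "0 < \<delta>" "\<And>v. u - \<delta> < v \<Longrightarrow> v < u \<Longrightarrow> 0 \<le> v \<Longrightarrow> expectation (\<lambda>\<omega>. real (cnt i v u \<omega>)) \<le> e'"
      using cnt_expectation_left[OF i _ e', of u] s u by auto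
    show "\<exists>\<delta>>0. \<forall>v. u - \<delta> < v \<and> v < u \<and> s \<le> v \<longrightarrow> ?f u - ?f v \<le> \<epsilon>"
    proof (intro exI[of _ "min \<delta> e'"] conjI allI impI)
      show "0 < min \<delta> e'" using \<delta> e' by simp
      fix v assume v: "u - min \<delta> e' < v \<and> v < u \<and> s \<le> v"
      have v0: "0 \<le> v" "v \<le> u" using v s by auto
      have "expectation (\<lambda>\<omega>. Y \<omega> * real (cnt i v u \<omega>)) \<le> expectation (\<lambda>\<omega>. \<bar>C\<bar> * real (cnt i v u \<omega>))"
      proof (rule integral_mono)
        show "integrable M (\<lambda>\<omega>. \<bar>C\<bar> * real (cnt i v u \<omega>))" using cnt_integrable[OF i v0] by simp
        show "Y \<omega> * real (cnt i v u \<omega>) \<le> \<bar>C\<bar> * real (cnt i v u \<omega>)" if "\<omega> \<in> space M" for \<omega>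
          using C[OF that] by (intro mult_right_mono) auto
      qed (rule Yc[OF v0])
      also have "\<dots> = \<bar>C\<bar> * expectation (\<lambda>\<omega>. real (cnt i v u \<omega>))" by simp
      also have "\<dots> \<le> \<bar>C\<bar> * e'" by (rule mult_left_mono[OF \<delta>(2)]) (use v v0 in auto)
      finally have 1: "expectation (\<lambda>\<omega>. Y \<omega> * real (cnt i v u \<omega>)) \<le> \<bar>C\<bar> * e'" .
      have "- b * (u - v) \<le> \<bar>b\<bar> * (u - v)" using v by (intro mult_right_mono) auto
      then have "- (b * (u - v)) \<le> \<bar>b\<bar> * (u - v)" by simp
      also have "\<dots> \<le> \<bar>b\<bar> * e'" using v by (intro mult_left_mono) auto
      finally have 2: "- (b * (u - v)) \<le> \<bar>b\<bar> * e'" .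
      have "\<bar>C\<bar> * e' + \<bar>b\<bar> * e' \<le> (\<bar>C\<bar> + \<bar>b\<bar> + 1) * e'" using e' by (simp add: distrib_right)
      also have "\<dots> = \<epsilon>" using C0 by (simp add: e'_def)
      finally have "\<bar>C\<bar> * e' + \<bar>b\<bar> * e' \<le> \<epsilon>" .
      moreover have "?f u - ?f v = expectation (\<lambda>\<omega>. Y \<omega> * real (cnt i v u \<omega>)) - b * (u - v)"
        by (rule split) (use v in auto)
      ultimately show "?f u - ?f v \<le> \<epsilon>" using 1 2 by linarith
    qed
  qed
  then show ?thesis by (simp add: cnt_def evs_def)
qed

text \<open>The mirror image of \<open>expectation_cnt_upper\<close>. Counts now enter with a
  negative sign, which is favourable on the left, so the left condition concerns the linear
  term.\<close>

lemma expectation_cnt_lower: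
  assumes i: "i \<in> {1..n}" and s: "0 \<le> s" "s \<le> t" and Y: "weight (\<F> s) Y"
    and b: "\<And>u. s \<le> u \<Longrightarrow> u < t \<Longrightarrow> b \<le> expectation (\<lambda>\<omega>. Y \<omega> * rt i u \<omega>)"
    and b0: "0 \<le> b"
  shows "b * (t - s) \<le> expectation (\<lambda>\<omega>. Y \<omega> * real (cnt i s t \<omega>))"
proof -
  have YM: "bdd_rv M Y" using bdd_rv_filtration_M[OF weight_bdd[OF Y]] .
  let ?f = "\<lambda>u. b * (u - s) - expectation (\<lambda>\<omega>. Y \<omega> * real (cnt i s u \<omega>))"
  have Yc: "integrable M (\<lambda>\<omega>. Y \<omega> * real (cnt i u v \<omega>))" if "0 \<le> u" "u \<le> v" for u v
    by (rule bdd_mult_integrable[OF YM cnt_integrable[OF i that]])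
  have split: "?f v - ?f u = b * (v - u) - expectation (\<lambda>\<omega>. Y \<omega> * real (cnt i u v \<omega>))" if "s \<le> u" "u \<le> v" for u v
    using expectation_cnt_split[OF i s(1) that YM] by (simp add: algebra_simps)
  have "?f t \<le> ?f s"
  proof (rule right_derivative_le_imp_decreasing[OF s(2)])
    fix u \<epsilon> :: real assume u: "s \<le> u" "u < t" and e: "0 < \<epsilon>"
    have Yu: "bdd_rv (\<F> u) Y" using weight_bdd[OF weight_filtration_mono[OF u(1) Y]] .
    obtain \<delta> where \<delta>: "0 < \<delta>" "\<And>v. u < v \<Longrightarrow> v < u + \<delta> \<Longrightarrow>
      \<bar>expectation (\<lambda>\<omega>. Y \<omega> * real (cnt i u v \<omega>)) - expectation (\<lambda>\<omega>. Y \<omega> * rt i u \<omega>) * (v - u)\<bar> \<le> \<epsilon> * (v - u)"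
      using rate_right[OF i _ Yu e] s u by auto
    show "\<exists>\<delta>>0. \<forall>v. u < v \<and> v < u + \<delta> \<and> v \<le> t \<longrightarrow> ?f v - ?f u \<le> \<epsilon> * (v - u)"
    proof (intro exI[of _ \<delta>] conjI allI impI \<delta>(1))
      fix v assume v: "u < v \<and> v < u + \<delta> \<and> v \<le> t"
      have "b * (v - u) \<le> expectation (\<lambda>\<omega>. Y \<omega> * rt i u \<omega>) * (v - u)"
        using b[OF u] v by (intro mult_right_mono) auto
      moreover have "\<bar>expectation (\<lambda>\<omega>. Y \<omega> * real (cnt i u v \<omega>)) - expectation (\<lambda>\<omega>. Y \<omega> * rt i u \<omega>) * (v - u)\<bar> \<le> \<epsilon> * (v - u)"
        by (rule \<delta>(2)) (use v in auto)
      moreover have "?f v - ?f u = b * (v - u) - expectation (\<lambda>\<omega>. Y \<omega> * real (cnt i u v \<omega>))"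
        by (rule split) (use u v in auto)
      ultimately show "?f v - ?f u \<le> \<epsilon> * (v - u)" by linarith
    qed
  next
    fix u \<epsilon> :: real assume u: "s < u" "u \<le> t" and e: "0 < \<epsilon>"
    define e' where "e' = \<epsilon> / (b + 1)"
    have e': "0 < e'" using e b0 by (simp add: e'_def)
    show "\<exists>\<delta>>0. \<forall>v. u - \<delta> < v \<and> v < u \<and> s \<le> v \<longrightarrow> ?f u - ?f v \<le> \<epsilon>"
    proof (intro exI[of _ e'] conjI allI impI e')
      fix v assume v: "u - e' < v \<and> v < u \<and> s \<le> v"
      have "b * (u - v) \<le> b * e'" using v b0 by (intro mult_left_mono) auto
      also have "\<dots> \<le> (b + 1) * e'" using e' by (simp add: distrib_right)
      also have "\<dots> = \<epsilon>" using b0 by (simp add: e'_def)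
      finally have "b * (u - v) \<le> \<epsilon>" .
      moreover have "0 \<le> expectation (\<lambda>\<omega>. Y \<omega> * real (cnt i v u \<omega>))"
        by (rule Bochner_Integration.integral_nonneg) (use weight_ge_0[OF Y] in auto)
      moreover have "?f u - ?f v = b * (u - v) - expectation (\<lambda>\<omega>. Y \<omega> * real (cnt i v u \<omega>))"
        by (rule split) (use v in auto)
      ultimately show "?f u - ?f v \<le> \<epsilon>" by linarith
    qed
  qed
  then show ?thesis by (simp add: cnt_def evs_def)
qed

section \<open>Expected counts over a short cell\<close>

lemma integral_grid:
  fixes f :: "real \<Rightarrow> real"
  assumes f: "continuous_on {s..t} f" and st: "s \<le> t" and k: "k \<le> m"
  shows "integral {s..grid s t m k} f = (\<Sum>p<k. integral {grid s t m p..grid s t m (Suc p)} f)"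
  using k
proof (induction k)
  case (Suc k)
  have "integral {s..grid s t m k} f + integral {grid s t m k..grid s t m (Suc k)} f = integral {s..grid s t m (Suc k)} f"
  proof (rule Henstock_Kurzweil_Integration.integral_combine)
    show "f integrable_on {s..grid s t m (Suc k)}"
      by (rule integrable_continuous_interval, rule continuous_on_subset[OF f])
        (use grid_bounds[OF st, of "Suc k" m] Suc.prems in auto)
  qed (use grid_bounds[OF st, of k m] grid_mono[OF st, of k "Suc k" m] Suc.prems in auto)
  then show ?case using Suc by simp
qed simp

text \<open>A bound for the integral against the counting process: on each grid cell
  \<open>f\<close> is nearly constant and the expected count is at most \<open>b\<close> times the
  mesh, so the expectation is at most \<open>b\<close> times a Riemann sum of
  \<open>f\<close>.\<close>

lemma expectation_isum_upper:
  assumes i: "i \<in> {1..n}" and s: "0 \<le> s" "s \<le> t" and Y: "weight (\<F> s) Y"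
    and b: "\<And>u. s \<le> u \<Longrightarrow> u < t \<Longrightarrow> expectation (\<lambda>\<omega>. Y \<omega> * rt i u \<omega>) \<le> b" "0 \<le> b"
    and f: "continuous_on {s..t} f" "\<And>x. s \<le> x \<Longrightarrow> x \<le> t \<Longrightarrow> 0 \<le> f x \<and> f x \<le> 1"
  shows "integrable M (\<lambda>\<omega>. Y \<omega> * isum f i s t \<omega>)"
    and "expectation (\<lambda>\<omega>. Y \<omega> * isum f i s t \<omega>) \<le> b * integral {s..t} f"
proof -
  have YM: "bdd_rv M Y" using bdd_rv_filtration_M[OF weight_bdd[OF Y]] .
  have Yc: "integrable M (\<lambda>\<omega>. Y \<omega> * real (cnt i u v \<omega>))" if "0 \<le> u" "u \<le> v" for u v
    by (rule bdd_mult_integrable[OF YM cnt_integrable[OF i that]])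
  have is_int: "integrable M (isum f i s t)"
  proof (rule Bochner_Integration.integrable_bound[OF cnt_integrable[OF i s]])
    show "isum f i s t \<in> borel_measurable M"
      by (rule measurable_from_subalg[OF filtration_subalgebra isum_filtration[OF i s f(1)]])
    show "AE \<omega> in M. norm (isum f i s t \<omega>) \<le> norm (real (cnt i s t \<omega>))"
    proof (rule AE_I2)
      fix \<omega>
      have "0 \<le> isum f i s t \<omega>" by (rule isum_nonneg) (use f(2) in auto)
      moreover have "isum f i s t \<omega> \<le> 1 * real (cnt i s t \<omega>)" by (rule isum_le) (use f(2) in auto)
      ultimately show "norm (isum f i s t \<omega>) \<le> norm (real (cnt i s t \<omega>))" by simp
    qed
  qed
  show YI: "integrable M (\<lambda>\<omega>. Y \<omega> * isum f i s t \<omega>)" by (rule bdd_mult_integrable[OF YM is_int])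
  show "expectation (\<lambda>\<omega>. Y \<omega> * isum f i s t \<omega>) \<le> b * integral {s..t} f"
  proof (rule field_le_epsilon)
    fix e :: real assume e: "0 < e"
    \<comment> \<open>Discretisation is paid twice, for the sum over events and for the integral,
      each time by \<open>\<epsilon> * b * (t - s)\<close>. The added 1 keeps the denominator
      positive.\<close>
    define \<epsilon> where "\<epsilon> = e / (2 * (b * (t - s)) + 1)"
    have pos: "0 < 2 * (b * (t - s)) + 1" using b(2) s by (simp add: add_nonneg_pos)
    have \<epsilon>: "0 < \<epsilon>" unfolding \<epsilon>_def using e pos by simp
    obtain m where m: "0 < m" "\<And>p x. p < m \<Longrightarrow> x \<in> {grid s t m p..grid s t m (Suc p)} \<Longrightarrow> \<bar>f x - f (grid s t m p)\<bar> \<le> \<epsilon>"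
      using uniform_grid[OF f(1) s(2) \<epsilon>] by blast
    let ?g = "grid s t m"
    let ?D = "(t - s) / real m"
    have g0: "0 \<le> ?g p" "?g p \<le> ?g (Suc p)" "s \<le> ?g p" for p
      using grid_mono[OF s(2), of 0 p m] grid_mono[OF s(2), of p "Suc p" m] s by auto
    have gt: "?g p \<le> t" if "p \<le> m" for p using grid_bounds[OF s(2) that] by simp
    have cell: "expectation (\<lambda>\<omega>. Y \<omega> * real (cnt i (?g p) (?g (Suc p)) \<omega>)) \<le> b * ?D" if "p < m" for p
    proof -
      have "expectation (\<lambda>\<omega>. Y \<omega> * real (cnt i (?g p) (?g (Suc p)) \<omega>)) \<le> b * (?g (Suc p) - ?g p)"
      proof (rule expectation_cnt_upper[OF i g0(1,2) weight_filtration_mono[OF g0(3) Y]])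
        fix u assume "?g p \<le> u" "u < ?g (Suc p)"
        then show "expectation (\<lambda>\<omega>. Y \<omega> * rt i u \<omega>) \<le> b"
          using b(1)[of u] g0(3)[of p] gt[of "Suc p"] that by simp
      qed
      then show ?thesis by (simp add: grid_step)
    qed
    have low: "(f (?g p) - \<epsilon>) * ?D \<le> integral {?g p..?g (Suc p)} f" if "p < m" for p
    proof -
      have fi: "f integrable_on {?g p..?g (Suc p)}"
        by (rule integrable_continuous_interval, rule continuous_on_subset[OF f(1)])
          (use g0(3)[of p] gt[of "Suc p"] that in auto)
      have "integral {?g p..?g (Suc p)} (\<lambda>_. f (?g p) - \<epsilon>) \<le> integral {?g p..?g (Suc p)} f"
      proof (rule integral_le[OF _ fi])
        fix x assume x: "x \<in> {?g p..?g (Suc p)}"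
        show "f (?g p) - \<epsilon> \<le> f x" using m(2)[OF that x] by linarith
      qed (rule integrable_continuous_interval[OF continuous_on_const])
      then show ?thesis using g0(2)[of p] by (simp add: grid_step mult.commute)
    qed
    have "expectation (\<lambda>\<omega>. Y \<omega> * isum f i s t \<omega>)
      \<le> expectation (\<lambda>\<omega>. \<Sum>p<m. (f (?g p) + \<epsilon>) * (Y \<omega> * real (cnt i (?g p) (?g (Suc p)) \<omega>)))"
    proof (rule integral_mono[OF YI])
      show "integrable M (\<lambda>\<omega>. \<Sum>p<m. (f (?g p) + \<epsilon>) * (Y \<omega> * real (cnt i (?g p) (?g (Suc p)) \<omega>)))"
        by (intro Bochner_Integration.integrable_sum integrable_mult_right Yc g0)
      fix \<omega> assume om: "\<omega> \<in> space M"
      have "isum f i s t \<omega> = (\<Sum>p<m. isum f i (?g p) (?g (Suc p)) \<omega>)"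
        using isum_grid[OF i om s order_refl, of f m] grid_m[OF m(1), of s t] by simp
      also have "\<dots> \<le> (\<Sum>p<m. (f (?g p) + \<epsilon>) * real (cnt i (?g p) (?g (Suc p)) \<omega>))"
      proof (intro sum_mono isum_le)
        fix p x assume "p \<in> {..<m}" "?g p < x" "x \<le> ?g (Suc p)"
        then show "f x \<le> f (?g p) + \<epsilon>" using m(2)[of p x] by auto
      qed
      finally have "Y \<omega> * isum f i s t \<omega> \<le> Y \<omega> * (\<Sum>p<m. (f (?g p) + \<epsilon>) * real (cnt i (?g p) (?g (Suc p)) \<omega>))"
        using weight_ge_0[OF Y] om by (intro mult_left_mono) auto
      then show "Y \<omega> * isum f i s t \<omega> \<le> (\<Sum>p<m. (f (?g p) + \<epsilon>) * (Y \<omega> * real (cnt i (?g p) (?g (Suc p)) \<omega>)))"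
        by (simp add: sum_distrib_left mult.left_commute)
    qed
    also have "\<dots> = (\<Sum>p<m. (f (?g p) + \<epsilon>) * expectation (\<lambda>\<omega>. Y \<omega> * real (cnt i (?g p) (?g (Suc p)) \<omega>)))"
    proof -
      have "integrable M (\<lambda>\<omega>. (f (?g p) + \<epsilon>) * (Y \<omega> * real (cnt i (?g p) (?g (Suc p)) \<omega>)))" for p
        by (intro integrable_mult_right Yc g0)
      then show ?thesis by (subst Bochner_Integration.integral_sum) simp_all
    qed
    also have "\<dots> \<le> (\<Sum>p<m. (f (?g p) + \<epsilon>) * (b * ?D))"
    proof (intro sum_mono mult_left_mono)
      fix p assume p: "p \<in> {..<m}"
      then show "expectation (\<lambda>\<omega>. Y \<omega> * real (cnt i (?g p) (?g (Suc p)) \<omega>)) \<le> b * ?D" using cell by simp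
      show "0 \<le> f (?g p) + \<epsilon>" using f(2)[of "?g p"] g0(3)[of p] gt[of p] p \<epsilon> by auto
    qed
    also have "\<dots> = b * (\<Sum>p<m. (f (?g p) - \<epsilon>) * ?D) + b * (2 * \<epsilon> * (t - s))"
    proof -
      have "(\<Sum>p<m. (f (?g p) + \<epsilon>) * (b * ?D)) = (\<Sum>p<m. b * ((f (?g p) - \<epsilon>) * ?D) + b * (2 * \<epsilon> * ?D))"
      proof (rule sum.cong[OF refl])
        fix p
        show "(f (?g p) + \<epsilon>) * (b * D) = b * ((f (?g p) - \<epsilon>) * D) + b * (2 * \<epsilon> * D)" for D
          by (simp add: algebra_simps)
      qed
      also have "\<dots> = (\<Sum>p<m. b * ((f (?g p) - \<epsilon>) * ?D)) + (\<Sum>p<m. b * (2 * \<epsilon> * ?D))"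
        by (rule sum.distrib)
      also have "(\<Sum>p<m. b * ((f (?g p) - \<epsilon>) * ?D)) = b * (\<Sum>p<m. (f (?g p) - \<epsilon>) * ?D)"
        by (rule sum_distrib_left[symmetric])
      also have "(\<Sum>p<m. b * (2 * \<epsilon> * ?D)) = real m * (b * (2 * \<epsilon> * ?D))" by simp
      also have "\<dots> = b * (2 * \<epsilon> * (real m * ?D))" by (simp only: mult_ac)
      also have "real m * ?D = t - s" using m(1) by simp
      finally show ?thesis .
    qed
    also have "\<dots> \<le> b * integral {s..t} f + b * (2 * \<epsilon> * (t - s))"
    proof -
      have "(\<Sum>p<m. (f (?g p) - \<epsilon>) * ?D) \<le> integral {s..t} f"
        using integral_grid[OF f(1) s(2) order_refl, of m] grid_m[OF m(1), of s t] sum_mono[of "{..<m}", OF low] by simp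
      then show ?thesis using b(2) by (simp add: mult_left_mono)
    qed
    also have "b * (2 * \<epsilon> * (t - s)) \<le> e"
    proof -
      have "b * (2 * \<epsilon> * (t - s)) \<le> (2 * (b * (t - s)) + 1) * \<epsilon>" using \<epsilon> by (simp add: algebra_simps)
      also have "\<dots> = e" unfolding \<epsilon>_def using pos by (simp del: distrib_right_numeral)
      finally show ?thesis .
    qed
    finally show "expectation (\<lambda>\<omega>. Y \<omega> * isum f i s t \<omega>) \<le> b * integral {s..t} f + e" by simp
  qed
qed

text \<open>Sparsity keeps the total influence on a node bounded independently of
  \<open>n\<close>.\<close>

lemma row_sum_le: "k \<in> {1..n} \<Longrightarrow> (\<Sum>j=1..n. w k j) \<le> real d * w_max"
proof -
  assume k: "k \<in> {1..n}"
  have "(\<Sum>j=1..n. w k j) = (\<Sum>j\<in>{j\<in>{1..n}. w k j \<noteq> 0}. w k j)"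
    by (rule sum.mono_neutral_right) auto
  also have "\<dots> \<le> real (card {j\<in>{1..n}. w k j \<noteq> 0}) * w_max"
    by (rule sum_bounded_above) (use weight_range k in auto)
  also have "\<dots> \<le> real d * w_max"
    using A.sparsity[OF k] const_pos by (intro mult_right_mono) auto
  finally show ?thesis .
qed

lemma weighted_rt_integrable:
  "k \<in> {1..n} \<Longrightarrow> 0 \<le> u \<Longrightarrow> bdd_rv M Y \<Longrightarrow> integrable M (\<lambda>\<omega>. Y \<omega> * rt k u \<omega>)"
  by (rule bdd_mult_integrable[OF _ rt_integrable])

lemma weighted_cnt_integrable:
  "k \<in> {1..n} \<Longrightarrow> 0 \<le> u \<Longrightarrow> u \<le> v \<Longrightarrow> bdd_rv M Y \<Longrightarrow> integrable M (\<lambda>\<omega>. Y \<omega> * real (cnt k u v \<omega>))"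
  by (rule bdd_mult_integrable[OF _ cnt_integrable])

lemma expectation_rt_upper:
  assumes k: "k \<in> {1..n}" and s: "0 \<le> s" "s \<le> u" and Y: "weight M Y"
  shows "expectation (\<lambda>\<omega>. Y \<omega> * rt k u \<omega>) \<le> expectation (\<lambda>\<omega>. Y \<omega> * rt k s \<omega>)
     + (L * \<mu>_max * (u - s)) * expectation Y + (\<Sum>j=1..n. w k j * expectation (\<lambda>\<omega>. Y \<omega> * real (cnt j s u \<omega>)))"
proof -
  note YM = weight_bdd[OF Y]
  have u: "0 \<le> u" using s by simp
  note i1 = weighted_rt_integrable[OF k s(1) YM]
  have i2: "integrable M (\<lambda>\<omega>. (L * \<mu>_max * (u - s)) * Y \<omega>)"
    by (rule integrable_mult_right[OF bdd_rv_integrable[OF YM]])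
  have i3: "integrable M (\<lambda>\<omega>. w k j * (Y \<omega> * real (cnt j s u \<omega>)))" if "j \<in> {1..n}" for j
    by (rule integrable_mult_right[OF weighted_cnt_integrable[OF that s YM]])
  have i4: "integrable M (\<lambda>\<omega>. \<Sum>j=1..n. w k j * (Y \<omega> * real (cnt j s u \<omega>)))"
    by (rule Bochner_Integration.integrable_sum[OF i3])
  have "expectation (\<lambda>\<omega>. Y \<omega> * rt k u \<omega>) \<le> expectation (\<lambda>\<omega>. (Y \<omega> * rt k s \<omega> + (L * \<mu>_max * (u - s)) * Y \<omega>)
      + (\<Sum>j=1..n. w k j * (Y \<omega> * real (cnt j s u \<omega>))))"
  proof (rule integral_mono[OF weighted_rt_integrable[OF k u YM]])
    show "integrable M (\<lambda>\<omega>. (Y \<omega> * rt k s \<omega> + (L * \<mu>_max * (u - s)) * Y \<omega>)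
      + (\<Sum>j=1..n. w k j * (Y \<omega> * real (cnt j s u \<omega>))))"
      by (intro Bochner_Integration.integrable_add i1 i2 i4)
    fix \<omega> assume om: "\<omega> \<in> space M"
    have "Y \<omega> * rt k u \<omega> \<le> Y \<omega> * (rt k s \<omega> + L * \<mu>_max * (u - s) + (\<Sum>j=1..n. w k j * real (cnt j s u \<omega>)))"
      by (rule mult_left_mono[OF rt_upper[OF k om s] weight_ge_0[OF Y om]])
    then show "Y \<omega> * rt k u \<omega> \<le> (Y \<omega> * rt k s \<omega> + (L * \<mu>_max * (u - s)) * Y \<omega>)
      + (\<Sum>j=1..n. w k j * (Y \<omega> * real (cnt j s u \<omega>)))"
      by (simp add: distrib_left sum_distrib_left mult.left_commute mult.commute)
  qed
  also have "\<dots> = expectation (\<lambda>\<omega>. Y \<omega> * rt k s \<omega>) + (L * \<mu>_max * (u - s)) * expectation Y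
     + (\<Sum>j=1..n. w k j * expectation (\<lambda>\<omega>. Y \<omega> * real (cnt j s u \<omega>)))"
  proof -
    have "expectation (\<lambda>\<omega>. \<Sum>j=1..n. w k j * (Y \<omega> * real (cnt j s u \<omega>)))
        = (\<Sum>j=1..n. w k j * expectation (\<lambda>\<omega>. Y \<omega> * real (cnt j s u \<omega>)))"
      by (subst Bochner_Integration.integral_sum[OF i3]) simp_all
    then show ?thesis
      using Bochner_Integration.integral_add[OF Bochner_Integration.integrable_add[OF i1 i2] i4]
        Bochner_Integration.integral_add[OF i1 i2] by simp
  qed
  finally show ?thesis .
qed

lemma expectation_rt_le:
  assumes k: "k \<in> {1..n}" and s: "0 \<le> s" and Y: "weight M Y"
    and supp: "\<And>\<omega>. \<omega> \<in> space M \<Longrightarrow> Y \<omega> \<noteq> 0 \<Longrightarrow> rt k s \<omega> \<le> B"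
  shows "expectation (\<lambda>\<omega>. Y \<omega> * rt k s \<omega>) \<le> B * expectation Y"
proof -
  have "expectation (\<lambda>\<omega>. Y \<omega> * rt k s \<omega>) \<le> expectation (\<lambda>\<omega>. B * Y \<omega>)"
  proof (rule integral_mono[OF weighted_rt_integrable[OF k s weight_bdd[OF Y]] integrable_mult_right[OF bdd_rv_integrable[OF weight_bdd[OF Y]]]])
    show "Y \<omega> * rt k s \<omega> \<le> B * Y \<omega>" if "\<omega> \<in> space M" for \<omega>
      using supp[OF that] weight_ge_0[OF Y that] by (cases "Y \<omega> = 0") (simp_all add: mult.commute)
  qed
  then show ?thesis by simp
qed

text \<open>
  Over a short cell the largest expected count bounds itself: it is at most the cell length times
  the initial rate plus a contraction of itself.
\<close>

lemma cell_upper: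
  assumes s: "0 \<le> s" and h: "0 \<le> h" "h * (real d * w_max) \<le> 1/2"
    and Y: "weight (\<F> s) Y" and B: "0 \<le> B"
    and supp: "\<And>\<omega> k. \<omega> \<in> space M \<Longrightarrow> Y \<omega> \<noteq> 0 \<Longrightarrow> k \<in> {1..n} \<Longrightarrow> rt k s \<omega> \<le> B"
    and k: "k \<in> {1..n}"
  shows "expectation (\<lambda>\<omega>. Y \<omega> * real (cnt k s (s + h) \<omega>)) \<le> 2 * h * (B + L * \<mu>_max * h) * expectation Y"
    and "s \<le> u \<Longrightarrow> u \<le> s + h \<Longrightarrow> expectation (\<lambda>\<omega>. Y \<omega> * rt k u \<omega>)
      \<le> expectation (\<lambda>\<omega>. Y \<omega> * rt k s \<omega>) + (L * \<mu>_max * h + real d * w_max * (2 * h * (B + L * \<mu>_max * h))) * expectation Y"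
proof -
  have YM: "weight M Y" using weight_filtration_M[OF Y] .
  have EY: "0 \<le> expectation Y" using expectation_nonneg_weight[OF YM] .
  let ?c = "\<lambda>k. expectation (\<lambda>\<omega>. Y \<omega> * real (cnt k s (s + h) \<omega>))"
  define m where "m = Max (?c ` {1..n})"
  have fin: "finite (?c ` {1..n})" "?c ` {1..n} \<noteq> {}" using n_pos by auto
  have cm: "?c j \<le> m" if "j \<in> {1..n}" for j unfolding m_def using fin that by (intro Max_ge) auto
  have c0: "0 \<le> ?c j" for j
    by (rule Bochner_Integration.integral_nonneg) (use weight_ge_0[OF YM] in auto)
  have m0: "0 \<le> m" using cm[OF k] c0[of k] by linarith
  have row: "(\<Sum>j=1..n. w k j * expectation (\<lambda>\<omega>. Y \<omega> * real (cnt j s u \<omega>))) \<le> real d * w_max * m"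
    if k: "k \<in> {1..n}" and u: "s \<le> u" "u \<le> s + h" for k u
  proof -
    have "(\<Sum>j=1..n. w k j * expectation (\<lambda>\<omega>. Y \<omega> * real (cnt j s u \<omega>))) \<le> (\<Sum>j=1..n. w k j * m)"
    proof (intro sum_mono mult_left_mono)
      fix j assume j: "j \<in> {1..n}"
      have "expectation (\<lambda>\<omega>. Y \<omega> * real (cnt j s u \<omega>)) \<le> ?c j"
      proof (rule integral_mono[OF weighted_cnt_integrable[OF j s u(1) weight_bdd[OF YM]] weighted_cnt_integrable[OF j s _ weight_bdd[OF YM]]])
        show "Y \<omega> * real (cnt j s u \<omega>) \<le> Y \<omega> * real (cnt j s (s + h) \<omega>)" if "\<omega> \<in> space M" for \<omega>
          using cnt_mono[OF j that s order_refl u(2)] weight_ge_0[OF YM that] by (intro mult_left_mono) auto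
      qed (use h in simp)
      then show "expectation (\<lambda>\<omega>. Y \<omega> * real (cnt j s u \<omega>)) \<le> m" using cm[OF j] by linarith
      show "0 \<le> w k j" using weight_range k j by auto
    qed
    also have "\<dots> = (\<Sum>j=1..n. w k j) * m" by (simp add: sum_distrib_right)
    also have "\<dots> \<le> real d * w_max * m" by (rule mult_right_mono[OF row_sum_le[OF k] m0])
    finally show ?thesis .
  qed
  have r: "expectation (\<lambda>\<omega>. Y \<omega> * rt k u \<omega>) \<le> expectation (\<lambda>\<omega>. Y \<omega> * rt k s \<omega>) + (L * \<mu>_max * h) * expectation Y + real d * w_max * m"
    if k: "k \<in> {1..n}" and u: "s \<le> u" "u \<le> s + h" for k u
  proof -
    have "(L * \<mu>_max * (u - s)) * expectation Y \<le> (L * \<mu>_max * h) * expectation Y"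
      using u const_pos by (intro mult_right_mono mult_left_mono EY) auto
    then show ?thesis using expectation_rt_upper[OF k s u(1) YM] row[OF k u] by linarith
  qed
  let ?b = "(B + L * \<mu>_max * h) * expectation Y"
  have cb: "?c k \<le> (?b + real d * w_max * m) * h" if k: "k \<in> {1..n}" for k
  proof -
    have "?c k \<le> (?b + real d * w_max * m) * ((s + h) - s)"
    proof (rule expectation_cnt_upper[OF k s _ Y])
      fix u assume u: "s \<le> u" "u < s + h"
      have "expectation (\<lambda>\<omega>. Y \<omega> * rt k s \<omega>) \<le> B * expectation Y"
        by (rule expectation_rt_le[OF k s YM supp[OF _ _ k]])
      then show "expectation (\<lambda>\<omega>. Y \<omega> * rt k u \<omega>) \<le> ?b + real d * w_max * m"
        using r[OF k u(1)] u(2) by (simp add: distrib_right)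
    qed (use h in simp)
    then show ?thesis by simp
  qed
  have "m \<le> (?b + real d * w_max * m) * h"
    unfolding m_def using fin cb by (intro Max.boundedI) (auto simp: m_def)
  also have "\<dots> = h * ?b + (h * (real d * w_max)) * m" by (simp add: algebra_simps)
  also have "\<dots> \<le> h * ?b + (1/2) * m" using h(2) m0 by (intro add_left_mono mult_right_mono)
  finally have mb: "m \<le> 2 * h * (B + L * \<mu>_max * h) * expectation Y" by (simp add: algebra_simps)
  show "?c k \<le> 2 * h * (B + L * \<mu>_max * h) * expectation Y" using cm[OF k] mb by linarith
  assume u: "s \<le> u" "u \<le> s + h"
  have "real d * w_max * m \<le> real d * w_max * (2 * h * (B + L * \<mu>_max * h) * expectation Y)"
    using mb const_pos by (intro mult_left_mono) auto
  then show "expectation (\<lambda>\<omega>. Y \<omega> * rt k u \<omega>)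
      \<le> expectation (\<lambda>\<omega>. Y \<omega> * rt k s \<omega>) + (L * \<mu>_max * h + real d * w_max * (2 * h * (B + L * \<mu>_max * h))) * expectation Y"
    using r[OF k u] by (simp add: algebra_simps)
qed

section \<open>Separating the events of a cell by refinement\<close>

definition call :: "real \<Rightarrow> real \<Rightarrow> 'a \<Rightarrow> nat" where
  "call s t \<omega> = (\<Sum>i=1..n. cnt i s t \<omega>)"

lemma call_filtration:
  assumes "0 \<le> s" "s \<le> u" "u \<le> t"
  shows "call s u \<in> measurable (\<F> t) (count_space UNIV)"
  unfolding call_def by (rule measurable_sum_nat) (use cnt_filtration assms in auto)

lemma pred_call:
  assumes "0 \<le> s" "s \<le> u" "u \<le> t"
  shows "Measurable.pred (\<F> t) (\<lambda>\<omega>. P (call s u \<omega>))"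
  by (rule measurable_compose[OF call_filtration[OF assms]]) simp

lemma call_split:
  assumes "\<omega> \<in> space M" "0 \<le> s" "s \<le> u" "u \<le> t"
  shows "call s t \<omega> = call s u \<omega> + call u t \<omega>"
  unfolding call_def sum.distrib[symmetric] by (rule sum.cong[OF refl cnt_split]) (use assms in auto)

lemma cnt_le_call: "i \<in> {1..n} \<Longrightarrow> cnt i s t \<omega> \<le> call s t \<omega>"
  unfolding call_def by (rule member_le_sum) auto

lemma weighted_cnt_le_call:
  assumes k: "k \<in> {1..n}"
  shows "(\<Sum>j=1..n. w k j * real (cnt j s u \<omega>)) \<le> w_max * real (call s u \<omega>)"
proof -
  have "(\<Sum>j=1..n. w k j * real (cnt j s u \<omega>)) \<le> (\<Sum>j=1..n. w_max * real (cnt j s u \<omega>))"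
    by (intro sum_mono mult_right_mono) (use weight_range k in auto)
  then show ?thesis by (simp add: call_def sum_distrib_left)
qed

text \<open>Events of different nodes never coincide on such a path, so the finitely many events
  have a positive smallest distance. A mesh below it isolates them.\<close>

lemma eventually_grid_separates:
  assumes dis: "disjoint_family_on (\<lambda>i. E i \<omega>) {1..n}" and om: "\<omega> \<in> space M" and s: "0 \<le> s" "s \<le> t"
  shows "\<forall>\<^sub>F m in sequentially. \<forall>p<m. call (grid s t m p) (grid s t m (Suc p)) \<omega> \<le> 1"
proof -
  let ?U = "\<lambda>u v. \<Union>i\<in>{1..n}. evs i u v \<omega>"
  have card: "call u v \<omega> = card (?U u v)" if "0 \<le> u" for u v
    unfolding call_def cnt_def
  proof (rule card_UN_disjoint[symmetric])
    show "\<forall>i\<in>{1..n}. finite (evs i u v \<omega>)" using finite_evs[OF _ om that] by blast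
    show "\<forall>i\<in>{1..n}. \<forall>j\<in>{1..n}. i \<noteq> j \<longrightarrow> evs i u v \<omega> \<inter> evs j u v \<omega> = {}"
      using dis unfolding disjoint_family_on_def evs_def by blast
  qed simp
  have fin: "finite (?U s t)" using finite_evs[OF _ om s(1)] by auto
  define G where "G = (\<lambda>(x, y). \<bar>x - y\<bar>) ` ((?U s t \<times> ?U s t) \<inter> {(x, y). x \<noteq> y})"
  have finG: "finite G" unfolding G_def using fin by (intro finite_imageI finite_Int) auto
  \<comment> \<open>The 1 stands in when there are fewer than two events.\<close>
  define g where "g = Min (insert 1 G)"
  have g: "0 < g" unfolding g_def using finG by (subst Min_gr_iff) (auto simp: G_def)
  have gap: "g \<le> \<bar>x - y\<bar>" if "x \<in> ?U s t" "y \<in> ?U s t" "x \<noteq> y" for x y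
    unfolding g_def using finG that by (intro Min_le) (auto simp: G_def)
  obtain m0 :: nat where m0: "(t - s) / g < real m0" using reals_Archimedean2 by blast
  show ?thesis unfolding eventually_sequentially
  proof (intro exI[of _ "Suc m0"] allI impI)
    fix m p assume m: "Suc m0 \<le> m" and p: "p < m"
    have "(t - s) / g < real m" using m m0 by linarith
    then have sm: "(t - s) / real m < g" using g m by (simp add: field_simps)
    have g0: "0 \<le> grid s t m p" using grid_bounds[OF s(2), of p m] p s by simp
    show "call (grid s t m p) (grid s t m (Suc p)) \<omega> \<le> 1"
    proof (rule ccontr)
      assume "\<not> ?thesis"
      then have "\<not> card (?U (grid s t m p) (grid s t m (Suc p))) \<le> Suc 0" using card[OF g0] by simp
      moreover have "finite (?U (grid s t m p) (grid s t m (Suc p)))" using finite_evs[OF _ om g0] by auto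
      ultimately obtain x y where xy: "x \<in> ?U (grid s t m p) (grid s t m (Suc p))" "y \<in> ?U (grid s t m p) (grid s t m (Suc p))" "x \<noteq> y"
        using card_le_Suc0_iff_eq by blast
      then have "\<bar>x - y\<bar> \<le> grid s t m (Suc p) - grid s t m p" by (auto simp: evs_def)
      then have "\<bar>x - y\<bar> < g" using sm by (simp add: grid_step)
      moreover have "x \<in> ?U s t" "y \<in> ?U s t"
        using xy grid_bounds[OF s(2), of p m] grid_bounds[OF s(2), of "Suc p" m] p by (fastforce simp: evs_def)+
      ultimately show False using gap xy(3) by fastforce
    qed
  qed
qed

definition crowded :: "real \<Rightarrow> real \<Rightarrow> nat \<Rightarrow> 'a \<Rightarrow> bool" where
  "crowded s t m \<omega> \<longleftrightarrow> (\<exists>p\<in>{..<m}. 2 \<le> call (grid s t m p) (grid s t m (Suc p)) \<omega>)"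

lemma pred_crowded:
  assumes "0 \<le> s" "s \<le> t"
  shows "Measurable.pred M (crowded s t m)"
  unfolding crowded_def
proof (rule pred_intros_finite(4))
  fix p assume "p \<in> {..<m}"
  have "Measurable.pred (\<F> (grid s t m (Suc p))) (\<lambda>\<omega>. 2 \<le> call (grid s t m p) (grid s t m (Suc p)) \<omega>)"
    using pred_call[of "grid s t m p" "grid s t m (Suc p)" "grid s t m (Suc p)" "\<lambda>x. 2 \<le> x"]
      grid_mono[OF assms(2), of 0 p m] grid_mono[OF assms(2), of p "Suc p" m] assms by simp
  then show "Measurable.pred M (\<lambda>\<omega>. 2 \<le> call (grid s t m p) (grid s t m (Suc p)) \<omega>)"
    by (rule measurable_from_subalg[OF filtration_subalgebra])
qed simp

text \<open>Dominated convergence along the refining grids. The factor \<open>X\<close> allows for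
  weighted counts, which are integrable but not bounded.\<close>

lemma crowded_vanishes:
  assumes s: "0 \<le> s" "s \<le> t" and X: "integrable M (X :: 'a \<Rightarrow> real)"
  shows "(\<lambda>m. expectation (\<lambda>\<omega>. X \<omega> * of_bool (crowded s t m \<omega>))) \<longlonglongrightarrow> 0"
proof -
  have Xm [measurable]: "X \<in> borel_measurable M" using X by auto
  have "(\<lambda>m. expectation (\<lambda>\<omega>. X \<omega> * of_bool (crowded s t m \<omega>))) \<longlonglongrightarrow> expectation (\<lambda>_. 0)"
  proof (rule integral_dominated_convergence)
    show "(\<lambda>\<omega>. X \<omega> * of_bool (crowded s t m \<omega>)) \<in> borel_measurable M" for m
      using bdd_rv_measurable[OF bdd_rv_of_bool[OF pred_crowded[OF s, of m]]] by measurable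
    show "integrable M (\<lambda>\<omega>. norm (X \<omega>))" using X by simp
    show "AE \<omega> in M. norm (X \<omega> * of_bool (crowded s t m \<omega>)) \<le> norm (X \<omega>)" for m
      by (rule AE_I2) (simp add: abs_mult mult_left_le)
    show "AE \<omega> in M. (\<lambda>m. X \<omega> * of_bool (crowded s t m \<omega>)) \<longlonglongrightarrow> 0"
      using no_simultaneous AE_space
    proof eventually_elim
      case (elim \<omega>)
      have "\<forall>\<^sub>F m in sequentially. X \<omega> * of_bool (crowded s t m \<omega>) = 0"
        using eventually_grid_separates[OF elim s]
      proof eventually_elim
        case (elim m)
        then have "\<not> crowded s t m \<omega>" unfolding crowded_def by (force simp: not_le)
        then show ?case by simp
      qed
      then show ?case by (rule tendsto_eventually)
    qed
  qed simp
  then show ?thesis by simp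
qed

lemma call_upper:
  assumes s: "0 \<le> s" and h: "0 \<le> h" "h * (real d * w_max) \<le> 1/2"
    and Y: "weight (\<F> s) Y" and B: "0 \<le> B"
    and supp: "\<And>\<omega> k. \<omega> \<in> space M \<Longrightarrow> Y \<omega> \<noteq> 0 \<Longrightarrow> k \<in> {1..n} \<Longrightarrow> rt k s \<omega> \<le> B"
  shows "integrable M (\<lambda>\<omega>. Y \<omega> * real (call s (s + h) \<omega>))"
    and "expectation (\<lambda>\<omega>. Y \<omega> * real (call s (s + h) \<omega>)) \<le> real n * (2 * h * (B + L * \<mu>_max * h)) * expectation Y"
proof -
  have YM: "bdd_rv M Y" using weight_bdd[OF weight_filtration_M[OF Y]] .
  have sh: "s \<le> s + h" using h by simp
  have eq: "(\<lambda>\<omega>. Y \<omega> * real (call s (s + h) \<omega>)) = (\<lambda>\<omega>. \<Sum>i=1..n. Y \<omega> * real (cnt i s (s + h) \<omega>))"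
    by (simp add: call_def sum_distrib_left)
  have i: "integrable M (\<lambda>\<omega>. Y \<omega> * real (cnt i s (s + h) \<omega>))" if "i \<in> {1..n}" for i
    by (rule weighted_cnt_integrable[OF that s sh YM])
  show "integrable M (\<lambda>\<omega>. Y \<omega> * real (call s (s + h) \<omega>))"
    unfolding eq by (rule Bochner_Integration.integrable_sum[OF i])
  have "expectation (\<lambda>\<omega>. Y \<omega> * real (call s (s + h) \<omega>)) = (\<Sum>i=1..n. expectation (\<lambda>\<omega>. Y \<omega> * real (cnt i s (s + h) \<omega>)))"
    unfolding eq by (rule Bochner_Integration.integral_sum[OF i])
  also have "\<dots> \<le> (\<Sum>i=1..n. 2 * h * (B + L * \<mu>_max * h) * expectation Y)"
    by (rule sum_mono, rule cell_upper(1)[OF s h Y B supp])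
  finally show "expectation (\<lambda>\<omega>. Y \<omega> * real (call s (s + h) \<omega>)) \<le> real n * (2 * h * (B + L * \<mu>_max * h)) * expectation Y"
    by simp
qed

lemma weighted_pred_call:
  assumes "weight (\<F> s) Y" "s \<le> t" "0 \<le> u" "u \<le> v" "v \<le> t"
  shows "weight (\<F> t) (\<lambda>\<omega>. Y \<omega> * of_bool (P (call u v \<omega>)))"
  by (rule weight_mult[OF weight_filtration_mono[OF assms(2,1)] weight_of_bool[OF pred_call[OF assms(3-5)]]])

lemma call_pos_upper:
  assumes s: "0 \<le> s" and h: "0 \<le> h" "h * (real d * w_max) \<le> 1/2"
    and Y: "weight (\<F> s) Y" and B: "0 \<le> B"
    and supp: "\<And>\<omega> k. \<omega> \<in> space M \<Longrightarrow> Y \<omega> \<noteq> 0 \<Longrightarrow> k \<in> {1..n} \<Longrightarrow> rt k s \<omega> \<le> B"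
  shows "expectation (\<lambda>\<omega>. Y \<omega> * of_bool (1 \<le> call s (s + h) \<omega>)) \<le> real n * (2 * h * (B + L * \<mu>_max * h)) * expectation Y"
proof -
  have sh: "s \<le> s + h" using h by simp
  have "expectation (\<lambda>\<omega>. Y \<omega> * of_bool (1 \<le> call s (s + h) \<omega>)) \<le> expectation (\<lambda>\<omega>. Y \<omega> * real (call s (s + h) \<omega>))"
  proof (rule integral_mono[OF bdd_rv_integrable[OF weight_bdd[OF weight_filtration_M[OF weighted_pred_call[OF Y sh s sh order_refl]]]] call_upper(1)[OF s h Y B supp]])
    show "Y \<omega> * of_bool (1 \<le> call s (s + h) \<omega>) \<le> Y \<omega> * real (call s (s + h) \<omega>)" if "\<omega> \<in> space M" for \<omega>
      using weight_ge_0[OF weight_filtration_M[OF Y] that] by (intro mult_left_mono) (auto simp: of_bool_def)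
  qed
  then show ?thesis using call_upper(2)[OF s h Y B supp] by linarith
qed

text \<open>Rates control the next event, not two at once, so the cell is refined. If no subcell is
  crowded, the second event falls into a subcell entered with exactly one event so far, where every
  rate is at most its initial bound plus drift plus one weight. Summation over the subcells gives
  the bound for a first event times the bound for the events that follow it; the crowded remainder
  tends to 0 under refinement.\<close>

lemma cell_two:
  assumes s: "0 \<le> s" and h: "0 \<le> h" "h * (real d * w_max) \<le> 1/2"
    and Y: "weight (\<F> s) Y" and B: "0 \<le> B"
    and supp: "\<And>\<omega> k. \<omega> \<in> space M \<Longrightarrow> Y \<omega> \<noteq> 0 \<Longrightarrow> k \<in> {1..n} \<Longrightarrow> rt k s \<omega> \<le> B"
  shows "expectation (\<lambda>\<omega>. Y \<omega> * of_bool (2 \<le> call s (s + h) \<omega>))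
    \<le> (real n * (2 * h * (B + 2 * L * \<mu>_max * h + w_max))) * (real n * (2 * h * (B + L * \<mu>_max * h))) * expectation Y"
proof (rule field_le_epsilon)
  fix e :: real assume e: "0 < e"
  have sh: "s \<le> s + h" using h by simp
  have YM: "bdd_rv M Y" and Yw: "weight M Y" using weight_bdd[OF weight_filtration_M[OF Y]] weight_filtration_M[OF Y] by auto
  have EY: "0 \<le> expectation Y" using expectation_nonneg_weight[OF Yw] .
  have "\<forall>\<^sub>F m in sequentially. expectation (\<lambda>\<omega>. Y \<omega> * of_bool (crowded s (s + h) m \<omega>)) < e"
    using crowded_vanishes[OF s sh bdd_rv_integrable[OF YM]] e by (rule order_tendstoD)
  then have "\<forall>\<^sub>F m in sequentially. expectation (\<lambda>\<omega>. Y \<omega> * of_bool (crowded s (s + h) m \<omega>)) < e \<and> 0 < m"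
    using eventually_gt_at_top[of 0] by (rule eventually_conj)
  then obtain m where m: "expectation (\<lambda>\<omega>. Y \<omega> * of_bool (crowded s (s + h) m \<omega>)) < e" "0 < m"
    by (auto simp: eventually_sequentially)
  let ?g = "grid s (s + h) m" and ?D = "h / real m"
  have g0: "0 \<le> ?g p" "?g p \<le> ?g (Suc p)" "s \<le> ?g p" for p
    using grid_mono[OF sh, of 0 p m] grid_mono[OF sh, of p "Suc p" m] s by auto
  have gt: "?g p \<le> s + h" if "p \<le> m" for p using grid_bounds[OF sh that] by simp
  have gS: "?g (Suc p) = ?g p + ?D" for p using grid_step[of s "s + h" m p] by simp
  have D: "0 \<le> ?D" "?D \<le> h" "?D * (real d * w_max) \<le> 1/2"
  proof -
    show "0 \<le> ?D" using h by simp
    show Dh: "?D \<le> h" using m(2) h by (simp add: divide_le_eq mult_le_cancel_left1)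
    have "?D * (real d * w_max) \<le> h * (real d * w_max)" using Dh const_pos by (intro mult_right_mono) auto
    then show "?D * (real d * w_max) \<le> 1/2" using h(2) by linarith
  qed
  let ?B2 = "B + 2 * L * \<mu>_max * h + w_max" and ?Bk = "B + L * \<mu>_max * h"
  have Lm: "0 \<le> L * \<mu>_max * h" using const_pos h by simp
  let ?Z = "\<lambda>p \<omega>. Y \<omega> * of_bool (call s (?g p) \<omega> = 1)"
  have Z: "weight (\<F> (?g p)) (?Z p)" for p
    by (rule weighted_pred_call[OF Y g0(3) s g0(3) order_refl])
  have EZ: "expectation (?Z p) \<le> real n * (2 * h * ?Bk) * expectation Y" if "p < m" for p
  proof -
    have "expectation (?Z p) \<le> expectation (\<lambda>\<omega>. Y \<omega> * of_bool (1 \<le> call s (s + h) \<omega>))"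
    proof (rule expectation_mono_bdd)
      show "bdd_rv M (?Z p)" using weight_bdd[OF weight_filtration_M[OF Z]] .
      show "bdd_rv M (\<lambda>\<omega>. Y \<omega> * of_bool (1 \<le> call s (s + h) \<omega>))"
        using weight_bdd[OF weight_filtration_M[OF weighted_pred_call[OF Y sh s sh order_refl]]] .
      show "?Z p \<omega> \<le> Y \<omega> * of_bool (1 \<le> call s (s + h) \<omega>)" if om: "\<omega> \<in> space M" for \<omega>
        using call_split[OF om s g0(3)[of p] gt[of p]] weight_ge_0[OF Yw om] \<open>p < m\<close> by (auto simp: of_bool_def)
    qed
    then show ?thesis using call_pos_upper[OF s h Y B supp] by linarith
  qed
  have sup2: "rt k (?g p) \<omega> \<le> B + L * \<mu>_max * h + w_max"
    if om: "\<omega> \<in> space M" and z: "?Z p \<omega> \<noteq> 0" and k: "k \<in> {1..n}" and p: "p < m" for \<omega> k p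
  proof -
    have "L * \<mu>_max * (?g p - s) \<le> L * \<mu>_max * h" using gt[of p] p const_pos by (intro mult_left_mono) auto
    moreover have "rt k s \<omega> \<le> B" using supp[OF om _ k] z by auto
    moreover have "(\<Sum>j=1..n. w k j * real (cnt j s (?g p) \<omega>)) \<le> w_max * real (call s (?g p) \<omega>)"
      by (rule weighted_cnt_le_call[OF k])
    moreover have "call s (?g p) \<omega> = 1" using z by (auto split: if_splits)
    ultimately show ?thesis using rt_upper[OF k om s g0(3)[of p]] by simp
  qed
  have iZ: "integrable M (\<lambda>\<omega>. ?Z p \<omega> * real (call (?g p) (?g (Suc p)) \<omega>))"
    and cell: "expectation (\<lambda>\<omega>. ?Z p \<omega> * real (call (?g p) (?g (Suc p)) \<omega>)) \<le> real n * (2 * ?D * ?B2) * (real n * (2 * h * ?Bk) * expectation Y)"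
    if p: "p < m" for p
  proof -
    have B': "0 \<le> B + L * \<mu>_max * h + w_max" using B Lm const_pos by simp
    show "integrable M (\<lambda>\<omega>. ?Z p \<omega> * real (call (?g p) (?g (Suc p)) \<omega>))"
      unfolding gS by (rule call_upper(1)[OF g0(1) D(1,3) Z B' sup2[OF _ _ _ p]])
    have "expectation (\<lambda>\<omega>. ?Z p \<omega> * real (call (?g p) (?g (Suc p)) \<omega>))
      \<le> real n * (2 * ?D * (B + L * \<mu>_max * h + w_max + L * \<mu>_max * ?D)) * expectation (?Z p)"
      unfolding gS by (rule call_upper(2)[OF g0(1) D(1,3) Z B' sup2[OF _ _ _ p]])
    also have "\<dots> \<le> real n * (2 * ?D * ?B2) * (real n * (2 * h * ?Bk) * expectation Y)"
    proof (intro mult_mono mult_left_mono EZ p)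
      have "L * \<mu>_max * ?D \<le> L * \<mu>_max * h" using D(2) const_pos by (intro mult_left_mono) auto
      then show "B + L * \<mu>_max * h + w_max + L * \<mu>_max * ?D \<le> ?B2" by simp
      show "0 \<le> real n * (2 * ?D * ?B2)" using D(1) h(1) B Lm const_pos by (intro mult_nonneg_nonneg add_nonneg_nonneg) auto
      show "0 \<le> expectation (?Z p)" using expectation_nonneg_weight[OF weight_filtration_M[OF Z]] .
    qed (use D B Lm h const_pos in \<open>auto intro!: mult_nonneg_nonneg add_nonneg_nonneg divide_nonneg_nonneg\<close>)
    finally show "expectation (\<lambda>\<omega>. ?Z p \<omega> * real (call (?g p) (?g (Suc p)) \<omega>)) \<le> real n * (2 * ?D * ?B2) * (real n * (2 * h * ?Bk) * expectation Y)" .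
  qed
  have bcr: "bdd_rv M (\<lambda>\<omega>. Y \<omega> * of_bool (crowded s (s + h) m \<omega>))"
    by (rule bdd_rv_mult[OF YM bdd_rv_of_bool[OF pred_crowded[OF s sh]]])
  have "expectation (\<lambda>\<omega>. Y \<omega> * of_bool (2 \<le> call s (s + h) \<omega>))
     \<le> expectation (\<lambda>\<omega>. (\<Sum>p<m. ?Z p \<omega> * real (call (?g p) (?g (Suc p)) \<omega>)) + Y \<omega> * of_bool (crowded s (s + h) m \<omega>))"
  proof (rule integral_mono)
    show "integrable M (\<lambda>\<omega>. Y \<omega> * of_bool (2 \<le> call s (s + h) \<omega>))"
      by (rule bdd_rv_integrable[OF weight_bdd[OF weight_filtration_M[OF weighted_pred_call[OF Y sh s sh order_refl]]]])
    show "integrable M (\<lambda>\<omega>. (\<Sum>p<m. ?Z p \<omega> * real (call (?g p) (?g (Suc p)) \<omega>)) + Y \<omega> * of_bool (crowded s (s + h) m \<omega>))"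
      by (intro Bochner_Integration.integrable_add Bochner_Integration.integrable_sum iZ bdd_rv_integrable[OF bcr]) simp
    fix \<omega> assume om: "\<omega> \<in> space M"
    have Y0: "0 \<le> Y \<omega>" using weight_ge_0[OF Yw om] .
    have nn: "0 \<le> (\<Sum>p<m. ?Z p \<omega> * real (call (?g p) (?g (Suc p)) \<omega>))"
      using Y0 by (intro sum_nonneg) auto
    show "Y \<omega> * of_bool (2 \<le> call s (s + h) \<omega>)
       \<le> (\<Sum>p<m. ?Z p \<omega> * real (call (?g p) (?g (Suc p)) \<omega>)) + Y \<omega> * of_bool (crowded s (s + h) m \<omega>)"
    proof (cases "2 \<le> call s (s + h) \<omega> \<and> \<not> crowded s (s + h) m \<omega>")
      case True
      \<comment> \<open>The grid point at which the total count first reaches 2; the subcell before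
        it holds the second event.\<close>
      define p where "p = (LEAST p. 2 \<le> call s (?g p) \<omega>)"
      have gm: "?g m = s + h" by (rule grid_m[OF m(2)])
      have ex: "2 \<le> call s (?g m) \<omega>" using True gm by simp
      have p2: "2 \<le> call s (?g p) \<omega>" unfolding p_def by (rule LeastI[of _ m]) (rule ex)
      have pm: "p \<le> m" unfolding p_def by (rule Least_le) (rule ex)
      have "p \<noteq> 0"
      proof
        assume "p = 0"
        then show False using p2 by (simp add: call_def cnt_def evs_def)
      qed
      then obtain r where r: "p = Suc r" by (cases p) auto
      have rm: "r < m" using pm r by simp
      have "\<not> 2 \<le> call s (?g r) \<omega>" using not_less_Least[of r "\<lambda>p. 2 \<le> call s (?g p) \<omega>"] r by (simp add: p_def)
      moreover have "call (?g r) (?g (Suc r)) \<omega> \<le> 1" using True rm unfolding crowded_def by (force simp: not_le)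
      moreover have "call s (?g (Suc r)) \<omega> = call s (?g r) \<omega> + call (?g r) (?g (Suc r)) \<omega>"
        by (rule call_split[OF om s g0(3) g0(2)])
      ultimately have c1: "call s (?g r) \<omega> = 1" "call (?g r) (?g (Suc r)) \<omega> = 1" using p2 r by auto
      have "?Z r \<omega> * real (call (?g r) (?g (Suc r)) \<omega>) \<le> (\<Sum>p<m. ?Z p \<omega> * real (call (?g p) (?g (Suc p)) \<omega>))"
        by (rule member_le_sum) (use rm Y0 in auto)
      moreover have "0 \<le> Y \<omega> * of_bool (crowded s (s + h) m \<omega>)" using Y0 by simp
      moreover have "?Z r \<omega> * real (call (?g r) (?g (Suc r)) \<omega>) = Y \<omega>" using c1 by simp
      moreover have "Y \<omega> * of_bool (2 \<le> call s (s + h) \<omega>) \<le> Y \<omega>" using Y0 by simp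
      ultimately show ?thesis by linarith
    next
      case False
      then have "Y \<omega> * of_bool (2 \<le> call s (s + h) \<omega>) \<le> Y \<omega> * of_bool (crowded s (s + h) m \<omega>)"
        using Y0 by (auto simp: of_bool_def)
      then show ?thesis using nn by linarith
    qed
  qed
  also have "\<dots> = (\<Sum>p<m. expectation (\<lambda>\<omega>. ?Z p \<omega> * real (call (?g p) (?g (Suc p)) \<omega>)))
      + expectation (\<lambda>\<omega>. Y \<omega> * of_bool (crowded s (s + h) m \<omega>))"
  proof -
    have i: "integrable M (\<lambda>\<omega>. \<Sum>p<m. ?Z p \<omega> * real (call (?g p) (?g (Suc p)) \<omega>))"
      by (intro Bochner_Integration.integrable_sum iZ) simp
    have "expectation (\<lambda>\<omega>. \<Sum>p<m. ?Z p \<omega> * real (call (?g p) (?g (Suc p)) \<omega>))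
      = (\<Sum>p<m. expectation (\<lambda>\<omega>. ?Z p \<omega> * real (call (?g p) (?g (Suc p)) \<omega>)))"
      by (rule Bochner_Integration.integral_sum) (rule iZ, simp)
    then show ?thesis using Bochner_Integration.integral_add[OF i bdd_rv_integrable[OF bcr]] by simp
  qed
  also have "\<dots> \<le> (\<Sum>p<m. real n * (2 * ?D * ?B2) * (real n * (2 * h * ?Bk) * expectation Y)) + e"
    using m(1) by (intro add_mono sum_mono cell) auto
  also have "(\<Sum>p<m. real n * (2 * ?D * ?B2) * (real n * (2 * h * ?Bk) * expectation Y))
     = (real n * (2 * h * ?B2)) * (real n * (2 * h * ?Bk)) * expectation Y"
    using m(2) by simp
  finally show "expectation (\<lambda>\<omega>. Y \<omega> * of_bool (2 \<le> call s (s + h) \<omega>))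
    \<le> (real n * (2 * h * ?B2)) * (real n * (2 * h * ?Bk)) * expectation Y + e" .
qed

lemma cell_fire_upper:
  assumes s: "0 \<le> s" and h: "0 \<le> h" "h * (real d * w_max) \<le> 1/2"
    and Y: "weight (\<F> s) Y" and B: "0 \<le> B"
    and supp: "\<And>\<omega> k. \<omega> \<in> space M \<Longrightarrow> Y \<omega> \<noteq> 0 \<Longrightarrow> k \<in> {1..n} \<Longrightarrow> rt k s \<omega> \<le> B"
    and k: "k \<in> {1..n}"
  shows "expectation (\<lambda>\<omega>. Y \<omega> * of_bool (1 \<le> cnt k s (s + h) \<omega>))
     \<le> h * expectation (\<lambda>\<omega>. Y \<omega> * rt k s \<omega>) + h * (L * \<mu>_max * h + real d * w_max * (2 * h * (B + L * \<mu>_max * h))) * expectation Y"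
proof -
  have sh: "s \<le> s + h" using h by simp
  have Yw: "weight M Y" using weight_filtration_M[OF Y] .
  let ?b = "expectation (\<lambda>\<omega>. Y \<omega> * rt k s \<omega>) + (L * \<mu>_max * h + real d * w_max * (2 * h * (B + L * \<mu>_max * h))) * expectation Y"
  have bb: "bdd_rv M (\<lambda>\<omega>. Y \<omega> * of_bool (1 \<le> cnt k s (s + h) \<omega>))"
  proof (rule bdd_rv_mult[OF weight_bdd[OF Yw] bdd_rv_of_bool])
    have "Measurable.pred (\<F> (s + h)) (\<lambda>\<omega>. 1 \<le> cnt k s (s + h) \<omega>)"
      by (rule measurable_compose[OF cnt_filtration[OF k s sh order_refl]]) simp
    then show "Measurable.pred M (\<lambda>\<omega>. 1 \<le> cnt k s (s + h) \<omega>)"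
      by (rule measurable_from_subalg[OF filtration_subalgebra])
  qed
  have "expectation (\<lambda>\<omega>. Y \<omega> * of_bool (1 \<le> cnt k s (s + h) \<omega>)) \<le> expectation (\<lambda>\<omega>. Y \<omega> * real (cnt k s (s + h) \<omega>))"
  proof (rule integral_mono[OF bdd_rv_integrable[OF bb] weighted_cnt_integrable[OF k s sh weight_bdd[OF Yw]]])
    show "Y \<omega> * of_bool (1 \<le> cnt k s (s + h) \<omega>) \<le> Y \<omega> * real (cnt k s (s + h) \<omega>)" if "\<omega> \<in> space M" for \<omega>
      using weight_ge_0[OF Yw that] by (intro mult_left_mono) (auto simp: of_bool_def)
  qed
  also have "\<dots> \<le> ?b * (s + h - s)"
    by (rule expectation_cnt_upper[OF k s sh Y], rule cell_upper(2)[OF s h Y B supp k]) auto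
  also have "\<dots> = h * expectation (\<lambda>\<omega>. Y \<omega> * rt k s \<omega>) + h * (L * \<mu>_max * h + real d * w_max * (2 * h * (B + L * \<mu>_max * h))) * expectation Y"
    by (simp add: algebra_simps)
  finally show ?thesis .
qed

text \<open>A count may exceed the indicator, so only events in subcells entered with no event of
  any node are counted; without crowding there is at most one of them. The loss is the initial rate
  on paths that already had an event in the cell, hence \<open>B\<close> times the probability of
  such an event.\<close>

lemma cell_fire_lower:
  assumes s: "0 \<le> s" and h: "0 \<le> h" "h * (real d * w_max) \<le> 1/2" and Lh: "L * h \<le> 1"
    and Y: "weight (\<F> s) Y" and B: "0 \<le> B"
    and supp: "\<And>\<omega> k. \<omega> \<in> space M \<Longrightarrow> Y \<omega> \<noteq> 0 \<Longrightarrow> k \<in> {1..n} \<Longrightarrow> rt k s \<omega> \<le> B"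
    and k: "k \<in> {1..n}"
  shows "h * expectation (\<lambda>\<omega>. Y \<omega> * rt k s \<omega>) - h * (L * h * B + B * (real n * (2 * h * (B + L * \<mu>_max * h)))) * expectation Y
     \<le> expectation (\<lambda>\<omega>. Y \<omega> * of_bool (1 \<le> cnt k s (s + h) \<omega>))"
proof (rule field_le_epsilon)
  fix e :: real assume e: "0 < e"
  have sh: "s \<le> s + h" using h by simp
  have YM: "bdd_rv M Y" and Yw: "weight M Y" using weight_bdd[OF weight_filtration_M[OF Y]] weight_filtration_M[OF Y] by auto
  have EY: "0 \<le> expectation Y" using expectation_nonneg_weight[OF Yw] .
  note iYc = weighted_cnt_integrable[OF k s sh YM]
  have "\<forall>\<^sub>F m in sequentially. expectation (\<lambda>\<omega>. Y \<omega> * real (cnt k s (s + h) \<omega>) * of_bool (crowded s (s + h) m \<omega>)) < e"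
    using crowded_vanishes[OF s sh iYc] e by (rule order_tendstoD)
  then have "\<forall>\<^sub>F m in sequentially. expectation (\<lambda>\<omega>. Y \<omega> * real (cnt k s (s + h) \<omega>) * of_bool (crowded s (s + h) m \<omega>)) < e \<and> 0 < m"
    using eventually_gt_at_top[of 0] by (rule eventually_conj)
  then obtain m where m: "expectation (\<lambda>\<omega>. Y \<omega> * real (cnt k s (s + h) \<omega>) * of_bool (crowded s (s + h) m \<omega>)) < e" "0 < m"
    by (auto simp: eventually_sequentially)
  let ?g = "grid s (s + h) m" and ?D = "h / real m"
  have g0: "0 \<le> ?g p" "?g p \<le> ?g (Suc p)" "s \<le> ?g p" for p
    using grid_mono[OF sh, of 0 p m] grid_mono[OF sh, of p "Suc p" m] s by auto
  have gt: "?g p \<le> s + h" if "p \<le> m" for p using grid_bounds[OF sh that] by simp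
  have D: "0 \<le> ?D" using h by simp
  let ?Z = "\<lambda>p \<omega>. Y \<omega> * of_bool (call s (?g p) \<omega> = 0)"
  have Z: "weight (\<F> (?g p)) (?Z p)" for p
    by (rule weighted_pred_call[OF Y g0(3) s g0(3) order_refl])
  have bZ: "bdd_rv M (?Z p)" for p using weight_bdd[OF weight_filtration_M[OF Z]] .
  let ?low = "expectation (\<lambda>\<omega>. Y \<omega> * rt k s \<omega>) - (L * h * B + B * (real n * (2 * h * (B + L * \<mu>_max * h)))) * expectation Y"
  have cell: "?low * ?D \<le> expectation (\<lambda>\<omega>. ?Z p \<omega> * real (cnt k (?g p) (?g (Suc p)) \<omega>))" if p: "p < m" for p
  proof -
    let ?X = "expectation (\<lambda>\<omega>. ?Z p \<omega> * rt k s \<omega>)"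
    have iX: "integrable M (\<lambda>\<omega>. ?Z p \<omega> * rt k s \<omega>)" by (rule weighted_rt_integrable[OF k s bZ])
    have X0: "0 \<le> ?X"
      by (rule Bochner_Integration.integral_nonneg) (use weight_ge_0[OF Yw] rt_nonneg[OF k _ s] in auto)
    have "(1 - L * h) * ?X * (?g (Suc p) - ?g p) \<le> expectation (\<lambda>\<omega>. ?Z p \<omega> * real (cnt k (?g p) (?g (Suc p)) \<omega>))"
    proof (rule expectation_cnt_lower[OF k g0(1,2) Z])
      show "0 \<le> (1 - L * h) * ?X" using Lh X0 by simp
      fix u assume u: "?g p \<le> u" "u < ?g (Suc p)"
      have su: "s \<le> u" "u \<le> s + h" using u g0(3)[of p] gt[of "Suc p"] p by auto
      have u0: "0 \<le> u" using su s by simp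
      have "expectation (\<lambda>\<omega>. (1 - L * h) * (?Z p \<omega> * rt k s \<omega>)) \<le> expectation (\<lambda>\<omega>. ?Z p \<omega> * rt k u \<omega>)"
      proof (rule integral_mono[OF integrable_mult_right[OF iX] weighted_rt_integrable[OF k u0 bZ]])
        fix \<omega> assume om: "\<omega> \<in> space M"
        have Lu: "L * (u - s) \<le> L * h" using su const_pos by (intro mult_left_mono) auto
        have sum0: "0 \<le> (\<Sum>j=1..n. w k j * real (cnt j s u \<omega>))"
          by (intro sum_nonneg mult_nonneg_nonneg) (use weight_range k in auto)
        have "(1 - L * h) * rt k s \<omega> \<le> (1 - L * (u - s)) * (rt k s \<omega> + (\<Sum>j=1..n. w k j * real (cnt j s u \<omega>)))"
          by (rule mult_mono) (use Lu Lh sum0 rt_nonneg[OF k om s] in auto)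
        also have "\<dots> \<le> rt k u \<omega>" by (rule rt_lower[OF k om s su(1)]) (use Lu Lh in simp)
        finally have "?Z p \<omega> * ((1 - L * h) * rt k s \<omega>) \<le> ?Z p \<omega> * rt k u \<omega>"
          using weight_ge_0[OF Yw om] by (intro mult_left_mono) auto
        then show "(1 - L * h) * (?Z p \<omega> * rt k s \<omega>) \<le> ?Z p \<omega> * rt k u \<omega>"
          by (simp only: mult.left_commute)
      qed
      then show "(1 - L * h) * ?X \<le> expectation (\<lambda>\<omega>. ?Z p \<omega> * rt k u \<omega>)" by simp
    qed
    moreover have "?g (Suc p) - ?g p = ?D" using grid_step[of s "s + h" m p] by simp
    moreover have "?low \<le> (1 - L * h) * ?X"
    proof -
      let ?P = "\<lambda>\<omega>. Y \<omega> * of_bool (1 \<le> call s (s + h) \<omega>)"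
      have bP: "bdd_rv M ?P"
        using weight_bdd[OF weight_filtration_M[OF weighted_pred_call[OF Y sh s sh order_refl]]] .
      have "expectation (\<lambda>\<omega>. Y \<omega> * rt k s \<omega>) \<le> expectation (\<lambda>\<omega>. ?Z p \<omega> * rt k s \<omega> + B * ?P \<omega>)"
      proof (rule integral_mono[OF weighted_rt_integrable[OF k s YM] Bochner_Integration.integrable_add[OF iX integrable_mult_right[OF bdd_rv_integrable[OF bP]]]])
        fix \<omega> assume om: "\<omega> \<in> space M"
        show "Y \<omega> * rt k s \<omega> \<le> ?Z p \<omega> * rt k s \<omega> + B * ?P \<omega>"
        proof (cases "Y \<omega> = 0 \<or> call s (?g p) \<omega> = 0")
          case True
          then show ?thesis using weight_ge_0[OF Yw om] B by auto
        next
          case False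
          then have "1 \<le> call s (s + h) \<omega>" using call_split[OF om s g0(3)[of p] gt[of p]] p by simp
          moreover have "Y \<omega> * rt k s \<omega> \<le> Y \<omega> * B"
            by (rule mult_left_mono[OF supp[OF om _ k] weight_ge_0[OF Yw om]]) (use False in auto)
          ultimately show ?thesis using False by (simp add: mult.commute)
        qed
      qed
      also have "\<dots> = ?X + B * expectation ?P"
        using Bochner_Integration.integral_add[OF iX integrable_mult_right[OF bdd_rv_integrable[OF bP], of B]] by simp
      also have "\<dots> \<le> ?X + B * (real n * (2 * h * (B + L * \<mu>_max * h)) * expectation Y)"
        using call_pos_upper[OF s h Y B supp] B by (intro add_left_mono mult_left_mono) auto
      finally have 1: "expectation (\<lambda>\<omega>. Y \<omega> * rt k s \<omega>) \<le> ?X + B * (real n * (2 * h * (B + L * \<mu>_max * h)) * expectation Y)" .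
      have "?X \<le> expectation (\<lambda>\<omega>. Y \<omega> * rt k s \<omega>)"
      proof (rule integral_mono[OF iX weighted_rt_integrable[OF k s YM]])
        show "?Z p \<omega> * rt k s \<omega> \<le> Y \<omega> * rt k s \<omega>" if om: "\<omega> \<in> space M" for \<omega>
          using weight_ge_0[OF Yw om] rt_nonneg[OF k om s] by (intro mult_right_mono) (auto simp: of_bool_def)
      qed
      also have "\<dots> \<le> B * expectation Y" by (rule expectation_rt_le[OF k s Yw supp[OF _ _ k]])
      finally have "L * h * ?X \<le> L * h * (B * expectation Y)" using const_pos h by (intro mult_left_mono) auto
      then show ?thesis using 1 by (simp add: algebra_simps)
    qed
    then have "?low * ?D \<le> (1 - L * h) * ?X * ?D" using D by (rule mult_right_mono)
    ultimately show ?thesis by simp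
  qed
  have bb: "bdd_rv M (\<lambda>\<omega>. Y \<omega> * of_bool (1 \<le> cnt k s (s + h) \<omega>))"
  proof (rule bdd_rv_mult[OF YM bdd_rv_of_bool])
    have "Measurable.pred (\<F> (s + h)) (\<lambda>\<omega>. 1 \<le> cnt k s (s + h) \<omega>)"
      by (rule measurable_compose[OF cnt_filtration[OF k s sh order_refl]]) simp
    then show "Measurable.pred M (\<lambda>\<omega>. 1 \<le> cnt k s (s + h) \<omega>)"
      by (rule measurable_from_subalg[OF filtration_subalgebra])
  qed
  have iZ: "integrable M (\<lambda>\<omega>. ?Z p \<omega> * real (cnt k (?g p) (?g (Suc p)) \<omega>))" for p
    by (rule weighted_cnt_integrable[OF k g0(1,2) bZ])
  have iC: "integrable M (\<lambda>\<omega>. Y \<omega> * real (cnt k s (s + h) \<omega>) * of_bool (crowded s (s + h) m \<omega>))"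
    using bdd_mult_integrable[OF bdd_rv_of_bool[OF pred_crowded[OF s sh]] iYc] by (simp add: mult.commute)
  have "h * expectation (\<lambda>\<omega>. Y \<omega> * rt k s \<omega>) - h * (L * h * B + B * (real n * (2 * h * (B + L * \<mu>_max * h)))) * expectation Y
      = ?low * h" by (simp add: algebra_simps)
  also have "\<dots> = (\<Sum>p<m. ?low * ?D)" using m(2) by simp
  also have "\<dots> \<le> (\<Sum>p<m. expectation (\<lambda>\<omega>. ?Z p \<omega> * real (cnt k (?g p) (?g (Suc p)) \<omega>)))"
    by (rule sum_mono) (rule cell, simp)
  also have "\<dots> = expectation (\<lambda>\<omega>. \<Sum>p<m. ?Z p \<omega> * real (cnt k (?g p) (?g (Suc p)) \<omega>))"
    by (rule Bochner_Integration.integral_sum[symmetric, OF iZ])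
  also have "\<dots> \<le> expectation (\<lambda>\<omega>. Y \<omega> * of_bool (1 \<le> cnt k s (s + h) \<omega>) + Y \<omega> * real (cnt k s (s + h) \<omega>) * of_bool (crowded s (s + h) m \<omega>))"
  proof (rule integral_mono[OF Bochner_Integration.integrable_sum[OF iZ] Bochner_Integration.integrable_add[OF bdd_rv_integrable[OF bb] iC]])
    fix \<omega> assume om: "\<omega> \<in> space M"
    have Y0: "0 \<le> Y \<omega>" using weight_ge_0[OF Yw om] .
    let ?c = "\<lambda>p. cnt k (?g p) (?g (Suc p)) \<omega>"
    have tot: "(\<Sum>p<m. real (?c p)) = real (cnt k s (s + h) \<omega>)"
      using isum_grid[OF k om s sh order_refl, of "\<lambda>_. 1" m] grid_m[OF m(2), of s "s + h"] by (simp add: isum_one)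
    have Zc: "(\<Sum>p<m. ?Z p \<omega> * real (?c p)) = Y \<omega> * (\<Sum>p<m. of_bool (call s (?g p) \<omega> = 0) * real (?c p))"
      by (simp only: sum_distrib_left mult.assoc)
    show "(\<Sum>p<m. ?Z p \<omega> * real (?c p)) \<le> Y \<omega> * of_bool (1 \<le> cnt k s (s + h) \<omega>) + Y \<omega> * real (cnt k s (s + h) \<omega>) * of_bool (crowded s (s + h) m \<omega>)"
    proof (cases "crowded s (s + h) m \<omega>")
      case True
      have "(\<Sum>p<m. of_bool (call s (?g p) \<omega> = 0) * real (?c p)) \<le> (\<Sum>p<m. real (?c p))"
        by (rule sum_mono) (auto simp: of_bool_def)
      then have "(\<Sum>p<m. ?Z p \<omega> * real (?c p)) \<le> Y \<omega> * real (cnt k s (s + h) \<omega>)"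
        unfolding Zc tot by (rule mult_left_mono[OF _ Y0])
      then show ?thesis using True Y0 by simp
    next
      case False
      have c1: "?c p \<le> 1" if "p < m" for p
      proof -
        have "call (?g p) (?g (Suc p)) \<omega> \<le> 1" using False that unfolding crowded_def by (force simp: not_le)
        then show ?thesis using cnt_le_call[OF k, of "?g p" "?g (Suc p)" \<omega>] by simp
      qed
      let ?S = "{p\<in>{..<m}. call s (?g p) \<omega> = 0 \<and> 1 \<le> ?c p}"
      have "(\<Sum>p<m. of_bool (call s (?g p) \<omega> = 0) * real (?c p)) = (\<Sum>p<m. if call s (?g p) \<omega> = 0 \<and> 1 \<le> ?c p then 1 else 0)"
      proof (rule sum.cong[OF refl])
        fix p assume "p \<in> {..<m}"
        then have "?c p \<le> 1" using c1 by simp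
        then show "of_bool (call s (?g p) \<omega> = 0) * real (?c p) = (if call s (?g p) \<omega> = 0 \<and> 1 \<le> ?c p then 1 else 0)"
          by (cases "?c p") auto
      qed
      also have "\<dots> = real (card ?S)" by (simp add: sum.If_cases Int_def)
      also have "\<dots> \<le> of_bool (1 \<le> cnt k s (s + h) \<omega>)"
      proof -
        have uniq: "p = r" if "p \<in> ?S" "r \<in> ?S" "p \<le> r" for p r
        proof (rule ccontr)
          assume "p \<noteq> r"
          then have pr: "Suc p \<le> r" using that by simp
          have "1 \<le> call (?g p) (?g (Suc p)) \<omega>" using that cnt_le_call[OF k, of "?g p" "?g (Suc p)" \<omega>] by simp
          moreover have "call s (?g (Suc p)) \<omega> = call s (?g p) \<omega> + call (?g p) (?g (Suc p)) \<omega>"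
            by (rule call_split[OF om s g0(3) g0(2)])
          moreover have "call s (?g r) \<omega> = call s (?g (Suc p)) \<omega> + call (?g (Suc p)) (?g r) \<omega>"
            by (rule call_split[OF om s g0(3) grid_mono[OF sh pr]])
          ultimately show False using that by simp
        qed
        have "\<forall>x\<in>?S. \<forall>y\<in>?S. x = y"
        proof (intro ballI)
          fix x y assume "x \<in> ?S" "y \<in> ?S"
          then show "x = y" using uniq[of x y] uniq[of y x] by (cases x y rule: linorder_le_cases) auto
        qed
        then have "card ?S \<le> 1" using card_le_Suc0_iff_eq[of ?S] by simp
        moreover have "1 \<le> cnt k s (s + h) \<omega>" if "?S \<noteq> {}"
        proof -
          obtain p where p: "p < m" "1 \<le> ?c p" using \<open>?S \<noteq> {}\<close> by blast
          have "?c p \<le> cnt k s (s + h) \<omega>" by (rule cnt_mono[OF k om s g0(3) gt]) (use p in simp)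
          then show ?thesis using p by simp
        qed
        ultimately show ?thesis by (cases "?S = {}") auto
      qed
      finally show ?thesis unfolding Zc using False Y0 by (simp add: mult_left_mono)
    qed
  qed
  also have "\<dots> = expectation (\<lambda>\<omega>. Y \<omega> * of_bool (1 \<le> cnt k s (s + h) \<omega>))
      + expectation (\<lambda>\<omega>. Y \<omega> * real (cnt k s (s + h) \<omega>) * of_bool (crowded s (s + h) m \<omega>))"
    by (rule Bochner_Integration.integral_add[OF bdd_rv_integrable[OF bb] iC])
  also have "\<dots> \<le> expectation (\<lambda>\<omega>. Y \<omega> * of_bool (1 \<le> cnt k s (s + h) \<omega>)) + e" using m(1) by simp
  finally show "h * expectation (\<lambda>\<omega>. Y \<omega> * rt k s \<omega>) - h * (L * h * B + B * (real n * (2 * h * (B + L * \<mu>_max * h)))) * expectation Y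
     \<le> expectation (\<lambda>\<omega>. Y \<omega> * of_bool (1 \<le> cnt k s (s + h) \<omega>)) + e" .
qed

section \<open>The process sampled on cells as a firing chain\<close>

definition rho :: "real \<Rightarrow> real \<Rightarrow> real" where
  "rho h B = (let C = B + 2 * L * \<mu>_max + w_max in
     h\<^sup>2 * (4 * (real n)\<^sup>2 * C\<^sup>2 + L * \<mu>_max + 2 * real d * w_max * C + L * B + 2 * real n * B * C))"

text \<open>Since \<open>h \<le> 1\<close>, the constant \<open>C\<close> dominates every rate
  expression in the cell estimates, and each of their error terms carries a factor
  \<open>h ^ 2\<close>. A unit of time has \<open>1 / h\<close> cells, so the accumulated error is
  of order \<open>h\<close>.\<close>

lemma rho_bounds:
  assumes h: "0 \<le> h" "h \<le> 1" and B: "0 \<le> B"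
  shows "0 \<le> rho h B"
    and "(real n * (2 * h * (B + 2 * L * \<mu>_max * h + w_max))) * (real n * (2 * h * (B + L * \<mu>_max * h))) \<le> rho h B"
    and "h * (L * \<mu>_max * h + real d * w_max * (2 * h * (B + L * \<mu>_max * h))) \<le> rho h B"
    and "h * (L * h * B + B * (real n * (2 * h * (B + L * \<mu>_max * h)))) \<le> rho h B"
proof -
  define C where "C = B + 2 * L * \<mu>_max + w_max"
  define a where "a = L * \<mu>_max"
  have a0: "0 \<le> a" using const_pos by (simp add: a_def)
  have C0: "0 \<le> C" using B const_pos a0 by (simp add: C_def a_def)
  have ah: "a * h \<le> a" using mult_left_mono[OF h(2) a0] by simp
  have c1: "B + 2 * L * \<mu>_max * h + w_max \<le> C" "B + L * \<mu>_max * h \<le> C"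
  proof -
    have "2 * L * \<mu>_max * h = 2 * (a * h)" "L * \<mu>_max * h = a * h" "C = B + 2 * a + w_max"
      by (simp_all add: a_def C_def)
    then show "B + 2 * L * \<mu>_max * h + w_max \<le> C" "B + L * \<mu>_max * h \<le> C"
      using ah a0 const_pos(7) by linarith+
  qed
  have c0: "0 \<le> B + L * \<mu>_max * h" using B h const_pos by simp
  have R: "rho h B = h\<^sup>2 * (4 * (real n)\<^sup>2 * C\<^sup>2) + h\<^sup>2 * (L * \<mu>_max) + h\<^sup>2 * (2 * real d * w_max * C) + h\<^sup>2 * (L * B) + h\<^sup>2 * (2 * real n * B * C)"
    unfolding rho_def Let_def C_def[symmetric] by (simp add: algebra_simps)
  have t: "0 \<le> h\<^sup>2 * (4 * (real n)\<^sup>2 * C\<^sup>2)" "0 \<le> h\<^sup>2 * (L * \<mu>_max)" "0 \<le> h\<^sup>2 * (2 * real d * w_max * C)"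
    "0 \<le> h\<^sup>2 * (L * B)" "0 \<le> h\<^sup>2 * (2 * real n * B * C)"
    using C0 B const_pos by auto
  show "0 \<le> rho h B" unfolding R using t by linarith
  have "(real n * (2 * h * (B + 2 * L * \<mu>_max * h + w_max))) * (real n * (2 * h * (B + L * \<mu>_max * h)))
     \<le> (real n * (2 * h * C)) * (real n * (2 * h * C))"
    by (intro mult_mono mult_left_mono c1) (use c0 C0 h in auto)
  also have "\<dots> = h\<^sup>2 * (4 * (real n)\<^sup>2 * C\<^sup>2)" by (simp add: power2_eq_square)
  finally show "(real n * (2 * h * (B + 2 * L * \<mu>_max * h + w_max))) * (real n * (2 * h * (B + L * \<mu>_max * h))) \<le> rho h B"
    unfolding R using t by linarith
  have "h * (L * \<mu>_max * h + real d * w_max * (2 * h * (B + L * \<mu>_max * h))) \<le> h * (L * \<mu>_max * h + real d * w_max * (2 * h * C))"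
    by (intro mult_left_mono add_left_mono c1) (use h const_pos in auto)
  also have "\<dots> = h\<^sup>2 * (L * \<mu>_max) + h\<^sup>2 * (2 * real d * w_max * C)" by (simp add: power2_eq_square algebra_simps)
  finally show "h * (L * \<mu>_max * h + real d * w_max * (2 * h * (B + L * \<mu>_max * h))) \<le> rho h B"
    unfolding R using t by linarith
  have "h * (L * h * B + B * (real n * (2 * h * (B + L * \<mu>_max * h)))) \<le> h * (L * h * B + B * (real n * (2 * h * C)))"
    by (intro mult_left_mono add_left_mono c1) (use h B in auto)
  also have "\<dots> = h\<^sup>2 * (L * B) + h\<^sup>2 * (2 * real n * B * C)" by (simp add: power2_eq_square algebra_simps)
  finally show "h * (L * h * B + B * (real n * (2 * h * (B + L * \<mu>_max * h)))) \<le> rho h B"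
    unfolding R using t by linarith
qed

definition ccount :: "real \<Rightarrow> nat \<Rightarrow> nat \<Rightarrow> 'a \<Rightarrow> nat" where
  "ccount h l i = cnt i (real l * h) (real (Suc l) * h)"

lemma ccount_sum:
  assumes "i \<in> {1..n}" "\<omega> \<in> space M" "0 \<le> h" "l \<le> l'"
  shows "(\<Sum>x=l..<l'. real (ccount h x i \<omega>)) = real (cnt i (real l * h) (real l' * h) \<omega>)"
  using assms(4)
proof (induction rule: dec_induct)
  case base then show ?case by (simp add: cnt_def evs_def)
next
  case (step m)
  have "cnt i (real l * h) (real (Suc m) * h) \<omega> = cnt i (real l * h) (real m * h) \<omega> + ccount h m i \<omega>"
    unfolding ccount_def by (rule cnt_split[OF assms(1,2)]) (use assms step in \<open>auto intro: mult_right_mono\<close>)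
  then show ?case using step by simp
qed

text \<open>The estimates for a single cell, started at \<open>real l * h\<close>, are the
  probabilistic assumptions of the chain with the common error \<open>rho h B\<close>; the pathwise
  bounds \<open>rt_upper\<close> and \<open>rt_lower\<close> are the remaining ones, with drift
  \<open>L * \<mu>_max\<close>.\<close>

lemma firing_chain_cells:
  assumes h: "0 < h" "h \<le> 1" "h * (real d * w_max) \<le> 1/2" and Lh: "L * h \<le> 1" and B: "0 \<le> B"
  shows "firing_chain M (\<lambda>l. \<F> (real l * h)) n (ccount h) (\<lambda>l i. rt i (real l * h)) w h (rho h B) (L * \<mu>_max) L w_max B d"
proof (intro firing_chain.intro filtered_prob_space.intro prob_space_axioms filtered_prob_space_axioms.intro firing_chain_axioms.intro)
  have h0: "0 \<le> h" using h by simp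
  have lh: "0 \<le> real l * h" for l using h by simp
  have Sl: "real (Suc l) * h = real l * h + h" for l by (simp add: algebra_simps)
  have lS: "real l * h \<le> real (Suc l) * h" for l by (rule mult_right_mono) (use h in auto)
  show "subalgebra M (\<F> (real l * h))" for l by (rule filtration_subalgebra)
  show "sets (\<F> (real l * h)) \<subseteq> sets (\<F> (real (Suc l) * h))" for l
    by (rule filtration_mono[OF lS])
  show "ccount h l i \<in> measurable (\<F> (real (Suc l) * h)) (count_space UNIV)" if "i \<in> {1..n}" for i l
    unfolding ccount_def by (rule cnt_filtration[OF that lh lS order_refl])
  show "rt i (real l * h) \<in> borel_measurable (\<F> (real l * h))" if "i \<in> {1..n}" for i l
    by (rule rt_filtration[OF that lh])
  show "0 \<le> rt i (real l * h) \<omega>" if "i \<in> {1..n}" "\<omega> \<in> space M" for i \<omega> l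
    by (rule rt_nonneg[OF that lh])
  show "0 \<le> w i j \<and> w i j \<le> w_max" if "i \<in> {1..n}" "j \<in> {1..n}" for i j
    by (rule weight_range[OF that])
  show "card {j\<in>{1..n}. w i j \<noteq> 0} \<le> d" if "i \<in> {1..n}" for i by (rule A.sparsity[OF that])
  show "0 \<le> h" "0 \<le> rho h B" "0 \<le> L * \<mu>_max" "0 \<le> L" "0 \<le> w_max" "0 \<le> B"
    using h B const_pos rho_bounds(1)[OF h0 h(2) B] by auto
  fix l Y assume Y: "weight (\<F> (real l * h)) Y"
    and supp: "\<And>\<omega> k. \<omega> \<in> space M \<Longrightarrow> Y \<omega> \<noteq> 0 \<Longrightarrow> k \<in> {1..n} \<Longrightarrow> rt k (real l * h) \<omega> \<le> B"
  have EY: "0 \<le> expectation Y" using expectation_nonneg_weight[OF weight_filtration_M[OF Y]] .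
  show "expectation (\<lambda>\<omega>. Y \<omega> * of_bool (2 \<le> (\<Sum>i=1..n. ccount h l i \<omega>))) \<le> rho h B * expectation Y"
    using cell_two[OF lh h0 h(3) Y B supp] mult_right_mono[OF rho_bounds(2)[OF h0 h(2) B] EY]
    unfolding ccount_def Sl call_def by linarith
  fix i assume i: "i \<in> {1..n}"
  show "expectation (\<lambda>\<omega>. Y \<omega> * of_bool (1 \<le> ccount h l i \<omega>))
        \<le> h * expectation (\<lambda>\<omega>. Y \<omega> * rt i (real l * h) \<omega>) + rho h B * expectation Y"
    using cell_fire_upper[OF lh h0 h(3) Y B supp i] mult_right_mono[OF rho_bounds(3)[OF h0 h(2) B] EY]
    unfolding ccount_def Sl by linarith
  show "h * expectation (\<lambda>\<omega>. Y \<omega> * rt i (real l * h) \<omega>) - rho h B * expectation Y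
        \<le> expectation (\<lambda>\<omega>. Y \<omega> * of_bool (1 \<le> ccount h l i \<omega>))"
    using cell_fire_lower[OF lh h0 h(3) Lh Y B supp i] mult_right_mono[OF rho_bounds(4)[OF h0 h(2) B] EY]
    unfolding ccount_def Sl by linarith
next
  have h0: "0 \<le> h" using h by simp
  fix l l' i :: nat and \<omega> assume l: "l \<le> l'" and i: "i \<in> {1..n}" and om: "\<omega> \<in> space M"
  have lh: "0 \<le> real l * h" "real l * h \<le> real l' * h" using h l by (auto intro: mult_right_mono)
  have d: "real l' * h - real l * h = h * real (l' - l)" using l by (simp add: of_nat_diff algebra_simps)
  have s: "(\<Sum>j=1..n. w i j * (\<Sum>x=l..<l'. real (ccount h x j \<omega>))) = (\<Sum>j=1..n. w i j * real (cnt j (real l * h) (real l' * h) \<omega>))"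
    by (rule sum.cong[OF refl]) (simp only: ccount_sum[OF _ om h0 l])
  show "rt i (real l' * h) \<omega> \<le> rt i (real l * h) \<omega> + L * \<mu>_max * (h * real (l' - l))
        + (\<Sum>j=1..n. w i j * (\<Sum>x=l..<l'. real (ccount h x j \<omega>)))"
    unfolding s d[symmetric] by (rule rt_upper[OF i om lh])
  assume Ll: "L * (h * real (l' - l)) \<le> 1"
  show "(1 - L * (h * real (l' - l))) * (rt i (real l * h) \<omega>
        + (\<Sum>j=1..n. w i j * (\<Sum>x=l..<l'. real (ccount h x j \<omega>)))) \<le> rt i (real l' * h) \<omega>"
    unfolding s d[symmetric] by (rule rt_lower[OF i om lh]) (use Ll d in simp)
qed

section \<open>Excitation inherited from earlier cells\<close>

definition cexc :: "real \<Rightarrow> nat \<Rightarrow> nat \<Rightarrow> nat \<Rightarrow> 'a \<Rightarrow> real" where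
  "cexc h m l i \<omega> = (if l < m then
     \<Sum>j=1..n. w i j * isum (\<phi> i j (real m * h)) j (real l * h) (real (Suc l) * h) \<omega> else 0)"

lemma cexc_eq: "l < m \<Longrightarrow> cexc h m l i \<omega>
  = (\<Sum>j=1..n. w i j * isum (\<phi> i j (real m * h)) j (real l * h) (real (Suc l) * h) \<omega>)"
  unfolding cexc_def by (rule if_P)

text \<open>Instance of \<open>not_alive_bound\<close> in which \<open>X\<close> is the excitation
  that reaches the start of cell \<open>m\<close> from the events of cell \<open>l\<close>, set to 0
  unless \<open>l < m\<close>. Its mean is governed by the weighted integral \<open>v\<close> of the
  kernels over cell \<open>l\<close>, and the sum of \<open>v\<close> over the cells is the quantity
  bounded by subcriticality. The constant \<open>\<mu>_max + real d * w_max\<close> covers the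
  baseline and the events at time 0, of which each node has at most one.\<close>

lemma not_alive_hawkes:
  assumes h: "0 < h" "h \<le> 1" "h * (real d * w_max) \<le> 1/2" and Lh: "L * h \<le> 1" and B: "0 \<le> B"
    and R: "0 \<le> R" "R \<le> B" and \<theta>: "0 \<le> \<theta>"
  shows "expectation (\<lambda>\<omega>. of_bool (\<not> firing_chain.alive n (ccount h) (\<lambda>l i. rt i (real l * h)) R 0 Q \<omega>))
    \<le> real Q * rho h B + real (Suc Q) * (real n * exp (\<theta> * ((\<mu>_max + real d * w_max) - R)
        + \<theta> * exp (\<theta> * w_max) * (R + (L * \<mu>_max * h + real d * w_max * (2 * h * (R + L * \<mu>_max * h)))) * (1 - \<eta>)))"
proof -
  interpret C: firing_chain M "\<lambda>l. \<F> (real l * h)" n "ccount h" "\<lambda>l i. rt i (real l * h)" w h "rho h B" "L * \<mu>_max" L w_max B d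
    by (rule firing_chain_cells[OF h Lh B])
  have h0: "0 \<le> h" using h by simp
  have lh: "0 \<le> real l * h" for l using h by simp
  have Sl: "real (Suc l) * h = real l * h + h" for l by (simp add: algebra_simps)
  have lS: "real l * h \<le> real (Suc l) * h" for l by (rule mult_right_mono) (use h in auto)
  have Slm: "real (Suc l) * h \<le> real m * h" if "l < m" for l m using that h0 by (intro mult_right_mono) auto
  \<comment> \<open>\<open>R\<close> plus the possible growth of an expected rate inside one
    cell.\<close>
  define Rp where "Rp = R + (L * \<mu>_max * h + real d * w_max * (2 * h * (R + L * \<mu>_max * h)))"
  have Rp0: "0 \<le> Rp" unfolding Rp_def using R const_pos h by auto
  define v where "v = (\<lambda>m l i. if l < m then \<Sum>j=1..n. w i j * integral {real l * h..real (Suc l) * h} (\<phi> i j (real m * h)) else 0)"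
  have cont: "continuous_on {real l * h..real (Suc l) * h} (\<phi> i j (real m * h))"
    if "i \<in> {1..n}" "j \<in> {1..n}" "l < m" for i j l m
    by (rule continuous_on_subset[OF kernel_section_continuous[OF that(1,2) order_refl]]) (use lh[of l] Slm[OF that(3)] in auto)
  have ker: "0 \<le> \<phi> i j (real m * h) x \<and> \<phi> i j (real m * h) x \<le> 1"
    if "i \<in> {1..n}" "j \<in> {1..n}" "l < m" "real l * h \<le> x" "x \<le> real (Suc l) * h" for i j l m x
  proof -
    have x: "0 \<le> x" "x \<le> real m * h" using that(4,5) lh[of l] Slm[OF that(3)] by linarith+
    show ?thesis using A.kernel_nonneg[OF that(1,2) x] kernel_le_1[OF that(1,2) x] by simp
  qed
  have dead: "expectation (\<lambda>\<omega>. of_bool (\<not> C.alive R 0 Q \<omega>))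
    \<le> real Q * rho h B + real (Suc Q) * (real n * exp (\<theta> * ((\<mu>_max + real d * w_max) - R) + \<theta> * exp (\<theta> * w_max) * Rp * (1 - \<eta>)))"
  proof (rule C.not_alive_bound[where X = "cexc h" and v = v])
    show "cexc h m l i \<in> borel_measurable (\<F> (real (Suc l) * h))" if i: "i \<in> {1..n}" for m l i
    proof (cases "l < m")
      case True
      have "(\<lambda>\<omega>. \<Sum>j=1..n. w i j * isum (\<phi> i j (real m * h)) j (real l * h) (real (Suc l) * h) \<omega>) \<in> borel_measurable (\<F> (real (Suc l) * h))"
        by (intro borel_measurable_sum borel_measurable_times borel_measurable_const isum_filtration lh lS cont i True)
      then show ?thesis using True by (simp add: cexc_def cong: measurable_cong)
    qed (simp add: cexc_def cong: measurable_cong)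
    show "0 \<le> cexc h m l i \<omega> \<and> cexc h m l i \<omega> \<le> w_max * real (C.tot l \<omega>)"
      if i: "i \<in> {1..n}" and om: "\<omega> \<in> space M" for m l i \<omega>
    proof (cases "l < m")
      case True
      have is0: "0 \<le> isum (\<phi> i j (real m * h)) j (real l * h) (real (Suc l) * h) \<omega>" if j: "j \<in> {1..n}" for j
        by (rule isum_nonneg) (use ker[OF i j True] in auto)
      have is1: "isum (\<phi> i j (real m * h)) j (real l * h) (real (Suc l) * h) \<omega> \<le> real (ccount h l j \<omega>)" if j: "j \<in> {1..n}" for j
        unfolding ccount_def using isum_le[of "real l * h" "real (Suc l) * h" "\<phi> i j (real m * h)" 1 j \<omega>] ker[OF i j True] by auto
      have "cexc h m l i \<omega> \<le> (\<Sum>j=1..n. w_max * real (ccount h l j \<omega>))"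
        unfolding cexc_eq[OF True] by (intro sum_mono mult_mono is0 is1) (use weight_range[OF i] const_pos in auto)
      also have "\<dots> = w_max * real (C.tot l \<omega>)" by (simp add: C.tot_def sum_distrib_left)
      finally have "cexc h m l i \<omega> \<le> w_max * real (C.tot l \<omega>)" .
      moreover have "0 \<le> cexc h m l i \<omega>"
        unfolding cexc_eq[OF True] by (intro sum_nonneg mult_nonneg_nonneg is0) (use weight_range[OF i] in auto)
      ultimately show ?thesis by simp
    qed (use const_pos in \<open>simp add: cexc_def\<close>)
    show "rt i (real m * h) \<omega> \<le> (\<mu>_max + real d * w_max) + (\<Sum>l<m. cexc h m l i \<omega>)"
      if i: "i \<in> {1..n}" and om: "\<omega> \<in> space M" for m i \<omega>
    proof -
      have split: "isum f j 0 (real k * h) \<omega> = (\<Sum>l<k. isum f j (real l * h) (real (Suc l) * h) \<omega>)" if j: "j \<in> {1..n}" for f j k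
      proof (induction k)
        case 0 then show ?case by (simp add: isum_def evs_def)
      next
        case (Suc k)
        have "isum f j 0 (real (Suc k) * h) \<omega> = isum f j 0 (real k * h) \<omega> + isum f j (real k * h) (real (Suc k) * h) \<omega>"
          by (rule isum_split[OF j om order_refl lh lS])
        then show ?case using Suc by simp
      qed
      have "(\<Sum>l<m. cexc h m l i \<omega>) = (\<Sum>l<m. \<Sum>j=1..n. w i j * isum (\<phi> i j (real m * h)) j (real l * h) (real (Suc l) * h) \<omega>)"
        by (rule sum.cong) (auto simp: cexc_def)
      also have "\<dots> = (\<Sum>j=1..n. w i j * (\<Sum>l<m. isum (\<phi> i j (real m * h)) j (real l * h) (real (Suc l) * h) \<omega>))"
        unfolding sum_distrib_left by (rule sum.swap)
      also have "\<dots> = (\<Sum>j=1..n. w i j * isum (\<phi> i j (real m * h)) j 0 (real m * h) \<omega>)"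
        by (rule sum.cong[OF refl]) (simp only: split)
      finally have 1: "(\<Sum>l<m. cexc h m l i \<omega>) = (\<Sum>j=1..n. w i j * isum (\<phi> i j (real m * h)) j 0 (real m * h) \<omega>)" .
      have "(\<Sum>j=1..n. w i j * (\<phi> i j (real m * h) 0 * real (event_count E j 0 \<omega>))) \<le> (\<Sum>j=1..n. w i j)"
      proof (rule sum_mono)
        fix j assume j: "j \<in> {1..n}"
        have "card (E j \<omega> \<inter> {0..0}) \<le> card {0::real}" by (rule card_mono) auto
        then have "real (event_count E j 0 \<omega>) \<le> 1" by (simp add: event_count_def)
        then have "\<phi> i j (real m * h) 0 * real (event_count E j 0 \<omega>) \<le> 1 * 1"
          by (intro mult_mono kernel_le_1 i j lh) auto
        then have "w i j * (\<phi> i j (real m * h) 0 * real (event_count E j 0 \<omega>)) \<le> w i j * 1"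
          using weight_range[OF i j] by (intro mult_left_mono) auto
        then show "w i j * (\<phi> i j (real m * h) 0 * real (event_count E j 0 \<omega>)) \<le> w i j" by simp
      qed
      also have "\<dots> \<le> real d * w_max" by (rule row_sum_le[OF i])
      finally show ?thesis unfolding 1 rt_eq[OF om lh] distrib_left sum.distrib
        using A.baseline_bounds[OF i lh[of m]] by linarith
    qed
    show "expectation (\<lambda>\<omega>. Y \<omega> * (of_bool (C.tot l \<omega> \<le> 1) * cexc h m l i \<omega>)) \<le> Rp * v m l i * expectation Y"
      if lm: "l < m" and i: "i \<in> {1..n}" and Y: "weight (\<F> (real l * h)) Y"
        and supp: "\<And>\<omega> k. \<omega> \<in> space M \<Longrightarrow> Y \<omega> \<noteq> 0 \<Longrightarrow> k \<in> {1..n} \<Longrightarrow> rt k (real l * h) \<omega> \<le> R" for m l i Y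
    proof -
      have Yw: "weight M Y" using weight_filtration_M[OF Y] .
      have EY: "0 \<le> expectation Y" using expectation_nonneg_weight[OF Yw] .
      have psi: "expectation (\<lambda>\<omega>. Y \<omega> * rt j u \<omega>) \<le> Rp * expectation Y"
        if j: "j \<in> {1..n}" and u: "real l * h \<le> u" "u < real (Suc l) * h" for j u
      proof -
        have "expectation (\<lambda>\<omega>. Y \<omega> * rt j u \<omega>) \<le> expectation (\<lambda>\<omega>. Y \<omega> * rt j (real l * h) \<omega>)
            + (L * \<mu>_max * h + real d * w_max * (2 * h * (R + L * \<mu>_max * h))) * expectation Y"
          by (rule cell_upper(2)[OF lh h0 h(3) Y R(1) supp j]) (use u Sl[of l] in auto)
        moreover have "expectation (\<lambda>\<omega>. Y \<omega> * rt j (real l * h) \<omega>) \<le> R * expectation Y"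
          by (rule expectation_rt_le[OF j lh Yw supp[OF _ _ j]])
        ultimately show ?thesis unfolding Rp_def by (simp add: algebra_simps)
      qed
      let ?I = "\<lambda>j. isum (\<phi> i j (real m * h)) j (real l * h) (real (Suc l) * h)"
      let ?J = "\<lambda>j. integral {real l * h..real (Suc l) * h} (\<phi> i j (real m * h))"
      have RE: "0 \<le> Rp * expectation Y" using Rp0 EY by simp
      have int: "integrable M (\<lambda>\<omega>. Y \<omega> * ?I j \<omega>)" and le: "expectation (\<lambda>\<omega>. Y \<omega> * ?I j \<omega>) \<le> Rp * expectation Y * ?J j"
        if j: "j \<in> {1..n}" for j
        using expectation_isum_upper[OF j lh lS Y psi[OF j] RE cont[OF i j lm] ker[OF i j lm]] by blast+
      have "expectation (\<lambda>\<omega>. Y \<omega> * (of_bool (C.tot l \<omega> \<le> 1) * cexc h m l i \<omega>)) \<le> expectation (\<lambda>\<omega>. \<Sum>j=1..n. w i j * (Y \<omega> * ?I j \<omega>))"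
      proof (rule integral_mono')
        show "integrable M (\<lambda>\<omega>. \<Sum>j=1..n. w i j * (Y \<omega> * ?I j \<omega>))"
          by (intro Bochner_Integration.integrable_sum integrable_mult_right int)
        fix \<omega> assume om: "\<omega> \<in> space M"
        have eq: "(\<Sum>j=1..n. w i j * (Y \<omega> * ?I j \<omega>)) = Y \<omega> * cexc h m l i \<omega>"
          unfolding cexc_eq[OF lm] by (simp only: sum_distrib_left mult.left_commute)
        have I0: "0 \<le> ?I j \<omega>" if "j \<in> {1..n}" for j by (rule isum_nonneg) (use ker[OF i that lm] in auto)
        have c0: "0 \<le> cexc h m l i \<omega>"
          unfolding cexc_eq[OF lm] by (intro sum_nonneg mult_nonneg_nonneg I0) (use weight_range[OF i] in auto)
        have "of_bool (C.tot l \<omega> \<le> 1) * cexc h m l i \<omega> \<le> cexc h m l i \<omega>" using c0 by simp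
        then show "Y \<omega> * (of_bool (C.tot l \<omega> \<le> 1) * cexc h m l i \<omega>) \<le> (\<Sum>j=1..n. w i j * (Y \<omega> * ?I j \<omega>))"
          unfolding eq by (rule mult_left_mono[OF _ weight_ge_0[OF Yw om]])
        show "0 \<le> (\<Sum>j=1..n. w i j * (Y \<omega> * ?I j \<omega>))"
          unfolding eq using c0 weight_ge_0[OF Yw om] by simp
      qed
      also have "\<dots> = (\<Sum>j=1..n. w i j * expectation (\<lambda>\<omega>. Y \<omega> * ?I j \<omega>))"
      proof -
        have "expectation (\<lambda>\<omega>. \<Sum>j=1..n. w i j * (Y \<omega> * ?I j \<omega>)) = (\<Sum>j=1..n. expectation (\<lambda>\<omega>. w i j * (Y \<omega> * ?I j \<omega>)))"
          by (rule Bochner_Integration.integral_sum) (intro integrable_mult_right int)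
        then show ?thesis by simp
      qed
      also have "\<dots> \<le> (\<Sum>j=1..n. w i j * (Rp * expectation Y * ?J j))"
        by (intro sum_mono mult_left_mono le) (use weight_range[OF i] in auto)
      also have "\<dots> = Rp * v m l i * expectation Y"
        unfolding v_def if_P[OF lm] by (simp only: sum_distrib_left sum_distrib_right mult_ac)
      finally show ?thesis .
    qed
    show "0 \<le> v m l i" if i: "i \<in> {1..n}" for m l i
    proof (cases "l < m")
      case True
      have "0 \<le> (\<Sum>j=1..n. w i j * integral {real l * h..real (Suc l) * h} (\<phi> i j (real m * h)))"
        by (intro sum_nonneg mult_nonneg_nonneg integral_nonneg integrable_continuous_interval cont i True)
          (use weight_range[OF i] ker[OF i _ True] in auto)
      then show ?thesis using True by (simp only: v_def if_True)
    qed (simp add: v_def)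
    show "(\<Sum>l<m. v m l i) \<le> 1 - \<eta>" if i: "i \<in> {1..n}" for m i
    proof -
      have split: "integral {0..real k * h} (\<phi> i j (real m * h)) = (\<Sum>l<k. integral {real l * h..real (Suc l) * h} (\<phi> i j (real m * h)))"
        if j: "j \<in> {1..n}" and k: "k \<le> m" for j k
        using k
      proof (induction k)
        case (Suc k)
        have "integral {0..real k * h} (\<phi> i j (real m * h)) + integral {real k * h..real (Suc k) * h} (\<phi> i j (real m * h))
            = integral {0..real (Suc k) * h} (\<phi> i j (real m * h))"
        proof (rule Henstock_Kurzweil_Integration.integral_combine[OF lh lS])
          show "\<phi> i j (real m * h) integrable_on {0..real (Suc k) * h}"
            by (rule integrable_continuous_interval, rule continuous_on_subset[OF kernel_section_continuous[OF i j order_refl]])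
              (use Slm[of k m] Suc.prems in auto)
        qed
        then show ?case using Suc by simp
      qed simp
      have "(\<Sum>l<m. v m l i) = (\<Sum>l<m. \<Sum>j=1..n. w i j * integral {real l * h..real (Suc l) * h} (\<phi> i j (real m * h)))"
        by (rule sum.cong) (auto simp: v_def)
      also have "\<dots> = (\<Sum>j=1..n. w i j * (\<Sum>l<m. integral {real l * h..real (Suc l) * h} (\<phi> i j (real m * h))))"
        unfolding sum_distrib_left by (rule sum.swap)
      also have "\<dots> = (\<Sum>j=1..n. w i j * integral {0..real m * h} (\<phi> i j (real m * h)))"
        by (rule sum.cong[OF refl]) (simp only: split order_refl)
      also have "\<dots> \<le> 1 - \<eta>" using A.subcritical[OF i lh[of m]] .
      finally show ?thesis .
    qed
  qed (use \<theta> Rp0 R in auto)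
  then show ?thesis unfolding Rp_def .
qed

end

section \<open>Scales and the estimator\<close>

text \<open>\<open>step_err\<close> with window length \<open>\<delta>\<close>, a bound
  \<open>D\<close> for the firing estimate of two windows, and the allowances
  \<open>\<delta> ^ 2\<close> for the cell errors of a window and \<open>\<delta> ^ 4\<close> for
  death. It no longer contains \<open>q\<close>, \<open>p\<close> or \<open>n\<close>, so that it
  can be compared with powers of one parameter.\<close>

definition step_bd :: "real \<Rightarrow> real \<Rightarrow> real \<Rightarrow> real \<Rightarrow> real \<Rightarrow> real \<Rightarrow> nat \<Rightarrow> real" where
  "step_bd \<kappa> L wm B \<delta> D m = (\<delta> * (\<kappa> * \<delta> + L * \<delta> * B + B * D) + \<delta>\<^sup>2) * D ^ m
     + \<delta> * ((2 * \<delta>) * (\<kappa> + L * (B + 2 * wm)) * D ^ m + (B + 2 * wm) * D ^ Suc m)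
     + \<delta> ^ 4 * (1 + (1 + \<delta> * B) + \<delta> * (B + 2 * wm))"

definition triple_bd :: "real \<Rightarrow> real \<Rightarrow> real \<Rightarrow> real \<Rightarrow> real \<Rightarrow> real \<Rightarrow> real" where
  "triple_bd \<kappa> L wm B \<delta> D = step_bd \<kappa> L wm B \<delta> D 2 + \<delta> * step_bd \<kappa> L wm B \<delta> D 1 * (B + 2 * wm)
     + \<delta>\<^sup>2 * step_bd \<kappa> L wm B \<delta> D 0 * (B + 2 * wm)\<^sup>2"

text \<open>
  All scales are powers of one parameter \<open>z\<close> with \<open>n = exp (z ^ 8)\<close>: windows have length
  \<open>z powr - 96\<close>, rates stay below \<open>z ^ 16\<close>, and every constant of the model is below \<open>z\<close> once
  \<open>n\<close> is large.  The conditions collected here are the inequalities between these scales.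
\<close>

definition scales_ok :: "real \<Rightarrow> bool" where
  "scales_ok z \<longleftrightarrow> 2 \<le> z \<and>
     z^16 + z*(3/z^96) + z*(z^16+1) \<le> z^18 \<and>
     4*(z^18+3*z)^2 + z + 2*z*z*(z^18+3*z) + z*z^18 + 2*z^18*(z^18+3*z) \<le> z^40 \<and>
     3 / (z^152 * exp (z^8)^2) + exp (z^8) * exp (-3*z^16) \<le> (1/z^96)^4 \<and>
     z^40 \<le> exp (z^8)^2 \<and>
     z*(1/z^96) + z*z*(2*(1/z^96)*(z^16+z*(1/z^96))) \<le> 1 \<and>
     z*z*(1/z^96) \<le> 1/2 \<and>
     z*(1/z^96)^3 \<le> 1 \<and>
     (1/z^96)^3*(z^16*(z*(z^16+z))) \<le> 1 \<and>
     3*((2*z+2)*((1/z^96)*z^18+(1/z^96)^2)) \<le> exp (-3) \<and>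
     z^896 * (1 / (z^152 * exp (z^8)^2)) \<le> 1/z \<and>
     (exp (z^8)^4*z^896+1)*(exp (z^8)*exp (z-z^15)) \<le> 1/z \<and>
     exp (z^8)*(exp (z^8)*(2*exp (-((z^896/3-1)*(1/z)^2*(1/z^96)^6/64)))) \<le> 1/z \<and>
     2 * triple_bd z z z (z^18) (1/z^96) (2*((2*z+2)*((1/z^96)*z^18+(1/z^96)^2))) \<le> (1/z) * (1/z^96)^3/2"

text \<open>The margins are wide. With \<open>\<delta> = 1 / z ^ 96\<close> the quantity
  \<open>D\<close> is about \<open>4 * z ^ 19 * \<delta>\<close>, so the triple error is of order
  \<open>z ^ 75 * \<delta> ^ 4\<close>, against an allowance of order
  \<open>\<delta> ^ 3 / z\<close>. The deviations have an exponent of order \<open>z ^ 318\<close>,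
  since \<open>318 = 896 - 2 - 6 * 96\<close>, against \<open>2 * z ^ 8\<close> from the pairs of
  nodes. For rates above \<open>z ^ 16\<close> the exponent \<open>z ^ 15\<close> meets
  \<open>5 * z ^ 8\<close> from the cells and nodes.\<close>

lemma eventually_scales_ok: "eventually scales_ok at_top"
  unfolding scales_ok_def
proof (intro eventually_conj)
  show "\<forall>\<^sub>F z in at_top. 2 * triple_bd z z z (z^18) (1/z^96) (2*((2*z+2)*((1/z^96)*z^18+(1/z^96)^2))) \<le> (1/z) * (1/z^96)^3/2"
    unfolding triple_bd_def step_bd_def power_0 power_one_right mult_1_right by real_asymp
qed real_asymp+

section \<open>The error terms in a common scale\<close>

context firing_chain
begin

lemma step_err_le:
  assumes c: "\<kappa> \<le> z" "L \<le> z" "wm \<le> z" and dl: "h * real q = \<delta>" and q\<rho>: "real q * \<rho> \<le> \<delta>\<^sup>2"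
    and \<tau>: "0 \<le> \<tau>" "\<tau> \<le> \<delta> ^ 4" and p: "0 \<le> p" "2 * (real q * p) \<le> D" and u: "u \<le> 2 * q"
  shows "step_err q p \<tau> m u (2 * wm) \<le> step_bd z z z B \<delta> D m"
proof -
  have dl0: "0 \<le> \<delta>" using dl param_nonneg by (metis mult_nonneg_nonneg of_nat_0_le_iff)
  have "0 \<le> real q * p" using p by simp
  then have qp: "real q * p \<le> D" using p by linarith
  have "real u * p \<le> real (2 * q) * p" using u p by (intro mult_right_mono) auto
  then have up: "real u * p \<le> D" using p by simp
  have "h * real u \<le> h * real (2 * q)" using u param_nonneg by (intro mult_left_mono) auto
  then have hu: "h * real u \<le> 2 * \<delta>" using dl by simp
  have up0: "0 \<le> real u * p" "0 \<le> D" using p up by (auto intro: order_trans[OF _ up])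
  have hu0: "0 \<le> h * real u" using param_nonneg by simp
  have z0: "0 \<le> z" using c param_nonneg by linarith
  show ?thesis unfolding step_err_def step_bd_def dl
    by (intro add_mono mult_mono power_mono order_refl c q\<rho> \<tau> qp up hu mult_nonneg_nonneg add_nonneg_nonneg zero_le_power)
      (use dl0 param_nonneg p up0 hu0 z0 c \<tau> in \<open>auto intro!: mult_nonneg_nonneg add_nonneg_nonneg zero_le_power\<close>)
qed

lemma triple_err_le:
  assumes c: "\<kappa> \<le> z" "L \<le> z" "wm \<le> z" and dl: "h * real q = \<delta>" and q\<rho>: "real q * \<rho> \<le> \<delta>\<^sup>2"
    and \<tau>: "0 \<le> \<tau>" "\<tau> \<le> \<delta> ^ 4" and p: "0 \<le> p" "2 * (real q * p) \<le> D"
  shows "triple_err q p \<tau> \<le> triple_bd z z z B \<delta> D"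
proof -
  note s = step_err_le[OF c dl q\<rho> \<tau> p]
  have dl0: "0 \<le> \<delta>" using dl param_nonneg by (metis mult_nonneg_nonneg of_nat_0_le_iff)
  have z0: "0 \<le> z" using c param_nonneg by linarith
  have D0: "0 \<le> D" using p by (meson mult_nonneg_nonneg of_nat_0_le_iff order_trans zero_le_numeral)
  have b0: "0 \<le> step_bd z z z B \<delta> D m" for m
    unfolding step_bd_def using dl0 z0 D0 param_nonneg by (intro add_nonneg_nonneg mult_nonneg_nonneg zero_le_power) auto
  have B0: "0 \<le> B + 2 * wm" "B + 2 * wm \<le> B + 2 * z" using param_nonneg c by auto
  show ?thesis unfolding triple_err_def triple_bd_def dl
    by (intro add_mono mult_mono s mult_left_mono power_mono B0 mult_nonneg_nonneg b0 zero_le_power dl0) auto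
qed

end

section \<open>The statistics read off the observed path, and the choice of parameters\<close>

definition block3 :: "real \<Rightarrow> nat \<Rightarrow> nat \<Rightarrow> nat \<Rightarrow> nat \<Rightarrow> (nat \<times> real \<Rightarrow> nat) \<Rightarrow> bool" where
  "block3 \<delta> k x1 x2 x3 obs \<longleftrightarrow>
     obs (x1, real (3 * k) * \<delta>) < obs (x1, real (3 * k + 1) * \<delta>) \<and>
     obs (x2, real (3 * k + 1) * \<delta>) < obs (x2, real (3 * k + 2) * \<delta>) \<and>
     obs (x3, real (3 * k + 2) * \<delta>) < obs (x3, real (3 * k + 3) * \<delta>)"

definition path_stat :: "real \<Rightarrow> nat \<Rightarrow> nat \<Rightarrow> nat \<Rightarrow> (nat \<times> real \<Rightarrow> nat) \<Rightarrow> real" where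
  "path_stat \<delta> K i j obs = (\<Sum>k<K. of_bool (block3 \<delta> k i j i obs) - of_bool (block3 \<delta> k i i j obs))"

context bounded_hawkes
begin

text \<open>At time 0 the integrals in \<open>subcritical\<close> extend over a single point and
  vanish.\<close>

lemma eta_le_1: "\<eta> \<le> 1"
  using A.subcritical[of 1 0] n_pos by simp

text \<open>A window consists of \<open>n ^ 4\<close> cells. The polynomial factor of
  \<open>rho\<close> is at most \<open>n ^ 2 * z ^ 40\<close>, where \<open>n ^ 2\<close> comes from
  pairs of events at arbitrary nodes, and \<open>h ^ 2\<close> contributes \<open>n ^ (-8)\<close>.
  This leaves \<open>n ^ (-2)\<close> for the window, and \<open>152 = 2 * 96 - 40\<close>.\<close>

lemma rho_le:
  assumes z: "scales_ok z" and c: "L \<le> z" "L * \<mu>_max \<le> z" "w_max \<le> z" "real d \<le> z"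
    and h: "h = (1 / z^96) / real n ^ 4" and n: "real n = exp (z^8)"
  shows "real n ^ 4 * rho h (z^18) \<le> 1 / (z^152 * exp (z^8)^2)"
proof -
  have z2: "2 \<le> z" and f: "4*(z^18+3*z)^2 + z + 2*z*z*(z^18+3*z) + z*z^18 + 2*z^18*(z^18+3*z) \<le> z^40"
    using z by (auto simp: scales_ok_def)
  define C where "C = z^18 + 2 * L * \<mu>_max + w_max"
  have C: "0 \<le> C" "C \<le> z^18 + 3 * z" using c const_pos z2 by (auto simp: C_def)
  have n1: "1 \<le> real n" using n_pos by simp
  have nn: "real n \<le> (real n)\<^sup>2" using n1 by (simp add: power2_eq_square)
  have n2: "1 \<le> (real n)\<^sup>2" using n1 by simp
  have "4 * (real n)\<^sup>2 * C\<^sup>2 + L * \<mu>_max + 2 * real d * w_max * C + L * z^18 + 2 * real n * z^18 * C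
     \<le> (real n)\<^sup>2 * (4*(z^18+3*z)^2) + (real n)\<^sup>2 * z + (real n)\<^sup>2 * (2*z*z*(z^18+3*z)) + (real n)\<^sup>2 * (z*z^18) + (real n)\<^sup>2 * (2*z^18*(z^18+3*z))"
  proof (intro add_mono)
    show "4 * (real n)\<^sup>2 * C\<^sup>2 \<le> (real n)\<^sup>2 * (4*(z^18+3*z)^2)"
      using power_mono[OF C(2) C(1), of 2] by (simp add: mult_left_mono)
    show "L * \<mu>_max \<le> (real n)\<^sup>2 * z" using mult_mono[OF n2 c(2)] const_pos by simp
    have "2 * real d * w_max * C \<le> 2 * z * z * (z^18+3*z)"
      using c C const_pos z2 by (intro mult_mono) auto
    then show "2 * real d * w_max * C \<le> (real n)\<^sup>2 * (2*z*z*(z^18+3*z))"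
      using mult_mono[OF n2, of "2 * real d * w_max * C"] C const_pos by simp
    have "L * z^18 \<le> z * z^18" using c z2 by (intro mult_right_mono) auto
    then show "L * z^18 \<le> (real n)\<^sup>2 * (z*z^18)"
      using mult_mono[OF n2, of "L * z^18"] const_pos z2 by simp
    have "real n * (2 * z^18 * C) \<le> (real n)\<^sup>2 * (2*z^18*(z^18+3*z))"
      using nn C z2 by (intro mult_mono) auto
    then show "2 * real n * z^18 * C \<le> (real n)\<^sup>2 * (2*z^18*(z^18+3*z))" by (simp add: mult_ac)
  qed
  also have "\<dots> = (real n)\<^sup>2 * (4*(z^18+3*z)^2 + z + 2*z*z*(z^18+3*z) + z*z^18 + 2*z^18*(z^18+3*z))"
    by (simp only: distrib_left)
  also have "\<dots> \<le> (real n)\<^sup>2 * z^40" by (rule mult_left_mono[OF f]) simp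
  finally have "rho h (z^18) \<le> h\<^sup>2 * ((real n)\<^sup>2 * z^40)"
    unfolding rho_def Let_def C_def[symmetric] by (rule mult_left_mono) simp
  then have "real n ^ 4 * rho h (z^18) \<le> real n ^ 4 * (h\<^sup>2 * ((real n)\<^sup>2 * z^40))"
    by (rule mult_left_mono) simp
  also have "\<dots> = 1 / (z^152 * (real n)\<^sup>2)"
  proof -
    have zp: "z ^ 192 = z ^ 152 * z ^ 40" by (simp flip: power_add)
    have np: "real n ^ 8 = real n ^ 4 * (real n)\<^sup>2 * (real n)\<^sup>2" by (simp flip: power_add)
    have "h\<^sup>2 = 1 / (z ^ 192 * real n ^ 8)"
      unfolding h by (simp add: power_divide power_mult_distrib flip: power_mult)
    then show ?thesis unfolding zp np using n1 z2 by (simp add: field_simps)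
  qed
  finally show ?thesis by (simp add: n)
qed

text \<open>The estimator compares counts at the ends of windows; this translates such a comparison
  into firings of cells and thereby links \<open>block3\<close> with \<open>fires3\<close>.\<close>

lemma later_iff:
  assumes i: "i \<in> {1..n}" and om: "\<omega> \<in> space M" and h: "0 \<le> h" and l: "l \<le> l'"
  shows "event_count E i (real l * h) \<omega> < event_count E i (real l' * h) \<omega> \<longleftrightarrow> (\<exists>x\<in>{l..<l'}. 1 \<le> ccount h x i \<omega>)"
proof -
  have lh: "0 \<le> real l * h" "real l * h \<le> real l' * h" using h l by (auto intro: mult_right_mono)
  have "event_count E i (real l * h) \<omega> < event_count E i (real l' * h) \<omega> \<longleftrightarrow> cnt i (real l * h) (real l' * h) \<omega> \<noteq> 0"
    using event_count_split[OF i om lh] by simp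
  also have "\<dots> \<longleftrightarrow> (\<Sum>x=l..<l'. real (ccount h x i \<omega>)) \<noteq> 0"
    unfolding ccount_sum[OF i om h l] by simp
  also have "\<dots> \<longleftrightarrow> (\<Sum>x=l..<l'. ccount h x i \<omega>) \<noteq> 0"
    unfolding of_nat_sum[symmetric] of_nat_eq_0_iff ..
  also have "\<dots> \<longleftrightarrow> (\<exists>x\<in>{l..<l'}. 1 \<le> ccount h x i \<omega>)"
    by (auto simp: Suc_le_eq)
  finally show ?thesis .
qed

text \<open>The success event \<open>G\<close> is left abstract: \<open>decide\<close> says that it
  follows from correct decisions for all pairs. Of the failure bound \<open>3 / z\<close>, two parts
  are for the death of the chain before the last block ends and one is for the deviations of the
  statistics.\<close>

lemma correct_prob:
  fixes K :: nat
  defines "\<delta> \<equiv> \<lambda>z::real. 1 / z^96"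
  assumes z: "scales_ok z" and n: "real n = exp (z^8)"
    and c: "L \<le> z" "L * \<mu>_max \<le> z" "w_max \<le> z" "real d \<le> z"
    and c0: "c0 = w_sep * \<mu>_min * w_min / 8" "1 / z \<le> c0" "c0 \<le> z"
    and \<theta>': "0 < \<theta>'" "exp (\<theta>' * w_max) * (1 - \<eta>) \<le> 1 - \<eta> / 2" "1 / z \<le> \<theta>' * \<eta> / 2"
      "\<theta>' * (\<mu>_max + real d * w_max + 1) \<le> z"
    and K: "z^896 / 3 - 1 \<le> real K" "real K \<le> z^896 / 3" "0 < K"
    and G: "{\<omega>\<in>space M. G \<omega>} \<in> sets M"
    and decide: "\<And>\<omega>. \<omega> \<in> space M \<Longrightarrow> (\<And>i j. i \<in> {1..n} \<Longrightarrow> j \<in> {1..n} \<Longrightarrow> i \<noteq> j \<Longrightarrow>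
        (c0 * real K * \<delta> z ^ 3 < \<bar>path_stat (\<delta> z) K i j (\<lambda>(i, t). event_count E i t \<omega>)\<bar> \<or>
         c0 * real K * \<delta> z ^ 3 < \<bar>path_stat (\<delta> z) K j i (\<lambda>(i, t). event_count E i t \<omega>)\<bar>) \<longleftrightarrow>
        (0 < w i j \<or> 0 < w j i)) \<Longrightarrow> G \<omega>"
  shows "1 - 3 / z \<le> prob {\<omega>\<in>space M. G \<omega>}"
proof -
  define dl where "dl = 1 / z^96"
  have f: "2 \<le> z"
    "z^16 + z*(3/z^96) + z*(z^16+1) \<le> z^18"
    "3 / (z^152 * exp (z^8)^2) + exp (z^8) * exp (-3*z^16) \<le> dl^4"
    "z^40 \<le> exp (z^8)^2"
    "z*dl + z*z*(2*dl*(z^16+z*dl)) \<le> 1"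
    "z*z*dl \<le> 1/2"
    "z*dl^3 \<le> 1"
    "dl^3*(z^16*(z*(z^16+z))) \<le> 1"
    "3*((2*z+2)*(dl*z^18+dl^2)) \<le> exp (-3)"
    "z^896 * (1 / (z^152 * exp (z^8)^2)) \<le> 1/z"
    "(exp (z^8)^4*z^896+1)*(exp (z^8)*exp (z-z^15)) \<le> 1/z"
    "exp (z^8)*(exp (z^8)*(2*exp (-((z^896/3-1)*(1/z)^2*dl^6/64)))) \<le> 1/z"
    "2 * triple_bd z z z (z^18) dl (2*((2*z+2)*(dl*z^18+dl^2))) \<le> (1/z) * dl^3/2"
    using z unfolding scales_ok_def dl_def by blast+
  \<comment> \<open>A window of length \<open>dl\<close> has \<open>q\<close> cells of length
    \<open>h\<close>. Rates are at most \<open>R\<close> at the start of a block and may climb to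
    \<open>B\<close> within it, which allows \<open>m0\<close> parent events of weight at most
    \<open>z\<close> each. With \<open>m0\<close> at least \<open>z ^ 16\<close> the factor
    \<open>exp (-3) ^ m0\<close> outweighs the \<open>exp (z ^ 8)\<close> nodes.\<close>
  define q where "q = n ^ 4"
  define h where "h = dl / real n ^ 4"
  define B where "B = z^18"
  define R where "R = z^16"
  define m0 where "m0 = nat \<lceil>z^16\<rceil>"
  define r where "r = rho h B"
  have z0: "0 < z" using f(1) by simp
  have dl: "0 < dl" using z0 by (simp add: dl_def)
  have n1: "1 \<le> real n" using n_pos by simp
  have q4: "real q = real n ^ 4" by (simp add: q_def)
  have q1: "1 \<le> real q" using n1 by (simp add: q4)
  have hq: "h * real q = dl" using n1 by (simp add: h_def q4)
  have h0: "0 < h" using dl n1 by (simp add: h_def)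
  have hd: "h \<le> dl" using mult_left_mono[OF q1, of h] h0 hq by simp
  have zdl: "2 * (z * dl) \<le> 1/2"
  proof -
    have "2 * (z * dl) \<le> z * (z * dl)" using f(1) dl by (intro mult_right_mono) auto
    then show ?thesis using f(6) by (simp add: mult.assoc)
  qed
  have dl1: "dl \<le> 1"
  proof -
    have "2 * dl \<le> z * dl" using f(1) dl by (intro mult_right_mono) auto
    then show ?thesis using zdl by linarith
  qed
  have h1: "h \<le> 1" using hd dl1 by simp
  have h2: "h * (real d * w_max) \<le> 1/2"
  proof -
    have "h * (real d * w_max) \<le> dl * (z * z)"
      using hd c const_pos dl z0 by (intro mult_mono) auto
    then show ?thesis using f(6) by (simp add: mult_ac)
  qed
  have Ldl: "L * (2 * dl) \<le> 1"
  proof -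
    have "L * (2 * dl) \<le> z * (2 * dl)" using c dl by (intro mult_right_mono) auto
    then show ?thesis using zdl by linarith
  qed
  have Lh: "L * h \<le> 1"
  proof -
    have "L * h \<le> L * (2 * dl)" using hd const_pos dl by (intro mult_left_mono) auto
    then show ?thesis using Ldl by simp
  qed
  have B0: "0 \<le> B" and R0: "0 \<le> R" using z0 by (auto simp: B_def R_def)
  interpret C: firing_chain M "\<lambda>l. \<F> (real l * h)" n "ccount h" "\<lambda>l i. rt i (real l * h)" w h "r" "L * \<mu>_max" L w_max B d
    unfolding r_def by (rule firing_chain_cells[OF h0 h1 h2 Lh B0])
  have r0: "0 \<le> r" using C.param_nonneg by simp
  have qr: "real q * r \<le> 1 / (z^152 * exp (z^8)^2)"
    unfolding q4 r_def B_def by (rule rho_le[OF z c _ n]) (simp add: h_def dl_def)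
  have qr2: "real q * r \<le> dl\<^sup>2"
  proof -
    have "1 / (z^152 * exp (z^8)^2) \<le> 1 / (z^152 * z^40)"
      using z0 f(4) by (intro divide_left_mono mult_left_mono mult_pos_pos) auto
    also have "\<dots> = dl\<^sup>2" by (simp add: dl_def power_divide flip: power_add power_mult)
    finally show ?thesis using qr by linarith
  qed
  define p where "p = real (2 * d + 2) * (h * B + r)"
  have p0: "0 \<le> p" unfolding p_def using h0 B0 r0 by simp
  have qp: "real q * p \<le> (2*z+2)*(dl*z^18+dl^2)"
  proof -
    have "real q * p = real (2 * d + 2) * (h * real q * B + real q * r)" by (simp add: p_def algebra_simps)
    also have "\<dots> \<le> (2*z+2)*(dl*z^18+dl^2)"
      unfolding hq using c(4) qr2 dl B0 r0 z0 by (intro mult_mono add_mono) (auto simp: B_def)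
    finally show ?thesis .
  qed
  have m0: "z^16 \<le> real m0" "real m0 \<le> z^16 + 1"
  proof -
    have "0 \<le> \<lceil>z^16\<rceil>" using z0 by (simp add: less_imp_le order_less_le_trans[of "-1" 0])
    then have "real m0 = of_int \<lceil>z^16\<rceil>" unfolding m0_def by simp
    then show "z^16 \<le> real m0" "real m0 \<le> z^16 + 1" by linarith+
  qed
  define \<tau> where "\<tau> = 3 / (z^152 * exp (z^8)^2) + exp (z^8) * exp (-3*z^16)"
  have \<tau>0: "0 \<le> \<tau>" unfolding \<tau>_def using z0 by simp
  have \<tau>: "real (q + q + q) * r + real n * (real (q + q + q) * p) ^ m0 \<le> \<tau>"
    unfolding \<tau>_def
  proof (rule add_mono)
    show "real (q + q + q) * r \<le> 3 / (z^152 * exp (z^8)^2)" using qr by simp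
    have "real (q + q + q) * p \<le> exp (-3)" using qp f(9) by simp
    then have "(real (q + q + q) * p) ^ m0 \<le> exp (-3) ^ m0" using p0 by (intro power_mono) auto
    also have "\<dots> = exp (real m0 * (-3))" by (rule exp_of_nat_mult[symmetric])
    also have "\<dots> \<le> exp (-3*z^16)" using m0 by simp
    finally show "real n * (real (q + q + q) * p) ^ m0 \<le> exp (z^8) * exp (-3*z^16)"
      unfolding n by (intro mult_left_mono) auto
  qed
  have h3: "h * real (q + q + q) = 3 * dl" "h * real (q + q) = 2 * dl" using hq by (simp_all add: algebra_simps)
  have RB: "R + L * \<mu>_max * (h * real (q + q + q)) + w_max * real m0 \<le> B"
  proof -
    have "L * \<mu>_max * (3 * dl) \<le> z * (3 * dl)" using c dl by (intro mult_right_mono) auto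
    moreover have "w_max * real m0 \<le> z * (z^16 + 1)" using c m0 const_pos z0 by (intro mult_mono) auto
    ultimately show ?thesis using f(2) unfolding R_def B_def h3 dl_def by simp
  qed
  have Lq: "L * (h * real (q + q)) \<le> 1" unfolding h3 by (rule Ldl)
  have gl: "(h * real q) ^ 3 * (R * (w_max * (R + w_max))) \<le> 1"
  proof -
    have "dl ^ 3 * (R * (w_max * (R + w_max))) \<le> dl^3*(z^16*(z*(z^16+z)))"
      unfolding R_def using c const_pos z0 dl by (intro mult_left_mono mult_mono) auto
    then show ?thesis using f(8) unfolding hq by linarith
  qed
  \<comment> \<open>The systematic error may use up half of the threshold \<open>c0 * dl ^ 3\<close>
    of a block. The exponent left per block is
    \<open>4 * \<theta> ^ 2 - \<theta> * (c0 * dl ^ 3 / 2)\<close>, and \<open>\<theta>\<close> is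
    its minimiser.\<close>
  define err where "err = c0 * dl^3 / 2"
  define \<theta> where "\<theta> = c0 * dl^3 / 16"
  have c00: "0 < c0" unfolding c0(1) using const_pos by simp
  have err: "2 * C.triple_err q p \<tau> \<le> err" "0 \<le> err"
  proof -
    have "C.triple_err q p \<tau> \<le> triple_bd z z z B dl (2*((2*z+2)*(dl*z^18+dl^2)))"
      by (rule C.triple_err_le[OF c(2,1,3) hq qr2 \<tau>0 _ p0]) (use f(3) qp in \<open>auto simp: \<tau>_def\<close>)
    then have "2 * C.triple_err q p \<tau> \<le> (1/z) * dl^3/2" using f(13) unfolding B_def by linarith
    also have "\<dots> \<le> err" unfolding err_def using c0(2) dl by (intro divide_right_mono mult_right_mono) auto
    finally show "2 * C.triple_err q p \<tau> \<le> err" .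
    show "0 \<le> err" unfolding err_def using c00 dl by simp
  qed
  have \<theta>: "0 \<le> \<theta>" "\<theta> \<le> 1/2"
  proof -
    show "0 \<le> \<theta>" unfolding \<theta>_def using c00 dl by simp
    have "c0 * dl^3 \<le> z * dl^3" using c0(3) dl by (intro mult_right_mono) auto
    then show "\<theta> \<le> 1/2" unfolding \<theta>_def using f(7) by linarith
  qed
  define thr where "thr = c0 * real K * dl^3"
  \<comment> \<open>One \<open>1 / z\<close> for cells with two events, one for rates above
    \<open>R\<close>.\<close>
  define \<beta> where "\<beta> = 2 / z"
  have dead: "expectation (\<lambda>\<omega>. of_bool (\<not> C.alive R 0 ((q + q + q) * K) \<omega>)) \<le> \<beta>"
  proof -
    define Q where "Q = (q + q + q) * K"
    define Rp where "Rp = R + (L * \<mu>_max * h + real d * w_max * (2 * h * (R + L * \<mu>_max * h)))"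
    have RB': "R \<le> B"
    proof -
      have "0 \<le> L * \<mu>_max * (h * real (q + q + q))" "0 \<le> w_max * real m0" using const_pos h0 by auto
      then show ?thesis using RB by linarith
    qed
    have "expectation (\<lambda>\<omega>. of_bool (\<not> C.alive R 0 Q \<omega>))
      \<le> real Q * rho h B + real (Suc Q) * (real n * exp (\<theta>' * ((\<mu>_max + real d * w_max) - R) + \<theta>' * exp (\<theta>' * w_max) * Rp * (1 - \<eta>)))"
      unfolding Rp_def by (rule not_alive_hawkes[OF h0 h1 h2 Lh B0 R0 RB']) (use \<theta>' in simp)
    also have "\<dots> \<le> 1 / z + 1 / z"
    proof (rule add_mono)
      have rQ: "real Q = 3 * real K * real q" by (simp add: Q_def)
      have "real Q * rho h B = 3 * real K * (real q * r)" unfolding rQ r_def by simp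
      also have "\<dots> \<le> z^896 * (1 / (z^152 * exp (z^8)^2))"
        using K(2) qr r0 z0 by (intro mult_mono) auto
      finally show "real Q * rho h B \<le> 1 / z" using f(10) by linarith
      have SQ: "real (Suc Q) \<le> exp (z^8)^4*z^896+1"
      proof -
        have "3 * real K * real q \<le> z^896 * real q" using K(2) by (intro mult_right_mono) auto
        then show ?thesis unfolding of_nat_Suc rQ q4 n by (simp add: mult.commute)
      qed
      have Rp: "0 \<le> Rp" "Rp \<le> R + 1"
      proof -
        show "0 \<le> Rp" unfolding Rp_def using R0 const_pos h0 by auto
        have a: "L * \<mu>_max * h \<le> z * dl" using c hd const_pos h0 z0 by (intro mult_mono) auto
        have "real d * w_max * (2 * h * (R + L * \<mu>_max * h)) \<le> z * z * (2 * dl * (z^16 + z * dl))"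
          unfolding R_def using c hd const_pos h0 z0 dl a by (intro mult_mono add_mono) auto
        then show "Rp \<le> R + 1" unfolding Rp_def using a f(5) by linarith
      qed
      have "\<theta>' * exp (\<theta>' * w_max) * Rp * (1 - \<eta>) = \<theta>' * ((exp (\<theta>' * w_max) * (1 - \<eta>)) * Rp)" by (simp add: mult_ac)
      also have "\<dots> \<le> \<theta>' * ((1 - \<eta> / 2) * (R + 1))"
        using \<theta>' Rp eta_le_1 const_pos by (intro mult_left_mono mult_mono) auto
      finally have e1: "\<theta>' * exp (\<theta>' * w_max) * Rp * (1 - \<eta>) \<le> \<theta>' * ((1 - \<eta> / 2) * (R + 1))" .
      \<comment> \<open>After tilting, the branching factor is still at most
        \<open>1 - \<eta> / 2\<close>, so a negative multiple of \<open>R\<close> survives in the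
        exponent; it is at least \<open>z ^ 15\<close> in size.\<close>
      have "\<theta>' * ((\<mu>_max + real d * w_max) - R) + \<theta>' * ((1 - \<eta> / 2) * (R + 1))
         = \<theta>' * (\<mu>_max + real d * w_max + 1) - \<theta>' * \<eta> / 2 - (\<theta>' * \<eta> / 2) * R"
        by (simp add: algebra_simps)
      moreover have "(1 / z) * R \<le> (\<theta>' * \<eta> / 2) * R" using \<theta>'(3) R0 by (rule mult_right_mono)
      moreover have "(1 / z) * R = z^15" unfolding R_def using z0 by (simp add: power_eq_if)
      moreover have "0 \<le> \<theta>' * \<eta> / 2" using \<theta>' const_pos by simp
      ultimately have "\<theta>' * ((\<mu>_max + real d * w_max) - R) + \<theta>' * exp (\<theta>' * w_max) * Rp * (1 - \<eta>) \<le> z - z^15"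
        using e1 \<theta>'(4) by linarith
      then have "real (Suc Q) * (real n * exp (\<theta>' * ((\<mu>_max + real d * w_max) - R) + \<theta>' * exp (\<theta>' * w_max) * Rp * (1 - \<eta>)))
        \<le> (exp (z^8)^4*z^896+1) * (exp (z^8) * exp (z - z^15))"
        unfolding n using SQ z0 by (intro mult_mono) auto
      then show "real (Suc Q) * (real n * exp (\<theta>' * ((\<mu>_max + real d * w_max) - R) + \<theta>' * exp (\<theta>' * w_max) * Rp * (1 - \<eta>))) \<le> 1 / z"
        using f(11) by linarith
    qed
    finally show ?thesis unfolding \<beta>_def Q_def by simp
  qed
  have thr: "thr = w_sep * \<mu>_min * w_min / 8 * real K * (h * real q) ^ 3" unfolding thr_def c0(1) hq ..
  have "\<exists>Z. weight M Z \<and>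
      expectation Z \<le> \<beta> + real n * (real n * (2 * exp (- (\<theta> * thr) + real K * (\<theta> * err + 4 * \<theta>\<^sup>2)))) \<and>
      (\<forall>\<omega>\<in>space M. Z \<omega> < 1 \<longrightarrow> (\<forall>i\<in>{1..n}. \<forall>j\<in>{1..n}. i \<noteq> j \<longrightarrow>
        ((thr < \<bar>C.stat q K i j \<omega>\<bar> \<or> thr < \<bar>C.stat q K j i \<omega>\<bar>) \<longleftrightarrow> (0 < w i j \<or> 0 < w j i))))"
  proof (rule C.recovery[OF RB _ Lq \<tau> gl err \<theta> _ const_pos(8) _ const_pos(1) const_pos(6) _ K(3) _ thr dead])
    show "real (2 * d + 2) * (h * B + r) \<le> p" by (simp add: p_def)
    show "w_sep \<le> w i i - w i j" if "i \<in> {1..n}" "j \<in> {1..n}" "i \<noteq> j" for i j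
      using A.weight_separation[OF that] .
    show "\<mu>_min \<le> rt k (real l * h) \<omega>" if "k \<in> {1..n}" "\<omega> \<in> space M" for l k \<omega>
      by (rule rt_ge[OF that]) (use h0 in simp)
    show "w i j = 0 \<or> w_min \<le> w i j" if "i \<in> {1..n}" "j \<in> {1..n}" for i j
      using A.weight_bounds[OF that] by auto
    show "0 < h * real q" using hq dl by simp
  qed
  then obtain Z where Z: "weight M Z"
    "expectation Z \<le> \<beta> + real n * (real n * (2 * exp (- (\<theta> * thr) + real K * (\<theta> * err + 4 * \<theta>\<^sup>2))))"
    "\<And>\<omega> i j. \<omega> \<in> space M \<Longrightarrow> Z \<omega> < 1 \<Longrightarrow> i \<in> {1..n} \<Longrightarrow> j \<in> {1..n} \<Longrightarrow> i \<noteq> j \<Longrightarrow>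
        ((thr < \<bar>C.stat q K i j \<omega>\<bar> \<or> thr < \<bar>C.stat q K j i \<omega>\<bar>) \<longleftrightarrow> (0 < w i j \<or> 0 < w j i))"
    by blast
  have EZ: "expectation Z \<le> 3 / z"
  proof -
    \<comment> \<open>In units of \<open>real K * c0 ^ 2 * dl ^ 6\<close> the terms are
      \<open>- 1/16\<close>, \<open>1/32\<close> and \<open>1/64\<close>.\<close>
    have "- (\<theta> * thr) + real K * (\<theta> * err + 4 * \<theta>\<^sup>2) = - (real K * c0^2 * dl^6 / 64)"
      unfolding \<theta>_def thr_def err_def by (simp add: power2_eq_square power_eq_if)
    moreover have "(z^896/3-1)*(1/z)^2*dl^6 \<le> real K * c0^2 * dl^6"
    proof (intro mult_right_mono mult_mono K power_mono c0)
      show "0 \<le> dl ^ 6" using dl by simp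
    qed (use z0 in auto)
    ultimately have "exp (- (\<theta> * thr) + real K * (\<theta> * err + 4 * \<theta>\<^sup>2)) \<le> exp (-((z^896/3-1)*(1/z)^2*dl^6/64))" by simp
    then have "real n * (real n * (2 * exp (- (\<theta> * thr) + real K * (\<theta> * err + 4 * \<theta>\<^sup>2))))
       \<le> exp (z^8)*(exp (z^8)*(2*exp (-((z^896/3-1)*(1/z)^2*dl^6/64))))"
      unfolding n by (intro mult_left_mono) auto
    then show ?thesis using Z(2) f(12) unfolding \<beta>_def by (simp add: add_divide_distrib[symmetric])
  qed
  have stat: "path_stat dl K i j (\<lambda>(i, t). event_count E i t \<omega>) = C.stat q K i j \<omega>"
    if om: "\<omega> \<in> space M" and ij: "i \<in> {1..n}" "j \<in> {1..n}" for i j \<omega>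
  proof -
    \<comment> \<open>Every end of a window is also the boundary of a cell, because
      \<open>dl\<close> is \<open>q\<close> cells.\<close>
    have t: "real (3 * k) * dl = real ((q + q + q) * k) * h" "real (3 * k + 1) * dl = real ((q + q + q) * k + q) * h"
      "real (3 * k + 2) * dl = real ((q + q + q) * k + (q + q)) * h" "real (3 * k + 3) * dl = real ((q + q + q) * k + (q + q) + q) * h" for k
      unfolding hq[symmetric] by (simp_all add: algebra_simps)
    have b: "block3 dl k x1 x2 x3 (\<lambda>(i, t). event_count E i t \<omega>) = C.fires3 q ((q + q + q) * k) x1 x2 x3 \<omega>"
      if x: "x1 \<in> {1..n}" "x2 \<in> {1..n}" "x3 \<in> {1..n}" for k x1 x2 x3
    proof -
      have le: "(q + q + q) * k \<le> (q + q + q) * k + q" "(q + q + q) * k + q \<le> (q + q + q) * k + (q + q)"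
        "(q + q + q) * k + (q + q) \<le> (q + q + q) * k + (q + q) + q" by simp_all
      note later = later_iff[OF _ om less_imp_le[OF h0]]
      show ?thesis
        unfolding block3_def C.fires3_def C.fires_def t prod.case conj_assoc
          later[OF x(1) le(1)] later[OF x(2) le(2)] later[OF x(3) le(3)] ..
    qed
    show ?thesis unfolding path_stat_def C.stat_def C.orient_def by (simp only: b[OF ij(1,2,1)] b[OF ij(1,1,2)])
  qed
  have Gi: "1 - Z \<omega> \<le> of_bool (G \<omega>)" if om: "\<omega> \<in> space M" for \<omega>
  proof (cases "Z \<omega> < 1")
    case True
    have "G \<omega>"
    proof (rule decide[OF om])
      fix i j assume ij: "i \<in> {1..n}" "j \<in> {1..n}" "i \<noteq> j"
      show "(c0 * real K * \<delta> z ^ 3 < \<bar>path_stat (\<delta> z) K i j (\<lambda>(i, t). event_count E i t \<omega>)\<bar> \<or>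
         c0 * real K * \<delta> z ^ 3 < \<bar>path_stat (\<delta> z) K j i (\<lambda>(i, t). event_count E i t \<omega>)\<bar>) \<longleftrightarrow>
        (0 < w i j \<or> 0 < w j i)"
        using Z(3)[OF om True ij] unfolding \<delta>_def dl_def[symmetric] stat[OF om ij(1,2)] stat[OF om ij(2,1)] thr_def .
    qed
    then show ?thesis using weight_ge_0[OF Z(1) om] by simp
  qed simp
  have bG: "bdd_rv M (\<lambda>\<omega>. of_bool (G \<omega>))"
    by (rule bdd_rv_of_bool) (use G in \<open>simp add: pred_def\<close>)
  have "1 - 3 / z \<le> 1 - expectation Z" using EZ by simp
  also have "\<dots> = expectation (\<lambda>\<omega>. 1 - Z \<omega>)"
    using expectation_diff_bdd[OF bdd_rv_const weight_bdd[OF Z(1)], of 1] by (simp add: prob_space)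
  also have "\<dots> \<le> expectation (\<lambda>\<omega>. of_bool (G \<omega>))"
    by (rule expectation_mono_bdd[OF bdd_rv_diff[OF bdd_rv_const weight_bdd[OF Z(1)]] bG Gi])
  also have "\<dots> = expectation (indicator {\<omega>\<in>space M. G \<omega>})"
    by (rule Bochner_Integration.integral_cong) (auto simp: indicator_def)
  also have "\<dots> = prob {\<omega>\<in>space M. G \<omega>}" using G by simp
  finally show ?thesis .
qed

end

section \<open>The estimator as a measurable function of the observed path\<close>

lemma dependency_graph_cong:
  assumes "\<And>i j. i \<in> {1..n} \<Longrightarrow> j \<in> {1..n} \<Longrightarrow> i \<noteq> j \<Longrightarrow>
    (0 < v i j \<or> 0 < v j i) \<longleftrightarrow> (0 < w i j \<or> 0 < w j i)"
  shows "dependency_graph n v = dependency_graph n w"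
proof -
  have "(i \<in> {1..n} \<and> j \<in> {1..n} \<and> i \<noteq> j \<and> (0 < v i j \<or> 0 < v j i))
      \<longleftrightarrow> (i \<in> {1..n} \<and> j \<in> {1..n} \<and> i \<noteq> j \<and> (0 < w i j \<or> 0 < w j i))" for i j
    using assms by blast
  then show ?thesis unfolding dependency_graph_def by simp
qed

text \<open>With \<open>ln n = z ^ 8\<close> this is \<open>1 / z ^ 96\<close>. The exponents match
  the horizon: at most \<open>ln n ^ 112\<close> windows of this length fit into a time
  \<open>ln n ^ 100\<close>, and three of them make a block.\<close>

definition window :: "nat \<Rightarrow> real" where
  "window n = 1 / ln (real n) ^ 12"

definition blocks :: "nat \<Rightarrow> nat" where
  "blocks n = nat \<lfloor>ln (real n) ^ 112 / 3\<rfloor>"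

definition detected :: "real \<Rightarrow> nat \<Rightarrow> (nat \<times> real \<Rightarrow> nat) \<Rightarrow> nat \<Rightarrow> nat \<Rightarrow> bool" where
  "detected c n obs i j \<longleftrightarrow>
     c * real (blocks n) * window n ^ 3 < \<bar>path_stat (window n) (blocks n) i j obs\<bar>"

text \<open>Detections serve as weights 0 and 1, so the disjunction inside
  \<open>dependency_graph\<close> joins the two statistics of a pair. The constants of the model
  enter through \<open>c\<close> alone.\<close>

definition graph_estimate :: "real \<Rightarrow> nat \<Rightarrow> (nat \<times> real \<Rightarrow> nat) \<Rightarrow> nat set \<times> nat set set" where
  "graph_estimate c n obs = dependency_graph n (\<lambda>i j. of_bool (detected c n obs i j))"

lemma window_times:
  assumes n: "2 \<le> n" and m: "m \<le> 3 * blocks n"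
  shows "0 \<le> real m * window n" "real m * window n \<le> horizon n"
proof -
  have l: "0 < ln (real n)" using n by simp
  then show "0 \<le> real m * window n" by (simp add: window_def)
  have "real m \<le> 3 * real (blocks n)" using m by linarith
  also have "\<dots> \<le> ln (real n) ^ 112"
    using l unfolding blocks_def by (simp add: le_divide_eq of_nat_nat) linarith
  finally have "real m * window n \<le> ln (real n) ^ 112 * window n"
    using l by (intro mult_right_mono) (auto simp: window_def)
  also have "\<dots> = horizon n"
  proof -
    have eq: "ln (real n) ^ 112 = ln (real n) ^ 100 * ln (real n) ^ 12" by (simp flip: power_add)
    have cancel: "(a * b) * (1 / b) = a" if "b \<noteq> 0" for a b :: real using that by simp
    show ?thesis unfolding window_def horizon_def eq by (rule cancel) (use l in simp)
  qed
  finally show "real m * window n \<le> horizon n" .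
qed

lemma block3_cong:
  assumes "\<And>x m. x \<in> {x1, x2, x3} \<Longrightarrow> m \<le> 3 * k + 3 \<Longrightarrow> obs (x, real m * \<delta>) = obs' (x, real m * \<delta>)"
  shows "block3 \<delta> k x1 x2 x3 obs = block3 \<delta> k x1 x2 x3 obs'"
  using assms[of x1 "3 * k"] assms[of x1 "3 * k + 1"] assms[of x2 "3 * k + 1"] assms[of x2 "3 * k + 2"]
    assms[of x3 "3 * k + 2"] assms[of x3 "3 * k + 3"]
  unfolding block3_def by (simp add: add.commute)

lemma path_stat_cong:
  assumes "\<And>x m. x \<in> {i, j} \<Longrightarrow> m \<le> 3 * K \<Longrightarrow> obs (x, real m * \<delta>) = obs' (x, real m * \<delta>)"
  shows "path_stat \<delta> K i j obs = path_stat \<delta> K i j obs'"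
  unfolding path_stat_def
proof (rule sum.cong[OF refl])
  fix k assume k: "k \<in> {..<K}"
  have "block3 \<delta> k i j i obs = block3 \<delta> k i j i obs'" "block3 \<delta> k i i j obs = block3 \<delta> k i i j obs'"
    by (rule block3_cong, rule assms; use k in auto)+
  then show "of_bool (block3 \<delta> k i j i obs) - of_bool (block3 \<delta> k i i j obs)
     = of_bool (block3 \<delta> k i j i obs') - (of_bool (block3 \<delta> k i i j obs') :: real)" by simp
qed

lemma pred_detected:
  assumes n: "2 \<le> n" and ij: "i \<in> {1..n}" "j \<in> {1..n}"
  shows "Measurable.pred (path_space n (horizon n)) (\<lambda>obs. detected c n obs i j)"
proof -
  let ?P = "path_space n (horizon n)"
  have comp: "(\<lambda>obs. obs (x, real m * window n)) \<in> measurable ?P (count_space UNIV)"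
    if "x \<in> {1..n}" "m \<le> 3 * blocks n" for x m
    unfolding path_space_def by (rule measurable_component_singleton) (use that window_times[OF n that(2)] in auto)
  have less: "Measurable.pred ?P (\<lambda>obs. obs (x, real m * window n) < obs (x, real m' * window n))"
    if "x \<in> {1..n}" "m \<le> 3 * blocks n" "m' \<le> 3 * blocks n" for x m m'
  proof -
    have [measurable]: "(\<lambda>obs. obs (x, real k * window n)) \<in> borel_measurable ?P" if "k \<le> 3 * blocks n" for k
      using measurable_compose[OF comp[OF \<open>x \<in> {1..n}\<close> that], of "\<lambda>x. x" borel] by simp
    show ?thesis using that by measurable
  qed
  have blk: "Measurable.pred ?P (block3 (window n) k x1 x2 x3)"
    if x: "x1 \<in> {1..n}" "x2 \<in> {1..n}" "x3 \<in> {1..n}" and k: "k < blocks n" for k x1 x2 x3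
    unfolding block3_def using k by (intro pred_intros_logic less x) auto
  have "path_stat (window n) (blocks n) i j \<in> borel_measurable ?P"
    unfolding path_stat_def
  proof (rule borel_measurable_sum)
    fix k assume k: "k \<in> {..<blocks n}"
    have [measurable]: "(\<lambda>obs. of_bool (block3 (window n) k x1 x2 x3 obs) :: real) \<in> borel_measurable ?P"
      if "x1 \<in> {1..n}" "x2 \<in> {1..n}" "x3 \<in> {1..n}" for x1 x2 x3
      by (rule bdd_rv_measurable[OF bdd_rv_of_bool[OF blk[OF that]]]) (use k in simp)
    show "(\<lambda>obs. of_bool (block3 (window n) k i j i obs) - of_bool (block3 (window n) k i i j obs) :: real) \<in> borel_measurable ?P"
      using ij by measurable
  qed
  then show ?thesis unfolding detected_def by measurable
qed

text \<open>The target carries the full power set of an uncountable type, so preimages of single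
  values would not be enough in general. The estimate factors through the set of detected pairs,
  which takes finitely many values.\<close>

lemma graph_estimate_measurable:
  assumes n: "2 \<le> n"
  shows "graph_estimate c n \<in> path_space n (horizon n) \<rightarrow>\<^sub>M count_space UNIV"
proof -
  let ?P = "path_space n (horizon n)" and ?A = "{1..n} \<times> {1..n}"
  define D where "D = (\<lambda>obs. {(i, j) \<in> ?A. detected c n obs i j})"
  define g where "g = (\<lambda>X. dependency_graph n (\<lambda>i j. of_bool ((i, j) \<in> X)))"
  have "D \<in> measurable ?P (count_space (Pow ?A))"
  proof (subst measurable_count_space_eq2, simp, intro conjI ballI)
    show "D \<in> space ?P \<rightarrow> Pow ?A" by (auto simp: D_def)
    fix X assume X: "X \<in> Pow ?A"
    have "Measurable.pred ?P (\<lambda>obs. \<forall>ij\<in>?A. detected c n obs (fst ij) (snd ij) = (ij \<in> X))"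
    proof (rule pred_intros_finite(3))
      fix ij assume "ij \<in> ?A"
      then have "Measurable.pred ?P (\<lambda>obs. detected c n obs (fst ij) (snd ij))"
        by (intro pred_detected[OF n]) auto
      then show "Measurable.pred ?P (\<lambda>obs. detected c n obs (fst ij) (snd ij) = (ij \<in> X))"
        by measurable
    qed simp
    moreover have "D -` {X} \<inter> space ?P = {obs\<in>space ?P. \<forall>ij\<in>?A. detected c n obs (fst ij) (snd ij) = (ij \<in> X)}"
    proof -
      have "D obs = {ij\<in>?A. detected c n obs (fst ij) (snd ij)}" for obs by (auto simp: D_def)
      moreover have "X = {ij\<in>?A. ij \<in> X}" using X by blast
      ultimately have "D obs = X \<longleftrightarrow> (\<forall>ij\<in>?A. detected c n obs (fst ij) (snd ij) = (ij \<in> X))" for obs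
        by blast
      then show ?thesis by (simp only: vimage_def Int_def singleton_iff mem_Collect_eq conj_commute)
    qed
    ultimately show "D -` {X} \<inter> space ?P \<in> sets ?P" by (simp add: pred_def)
  qed
  then have "(\<lambda>obs. g (D obs)) \<in> measurable ?P (count_space UNIV)"
    by (rule measurable_compose) simp
  moreover have "(\<lambda>obs. g (D obs)) = graph_estimate c n"
    unfolding g_def D_def graph_estimate_def
    by (rule ext, rule dependency_graph_cong) (auto split: if_splits)
  ultimately show ?thesis by simp
qed

text \<open>Tilting multiplies the branching ratio \<open>1 - \<eta>\<close> by
  \<open>exp (\<theta> * v)\<close>, which is close to 1 for small \<open>\<theta>\<close>; half of
  the margin \<open>\<eta>\<close> may be given up. In the first case \<open>\<theta>\<close> is
  chosen to reach equality. In the second the ratio is at most 0, and enlarging the exponential only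
  lowers the left side.\<close>

lemma tilt_exists:
  fixes \<eta> v :: real
  assumes "0 < \<eta>" "0 < v"
  shows "\<exists>\<theta>>0. exp (\<theta> * v) * (1 - \<eta>) \<le> 1 - \<eta> / 2"
proof (cases "\<eta> < 1")
  case True
  have 1: "1 < (1 - \<eta> / 2) / (1 - \<eta>)" using True assms by (simp add: less_divide_eq)
  have "exp (ln ((1 - \<eta> / 2) / (1 - \<eta>)) / v * v) * (1 - \<eta>) = 1 - \<eta> / 2"
    using 1 True assms by simp
  then show ?thesis using 1 assms by (intro exI[of _ "ln ((1 - \<eta> / 2) / (1 - \<eta>)) / v"]) simp
next
  case False
  have "exp (1 * v) * (1 - \<eta>) \<le> 1 * (1 - \<eta>)"
    using False assms by (intro mult_right_mono_neg) auto
  also have "\<dots> \<le> 1 - \<eta> / 2" using assms by simp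
  finally show ?thesis by (intro exI[of _ 1]) simp
qed

lemma graph_estimate_correct:
  fixes E :: "nat \<Rightarrow> 'a \<Rightarrow> real set"
  assumes H: "bounded_hawkes M n E \<mu> \<phi> w \<mu>_min \<mu>_max \<Phi> \<eta> L w_min w_max w_sep d" and n: "2 \<le> n"
    and z: "scales_ok z" "real n = exp (z ^ 8)"
    and c: "L \<le> z" "L * \<mu>_max \<le> z" "w_max \<le> z" "real d \<le> z"
    and c0: "c0 = w_sep * \<mu>_min * w_min / 8" "1 / z \<le> c0" "c0 \<le> z"
    and \<theta>: "0 < \<theta>" "exp (\<theta> * w_max) * (1 - \<eta>) \<le> 1 - \<eta> / 2" "1 / z \<le> \<theta> * \<eta> / 2"
      "\<theta> * (\<mu>_max + real d * w_max + 1) \<le> z"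
  shows "1 - 3 / z \<le> measure M {\<omega>\<in>space M. graph_estimate c0 n (observed_path n E (horizon n) \<omega>) = dependency_graph n w}"
proof -
  interpret bounded_hawkes M n E \<mu> \<phi> w \<mu>_min \<mu>_max \<Phi> \<eta> L w_min w_max w_sep d by (rule H)
  have z2: "2 \<le> z" using z(1) by (simp add: scales_ok_def)
  have lnn: "ln (real n) = z ^ 8" using z(2) by simp
  have win: "window n = 1 / z ^ 96" unfolding window_def lnn by (simp flip: power_mult)
  have pow: "ln (real n) ^ 112 = z ^ 896" unfolding lnn by (simp flip: power_mult)
  have K: "z^896 / 3 - 1 \<le> real (blocks n)" "real (blocks n) \<le> z^896 / 3" "0 < blocks n"
  proof -
    have "(2::real) ^ 2 \<le> 2 ^ 896" by (rule power_increasing) auto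
    also have "\<dots> \<le> z ^ 896" using z2 by (intro power_mono) auto
    finally have z4: "4 \<le> z ^ 896" by simp
    have "(0::int) \<le> \<lfloor>z ^ 896 / 3\<rfloor>" using z4 by (simp add: le_floor_iff)
    then have b: "real (blocks n) = of_int \<lfloor>z ^ 896 / 3\<rfloor>" unfolding blocks_def pow by simp
    show "z^896 / 3 - 1 \<le> real (blocks n)" "real (blocks n) \<le> z^896 / 3" unfolding b by linarith+
    then have "0 < real (blocks n)" using z4 by linarith
    then show "0 < blocks n" by simp
  qed
  have obs: "observed_path n E (horizon n) \<in> measurable M (path_space n (horizon n))"
    by (rule observed_path_measurable[OF refl]) (rule measurable_count)
  have Gm: "{\<omega>\<in>space M. graph_estimate c0 n (observed_path n E (horizon n) \<omega>) = dependency_graph n w} \<in> sets M"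
    using measurable_sets[OF measurable_compose[OF obs graph_estimate_measurable[OF n, of c0]], of "{dependency_graph n w}"]
    by (simp add: vimage_def Int_def conj_commute)
  show ?thesis
  proof (rule correct_prob[OF z c c0 \<theta> K Gm])
    fix \<omega> assume om: "\<omega> \<in> space M"
    let ?N = "\<lambda>(i, t). event_count E i t \<omega>"
    assume dec: "\<And>i j. i \<in> {1..n} \<Longrightarrow> j \<in> {1..n} \<Longrightarrow> i \<noteq> j \<Longrightarrow>
        (c0 * real (blocks n) * (1 / z^96) ^ 3 < \<bar>path_stat (1 / z^96) (blocks n) i j ?N\<bar> \<or>
         c0 * real (blocks n) * (1 / z^96) ^ 3 < \<bar>path_stat (1 / z^96) (blocks n) j i ?N\<bar>) \<longleftrightarrow>
        (0 < w i j \<or> 0 < w j i)"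
    \<comment> \<open>All ends of windows lie within the horizon, where the observed path agrees
      with the counts.\<close>
    have same: "path_stat (window n) (blocks n) i j (observed_path n E (horizon n) \<omega>) = path_stat (window n) (blocks n) i j ?N"
      if ij: "i \<in> {1..n}" "j \<in> {1..n}" for i j
    proof (rule path_stat_cong)
      fix x m assume "x \<in> {i, j}" "m \<le> 3 * blocks n"
      then show "observed_path n E (horizon n) \<omega> (x, real m * window n) = ?N (x, real m * window n)"
        using ij window_times[OF n, of m] unfolding observed_path_def by auto
    qed
    show "graph_estimate c0 n (observed_path n E (horizon n) \<omega>) = dependency_graph n w"
      unfolding graph_estimate_def
    proof (rule dependency_graph_cong)
      fix i j assume ij: "i \<in> {1..n}" "j \<in> {1..n}" "i \<noteq> j"
      show "((0::real) < of_bool (detected c0 n (observed_path n E (horizon n) \<omega>) i j) \<or>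
          (0::real) < of_bool (detected c0 n (observed_path n E (horizon n) \<omega>) j i)) \<longleftrightarrow> (0 < w i j \<or> 0 < w j i)"
        using dec[OF ij, folded win] unfolding detected_def same[OF ij(1,2)] same[OF ij(2,1)] by simp
    qed
  qed
qed

theorem theorem1:
  fixes \<mu>_min \<mu>_max \<Phi> \<eta> L w_min w_max w_sep :: real and d :: nat
  assumes "\<mu>_min > 0" "\<mu>_max > 0" "\<Phi> > 0" "\<eta> > 0" "L > 0" "w_min > 0" "w_max > 0" "w_sep > 0"
    and "d \<ge> 1"
  shows "\<exists>G_hat :: nat \<Rightarrow> (nat \<times> real \<Rightarrow> nat) \<Rightarrow> nat set \<times> nat set set.
    (\<forall>n\<ge>2. G_hat n \<in> path_space n (horizon n) \<rightarrow>\<^sub>M count_space UNIV) \<and>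
    (\<forall>(M :: nat \<Rightarrow> 'a measure) (E :: nat \<Rightarrow> nat \<Rightarrow> 'a \<Rightarrow> real set)
      (\<mu> :: nat \<Rightarrow> nat \<Rightarrow> real \<Rightarrow> real) (\<phi> :: nat \<Rightarrow> nat \<Rightarrow> nat \<Rightarrow> real \<Rightarrow> real \<Rightarrow> real)
      (w :: nat \<Rightarrow> nat \<Rightarrow> nat \<Rightarrow> real).
      (\<forall>n\<ge>2. hawkes_process (M n) n (E n) (\<mu> n) (\<phi> n) (w n) \<and>
              hawkes_assumptions n (\<mu> n) (\<phi> n) (w n) \<mu>_min \<mu>_max \<Phi> \<eta> L w_min w_max w_sep d)
      \<longrightarrow> (\<lambda>n. measure (M n) {\<omega> \<in> space (M n).
              G_hat n (observed_path n (E n) (horizon n) \<omega>) = dependency_graph n (w n)})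
          \<longlonglongrightarrow> 1)"
proof -
  \<comment> \<open>This is the threshold constant of \<open>stat_decides\<close>. Like
    \<open>\<theta>\<close> and all conditions collected in \<open>ev\<close>, it depends only on
    the fixed constants, so the failure bound \<open>3 / z n\<close> holds from the same
    \<open>n\<close> on for every model.\<close>
  define c0 where "c0 = w_sep * \<mu>_min * w_min / 8"
  have c0: "0 < c0" using assms by (simp add: c0_def)
  obtain \<theta> where \<theta>: "0 < \<theta>" "exp (\<theta> * w_max) * (1 - \<eta>) \<le> 1 - \<eta> / 2"
    using tilt_exists[of \<eta> w_max] assms by blast
  define z where "z = (\<lambda>n. root 8 (ln (real n)))"
  have zlim: "filterlim z at_top sequentially" unfolding z_def by real_asymp
  have ge: "\<forall>\<^sub>F n in sequentially. C \<le> z n" for C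
    using zlim by (simp add: filterlim_at_top)
  have inv: "\<forall>\<^sub>F n in sequentially. 1 / z n \<le> C" if C: "0 < C" for C
    using ge[of "1 / C"]
  proof eventually_elim
    case (elim n)
    moreover have "0 < 1 / C" using C by simp
    ultimately have "0 < z n" by linarith
    then show ?case using elim C by (simp add: field_simps)
  qed
  have "0 < \<theta> * \<eta> / 2" using \<theta> assms by simp
  then have ev: "\<forall>\<^sub>F n in sequentially. 2 \<le> n \<and> scales_ok (z n) \<and> L \<le> z n \<and> L * \<mu>_max \<le> z n \<and> w_max \<le> z n \<and> real d \<le> z n
      \<and> 1 / z n \<le> c0 \<and> c0 \<le> z n \<and> 1 / z n \<le> \<theta> * \<eta> / 2 \<and> \<theta> * (\<mu>_max + real d * w_max + 1) \<le> z n"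
    by (intro eventually_conj ge inv c0 eventually_ge_at_top eventually_compose_filterlim[OF eventually_scales_ok zlim])
  show ?thesis
  proof (intro exI[of _ "graph_estimate c0"] conjI allI impI)
    show "graph_estimate c0 n \<in> path_space n (horizon n) \<rightarrow>\<^sub>M count_space UNIV" if "2 \<le> n" for n
      by (rule graph_estimate_measurable[OF that])
  next
    fix M :: "nat \<Rightarrow> 'a measure" and E :: "nat \<Rightarrow> nat \<Rightarrow> 'a \<Rightarrow> real set"
      and \<mu> :: "nat \<Rightarrow> nat \<Rightarrow> real \<Rightarrow> real" and \<phi> :: "nat \<Rightarrow> nat \<Rightarrow> nat \<Rightarrow> real \<Rightarrow> real \<Rightarrow> real"
      and w :: "nat \<Rightarrow> nat \<Rightarrow> nat \<Rightarrow> real"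
    assume H: "\<forall>n\<ge>2. hawkes_process (M n) n (E n) (\<mu> n) (\<phi> n) (w n) \<and>
              hawkes_assumptions n (\<mu> n) (\<phi> n) (w n) \<mu>_min \<mu>_max \<Phi> \<eta> L w_min w_max w_sep d"
    let ?p = "\<lambda>n. measure (M n) {\<omega> \<in> space (M n).
              graph_estimate c0 n (observed_path n (E n) (horizon n) \<omega>) = dependency_graph n (w n)}"
    show "?p \<longlonglongrightarrow> 1"
    proof (rule tendsto_sandwich)
      show "\<forall>\<^sub>F n in sequentially. 1 - 3 / z n \<le> ?p n"
        using ev
      proof eventually_elim
        case (elim n)
        have BH: "bounded_hawkes (M n) n (E n) (\<mu> n) (\<phi> n) (w n) \<mu>_min \<mu>_max \<Phi> \<eta> L w_min w_max w_sep d"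
          using H elim assms by (intro bounded_hawkes.intro bounded_hawkes_axioms.intro) auto
        have "z n ^ 8 = ln (real n)" unfolding z_def using elim by (intro real_root_pow_pos2) auto
        then have "real n = exp (z n ^ 8)" using elim by simp
        then show ?case
          using graph_estimate_correct[OF BH] elim \<theta> c0_def by blast
      qed
      show "\<forall>\<^sub>F n in sequentially. ?p n \<le> 1"
        using eventually_ge_at_top[of 2]
      proof eventually_elim
        case (elim n)
        then have "prob_space (M n)" using H by (auto simp: hawkes_process_def)
        then show ?case by (rule prob_space.prob_le_1)
      qed
      have "(\<lambda>n. 3 / z n) \<longlonglongrightarrow> 0" by (rule tendsto_divide_0[OF tendsto_const filterlim_at_top_imp_at_infinity[OF zlim]])
      then show "(\<lambda>n. 1 - 3 / z n) \<longlonglongrightarrow> 1" using tendsto_diff[OF tendsto_const[of 1]] by fastforce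
    qed simp
  qed
qed

end
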